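(* Let $N\ge1$ and $p_{\mathrm{St}}<p<1+\frac4N$. Let $\{\phi_n\}_n$ be a bounded sequence in $\mathcal{F}H^1$. Then there exist a subsequence of $\{\phi_n\}$, denoted again by $\{\phi_n\}$, and sequences $\{\psi^j\}_{j\ge1}\subset\mathcal{F}H^1$, $\{W_n^j\}_{n,j}\subset\mathcal{F}H^1$ and $\{\xi_n^j\}_{n,j}\subset\mathbb{R}^N$ such that for every $l\ge1$ $$\phi_n=\sum_{j=1}^l e^{i\xi_n^j\cdot x}\psi^j+W_n^l\quad\text{in }\mathcal{F}H^1,$$ and $$\|\phi_n\|_{\mathcal{F}\dot H^s}^2-\sum_{j=1}^l\|\psi^j\|_{\mathcal{F}\dot H^s}^2-\|W_n^l\|_{\mathcal{F}\dot H^s}^2\to0\quad(n\to\infty)\quad\text{for all }s\in[0,1].$$ Furthermore, there exists $J\in\{0,1,2,\dots\}\cup\{\infty\}$ such that: $\psi^j\equiv0$ for all $j\ge1$ if $J=0$; $\psi^j\not\equiv0$ for all $j\ge1$ if $J=\infty$; and $\psi^j\not\equiv0$ for $j\le J$, $\psi^j\equiv0$ for $j>J$ if $1\le J<\infty$. For all (finite) indices $1\le i,j\le J$ with $i\ne j$, $$\lim_{n\to\infty}|\xi_n^i-\xi_n^j|=\infty.$$ In addition, $$\limsup_{n\to\infty}\|e^{it\Delta}W_n^l\|_{L^\rho((0,\infty),L^\gamma)}\to0\quad\text{as }l\to\infty.$$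
   Context: $p_{\mathrm{St}}:=1+\frac{2-N+\sqrt{N^2+12N+4}}{2N}$, $\rho=\frac{2(p^2-1)}{4-(N-2)(p-1)}$, $\gamma=p+1$. $\mathcal{F}H^1=\{f\in L^2(\mathbb{R}^N): xf\in L^2(\mathbb{R}^N)\}$ with $\|f\|_{\mathcal{F}H^1}^2=\|f\|_{L^2}^2+\|xf\|_{L^2}^2$ (complex-valued functions), and $\|f\|_{\mathcal{F}\dot H^s}:=\||x|^sf\|_{L^2}$. $e^{it\Delta}$ is the free Schrödinger group, and $\|\cdot\|_{L^\rho(I,L^\gamma)}$ is the mixed norm $L^\rho$ in $t\in I$, $L^\gamma$ in $x\in\mathbb{R}^N$. *)

theory Defs
  imports "HOL-Analysis.Analysis" "HOL-Library.Extended_Nat"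
begin

(* Elements of function spaces on R^N are Borel measurable representatives; equality in such a
   space is equality almost everywhere with respect to lborel. *)

(* Meant for exponents a > 0 only. *)
definition enn_powr :: "ennreal \<Rightarrow> real \<Rightarrow> ennreal" where
  "enn_powr x a = (if x = \<infinity> then \<infinity> else ennreal (enn2real x powr a))"

(* The L^q norm for 0 < q < \<infinity>, with value \<infinity> outside L^q. *)
definition Lp_norm :: "real \<Rightarrow> (real ^ 'n \<Rightarrow> 'b::euclidean_space) \<Rightarrow> ennreal" where
  "Lp_norm q f = enn_powr (\<integral>\<^sup>+ x. ennreal (norm (f x) powr q) \<partial>lborel) (1 / q)"

definition in_Lp :: "real \<Rightarrow> (real ^ 'n \<Rightarrow> 'b::euclidean_space) \<Rightarrow> bool" where
  "in_Lp q f \<longleftrightarrow> f \<in> borel_measurable lborel \<and> Lp_norm q f < \<infinity>"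

(* The norm of L^q(I, L^r), for 0 < q, r < \<infinity>. *)
definition mixed_norm ::
  "real set \<Rightarrow> real \<Rightarrow> real \<Rightarrow> (real \<Rightarrow> real ^ 'n \<Rightarrow> complex) \<Rightarrow> ennreal" where
  "mixed_norm I q r u =
     enn_powr (\<integral>\<^sup>+ t. enn_powr (Lp_norm r (u t)) q * indicator I t \<partial>lborel) (1 / q)"

definition pos_mult :: "(real ^ 'n \<Rightarrow> complex) \<Rightarrow> real ^ 'n \<Rightarrow> complex ^ 'n" where
  "pos_mult f x = (\<chi> i. of_real (x $ i) * f x)"

definition FH1 :: "(real ^ 'n \<Rightarrow> complex) set" where
  "FH1 = {f. in_Lp 2 f \<and> in_Lp 2 (pos_mult f)}"

definition FH1_norm :: "(real ^ 'n \<Rightarrow> complex) \<Rightarrow> real" where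
  "FH1_norm f = sqrt ((enn2real (Lp_norm 2 f))\<^sup>2 + (enn2real (Lp_norm 2 (pos_mult f)))\<^sup>2)"

(* Since 0 powr 0 = 0, the weight for s = 0 differs from 1 at the origin, a null set. *)
definition FHdot_norm :: "real \<Rightarrow> (real ^ 'n \<Rightarrow> complex) \<Rightarrow> real" where
  "FHdot_norm s f = enn2real (Lp_norm 2 (\<lambda>x. of_real (norm x powr s) * f x))"

definition fourier_L1 :: "(real ^ 'n \<Rightarrow> complex) \<Rightarrow> real ^ 'n \<Rightarrow> complex" where
  "fourier_L1 f \<xi> =
     of_real ((2 * pi) powr (- real CARD('n) / 2)) * (LINT x|lborel. cis (- (x \<bullet> \<xi>)) * f x)"

(* g is the Fourier-Plancherel transform of f: the L^2 limit, as R \<rightarrow> \<infinity>, of the transforms of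
   the truncations of f to balls of radius R, which are integrable. *)
definition fourier_L2 :: "(real ^ 'n \<Rightarrow> complex) \<Rightarrow> (real ^ 'n \<Rightarrow> complex) \<Rightarrow> bool" where
  "fourier_L2 f g \<longleftrightarrow> in_Lp 2 f \<and> in_Lp 2 g \<and>
     ((\<lambda>R::real. Lp_norm 2 (\<lambda>\<xi>. fourier_L1 (\<lambda>x. indicator (cball 0 R) x * f x) \<xi> - g \<xi>))
        \<longlongrightarrow> 0) at_top"

(* The free Schroedinger group on L^2, i.e. the inverse transform of exp(-it|\<xi>|^2) times the
   transform of f; for each t the value is a chosen representative, unique up to null sets. *)
definition schroedinger :: "real \<Rightarrow> (real ^ 'n \<Rightarrow> complex) \<Rightarrow> real ^ 'n \<Rightarrow> complex" where
  "schroedinger t f =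
     (SOME u. \<exists>g. fourier_L2 f g \<and> fourier_L2 u (\<lambda>\<xi>. cis (- (t * (norm \<xi>)\<^sup>2)) * g \<xi>))"

definition p_St :: "real \<Rightarrow> real" where
  "p_St N = 1 + (2 - N + sqrt (N\<^sup>2 + 12 * N + 4)) / (2 * N)"

definition rho_exp :: "real \<Rightarrow> real \<Rightarrow> real" where
  "rho_exp N p = 2 * (p\<^sup>2 - 1) / (4 - (N - 2) * (p - 1))"

definition gamma_exp :: "real \<Rightarrow> real" where
  "gamma_exp p = p + 1"

end

theory Submission
  imports Defs "HOL-Probability.Probability" "HOL-Complex_Analysis.Complex_Analysis"
begin

text \<open>Multiplication by \<open>sqrt (1 + |x|\<^sup>2)\<close> identifies the weighted space with \<open>L\<^sup>2\<close>, on which the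
  modulations act as a unitary group. Along an ultrafilter every bounded sequence of frames has a
  weak limit, so profiles are extracted greedily: each is a weak limit of the remainder in a moving
  frame and has at least half of the largest possible norm. The Pythagoras identity makes these
  norms tend to zero, hence the remainder pairs uniformly weakly to zero with every modulation of a
  compact family of test functions. A diagonal subsequence replaces the ultrafilter at the end.

  For the smallness of the evolution, times below a small \<open>T\<close> are absorbed by a Strichartz
  estimate for data bounded in \<open>L\<^sup>2\<close>. For \<open>t \<ge> T\<close> the datum is cut at a radius \<open>R\<close>: the outer part
  is small by the weight, and the inner part is, by the kernel of the group, an oscillatory integral
  that is small in \<open>L\<^sup>\<infinity>\<close> by the weak convergence. The bounds \<open>p_St < p < 1 + 4/N\<close> are what makes
  the time integral converge at infinity and at zero.\<close>

section \<open>The Hilbert space of square integrable functions\<close>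

text \<open>The obstacle is that smallness of the evolution is needed uniformly in infinitely many
  times and points. For \<open>t \<ge> T\<close> the phase of the kernel splits into a factor
  depending only on \<open>x\<close>, a modulation with frequency \<open>x / (2t)\<close> and a
  quadratic phase with coefficient \<open>1 / (4t)\<close>. The frequencies are absorbed by the
  supremum over all frames, and the coefficients lie in the compact interval from \<open>0\<close>
  to \<open>1 / (4T)\<close>. Hence weak vanishing in every frame, tested on one compact family,
  controls all these \<open>(t, x)\<close> together. The threshold \<open>p_St\<close> is the value
  at which the decay exponent of the time integrand equals 1. Above it that decay is not integrable
  at time zero, so short times need their own estimate; \<open>p < 1 + 4/N\<close> puts the space
  exponent strictly below the diagonal Strichartz exponent \<open>2 + 4/N\<close>. All
  \<open>s \<in> [0,1]\<close> are treated at once because the weights become bounded real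
  multipliers commuting with modulations: the expansion of the norms is exact up to pairings of
  weakly null remainders with a compact set.\<close>

definition sq_int :: "('a::euclidean_space \<Rightarrow> complex) \<Rightarrow> bool" where
  "sq_int f \<longleftrightarrow> f \<in> borel_measurable borel \<and> integrable lborel (\<lambda>x. (norm (f x))\<^sup>2)"

lemma sq_int_measurable [measurable_dest]: "sq_int f \<Longrightarrow> f \<in> borel_measurable borel"
  by (simp add: sq_int_def)

lemma sq_int_integrable: "sq_int f \<Longrightarrow> integrable lborel (\<lambda>x. (norm (f x))\<^sup>2)"
  by (simp add: sq_int_def)

lemma sq_int_iff_nn:
  "sq_int f \<longleftrightarrow> f \<in> borel_measurable borel \<and> (\<integral>\<^sup>+x. ennreal ((norm (f x))\<^sup>2) \<partial>lborel) < \<infinity>"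
  by (auto simp: sq_int_def integrable_iff_bounded)

lemma sq_int_dominated:
  assumes "sq_int f" and [measurable]: "g \<in> borel_measurable borel"
    and "\<And>x. norm (g x) \<le> C * norm (f x)"
  shows "sq_int g"
proof -
  have [measurable]: "f \<in> borel_measurable borel" using assms by auto
  have le: "(norm (g x))\<^sup>2 \<le> C\<^sup>2 * (norm (f x))\<^sup>2" for x
    using power_mono[OF assms(3) norm_ge_zero, of x 2] by (simp add: power_mult_distrib)
  have "integrable lborel (\<lambda>x. (norm (g x))\<^sup>2)"
    by (rule Bochner_Integration.integrable_bound[OF
        integrable_mult_right[OF sq_int_integrable[OF assms(1)], of "C\<^sup>2"]])
      (use le in \<open>auto\<close>)
  then show ?thesis by (simp add: sq_int_def)
qed

lemma sq_int_zero [simp]: "sq_int (\<lambda>_. 0)"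
  by (simp add: sq_int_def)

lemma sq_int_cmult: "sq_int f \<Longrightarrow> sq_int (\<lambda>x. c * f x)"
  by (rule sq_int_dominated[where C="norm c"]) (auto simp: norm_mult)

lemma sq_int_add:
  assumes "sq_int f" "sq_int g" shows "sq_int (\<lambda>x. f x + g x)"
proof -
  have [measurable]: "f \<in> borel_measurable borel" "g \<in> borel_measurable borel" using assms by auto
  have le: "(norm (f x + g x))\<^sup>2 \<le> 2 * (norm (f x))\<^sup>2 + 2 * (norm (g x))\<^sup>2" for x
  proof -
    have "(norm (f x + g x))\<^sup>2 \<le> (norm (f x) + norm (g x))\<^sup>2"
      by (intro power_mono norm_triangle_ineq) auto
    also have "\<dots> \<le> 2 * (norm (f x))\<^sup>2 + 2 * (norm (g x))\<^sup>2"
      using zero_le_power2[of "norm (f x) - norm (g x)"] by (simp add: power2_eq_square algebra_simps)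
    finally show ?thesis .
  qed
  have "integrable lborel (\<lambda>x. (norm (f x + g x))\<^sup>2)"
    by (rule Bochner_Integration.integrable_bound[where f="\<lambda>x. 2 * (norm (f x))\<^sup>2 + 2 * (norm (g x))\<^sup>2"])
      (use le assms in \<open>auto intro!: Bochner_Integration.integrable_add simp: sq_int_def\<close>)
  then show ?thesis by (simp add: sq_int_def)
qed

lemma sq_int_uminus: "sq_int f \<Longrightarrow> sq_int (\<lambda>x. - f x)"
  using sq_int_cmult[of f "-1"] by simp

lemma sq_int_diff: "sq_int f \<Longrightarrow> sq_int g \<Longrightarrow> sq_int (\<lambda>x. f x - g x)"
  using sq_int_add[of f "\<lambda>x. - g x"] sq_int_uminus[of g] by simp

lemma sq_int_prod_integrable:
  assumes "sq_int f" "sq_int g" shows "integrable lborel (\<lambda>x. f x * g x)"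
proof -
  have [measurable]: "f \<in> borel_measurable borel" "g \<in> borel_measurable borel" using assms by auto
  have le: "norm (f x) * norm (g x) \<le> (norm (f x))\<^sup>2 + (norm (g x))\<^sup>2" for x
    using sum_squares_bound[of "norm (f x)" "norm (g x)"]
      mult_nonneg_nonneg[OF norm_ge_zero[of "f x"] norm_ge_zero[of "g x"]] by linarith
  show ?thesis
    by (rule Bochner_Integration.integrable_bound[where f="\<lambda>x. (norm (f x))\<^sup>2 + (norm (g x))\<^sup>2"])
      (use le assms in \<open>auto intro!: Bochner_Integration.integrable_add simp: sq_int_def norm_mult\<close>)
qed

lemma borel_measurable_cnj [measurable (raw)]:
  "f \<in> borel_measurable M \<Longrightarrow> (\<lambda>x. cnj (f x)) \<in> borel_measurable M"
  by (rule borel_measurable_continuous_on[OF continuous_on_cnj[OF continuous_on_id]])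

lemma Re_mult_cnj_self: "Re (z * cnj z) = (norm z)\<^sup>2"
  by (simp only: complex_mult_cnj cmod_power2 Re_complex_of_real)

lemma sq_int_cnj: "sq_int f \<Longrightarrow> sq_int (\<lambda>x. cnj (f x))"
  by (rule sq_int_dominated[where C=1 and f=f]) (auto)

lemma sq_int_cnj_integrable:
  "sq_int f \<Longrightarrow> sq_int g \<Longrightarrow> integrable lborel (\<lambda>x. f x * cnj (g x))"
  by (intro sq_int_prod_integrable sq_int_cnj)

lemma sq_int_Re_integrable:
  "sq_int f \<Longrightarrow> sq_int g \<Longrightarrow> integrable lborel (\<lambda>x. Re (f x * cnj (g x)))"
  using integrable_Re[OF sq_int_cnj_integrable] by simp

lemma sq_int_AE_cong:
  assumes "sq_int f" "AE x in lborel. f x = g x" and [measurable]: "g \<in> borel_measurable borel"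
  shows "sq_int g"
proof -
  have [measurable]: "f \<in> borel_measurable borel" using assms by auto
  have "integrable lborel (\<lambda>x. (norm (g x))\<^sup>2) = integrable lborel (\<lambda>x. (norm (f x))\<^sup>2)"
    by (rule integrable_cong_AE) (use assms(2) in auto)
  then show ?thesis using assms by (simp add: sq_int_def)
qed

\<comment> \<open>A type of classes modulo null sets is formed so that the abstract Hilbert space
  arguments, stated for instances of \<open>real_inner\<close> and \<open>complete_space\<close>,
  apply to it. The relation is partial because only square integrable functions have a
  class.\<close>
quotient_type (overloaded) 'a l2 = "'a::euclidean_space \<Rightarrow> complex" /
  partial: "\<lambda>f g. sq_int f \<and> sq_int g \<and> (AE x in lborel. f x = g x)"
proof (rule part_equivpI)
  show "\<exists>f :: 'a \<Rightarrow> complex. sq_int f \<and> sq_int f \<and> (AE x in lborel. f x = f x)"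
    by (rule exI[of _ "\<lambda>_. 0"]) simp
  show "symp (\<lambda>f g :: 'a \<Rightarrow> complex. sq_int f \<and> sq_int g \<and> (AE x in lborel. f x = g x))"
    by (auto simp: symp_def)
  show "transp (\<lambda>f g :: 'a \<Rightarrow> complex. sq_int f \<and> sq_int g \<and> (AE x in lborel. f x = g x))"
    unfolding transp_def by (auto elim: eventually_elim2)
qed

definition Fn :: "'a::euclidean_space l2 \<Rightarrow> 'a \<Rightarrow> complex" where "Fn = rep_l2"
definition L2c :: "('a::euclidean_space \<Rightarrow> complex) \<Rightarrow> 'a l2" where "L2c = abs_l2"

lemma sq_int_Fn [simp]: "sq_int (Fn x)"
  unfolding Fn_def using Quotient3_rep_reflp[OF Quotient3_l2, of x] by simp

lemma Fn_measurable [measurable]: "Fn x \<in> borel_measurable borel"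
  using sq_int_Fn sq_int_measurable by blast

lemma L2c_Fn [simp]: "L2c (Fn x) = x"
  unfolding Fn_def L2c_def by (rule Quotient3_abs_rep[OF Quotient3_l2])

lemma L2c_eq_iff: "sq_int f \<Longrightarrow> sq_int g \<Longrightarrow> L2c f = L2c g \<longleftrightarrow> (AE x in lborel. f x = g x)"
  unfolding L2c_def using Quotient3_rel[OF Quotient3_l2, of f g] by simp

lemma Fn_L2c: "sq_int f \<Longrightarrow> AE x in lborel. Fn (L2c f) x = f x"
  using L2c_eq_iff[OF sq_int_Fn, of f "L2c f"] by simp

lemma l2_eqI: "AE x in lborel. Fn u x = Fn v x \<Longrightarrow> u = v"
  using L2c_eq_iff[OF sq_int_Fn sq_int_Fn, of u v] by simp

lemma L2c_eqI: "AE x in lborel. f x = Fn v x \<Longrightarrow> sq_int f \<Longrightarrow> L2c f = v"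
  using L2c_eq_iff[of f "Fn v"] by simp

text \<open>The inner product is the real part of the complex one. It has the same norm and the same
  weak convergence, and a complex pairing is recovered by testing also against the multiple by
  \<open>\<i>\<close>.\<close>

instantiation l2 :: (euclidean_space) real_inner
begin

definition zero_l2_def: "0 = L2c (\<lambda>_. 0)"
definition plus_l2_def: "u + v = L2c (\<lambda>x. Fn u x + Fn v x)"
definition uminus_l2_def: "- u = L2c (\<lambda>x. - Fn u x)"
definition minus_l2_def: "u - v = L2c (\<lambda>x. Fn u x - Fn v x)"
definition scaleR_l2_def: "r *\<^sub>R u = L2c (\<lambda>x. of_real r * Fn u x)"
definition inner_l2_def: "inner u v = (LINT x|lborel. Re (Fn u x * cnj (Fn v x)))"
definition norm_l2_def: "norm (u::'a l2) = sqrt (inner u u)"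
definition dist_l2_def: "dist (u::'a l2) v = norm (u - v)"
definition sgn_l2_def: "sgn (u::'a l2) = scaleR (inverse (norm u)) u"
definition uniformity_l2_def:
  "(uniformity :: ('a l2 \<times> 'a l2) filter) = (INF e\<in>{0<..}. principal {(x, y). dist x y < e})"
definition open_l2_def:
  "open (U :: 'a l2 set) \<longleftrightarrow> (\<forall>x\<in>U. eventually (\<lambda>(x', y). x' = x \<longrightarrow> y \<in> U) uniformity)"

lemma Fn_zero: "AE x in lborel. Fn (0::'a l2) x = 0"
  unfolding zero_l2_def by (rule Fn_L2c) simp
lemma Fn_plus: "AE x in lborel. Fn (u + v :: 'a l2) x = Fn u x + Fn v x"
  unfolding plus_l2_def by (rule Fn_L2c) (simp add: sq_int_add)
lemma Fn_uminus: "AE x in lborel. Fn (- u :: 'a l2) x = - Fn u x"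
  unfolding uminus_l2_def by (rule Fn_L2c) (simp add: sq_int_uminus)
lemma Fn_minus: "AE x in lborel. Fn (u - v :: 'a l2) x = Fn u x - Fn v x"
  unfolding minus_l2_def by (rule Fn_L2c) (simp add: sq_int_diff)
lemma Fn_scaleR: "AE x in lborel. Fn (r *\<^sub>R u :: 'a l2) x = of_real r * Fn u x"
  unfolding scaleR_l2_def by (rule Fn_L2c) (simp add: sq_int_cmult)

lemma inner_l2_AE:
  assumes "AE x in lborel. Fn (u::'a l2) x * cnj (Fn v x) = h x" and [measurable]: "h \<in> borel_measurable borel"
  shows "inner u v = (LINT x|lborel. Re (h x))"
proof -
  have "AE x in lborel. Re (Fn u x * cnj (Fn v x)) = Re (h x)"
    using assms(1) by eventually_elim (rule arg_cong[where f=Re])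
  then show ?thesis unfolding inner_l2_def by (intro integral_cong_AE) measurable
qed

instance
proof
  fix a b c u v w :: "'a l2" and r s :: real
  show "a + b + c = a + (b + c)"
    by (rule l2_eqI) (use Fn_plus[of "a+b" c] Fn_plus[of a b] Fn_plus[of a "b+c"] Fn_plus[of b c] in eventually_elim, simp)
  show "a + b = b + a"
    by (rule l2_eqI) (use Fn_plus[of a b] Fn_plus[of b a] in eventually_elim, simp)
  show "0 + a = a"
    by (rule l2_eqI) (use Fn_plus[of 0 a] Fn_zero in eventually_elim, simp)
  show "- a + a = 0"
    by (rule l2_eqI) (use Fn_plus[of "-a" a] Fn_uminus[of a] Fn_zero in eventually_elim, simp)
  show "a - b = a + - b"
    by (rule l2_eqI) (use Fn_plus[of a "- b"] Fn_minus[of a b] Fn_uminus[of b] in eventually_elim, simp)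
  show "r *\<^sub>R (a + b) = r *\<^sub>R a + r *\<^sub>R b"
    by (rule l2_eqI) (use Fn_scaleR[of r "a+b"] Fn_plus[of a b] Fn_plus[of "r *\<^sub>R a" "r *\<^sub>R b"] Fn_scaleR[of r a] Fn_scaleR[of r b]
        in eventually_elim, simp add: algebra_simps)
  show "(r + s) *\<^sub>R a = r *\<^sub>R a + s *\<^sub>R a"
    by (rule l2_eqI) (use Fn_scaleR[of "r+s" a] Fn_plus[of "r *\<^sub>R a" "s *\<^sub>R a"] Fn_scaleR[of r a] Fn_scaleR[of s a]
        in eventually_elim, simp add: algebra_simps)
  show "r *\<^sub>R s *\<^sub>R a = (r * s) *\<^sub>R a"
    by (rule l2_eqI) (use Fn_scaleR[of "r" "s *\<^sub>R a"] Fn_scaleR[of s a] Fn_scaleR[of "r * s" a]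
        in eventually_elim, simp add: algebra_simps)
  show "1 *\<^sub>R a = a"
    by (rule l2_eqI) (use Fn_scaleR[of 1 a] in eventually_elim, simp)
  show "dist u v = norm (u - v)" by (rule dist_l2_def)
  show "sgn u = scaleR (inverse (norm u)) u" by (rule sgn_l2_def)
  show "(uniformity :: ('a l2 \<times> 'a l2) filter) = (INF e\<in>{0<..}. principal {(x, y). dist x y < e})"
    by (rule uniformity_l2_def)
  show "open (U :: 'a l2 set) \<longleftrightarrow> (\<forall>x\<in>U. eventually (\<lambda>(x', y). x' = x \<longrightarrow> y \<in> U) uniformity)" for U
    by (rule open_l2_def)
  show "norm u = sqrt (inner u u)" by (rule norm_l2_def)
  show "inner u v = inner v u"
    unfolding inner_l2_def by (rule Bochner_Integration.integral_cong) (auto simp: mult.commute)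
  have "inner (u + v) w = (LINT x|lborel. Re ((Fn u x + Fn v x) * cnj (Fn w x)))"
    by (rule inner_l2_AE) (use Fn_plus[of u v] in \<open>eventually_elim, simp\<close>, measurable)
  also have "\<dots> = inner u w + inner v w"
    unfolding inner_l2_def
    by (subst Bochner_Integration.integral_add[symmetric]) (auto simp: sq_int_Re_integrable algebra_simps simp del: times_complex.sel)
  finally show "inner (u + v) w = inner u w + inner v w" .
  have "inner (r *\<^sub>R u) w = (LINT x|lborel. Re ((of_real r * Fn u x) * cnj (Fn w x)))"
    by (rule inner_l2_AE) (use Fn_scaleR[of r u] in \<open>eventually_elim, simp\<close>, measurable)
  also have "\<dots> = r * inner u w"
    unfolding inner_l2_def by (subst Bochner_Integration.integral_mult_right_zero[symmetric])
      (auto simp: algebra_simps intro!: Bochner_Integration.integral_cong)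
  finally show "inner (r *\<^sub>R u) w = r * inner u w" .
  have eq: "inner u u = (LINT x|lborel. (norm (Fn u x))\<^sup>2)"
    unfolding inner_l2_def by (rule Bochner_Integration.integral_cong) (simp_all only: Re_mult_cnj_self)
  show "0 \<le> inner u u" unfolding eq by simp
  show "(inner u u = 0) = (u = 0)"
  proof
    assume "inner u u = 0"
    then have "AE x in lborel. (norm (Fn u x))\<^sup>2 = 0"
      unfolding eq using integral_nonneg_eq_0_iff_AE[OF sq_int_integrable[OF sq_int_Fn[of u]]] by simp
    then have ae: "AE x in lborel. Fn u x = 0" by simp
    show "u = 0" by (rule l2_eqI) (use ae Fn_zero in eventually_elim, simp)
  next
    assume "u = 0"
    then have "AE x in lborel. (norm (Fn u x))\<^sup>2 = 0" using Fn_zero by auto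
    then show "inner u u = 0"
      unfolding eq using integral_nonneg_eq_0_iff_AE[OF sq_int_integrable[OF sq_int_Fn[of u]]] by simp
  qed
qed

end

lemma norm_l2_sq: "(norm u)\<^sup>2 = (LINT x|lborel. (norm (Fn u x))\<^sup>2)"
  unfolding power2_norm_eq_inner[of u] inner_l2_def
  by (rule Bochner_Integration.integral_cong) (simp_all only: Re_mult_cnj_self)

lemma nn_norm_l2: "(\<integral>\<^sup>+x. ennreal ((norm (Fn u x))\<^sup>2) \<partial>lborel) = ennreal ((norm u)\<^sup>2)"
  unfolding norm_l2_sq by (rule nn_integral_eq_integral) (auto simp: sq_int_integrable)

lemma nn_norm_L2c:
  assumes "sq_int f"
  shows "(\<integral>\<^sup>+x. ennreal ((norm (f x))\<^sup>2) \<partial>lborel) = ennreal ((norm (L2c f))\<^sup>2)"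
  unfolding nn_norm_l2[symmetric] by (rule nn_integral_cong_AE) (use Fn_L2c[OF assms] in auto)

lemma norm_L2c_sq: "sq_int f \<Longrightarrow> (norm (L2c f))\<^sup>2 = (LINT x|lborel. (norm (f x))\<^sup>2)"
  unfolding norm_l2_sq by (rule integral_cong_AE) (use Fn_L2c[of f] in auto)

lemma inner_L2c:
  assumes "sq_int f" "sq_int g"
  shows "inner (L2c f) (L2c g) = (LINT x|lborel. Re (f x * cnj (g x)))"
proof -
  have [measurable]: "f \<in> borel_measurable borel" "g \<in> borel_measurable borel" using assms by auto
  show ?thesis
    by (rule inner_l2_AE) (use Fn_L2c[OF assms(1)] Fn_L2c[OF assms(2)] in \<open>eventually_elim, simp\<close>, measurable)
qed

lemma L2c_add:
  assumes "sq_int f" "sq_int g" shows "L2c (\<lambda>x. f x + g x) = L2c f + L2c g"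
  by (rule L2c_eqI, use Fn_plus[of "L2c f" "L2c g"] Fn_L2c[OF assms(1)] Fn_L2c[OF assms(2)] in eventually_elim)
    (auto simp: sq_int_add assms)

lemma L2c_diff:
  assumes "sq_int f" "sq_int g" shows "L2c (\<lambda>x. f x - g x) = L2c f - L2c g"
  by (rule L2c_eqI, use Fn_minus[of "L2c f" "L2c g"] Fn_L2c[OF assms(1)] Fn_L2c[OF assms(2)] in eventually_elim)
    (auto simp: sq_int_diff assms)

lemma L2c_scaleR:
  assumes "sq_int f" shows "L2c (\<lambda>x. of_real r * f x) = r *\<^sub>R L2c f"
  by (rule L2c_eqI, use Fn_scaleR[of r "L2c f"] Fn_L2c[OF assms] in eventually_elim)
    (auto simp: sq_int_cmult assms)

section \<open>Norm limits, pointwise limits and completeness\<close>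

lemma L2_limit_AE_subseq:
  assumes "(\<lambda>n. u n) \<longlonglongrightarrow> (v :: 'a::euclidean_space l2)"
  shows "\<exists>r::nat \<Rightarrow> nat. strict_mono r \<and> (AE x in lborel. (\<lambda>n. Fn (u (r n)) x) \<longlonglongrightarrow> Fn v x)"
proof -
  have "(\<lambda>n. norm (u n - v)) \<longlonglongrightarrow> 0" using assms by (simp add: LIM_zero_iff tendsto_norm_zero)
  then have "(\<lambda>n. (norm (u n - v))\<^sup>2) \<longlonglongrightarrow> 0" using tendsto_power[of _ 0 sequentially 2] by fastforce
  then have "(\<lambda>n. LINT x|lborel. norm ((norm (Fn (u n - v) x))\<^sup>2)) \<longlonglongrightarrow> 0"
    by (simp add: norm_l2_sq)
  then obtain r :: "nat \<Rightarrow> nat" where r: "strict_mono r"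
    and lim: "AE x in lborel. (\<lambda>n. (norm (Fn (u (r n) - v) x))\<^sup>2) \<longlonglongrightarrow> 0"
    using tendsto_L1_AE_subseq[where u="\<lambda>n x. (norm (Fn (u n - v) x))\<^sup>2" and M=lborel]
    by (auto simp: sq_int_integrable)
  have "AE x in lborel. \<forall>n. Fn (u (r n) - v) x = Fn (u (r n)) x - Fn v x"
    unfolding AE_all_countable using Fn_minus by blast
  with lim have "AE x in lborel. (\<lambda>n. Fn (u (r n)) x) \<longlonglongrightarrow> Fn v x"
  proof eventually_elim
    case (elim x)
    then have "(\<lambda>n. sqrt ((norm (Fn (u (r n)) x - Fn v x))\<^sup>2)) \<longlonglongrightarrow> sqrt 0"
      by (intro tendsto_real_sqrt) simp
    then show ?case by (simp add: LIM_zero_iff tendsto_norm_zero_iff)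
  qed
  with r show ?thesis by blast
qed

text \<open>Identifies a limit in norm with one computed pointwise. This is how explicit formulas
  are attached to transforms that are only defined as norm limits.\<close>

lemma L2_limit_pointwise:
  assumes "(\<lambda>n. u n) \<longlonglongrightarrow> (v :: 'a::euclidean_space l2)"
    and "AE x in lborel. (\<lambda>n. Fn (u n) x) \<longlonglongrightarrow> g x"
  shows "AE x in lborel. Fn v x = g x"
proof -
  obtain r :: "nat \<Rightarrow> nat" where r: "strict_mono r" "AE x in lborel. (\<lambda>n. Fn (u (r n)) x) \<longlonglongrightarrow> Fn v x"
    using L2_limit_AE_subseq[OF assms(1)] by blast
  from r(2) assms(2) show ?thesis
  proof eventually_elim
    case (elim x)
    then show ?case using LIMSEQ_subseq_LIMSEQ[OF elim(2) r(1)] LIMSEQ_unique by (auto simp: o_def)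
  qed
qed

lemma L2_dominated_convergence:
  fixes f :: "'a::euclidean_space \<Rightarrow> complex"
  assumes "\<And>n. sq_int (s n)" "sq_int f" "sq_int w"
    and "AE x in lborel. (\<lambda>n. s n x) \<longlonglongrightarrow> f x" and "\<And>n x. norm (s n x) \<le> norm (w x)"
  shows "(\<lambda>n. L2c (s n)) \<longlonglongrightarrow> L2c f"
proof -
  have [measurable]: "f \<in> borel_measurable borel" "w \<in> borel_measurable borel" "\<And>n. s n \<in> borel_measurable borel"
    using assms by auto
  have ae: "AE x in lborel. norm (f x) \<le> norm (w x)"
    using assms(4) by eventually_elim (rule Lim_bounded[OF tendsto_norm], use assms(5) in auto)
  have "(\<lambda>n. LINT x|lborel. (norm (s n x - f x))\<^sup>2) \<longlonglongrightarrow> (LINT x|(lborel::'a measure). 0)"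
  proof (rule integral_dominated_convergence[where w="\<lambda>x. 4 * (norm (w x))\<^sup>2"])
    show "integrable lborel (\<lambda>x. 4 * (norm (w x))\<^sup>2)" using assms(3) by (simp add: sq_int_integrable)
    show "AE x in lborel. (\<lambda>n. (norm (s n x - f x))\<^sup>2) \<longlonglongrightarrow> 0"
      using assms(4)
    proof eventually_elim
      case (elim x)
      then have "(\<lambda>n. norm (s n x - f x)) \<longlonglongrightarrow> 0" by (simp add: LIM_zero_iff tendsto_norm_zero)
      then show ?case using tendsto_power[of _ 0 sequentially 2] by fastforce
    qed
    show "AE x in lborel. norm ((norm (s n x - f x))\<^sup>2) \<le> 4 * (norm (w x))\<^sup>2" for n
      using ae
    proof eventually_elim
      case (elim x)
      have "norm (s n x - f x) \<le> 2 * norm (w x)"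
        using norm_triangle_ineq4[of "s n x" "f x"] assms(5)[of n x] elim by linarith
      from power_mono[OF this norm_ge_zero, of 2] show ?case by (simp add: power_mult_distrib)
    qed
  qed auto
  then have "(\<lambda>n. (norm (L2c (s n) - L2c f))\<^sup>2) \<longlonglongrightarrow> 0"
    using assms by (simp add: L2c_diff[symmetric] norm_L2c_sq sq_int_diff)
  then have "(\<lambda>n. sqrt ((norm (L2c (s n) - L2c f))\<^sup>2)) \<longlonglongrightarrow> sqrt 0" by (rule tendsto_real_sqrt)
  then show ?thesis by (simp add: LIM_zero_iff tendsto_norm_zero_iff)
qed

text \<open>Riesz-Fischer: a fast subsequence converges almost everywhere, Fatou's lemma bounds its
  distance to the pointwise limit, and the Cauchy property carries the convergence over to the whole
  sequence.\<close>

lemma Cauchy_l2_convergent: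
  fixes X :: "nat \<Rightarrow> 'a::euclidean_space l2"
  assumes "Cauchy X" shows "convergent X"
proof -
  have "\<exists>N. \<forall>m\<ge>N. \<forall>n\<ge>N. dist (X m) (X n) < (1/2)^k" for k
    using assms unfolding Cauchy_def by simp
  then obtain N where N: "\<And>k m n. m \<ge> N k \<Longrightarrow> n \<ge> N k \<Longrightarrow> dist (X m) (X n) < (1/2)^k" by metis
  \<comment> \<open>The sum passes every threshold \<open>N j\<close> with \<open>j \<le> k\<close>,
    although the thresholds need not be monotone.\<close>
  define R where "R k = (\<Sum>i\<le>k. N i) + k" for k
  have RN: "R k \<ge> N j" if "j \<le> k" for j k
    unfolding R_def using member_le_sum[of j "{..k}" N] that by auto
  define f where "f k = Fn (X (R k))" for k
  have [measurable]: "f k \<in> borel_measurable borel" for k by (simp add: f_def)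
  have fd: "(\<integral>\<^sup>+x. ennreal ((norm (f m x - f n x))\<^sup>2) \<partial>lborel) \<le> ennreal (((1/2)^k)\<^sup>2)" if "m \<ge> k" "n \<ge> k" for m n k
  proof -
    have "(\<integral>\<^sup>+x. ennreal ((norm (f m x - f n x))\<^sup>2) \<partial>lborel) = ennreal ((norm (X (R m) - X (R n)))\<^sup>2)"
      unfolding f_def by (subst nn_norm_L2c) (auto simp: sq_int_diff minus_l2_def[symmetric])
    also have "\<dots> \<le> ennreal (((1/2)^k)\<^sup>2)"
      using N[of k "R m" "R n"] RN that by (intro ennreal_leI power_mono) (auto simp: dist_norm)
    finally show ?thesis .
  qed
  \<comment> \<open>The squared increments have integral at most \<open>(1/4)^k\<close>. The weight
    \<open>2^k\<close> still leaves a convergent series, and its finiteness at \<open>x\<close>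
    forces the increments there to decay like \<open>(1 / sqrt 2)^k\<close>, which is
    summable.\<close>
  have "(\<integral>\<^sup>+x. (\<Sum>k. ennreal (2^k * (norm (f (Suc k) x - f k x))\<^sup>2)) \<partial>lborel)
      = (\<Sum>k. \<integral>\<^sup>+x. ennreal (2^k * (norm (f (Suc k) x - f k x))\<^sup>2) \<partial>lborel)"
    by (rule nn_integral_suminf) simp
  also have "\<dots> \<le> (\<Sum>k. ennreal ((1/2)^k))"
  proof (rule suminf_le)
    fix k
    have "(\<integral>\<^sup>+x. ennreal (2^k * (norm (f (Suc k) x - f k x))\<^sup>2) \<partial>lborel)
        = ennreal (2^k) * (\<integral>\<^sup>+x. ennreal ((norm (f (Suc k) x - f k x))\<^sup>2) \<partial>lborel)"
      by (subst nn_integral_cmult[symmetric]) (auto simp: ennreal_mult)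
    also have "\<dots> \<le> ennreal (2^k) * ennreal (((1/2)^k)\<^sup>2)"
      by (intro mult_left_mono fd) auto
    also have "\<dots> = ennreal ((1/2)^k)"
      by (simp add: ennreal_mult[symmetric] power2_eq_square power_divide)
    finally show "(\<integral>\<^sup>+x. ennreal (2^k * (norm (f (Suc k) x - f k x))\<^sup>2) \<partial>lborel) \<le> ennreal ((1/2)^k)" .
  qed auto
  also have "\<dots> = ennreal (\<Sum>k. (1/2)^k)" by (rule suminf_ennreal_eq) (auto intro: summable_sums)
  finally have "(\<integral>\<^sup>+x. (\<Sum>k. ennreal (2^k * (norm (f (Suc k) x - f k x))\<^sup>2)) \<partial>lborel) \<noteq> \<infinity>"
    by (auto simp: top_unique)
  then have "AE x in lborel. (\<Sum>k. ennreal (2^k * (norm (f (Suc k) x - f k x))\<^sup>2)) \<noteq> \<infinity>"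
    by (intro nn_integral_PInf_AE) auto
  then have conv: "AE x in lborel. convergent (\<lambda>k. f k x)"
  proof eventually_elim
    case (elim x)
    have "summable (\<lambda>k. 2^k * (norm (f (Suc k) x - f k x))\<^sup>2)"
      by (rule summable_suminf_not_top) (use elim in auto)
    then have "(\<lambda>k. 2^k * (norm (f (Suc k) x - f k x))\<^sup>2) \<longlonglongrightarrow> 0" by (rule summable_LIMSEQ_zero)
    then have "Bseq (\<lambda>k. 2^k * (norm (f (Suc k) x - f k x))\<^sup>2)" by (intro convergent_imp_Bseq convergentI)
    then obtain C where C: "C > 0" "\<And>k. norm (2^k * (norm (f (Suc k) x - f k x))\<^sup>2) \<le> C"
      by (auto simp: Bseq_def)
    have bnd: "norm (f (Suc k) x - f k x) \<le> sqrt C * (1 / sqrt 2)^k" for k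
    proof -
      have "(norm (f (Suc k) x - f k x))\<^sup>2 \<le> C / 2^k"
        using C(2)[of k] by (simp add: field_simps)
      from real_sqrt_le_mono[OF this] show ?thesis
        by (simp add: real_sqrt_divide real_sqrt_power power_divide)
    qed
    have "summable (\<lambda>k. f (Suc k) x - f k x)"
      by (rule summable_comparison_test'[OF _ bnd]) (auto intro!: summable_mult summable_geometric)
    then have "convergent (\<lambda>n. \<Sum>k<n. f (Suc k) x - f k x)" by (simp add: summable_iff_convergent)
    then have "convergent (\<lambda>n. f n x - f 0 x)" by (simp only: sum_lessThan_telescope[of "\<lambda>k. f k x"])
    then have "convergent (\<lambda>n. (f n x - f 0 x) + f 0 x)" by (rule convergent_add) (rule convergent_const)
    then show ?case by simp
  qed
  define g where "g x = lim (\<lambda>k. f k x)" for x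
  have [measurable]: "g \<in> borel_measurable borel" unfolding g_def by measurable
  have lim: "AE x in lborel. (\<lambda>k. f k x) \<longlonglongrightarrow> g x"
    using conv by eventually_elim (simp add: g_def convergent_LIMSEQ_iff)
  \<comment> \<open>Fatou's lemma in \<open>m\<close> with \<open>k\<close> fixed.\<close>
  have gf: "(\<integral>\<^sup>+x. ennreal ((norm (g x - f k x))\<^sup>2) \<partial>lborel) \<le> ennreal (((1/2)^k)\<^sup>2)" for k
  proof -
    have "(\<integral>\<^sup>+x. ennreal ((norm (g x - f k x))\<^sup>2) \<partial>lborel)
        = (\<integral>\<^sup>+x. liminf (\<lambda>m. ennreal ((norm (f m x - f k x))\<^sup>2)) \<partial>lborel)"
    proof (rule nn_integral_cong_AE, use lim in eventually_elim)
      case (elim x)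
      then have "(\<lambda>m. ennreal ((norm (f m x - f k x))\<^sup>2)) \<longlonglongrightarrow> ennreal ((norm (g x - f k x))\<^sup>2)"
        by (intro tendsto_intros)
      then show ?case by (intro lim_imp_Liminf[symmetric]) auto
    qed
    also have "\<dots> \<le> liminf (\<lambda>m. \<integral>\<^sup>+x. ennreal ((norm (f m x - f k x))\<^sup>2) \<partial>lborel)"
      by (rule nn_integral_liminf) simp
    also have "\<dots> \<le> ennreal (((1/2)^k)\<^sup>2)"
      by (rule Liminf_le) (auto intro!: eventually_sequentiallyI[of k] fd)
    finally show ?thesis .
  qed
  have "sq_int (\<lambda>x. g x - f 0 x)"
    unfolding sq_int_iff_nn using gf[of 0] by (auto simp: le_less_trans)
  then have sg: "sq_int g" using sq_int_add[of "\<lambda>x. g x - f 0 x" "f 0"] by (simp add: f_def)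
  have bd: "norm (X (R k) - L2c g) \<le> (1/2)^k" for k
  proof -
    have "ennreal ((norm (L2c g - X (R k)))\<^sup>2) \<le> ennreal (((1/2)^k)\<^sup>2)"
      using gf[of k] sg nn_norm_L2c[of "\<lambda>x. g x - f k x"] by (simp add: f_def sq_int_diff L2c_diff)
    then have "(norm (L2c g - X (R k)))\<^sup>2 \<le> ((1/2)^k)\<^sup>2" by (simp add: ennreal_le_iff)
    then show ?thesis by (simp add: power_mono_iff norm_minus_commute)
  qed
  have "X \<longlonglongrightarrow> L2c g"
    unfolding LIMSEQ_iff
  proof (intro allI impI)
    fix e :: real assume "e > 0"
    then obtain k where k: "(1/2)^k < e/2" using real_arch_pow_inv[of "e/2" "1/2"] by auto
    have "norm (X n - L2c g) < e" if "n \<ge> N k" for n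
    proof -
      have "norm (X n - X (R k)) < (1/2)^k" using N[of k n "R k"] RN[of k k] that by (simp add: dist_norm)
      then show ?thesis
        using bd[of k] k norm_triangle_ineq[of "X n - X (R k)" "X (R k) - L2c g"] by simp
    qed
    then show "\<exists>no. \<forall>n\<ge>no. norm (X n - L2c g) < e" by blast
  qed
  then show ?thesis by (rule convergentI)
qed

instance l2 :: (euclidean_space) complete_space
  by standard (rule Cauchy_l2_convergent)
section \<open>Limits along ultrafilters\<close>

definition ultra :: "'a filter \<Rightarrow> bool" where
  "ultra F \<longleftrightarrow> F \<noteq> bot \<and> (\<forall>P. eventually P F \<or> eventually (\<lambda>x. \<not> P x) F)"

text \<open>Zorn's lemma for the nontrivial filters below \<open>F\<close>, looking for a minimal
  one. The infimum of a chain stays nontrivial because the infimum of finitely many members of a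
  chain is one of them.\<close>

lemma ultra_exists:
  assumes "F \<noteq> bot" shows "\<exists>U. ultra U \<and> U \<le> F"
proof -
  define A where "A = {G. G \<noteq> bot \<and> G \<le> F}"
  have "\<exists>m\<in>A. \<forall>a\<in>A. a \<le> m \<longrightarrow> a = m"
  proof (rule predicate_Zorn)
    show "partial_order_on A (relation_of (\<lambda>a b. b \<le> a) A)"
      by (rule partial_order_on_relation_ofI) auto
  next
    fix C assume "C \<in> Chains (relation_of (\<lambda>a b. b \<le> a) A)"
    then have CA: "C \<subseteq> A" and ch: "\<And>a b. a \<in> C \<Longrightarrow> b \<in> C \<Longrightarrow> b \<le> a \<or> a \<le> b"
      by (auto simp: Chains_def relation_of_def)
    show "\<exists>u\<in>A. \<forall>a\<in>C. u \<le> a"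
    proof (cases "C = {}")
      case True
      then show ?thesis using assms by (auto simp: A_def)
    next
      case False
      have fin: "Inf X \<in> C" if "finite X" "X \<noteq> {}" "X \<subseteq> C" for X
        using that
      proof (induction X rule: finite_ne_induct)
        case (insert x X)
        then show ?case using ch[of x "Inf X"] by (auto simp: inf_absorb1 inf_absorb2)
      qed auto
      have "Inf C \<noteq> bot"
      proof (rule Inf_filter_not_bot)
        fix X assume X: "X \<subseteq> C" "finite X"
        show "Inf X \<noteq> bot"
        proof (cases "X = {}")
          case True
          have "(top :: 'a filter) \<noteq> bot"
          proof
            assume t: "(top :: 'a filter) = bot"
            have "F \<le> bot" unfolding t[symmetric] by (rule top_greatest)
            then show False using assms by (simp add: bot_unique)
          qed
          then show ?thesis using True by simp
        next
          case False then show ?thesis using fin[of X] X CA by (auto simp: A_def)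
        qed
      qed
      moreover obtain c where "c \<in> C" using False by auto
      then have "Inf C \<le> F" using CA Inf_lower[of c C] by (force simp: A_def)
      ultimately show ?thesis by (intro bexI[of _ "Inf C"]) (auto simp: A_def intro: Inf_lower)
    qed
  qed
  then obtain U where U: "U \<in> A" and min: "\<And>G. G \<in> A \<Longrightarrow> G \<le> U \<Longrightarrow> G = U" by blast
  \<comment> \<open>If \<open>P\<close> does not hold eventually, restricting \<open>U\<close> to
    the complement of \<open>P\<close> gives a nontrivial smaller filter, which by minimality is
    \<open>U\<close> itself.\<close>
  have "eventually (\<lambda>x. \<not> P x) U" if "\<not> eventually P U" for P
  proof -
    have "inf U (principal {x. \<not> P x}) \<noteq> bot"
      using that unfolding trivial_limit_def eventually_inf_principal by auto
    then have "inf U (principal {x. \<not> P x}) = U" using U by (intro min) (auto simp: A_def intro: le_infI1)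
    moreover have "eventually (\<lambda>x. \<not> P x) (inf U (principal {x. \<not> P x}))"
      unfolding eventually_inf_principal by simp
    ultimately show ?thesis by simp
  qed
  then show ?thesis using U by (auto simp: ultra_def A_def)
qed

lemma ultra_nontrivial: "ultra U \<Longrightarrow> U \<noteq> bot"
  by (simp add: ultra_def)

lemma ultra_not_eventually: "ultra U \<Longrightarrow> \<not> eventually P U \<Longrightarrow> eventually (\<lambda>x. \<not> P x) U"
  by (auto simp: ultra_def)

text \<open>Otherwise each point of \<open>K\<close> has a neighbourhood that is eventually avoided,
  and finitely many of these neighbourhoods cover \<open>K\<close>.\<close>

lemma ultra_compact_limit:
  assumes U: "ultra U" and K: "compact K" and ev: "eventually (\<lambda>x. f x \<in> K) U"
  shows "\<exists>l\<in>K. (f \<longlongrightarrow> l) U"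
proof (rule ccontr)
  assume "\<not> (\<exists>l\<in>K. (f \<longlongrightarrow> l) U)"
  then have "\<forall>l\<in>K. \<exists>S. open S \<and> l \<in> S \<and> \<not> eventually (\<lambda>x. f x \<in> S) U"
    by (auto simp: tendsto_def)
  then obtain S where S: "\<And>l. l \<in> K \<Longrightarrow> open (S l)" "\<And>l. l \<in> K \<Longrightarrow> l \<in> S l"
    and ne: "\<And>l. l \<in> K \<Longrightarrow> \<not> eventually (\<lambda>x. f x \<in> S l) U" by metis
  have "K \<subseteq> (\<Union>l\<in>K. S l)" using S by blast
  then obtain D where D: "D \<subseteq> K" "finite D" "K \<subseteq> (\<Union>l\<in>D. S l)"
    using compactE_image[OF K, of K S] S(1) by metis
  have "eventually (\<lambda>x. \<forall>l\<in>D. f x \<notin> S l) U"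
    using D ne ultra_not_eventually[OF U] by (intro eventually_ball_finite) auto
  then have "eventually (\<lambda>x. False) U" using ev by eventually_elim (use D in blast)
  then show False using ultra_nontrivial[OF U] by simp
qed

lemma ultra_bounded_limit:
  fixes f :: "'b \<Rightarrow> 'a::euclidean_space"
  assumes "ultra U" "eventually (\<lambda>x. norm (f x) \<le> C) U"
  shows "\<exists>l. (f \<longlongrightarrow> l) U"
  using ultra_compact_limit[OF assms(1) compact_cball[of 0 C], of f] assms(2) by auto

text \<open>The passage from the ultrafilter back to sequences: countably many properties that hold
  along \<open>U\<close> hold along one subsequence, the property with number \<open>k\<close> from
  index \<open>k\<close> on. Since \<open>U\<close> lies below \<open>sequentially\<close>,
  arbitrarily large indices are available at every stage.\<close>

lemma diagonal_subsequence:
  fixes U :: "nat filter" and P :: "nat \<Rightarrow> nat \<Rightarrow> bool"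
  assumes "U \<noteq> bot" "U \<le> sequentially" "\<And>k. eventually (P k) U"
  shows "\<exists>r. strict_mono r \<and> (\<forall>k. \<forall>n\<ge>k. P k (r n))"
proof -
  have ev: "eventually (\<lambda>m. (\<forall>k\<le>n. P k m) \<and> x < m) U" for n x :: nat
  proof (rule eventually_conj)
    have "eventually (\<lambda>m. \<forall>k\<in>{..n}. P k m) U"
      by (rule eventually_ball_finite) (use assms(3) in auto)
    then show "eventually (\<lambda>m. \<forall>k\<le>n. P k m) U" by (rule eventually_mono) auto
    show "eventually (\<lambda>m. x < m) U"
      using assms(2) eventually_gt_at_top[of x] by (auto simp: le_filter_def)
  qed
  have "\<exists>f. \<forall>n. (\<forall>k\<le>n. P k (f n)) \<and> f n < f (Suc n)"
  proof (rule dependent_nat_choice)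
    show "\<exists>x. \<forall>k\<le>0. P k x"
      using eventually_happens[OF ev[of 0 0]] assms(1) by auto
    show "\<exists>y. (\<forall>k\<le>Suc n. P k y) \<and> x < y" for x n
      using eventually_happens[OF ev[of "Suc n" x]] assms(1) by auto
  qed
  then obtain f where "\<forall>n. (\<forall>k\<le>n. P k (f n)) \<and> f n < f (Suc n)" by blast
  then show ?thesis by (intro exI[of _ f]) (auto simp: strict_mono_Suc_iff)
qed

section \<open>Weak compactness in Hilbert space\<close>

text \<open>The representing vector minimises the functional \<open>Q h\<close>, the squared norm of
  \<open>h\<close> minus \<open>2 * l h\<close>; the first variation at the minimum is the claimed
  identity.\<close>

lemma riesz_representation:
  fixes l :: "'h::{real_inner,complete_space} \<Rightarrow> real"
  assumes lin: "linear l" and bd: "\<And>h. \<bar>l h\<bar> \<le> C * norm h"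
  shows "\<exists>v. \<forall>h. l h = inner v h"
proof -
  define Q where "Q h = (norm h)\<^sup>2 - 2 * l h" for h
  have low: "Q h \<ge> - (C\<^sup>2)" for h
  proof -
    have "2 * l h \<le> 2 * (C * norm h)" using bd[of h] by linarith
    then show ?thesis using zero_le_power2[of "norm h - C"]
      unfolding Q_def by (simp add: power2_eq_square algebra_simps)
  qed
  define m where "m = Inf (range Q)"
  have bdd: "bdd_below (range Q)" using low by (auto intro!: bdd_belowI[of _ "-(C\<^sup>2)"])
  have mle: "m \<le> Q h" for h unfolding m_def by (rule cInf_lower) (use bdd in auto)
  have "\<exists>h. Q h < m + 1 / Suc n" for n
  proof -
    have "Inf (range Q) < m + 1 / Suc n" by (simp add: m_def)
    from cInf_lessD[OF _ this] show ?thesis by auto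
  qed
  then obtain h where h: "\<And>n. Q (h n) < m + 1 / Suc n" by metis
  \<comment> \<open>The parallelogram identity at the midpoint makes minimising sequences
    Cauchy.\<close>
  have par: "(norm (a - b))\<^sup>2 \<le> 2 * (Q a + Q b) - 4 * m" for a b
  proof -
    have "Q ((1/2) *\<^sub>R (a + b)) = (Q a + Q b) / 2 - (norm (a - b))\<^sup>2 / 4"
      unfolding Q_def linear_scale[OF lin] linear_add[OF lin] power2_norm_eq_inner
      by (simp add: inner_simps inner_commute field_simps)
    with mle[of "(1/2) *\<^sub>R (a + b)"] show ?thesis by linarith
  qed
  have "Cauchy h"
    unfolding Cauchy_def
  proof (intro allI impI)
    fix e :: real assume e: "e > 0"
    have gen: "x \<le> 2 * (a + b) - 4 * c \<Longrightarrow> a < c + d / 4 \<Longrightarrow> b < c + d / 4 \<Longrightarrow> x < d"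
      for x a b c d :: real by auto
    have "e\<^sup>2 / 4 > 0" using e by simp
    then obtain N where N: "1 / Suc N < e\<^sup>2 / 4" using nat_approx_posE by blast
    have "dist (h i) (h j) < e" if "i \<ge> N" "j \<ge> N" for i j
    proof -
      have Qs: "Q (h k) < m + e\<^sup>2 / 4" if "k \<ge> N" for k
      proof -
        have "1 / real (Suc k) \<le> 1 / real (Suc N)" using that by (intro divide_left_mono) auto
        with N have "m + 1 / real (Suc k) < m + e\<^sup>2 / 4" by (meson add_strict_left_mono le_less_trans)
        with h[of k] show ?thesis by (rule less_trans)
      qed
      have "(norm (h i - h j))\<^sup>2 < e\<^sup>2"
        by (rule gen[OF par[of "h i" "h j"] Qs[OF that(1)] Qs[OF that(2)]])
      then show ?thesis using e by (simp add: dist_norm power_less_imp_less_base)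
    qed
    then show "\<exists>M. \<forall>m\<ge>M. \<forall>n\<ge>M. dist (h m) (h n) < e" by blast
  qed
  then obtain v where v: "h \<longlonglongrightarrow> v" using Cauchy_convergent_iff convergentD by blast
  have bl: "bounded_linear l"
    using lin bd by (intro bounded_linear_intro[where K=C]) (auto simp: linear_add linear_scale mult.commute)
  have "(\<lambda>n. Q (h n)) \<longlonglongrightarrow> Q v"
    unfolding Q_def by (intro tendsto_intros bounded_linear.tendsto[OF bl] v)
  moreover have "(\<lambda>n. m + 1 / Suc n) \<longlonglongrightarrow> m + 0"
    by (intro tendsto_add tendsto_const LIMSEQ_Suc[OF lim_1_over_n])
  ultimately have Qv: "Q v \<le> m"
    using h by (intro LIMSEQ_le[of "\<lambda>n. Q (h n)" _ "\<lambda>n. m + 1 / Suc n"]) (auto intro: less_imp_le)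
  have "l k = inner v k" for k
  proof -
    define d where "d = inner v k - l k"
    have ineq: "0 \<le> 2 * t * d + t\<^sup>2 * (norm k)\<^sup>2" for t
    proof -
      have "Q (v + t *\<^sub>R k) = Q v + 2 * t * d + t\<^sup>2 * (norm k)\<^sup>2"
        unfolding Q_def d_def linear_scale[OF lin] linear_add[OF lin] power2_norm_eq_inner
        by (simp add: inner_simps inner_commute algebra_simps power2_eq_square)
      with mle[of "v + t *\<^sub>R k"] Qv show ?thesis by linarith
    qed
    have "d = 0"
    proof (cases "norm k = 0")
      case True
      then show ?thesis by (simp add: d_def linear_0[OF lin])
    next
      case False
      then have pos: "(norm k)\<^sup>2 > 0" by simp
      \<comment> \<open>The step size minimises the quadratic in \<open>t\<close>, so that its value
        there is nonpositive and vanishes only for \<open>d = 0\<close>.\<close>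
      have "0 \<le> 2 * (- d / (norm k)\<^sup>2) * d + (- d / (norm k)\<^sup>2)\<^sup>2 * (norm k)\<^sup>2" by (rule ineq)
      also have "\<dots> = - (d\<^sup>2 / (norm k)\<^sup>2)" using pos by (simp add: field_simps power2_eq_square)
      finally show ?thesis using pos by (simp add: zero_le_divide_iff divide_le_0_iff)
    qed
    then show ?thesis by (simp add: d_def)
  qed
  then show ?thesis by blast
qed

definition weakly :: "'b filter \<Rightarrow> ('b \<Rightarrow> 'h::real_inner) \<Rightarrow> 'h \<Rightarrow> bool" where
  "weakly F x l \<longleftrightarrow> (\<forall>h. ((\<lambda>n. inner (x n) h) \<longlongrightarrow> inner l h) F)"

lemma weaklyD: "weakly F x l \<Longrightarrow> ((\<lambda>n. inner (x n) h) \<longlongrightarrow> inner l h) F"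
  by (simp add: weakly_def)

lemma abs_inner_le: "norm x \<le> C \<Longrightarrow> \<bar>inner x h\<bar> \<le> C * norm h" for x h :: "'h::real_inner"
  using Cauchy_Schwarz_ineq2[of x h] mult_right_mono[of "norm x" C "norm h"] by simp

text \<open>Along an ultrafilter all bounded pairings converge at once, and their limits form a
  bounded linear functional, to which Riesz representation applies.\<close>

lemma ultra_weak_compact:
  fixes x :: "'b \<Rightarrow> 'h::{real_inner,complete_space}"
  assumes U: "ultra U" and bd: "\<And>n. norm (x n) \<le> C"
  shows "\<exists>l. weakly U x l"
proof -
  have "\<exists>L. ((\<lambda>n. inner (x n) h) \<longlongrightarrow> L) U" for h
    by (rule ultra_bounded_limit[OF U, of _ "C * norm h"])
      (use abs_inner_le[OF bd] in \<open>auto intro!: always_eventually\<close>)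
  then obtain L where L: "\<And>h. ((\<lambda>n. inner (x n) h) \<longlongrightarrow> L h) U" by metis
  have nt: "U \<noteq> bot" by (rule ultra_nontrivial[OF U])
  have "linear L"
  proof (rule linearI)
    show "L (a + b) = L a + L b" for a b
      by (rule tendsto_unique[OF nt L]) (simp add: inner_simps tendsto_add L)
    show "L (r *\<^sub>R a) = r *\<^sub>R L a" for r a
      by (rule tendsto_unique[OF nt L]) (simp add: inner_simps tendsto_mult L)
  qed
  moreover have "\<bar>L h\<bar> \<le> C * norm h" for h
    by (rule tendsto_upperbound[OF tendsto_rabs[OF L] _ nt])
      (use abs_inner_le[OF bd] in \<open>auto intro!: always_eventually\<close>)
  ultimately obtain v where "\<forall>h. L h = inner v h" using riesz_representation by blast
  then show ?thesis using L by (auto simp: weakly_def)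
qed

lemma weakly_norm_le:
  assumes "F \<noteq> bot" "weakly F x l" "\<And>n. norm (x n) \<le> C"
  shows "norm l \<le> C"
proof -
  have "inner l l \<le> C * norm l"
    by (rule tendsto_upperbound[OF weaklyD[OF assms(2)] _ assms(1)])
      (use abs_inner_le[OF assms(3)] in \<open>auto intro!: always_eventually simp: abs_le_iff\<close>)
  then have "norm l * norm l \<le> C * norm l" by (simp add: dot_square_norm power2_eq_square)
  moreover have "0 \<le> C" using assms(3) norm_ge_zero order_trans by blast
  ultimately show ?thesis by (cases "norm l = 0") auto
qed

lemma weakly_strong_inner:
  assumes "weakly F x l" "\<And>n. norm (x n) \<le> C" "(h \<longlongrightarrow> k) F"
  shows "((\<lambda>n. inner (x n) (h n)) \<longlongrightarrow> inner l k) F"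
proof -
  have "((\<lambda>n. norm (h n - k)) \<longlongrightarrow> 0) F" using assms(3) by (simp add: LIM_zero_iff tendsto_norm_zero)
  then have z: "((\<lambda>n. C * norm (h n - k)) \<longlongrightarrow> 0) F" using tendsto_mult_right_zero by blast
  have "((\<lambda>n. inner (x n) (h n - k)) \<longlongrightarrow> 0) F"
    by (rule Lim_null_comparison[OF _ z]) (use abs_inner_le[OF assms(2)] in \<open>auto intro!: always_eventually\<close>)
  from tendsto_add[OF this weaklyD[OF assms(1), of k]] show ?thesis by (simp add: inner_simps)
qed

text \<open>Violating test vectors, one for each index, would converge inside \<open>K\<close> along
  the ultrafilter, and a weakly null bounded family paired with a convergent one tends to
  zero.\<close>

lemma weakly_null_uniform:
  assumes U: "ultra U" and "weakly U x 0" and bd: "\<And>n. norm (x n) \<le> C" and K: "compact K" and e: "e > 0"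
  shows "eventually (\<lambda>n. \<forall>h\<in>K. \<bar>inner (x n) h\<bar> \<le> e) U"
proof (rule ccontr)
  assume "\<not> ?thesis"
  then have ev: "eventually (\<lambda>n. \<exists>h. h \<in> K \<and> \<bar>inner (x n) h\<bar> > e) U"
    by (drule_tac ultra_not_eventually[OF U]) (auto simp: not_le elim: eventually_mono)
  define h where "h n = (SOME h. h \<in> K \<and> \<bar>inner (x n) h\<bar> > e)" for n
  have hev: "eventually (\<lambda>n. h n \<in> K \<and> \<bar>inner (x n) (h n)\<bar> > e) U"
    using ev by eventually_elim (auto simp: h_def intro: someI2_ex)
  then have "eventually (\<lambda>n. h n \<in> K) U" by eventually_elim simp
  then obtain k where "(h \<longlongrightarrow> k) U" using ultra_compact_limit[OF U K] by blast
  from weakly_strong_inner[OF assms(2) bd this]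
  have "((\<lambda>n. \<bar>inner (x n) (h n)\<bar>) \<longlongrightarrow> 0) U" by (simp add: tendsto_rabs_zero_iff)
  from order_tendstoD(2)[OF this e] hev have "eventually (\<lambda>_. False) U" by eventually_elim simp
  then show False using ultra_nontrivial[OF U] by simp
qed

section \<open>Profile decomposition for a group of dislocations\<close>

text \<open>The axioms serve the two possible behaviours of a pair of frames: if their difference
  stays bounded, \<open>M_cont\<close> turns one into a convergent perturbation of the other; if it
  escapes to infinity, \<open>M_mixing\<close> makes them asymptotically orthogonal.\<close>

locale dislocations =
  fixes M :: "'v::euclidean_space \<Rightarrow> 'h::{real_inner,complete_space} \<Rightarrow> 'h"
  assumes M_linear: "linear (M a)"
    and M_zero: "M 0 x = x"
    and M_add: "M (a + b) x = M a (M b x)"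
    and M_inner: "inner (M a x) (M a y) = inner x y"
    and M_cont: "continuous_on UNIV (\<lambda>a. M a x)"
    and M_mixing: "((\<lambda>a. inner (M a x) y) \<longlongrightarrow> 0) at_infinity"
begin

lemma M_adjoint: "inner (M a x) y = inner x (M (- a) y)"
  using M_inner[of a x "M (-a) y"] by (simp add: M_add[symmetric] M_zero)

lemma norm_M [simp]: "norm (M a x) = norm x"
  by (simp add: norm_eq_sqrt_inner M_inner)

definition profiles :: "'b filter \<Rightarrow> ('b \<Rightarrow> 'h) \<Rightarrow> 'h set" where
  "profiles U w = {\<Psi>. \<exists>\<xi>. weakly U (\<lambda>n. M (- \<xi> n) (w n)) \<Psi>}"

text \<open>Measures concentration: for a bounded family along an ultrafilter it is zero exactly
  when every moving frame sees only the weak limit 0.\<close>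

definition nu :: "'b filter \<Rightarrow> ('b \<Rightarrow> 'h) \<Rightarrow> real" where
  "nu U w = Sup (norm ` profiles U w)"

lemma profiles_norm_le_nu:
  assumes "ultra U" "\<And>n. norm (w n) \<le> C" "\<Psi> \<in> profiles U w"
  shows "norm \<Psi> \<le> nu U w"
proof -
  have "norm x \<le> C" if "x \<in> profiles U w" for x
    using that weakly_norm_le[OF ultra_nontrivial[OF assms(1)]] assms(2) unfolding profiles_def by force
  then have "bdd_above (norm ` profiles U w)" by (auto intro!: bdd_aboveI[of _ C])
  then show ?thesis unfolding nu_def using assms(3) by (intro cSup_upper) auto
qed

text \<open>The supremum defining \<open>nu\<close> need not be attained, hence the factor 2; if it
  is zero, any weak limit will do.\<close>

lemma profile_choice:
  assumes U: "ultra U" and bd: "\<And>n. norm (w n) \<le> C"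
  shows "\<exists>p. weakly U (\<lambda>n. M (- fst p n) (w n)) (snd p) \<and> nu U w \<le> 2 * norm (snd p)"
proof -
  obtain l where l: "weakly U (\<lambda>n. M (- 0) (w n)) l"
    using ultra_weak_compact[OF U, of "\<lambda>n. M (-0) (w n)"] bd by auto
  then have lp: "l \<in> profiles U w" unfolding profiles_def by (intro CollectI exI[of _ "\<lambda>_. 0"]) simp
  show ?thesis
  proof (cases "nu U w \<le> 0")
    case True
    then show ?thesis using l by (intro exI[of _ "(\<lambda>_. 0, l)"]) (auto intro: order_trans)
  next
    case False
    then have "nu U w / 2 < Sup (norm ` profiles U w)" by (simp add: nu_def)
    from less_cSupD[OF _ this] lp obtain x where x: "x \<in> profiles U w" "nu U w / 2 < norm x" by auto
    then show ?thesis unfolding profiles_def by force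
  qed
qed

text \<open>Choose a violating frame and test vector for each index. Moving the frame over to
  \<open>w\<close> by adjointness produces a profile, of norm at most \<open>nu U w\<close>, while
  the test vectors converge in \<open>K\<close>. Uniformity in the frame will later be uniformity
  over all points of space.\<close>

lemma nu_uniform:
  assumes U: "ultra U" and bd: "\<And>n. norm (w n) \<le> C"
    and K: "compact K" and B: "\<And>h. h \<in> K \<Longrightarrow> norm h \<le> B" and e: "e > 0"
  shows "eventually (\<lambda>n. \<forall>\<xi>. \<forall>h\<in>K. \<bar>inner (w n) (M \<xi> h)\<bar> \<le> B * nu U w + e) U"
proof (rule ccontr)
  assume "\<not> ?thesis"
  from ultra_not_eventually[OF U this]
  have ev: "eventually (\<lambda>n. \<exists>p. snd p \<in> K \<and> \<bar>inner (w n) (M (fst p) (snd p))\<bar> > B * nu U w + e) U"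
  proof eventually_elim
    case (elim n)
    then obtain \<xi> h where "h \<in> K" "B * nu U w + e < \<bar>inner (w n) (M \<xi> h)\<bar>" by (auto simp: not_le)
    then show ?case by (intro exI[of _ "(\<xi>, h)"]) simp
  qed
  define p where "p n = (SOME p. snd p \<in> K \<and> \<bar>inner (w n) (M (fst p) (snd p))\<bar> > B * nu U w + e)" for n
  have pev: "eventually (\<lambda>n. snd (p n) \<in> K \<and> \<bar>inner (w n) (M (fst (p n)) (snd (p n)))\<bar> > B * nu U w + e) U"
    using ev by eventually_elim (unfold p_def, rule someI_ex)
  then have "eventually (\<lambda>n. snd (p n) \<in> K) U" by eventually_elim simp
  from ultra_compact_limit[OF U K this]
  obtain k where k: "k \<in> K" "((\<lambda>n. snd (p n)) \<longlongrightarrow> k) U" by blast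
  obtain \<Psi> where \<Psi>: "weakly U (\<lambda>n. M (- fst (p n)) (w n)) \<Psi>"
    using ultra_weak_compact[OF U, of "\<lambda>n. M (- fst (p n)) (w n)"] bd by auto
  then have nP: "norm \<Psi> \<le> nu U w" by (intro profiles_norm_le_nu[OF U bd]) (auto simp: profiles_def)
  have "((\<lambda>n. inner (M (- fst (p n)) (w n)) (snd (p n))) \<longlongrightarrow> inner \<Psi> k) U"
    by (rule weakly_strong_inner[where C=C, OF \<Psi> _ k(2)]) (simp add: bd)
  then have lim: "((\<lambda>n. \<bar>inner (w n) (M (fst (p n)) (snd (p n)))\<bar>) \<longlongrightarrow> \<bar>inner \<Psi> k\<bar>) U"
    by (intro tendsto_rabs) (simp add: M_adjoint)
  have "\<bar>inner \<Psi> k\<bar> \<le> nu U w * norm k" by (rule abs_inner_le[OF nP])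
  also have "\<dots> \<le> nu U w * B" using nP norm_ge_zero[of \<Psi>] by (intro mult_left_mono B k) linarith
  finally have "\<bar>inner \<Psi> k\<bar> < B * nu U w + e" using e by (simp add: mult.commute)
  from order_tendstoD(2)[OF lim this] pev have "eventually (\<lambda>_. False) U" by eventually_elim simp
  then show False using ultra_nontrivial[OF U] by simp
qed

text \<open>Subtracting exactly the weak limit makes the new remainder weakly null in the frame just
  used. Boundedness persists because a fixed vector, moved by isometries, is subtracted.\<close>

lemma profile_sequence:
  assumes U: "ultra U" and bd: "\<And>n. norm (\<Phi> n) \<le> C"
  obtains w \<xi> \<Psi> where "w 0 = \<Phi>" "\<And>l n. w (Suc l) n = w l n - M (\<xi> (Suc l) n) (\<Psi> (Suc l))"
    "\<And>l. weakly U (\<lambda>n. M (- \<xi> (Suc l) n) (w (Suc l) n)) 0"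
    "\<And>l. weakly U (\<lambda>n. M (- \<xi> (Suc l) n) (w l n)) (\<Psi> (Suc l))"
    "\<And>l. nu U (w l) \<le> 2 * norm (\<Psi> (Suc l))" "\<And>l. \<exists>B. \<forall>n. norm (w l n) \<le> B"
proof -
  define ch where "ch w = (SOME p. weakly U (\<lambda>n. M (- fst p n) (w n)) (snd p) \<and> nu U w \<le> 2 * norm (snd p))" for w :: "_ \<Rightarrow> 'h"
  define w where "w = rec_nat \<Phi> (\<lambda>_ v n. v n - M (fst (ch v) n) (snd (ch v)))"
  \<comment> \<open>The shift numbers profiles from 1: the one with number \<open>Suc l\<close> is
    extracted from \<open>w l\<close>.\<close>
  define \<xi> where "\<xi> j = fst (ch (w (j - 1)))" for j
  define \<Psi> where "\<Psi> j = snd (ch (w (j - 1)))" for j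
  have w0: "w 0 = \<Phi>" by (simp add: w_def)
  have wS: "w (Suc l) n = w l n - M (\<xi> (Suc l) n) (\<Psi> (Suc l))" for l n
    by (simp add: w_def \<xi>_def \<Psi>_def)
  have bdd: "\<exists>B. \<forall>n. norm (w l n) \<le> B" for l
  proof (induction l)
    case 0 then show ?case using bd w0 by auto
  next
    case (Suc l)
    then obtain B where B: "\<And>n. norm (w l n) \<le> B" by blast
    have "norm (w (Suc l) n) \<le> B + norm (\<Psi> (Suc l))" for n
      unfolding wS using norm_triangle_ineq4[of "w l n" "M (\<xi> (Suc l) n) (\<Psi> (Suc l))"] B[of n] by simp
    then show ?case by blast
  qed
  have ch: "weakly U (\<lambda>n. M (- \<xi> (Suc l) n) (w l n)) (\<Psi> (Suc l)) \<and> nu U (w l) \<le> 2 * norm (\<Psi> (Suc l))" for l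
  proof -
    obtain B where "\<And>n. norm (w l n) \<le> B" using bdd by blast
    from someI_ex[OF profile_choice[OF U this]] show ?thesis
      unfolding \<xi>_def \<Psi>_def by (simp add: ch_def)
  qed
  have "weakly U (\<lambda>n. M (- \<xi> (Suc l) n) (w (Suc l) n)) 0" for l
    unfolding weakly_def
  proof
    fix h
    have "((\<lambda>n. inner (M (- \<xi> (Suc l) n) (w l n)) h - inner (\<Psi> (Suc l)) h) \<longlongrightarrow>
        inner (\<Psi> (Suc l)) h - inner (\<Psi> (Suc l)) h) U"
      by (intro tendsto_diff weaklyD tendsto_const) (use ch in blast)
    then show "((\<lambda>n. inner (M (- \<xi> (Suc l) n) (w (Suc l) n)) h) \<longlongrightarrow> inner 0 h) U"
      by (simp add: wS linear_diff[OF M_linear] M_add[symmetric] M_zero inner_simps)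
  qed
  with that[OF w0 wS] ch bdd show ?thesis by blast
qed

text \<open>If the frequencies stayed at bounded distance, the weak limit of the remainder seen from
  the later frame would vanish, since it vanishes from the earlier one.\<close>
lemma profile_divergence:
  fixes w :: "nat \<Rightarrow> 'b \<Rightarrow> 'h" and \<xi> :: "nat \<Rightarrow> 'b \<Rightarrow> 'v"
  assumes U: "ultra U" and wS: "\<And>l n. w (Suc l) n = w l n - M (\<xi> (Suc l) n) (\<Psi> (Suc l))"
    and w0: "\<And>l. weakly U (\<lambda>n. M (- \<xi> (Suc l) n) (w (Suc l) n)) 0"
    and w1: "\<And>l. weakly U (\<lambda>n. M (- \<xi> (Suc l) n) (w l n)) (\<Psi> (Suc l))"
    and bd: "\<And>l. \<exists>B. \<forall>n. norm (w l n) \<le> B"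
  shows "1 \<le> i \<Longrightarrow> i < j \<Longrightarrow> \<Psi> j \<noteq> 0 \<Longrightarrow> filterlim (\<lambda>n. norm (\<xi> i n - \<xi> j n)) at_top U"
\<comment> \<open>Induction on the gap takes care of the profiles strictly between \<open>i\<close>
  and \<open>j\<close>: their frames are already known to separate from that of \<open>j\<close>, so
  mixing removes them from the weak limit seen there.\<close>
proof (induction "j - i" arbitrary: i rule: less_induct)
  case less
  obtain j' where j': "j = Suc j'" using less by (cases j) auto
  obtain i' where i': "i = Suc i'" using less by (cases i) auto
  have sumw: "w m n = w i n - (\<Sum>k=Suc i..m. M (\<xi> k n) (\<Psi> k))" if "m \<ge> i" for m n
    using that by (induction m rule: dec_induct) (auto simp: wS sum.atLeast_Suc_atMost algebra_simps)
  show ?case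
  proof (rule ccontr)
    assume "\<not> ?case"
    then obtain Z where "\<not> eventually (\<lambda>n. Z \<le> norm (\<xi> i n - \<xi> j n)) U"
      by (auto simp: filterlim_at_top)
    from ultra_not_eventually[OF U this]
    have "eventually (\<lambda>n. norm (\<xi> i n - \<xi> j n) \<le> Z) U" by eventually_elim simp
    from ultra_bounded_limit[OF U this] obtain \<zeta> where \<zeta>: "((\<lambda>n. \<xi> i n - \<xi> j n) \<longlongrightarrow> \<zeta>) U" by blast
    obtain B where B: "\<And>n. norm (w i n) \<le> B" using bd by blast
    have "inner (\<Psi> j) h = 0" for h
    proof -
      have l1: "((\<lambda>n. inner (M (- \<xi> j n) (w j' n)) h) \<longlongrightarrow> inner (\<Psi> j) h) U"
        using weaklyD[OF w1[of j']] by (simp add: j')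
      \<comment> \<open>A bounded difference of frequencies has a limit along the ultrafilter, so
        changing from one frame to the other amounts to a strongly convergent change of the test
        vector.\<close>
      have c: "((\<lambda>n. M (- (\<xi> i n - \<xi> j n)) h) \<longlongrightarrow> M (- \<zeta>) h) U"
        by (rule continuous_on_tendsto_compose[OF M_cont]) (use \<zeta> in \<open>auto intro: tendsto_minus simp del: minus_diff_eq\<close>)
      have "((\<lambda>n. inner (M (- \<xi> i n) (w i n)) (M (- (\<xi> i n - \<xi> j n)) h)) \<longlongrightarrow> inner 0 (M (- \<zeta>) h)) U"
        by (rule weakly_strong_inner[OF _ _ c]) (use w0[of i'] B in \<open>auto simp: i'\<close>)
      then have l2: "((\<lambda>n. inner (M (- \<xi> j n) (w i n)) h) \<longlongrightarrow> 0) U"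
        by (simp add: M_adjoint[of "- \<xi> i _"] M_adjoint[of "- \<xi> j _"] M_add[symmetric])
      have l3: "((\<lambda>n. \<Sum>k=Suc i..j'. inner (M (- \<xi> j n) (M (\<xi> k n) (\<Psi> k))) h) \<longlongrightarrow> 0) U"
      proof (rule tendsto_null_sum)
        fix k assume k: "k \<in> {Suc i..j'}"
        have "filterlim (\<lambda>n. norm (\<xi> k n - \<xi> j n)) at_top U"
          by (rule less.hyps) (use k j' less in auto)
        then have "filterlim (\<lambda>n. \<xi> k n - \<xi> j n) at_infinity U"
          by (simp add: filterlim_at_infinity_conv_norm_at_top)
        from filterlim_compose[OF M_mixing this]
        show "((\<lambda>n. inner (M (- \<xi> j n) (M (\<xi> k n) (\<Psi> k))) h) \<longlongrightarrow> 0) U"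
          by (simp add: M_add[symmetric] algebra_simps)
      qed
      have "((\<lambda>n. inner (M (- \<xi> j n) (w j' n)) h) \<longlongrightarrow> 0 - 0) U"
        using tendsto_diff[OF l2 l3] less j'
        by (simp add: sumw[of j'] linear_diff[OF M_linear] linear_sum[OF M_linear] inner_simps inner_sum_left)
      from tendsto_unique[OF ultra_nontrivial[OF U] l1 this] show ?thesis by simp
    qed
    then have "\<Psi> j = 0" using inner_eq_zero_iff by blast
    then show False using less by simp
  qed
qed

text \<open>The cross term pairs the new remainder, seen in the frame of the subtracted profile,
  with that profile, and there the remainder is weakly null.\<close>

lemma profile_pythagoras:
  fixes w :: "nat \<Rightarrow> 'b \<Rightarrow> 'h"
  assumes wS: "\<And>l n. w (Suc l) n = w l n - M (\<xi> (Suc l) n) (\<Psi> (Suc l))"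
    and w0: "\<And>l. weakly U (\<lambda>n. M (- \<xi> (Suc l) n) (w (Suc l) n)) 0"
    and L: "((\<lambda>n. (norm (w 0 n))\<^sup>2) \<longlongrightarrow> L) U"
  shows "((\<lambda>n. (norm (w l n))\<^sup>2) \<longlongrightarrow> L - (\<Sum>j=1..l. (norm (\<Psi> j))\<^sup>2)) U"
proof (induction l)
  case 0 then show ?case using L by simp
next
  case (Suc l)
  have eq: "(norm (w (Suc l) n))\<^sup>2 = (norm (w l n))\<^sup>2 - (norm (\<Psi> (Suc l)))\<^sup>2
      - 2 * inner (M (- \<xi> (Suc l) n) (w (Suc l) n)) (\<Psi> (Suc l))" for n
  proof -
    have "w l n = w (Suc l) n + M (\<xi> (Suc l) n) (\<Psi> (Suc l))" by (simp add: wS)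
    then show ?thesis
      by (simp add: power2_norm_eq_inner inner_add_left inner_add_right M_inner inner_commute
          M_adjoint[of "\<xi> (Suc l) n" "\<Psi> (Suc l)" "w (Suc l) n", unfolded inner_commute[of "M _ (\<Psi> _)"]])
  qed
  have "((\<lambda>n. (norm (w (Suc l) n))\<^sup>2) \<longlongrightarrow> (L - (\<Sum>j=1..l. (norm (\<Psi> j))\<^sup>2)) - (norm (\<Psi> (Suc l)))\<^sup>2 - 2 * inner 0 (\<Psi> (Suc l))) U"
    unfolding eq by (intro tendsto_intros Suc weaklyD w0)
  then show ?case by (simp add: algebra_simps)
qed

text \<open>The limiting squared norms stay nonnegative, so the squared norms of the profiles are
  summable; hence the profiles tend to zero and with them \<open>nu\<close>, which is at most twice
  their norm. In the second claim the added 1 is slack, since the Pythagoras identity bounds the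
  remainder by \<open>C\<close> only in the limit along \<open>U\<close>.\<close>

lemma nu_tendsto_zero:
  fixes w :: "nat \<Rightarrow> 'b \<Rightarrow> 'h"
  assumes U: "ultra U" and wS: "\<And>l n. w (Suc l) n = w l n - M (\<xi> (Suc l) n) (\<Psi> (Suc l))"
    and w0: "\<And>l. weakly U (\<lambda>n. M (- \<xi> (Suc l) n) (w (Suc l) n)) 0"
    and nu: "\<And>l. nu U (w l) \<le> 2 * norm (\<Psi> (Suc l))" and nonneg: "\<And>l. 0 \<le> nu U (w l)"
    and bd: "\<And>n. norm (w 0 n) \<le> C"
  shows "(\<lambda>l. nu U (w l)) \<longlonglongrightarrow> 0" and "\<And>l. eventually (\<lambda>n. norm (w l n) \<le> C + 1) U"
proof -
  have nt: "U \<noteq> bot" by (rule ultra_nontrivial[OF U])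
  have C: "0 \<le> C" using bd norm_ge_zero order_trans by blast
  have le: "(norm (w 0 n))\<^sup>2 \<le> C\<^sup>2" for n using bd by (intro power_mono) auto
  then obtain L where L: "((\<lambda>n. (norm (w 0 n))\<^sup>2) \<longlongrightarrow> L) U"
    using ultra_bounded_limit[OF U, of "\<lambda>n. (norm (w 0 n))\<^sup>2" "C\<^sup>2"] by auto
  have LC: "L \<le> C\<^sup>2" by (rule tendsto_upperbound[OF L _ nt]) (use le in auto)
  note pyth = profile_pythagoras[OF wS w0 L]
  have bnd: "(\<Sum>j=1..l. (norm (\<Psi> j))\<^sup>2) \<le> C\<^sup>2" for l
  proof -
    have "0 \<le> L - (\<Sum>j=1..l. (norm (\<Psi> j))\<^sup>2)"
      by (rule tendsto_lowerbound[OF pyth _ nt]) auto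
    then show ?thesis using LC by simp
  qed
  have "summable (\<lambda>j. (norm (\<Psi> (Suc j)))\<^sup>2)"
  proof (rule bounded_imp_summable)
    show "(\<Sum>k\<le>n. (norm (\<Psi> (Suc k)))\<^sup>2) \<le> C\<^sup>2" for n
      using bnd[of "Suc n"] by (simp only: sum.atLeast_Suc_atMost_Suc_shift atLeast0AtMost[symmetric] One_nat_def o_def)
  qed auto
  from summable_LIMSEQ_zero[OF this] have "(\<lambda>j. sqrt ((norm (\<Psi> (Suc j)))\<^sup>2)) \<longlonglongrightarrow> sqrt 0"
    by (rule tendsto_real_sqrt)
  then have "(\<lambda>j. 2 * norm (\<Psi> (Suc j))) \<longlonglongrightarrow> 0" using tendsto_mult_right_zero by force
  then show "(\<lambda>l. nu U (w l)) \<longlonglongrightarrow> 0"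
    by (rule Lim_null_comparison[rotated]) (use nu nonneg in auto)
  show "eventually (\<lambda>n. norm (w l n) \<le> C + 1) U" for l
  proof -
    have "L - (\<Sum>j=1..l. (norm (\<Psi> j))\<^sup>2) \<le> C\<^sup>2" using LC sum_nonneg[of "{1..l}" "\<lambda>j. (norm (\<Psi> j))\<^sup>2"] by simp
    also have "\<dots> < (C + 1)\<^sup>2" using C by (simp add: power2_eq_square algebra_simps)
    finally have "L - (\<Sum>j=1..l. (norm (\<Psi> j))\<^sup>2) < (C + 1)\<^sup>2" .
    from order_tendstoD(2)[OF pyth this] show ?thesis
      by eventually_elim (use C in \<open>auto dest: power_less_imp_less_base intro: less_imp_le\<close>)
  qed
qed

end
lemma borel_measurable_cis [measurable (raw)]:
  "f \<in> borel_measurable M \<Longrightarrow> (\<lambda>x. cis (f x)) \<in> borel_measurable M"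
  by (rule borel_measurable_continuous_on[OF continuous_on_cis[OF continuous_on_id]])

section \<open>Gaussian integrals\<close>

lemma lborel_prod_integral:
  fixes f :: "'a::euclidean_space \<Rightarrow> real \<Rightarrow> complex"
  assumes "\<And>b. b \<in> Basis \<Longrightarrow> integrable lborel (f b)"
  shows "integrable lborel (\<lambda>x::'a. \<Prod>b\<in>Basis. f b (x \<bullet> b))"
    and "(LINT x|lborel. (\<Prod>b\<in>Basis. f b (x \<bullet> b))) = (\<Prod>b\<in>Basis. (LINT s|lborel. f b s))"
proof -
  interpret product_sigma_finite "\<lambda>_::'a. lborel :: real measure" by standard
  let ?T = "\<lambda>g. \<Sum>b\<in>(Basis::'a set). g b *\<^sub>R b"
  have [measurable]: "\<And>b. b \<in> Basis \<Longrightarrow> f b \<in> borel_measurable borel"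
    using borel_measurable_integrable[OF assms] by simp
  have meas: "(\<lambda>x::'a. \<Prod>b\<in>Basis. f b (x \<bullet> b)) \<in> borel_measurable borel" by measurable
  have T: "?T \<in> measurable (\<Pi>\<^sub>M b\<in>(Basis::'a set). lborel) borel" by measurable
  have eq: "(\<Prod>b\<in>Basis. f b (?T g \<bullet> b)) = (\<Prod>b\<in>Basis. f b (g b))" for g
    by (intro prod.cong refl) (simp add: inner_sum_left_Basis)
  have "integrable (distr (\<Pi>\<^sub>M b\<in>(Basis::'a set). lborel) borel ?T) (\<lambda>x::'a. \<Prod>b\<in>Basis. f b (x \<bullet> b))"
    using product_integrable_prod[of Basis f] assms by (subst integrable_distr_eq[OF T meas]) (simp add: eq)
  then show "integrable lborel (\<lambda>x::'a. \<Prod>b\<in>Basis. f b (x \<bullet> b))" by (simp only: lborel_eq[symmetric])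
  have "(LINT x|distr (\<Pi>\<^sub>M b\<in>(Basis::'a set). lborel) borel ?T. (\<Prod>b\<in>Basis. f b (x \<bullet> b))) = (\<Prod>b\<in>Basis. (LINT s|lborel. f b s))"
    using product_integral_prod[of Basis f] assms by (subst integral_distr[OF T meas]) (simp add: eq)
  then show "(LINT x|lborel. (\<Prod>b\<in>Basis. f b (x \<bullet> b))) = (\<Prod>b\<in>Basis. (LINT s|lborel. f b s))"
    by (simp only: lborel_eq[symmetric])
qed

lemma integral_lborel_affine:
  fixes f :: "'a::euclidean_space \<Rightarrow> 'b::{banach, second_countable_topology}"
  assumes "c \<noteq> 0" and [measurable]: "f \<in> borel_measurable borel"
  shows "(LINT x|lborel. f x) = \<bar>c\<bar> ^ DIM('a) *\<^sub>R (LINT x|lborel. f (t + c *\<^sub>R x))"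
  by (subst lborel_affine[OF assms(1), of t]) (simp add: integral_density integral_distr)

text \<open>A rescaling, with \<open>k = sqrt (2 * a)\<close>, of the characteristic function of the
  standard normal distribution.\<close>

lemma gaussian_1d_real:
  assumes a: "a > 0"
  shows "integrable lborel (\<lambda>x. exp (- a * x\<^sup>2) :: real)"
    and "(LINT x|lborel. exp (- (of_real a * (of_real x)\<^sup>2)) * cis (s * x)) =
      of_real (sqrt (pi / a) * exp (- s\<^sup>2 / (4 * a)))"
proof -
  define k where "k = sqrt (2 * a)"
  have k: "k > 0" "k\<^sup>2 = 2 * a" using a by (auto simp: k_def)
  have "integrable lborel std_normal_density" using integrable_std_normal_moment[of 0] by simp
  then have "integrable lborel (\<lambda>x. sqrt (2 * pi) * std_normal_density (0 + k * x))"
    using k by (intro integrable_mult_right lborel_integrable_real_affine) auto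
  moreover have "sqrt (2 * pi) * std_normal_density (0 + k * x) = exp (- a * x\<^sup>2)" for x
    by (simp add: std_normal_density_def power_mult_distrib k)
  ultimately show "integrable lborel (\<lambda>x. exp (- a * x\<^sup>2) :: real)" by (simp only:)
  have "char std_normal_distribution (s / k) =
      (LINT x|lborel. std_normal_density x *\<^sub>R iexp (s / k * x))"
    unfolding char_def by (subst integral_density) (auto simp: normal_density_nonneg)
  also have "\<dots> = \<bar>k\<bar> *\<^sub>R (LINT x|lborel. std_normal_density (0 + k * x) *\<^sub>R iexp (s / k * (0 + k * x)))"
    by (rule lborel_integral_real_affine) (use k in auto)
  also have "(LINT x|lborel. std_normal_density (0 + k * x) *\<^sub>R iexp (s / k * (0 + k * x)))
      = (LINT x|lborel. of_real (1 / sqrt (2 * pi)) * (exp (- (of_real a * (of_real x)\<^sup>2)) * cis (s * x)))"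
  proof (rule Bochner_Integration.integral_cong[OF refl])
    fix x
    have "std_normal_density (0 + k * x) = 1 / sqrt (2 * pi) * exp (- (a * x\<^sup>2))"
      by (simp add: std_normal_density_def power_mult_distrib k)
    moreover have "complex_of_real (exp (- (a * x\<^sup>2))) = exp (- (of_real a * (of_real x)\<^sup>2))"
      by (simp flip: exp_of_real)
    moreover have "iexp (s / k * (0 + k * x)) = cis (s * x)" using k by (simp add: cis_conv_exp)
    ultimately show "std_normal_density (0 + k * x) *\<^sub>R iexp (s / k * (0 + k * x)) =
      of_real (1 / sqrt (2 * pi)) * (exp (- (of_real a * (of_real x)\<^sup>2)) * cis (s * x))"
      by (simp only: scaleR_conv_of_real of_real_mult mult.assoc)
  qed
  also have "\<dots> = of_real (1 / sqrt (2 * pi)) * (LINT x|lborel. exp (- (of_real a * (of_real x)\<^sup>2)) * cis (s * x))"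
    by (rule integral_mult_right_zero)
  finally have "of_real (exp (- ((s / k)\<^sup>2) / 2)) =
     of_real (k / sqrt (2 * pi)) * (LINT x|lborel. exp (- (of_real a * (of_real x)\<^sup>2)) * cis (s * x))"
    using k by (simp add: char_std_normal_distribution scaleR_conv_of_real mult.assoc)
  then have "(LINT x|lborel. exp (- (of_real a * (of_real x)\<^sup>2)) * cis (s * x)) =
     of_real (sqrt (2 * pi) / k) * of_real (exp (- ((s / k)\<^sup>2) / 2))"
    using k by (simp add: field_simps)
  moreover have "sqrt (2 * pi) / k = sqrt (pi / a)"
    using a by (simp add: k_def flip: real_sqrt_divide)
  moreover have "- ((s / k)\<^sup>2) / 2 = - s\<^sup>2 / (4 * a)" by (simp add: power_divide k)
  ultimately show "(LINT x|lborel. exp (- (of_real a * (of_real x)\<^sup>2)) * cis (s * x)) =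
      of_real (sqrt (pi / a) * exp (- s\<^sup>2 / (4 * a)))" by simp
qed

lemma gaussian_1d_integrable:
  assumes "Re z > 0"
  shows "integrable lborel (\<lambda>x. exp (- (z * (of_real x)\<^sup>2)) * cis (s * x))"
  by (rule Bochner_Integration.integrable_bound[OF gaussian_1d_real(1)[OF assms]])
    (auto simp: norm_mult power2_eq_square)

text \<open>The integrals over \<open>[-n, n]\<close> are holomorphic by differentiation under the
  integral sign, and they converge locally uniformly.\<close>

lemma gaussian_1d_holomorphic:
  "(\<lambda>z. LINT x|lborel. exp (- (z * (of_real x)\<^sup>2)) * cis (s * x)) holomorphic_on {z. Re z > 0}"
proof (rule holomorphic_uniform_sequence)
  let ?f = "\<lambda>z x. exp (- (z * (of_real x)\<^sup>2)) * cis (s * x)"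
  show "open {z. Re z > 0}" by (rule open_halfspace_Re_gt)
  show "(\<lambda>z. integral (cbox (- real n) (real n)) (?f z)) holomorphic_on {z. Re z > 0}" for n
  proof (rule leibniz_rule_holomorphic)
    show "((\<lambda>z. ?f z x) has_field_derivative - (of_real x)\<^sup>2 * ?f z x) (at z within {z. Re z > 0})" for z x
      by (auto intro!: derivative_eq_intros)
    show "?f z integrable_on cbox (- real n) (real n)" for z
      by (intro integrable_continuous continuous_intros)
    show "continuous_on ({z. Re z > 0} \<times> cbox (- real n) (real n)) (\<lambda>(z, x). - (of_real x)\<^sup>2 * ?f z x)"
      by (auto simp: case_prod_unfold intro!: continuous_intros)
    show "convex {z. Re z > 0}" by (rule convex_halfspace_Re_gt)
  qed
  fix z0 :: complex assume "z0 \<in> {z. Re z > 0}"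
  then have z0: "Re z0 > 0" by simp
  \<comment> \<open>On the disc of this radius the real part stays above \<open>d\<close>, so one
    real Gaussian tail bounds the truncation error for all its points.\<close>
  define d where "d = Re z0 / 2"
  have d: "d > 0" using z0 by (simp add: d_def)
  have sub: "Re z \<ge> d" if "z \<in> cball z0 d" for z
    using abs_Re_le_cmod[of "z0 - z"] that by (auto simp: dist_norm d_def)
  define e where "e n = (LINT x|lborel. indicator (- {- real n..real n}) x * exp (- d * x\<^sup>2))" for n :: nat
  have e0: "e \<longlonglongrightarrow> 0"
  proof -
    have "e \<longlonglongrightarrow> (LINT x|(lborel::real measure). 0)"
      unfolding e_def
    proof (rule integral_dominated_convergence[where w="\<lambda>x. exp (- d * x\<^sup>2)"])
      show "AE x in lborel. (\<lambda>n. indicator (- {- real n..real n}) x * exp (- d * x\<^sup>2)) \<longlonglongrightarrow> 0"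
      proof (rule AE_I2)
        fix x :: real
        obtain N :: nat where N: "\<bar>x\<bar> \<le> real N" using real_arch_simple by blast
        have "eventually (\<lambda>n. indicator (- {- real n..real n}) x * exp (- d * x\<^sup>2) = 0) sequentially"
          by (rule eventually_sequentiallyI[of N]) (use N in \<open>auto simp: indicator_def\<close>)
        then show "(\<lambda>n. indicator (- {- real n..real n}) x * exp (- d * x\<^sup>2)) \<longlonglongrightarrow> 0"
          by (rule tendsto_eventually)
      qed
    qed (use gaussian_1d_real(1)[OF d] in \<open>auto simp: indicator_def\<close>)
    then show ?thesis by simp
  qed
  have bound: "dist (integral (cbox (- real n) (real n)) (?f z)) (LINT x|lborel. ?f z x) \<le> e n"
    if z: "z \<in> cball z0 d" for z n
  proof -
    have Rz: "Re z > 0" using sub[OF z] d by linarith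
    have intg: "set_integrable lborel (cbox (- real n) (real n)) (?f z)"
      unfolding set_integrable_def
      by (rule integrable_mult_indicator[OF _ gaussian_1d_integrable[OF Rz]]) auto
    have "integral (cbox (- real n) (real n)) (?f z) = (LINT x|lborel. indicator (cbox (- real n) (real n)) x *\<^sub>R ?f z x)"
      using set_borel_integral_eq_integral(2)[OF intg] by (simp add: set_lebesgue_integral_def)
    then have "dist (integral (cbox (- real n) (real n)) (?f z)) (LINT x|lborel. ?f z x) =
       norm ((LINT x|lborel. ?f z x) - (LINT x|lborel. indicator (cbox (- real n) (real n)) x *\<^sub>R ?f z x))"
      by (simp only: dist_norm norm_minus_commute)
    also have "(LINT x|lborel. ?f z x) - (LINT x|lborel. indicator (cbox (- real n) (real n)) x *\<^sub>R ?f z x) =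
       (LINT x|lborel. ?f z x - indicator (cbox (- real n) (real n)) x *\<^sub>R ?f z x)"
      by (rule Bochner_Integration.integral_diff[symmetric, OF gaussian_1d_integrable[OF Rz] intg[unfolded set_integrable_def]])
    also have "norm \<dots> \<le> e n"
      unfolding e_def
    proof (rule order_trans[OF integral_norm_bound integral_mono])
      show "integrable lborel (\<lambda>x. norm (?f z x - indicator (cbox (- real n) (real n)) x *\<^sub>R ?f z x))"
        by (rule integrable_norm, rule Bochner_Integration.integrable_diff[OF gaussian_1d_integrable[OF Rz] intg[unfolded set_integrable_def]])
      show "integrable lborel (\<lambda>x. indicator (- {- real n..real n}) x * exp (- d * x\<^sup>2))"
        using integrable_mult_indicator[OF _ gaussian_1d_real(1)[OF d], of "- {- real n..real n}"] by simp
      fix x :: real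
      have "d * x\<^sup>2 \<le> Re z * x\<^sup>2" using sub[OF z] by (intro mult_right_mono) auto
      then have "norm (?f z x) \<le> exp (- d * x\<^sup>2)" by (simp add: norm_mult power2_eq_square)
      then show "norm (?f z x - indicator (cbox (- real n) (real n)) x *\<^sub>R ?f z x) \<le>
          indicator (- {- real n..real n}) x * exp (- d * x\<^sup>2)"
        by (auto simp: indicator_def)
    qed
    finally show ?thesis .
  qed
  have "uniform_limit (cball z0 d) (\<lambda>n z. integral (cbox (- real n) (real n)) (?f z)) (\<lambda>z. LINT x|lborel. ?f z x) sequentially"
  proof (rule uniform_limitI)
    fix r :: real assume "r > 0"
    from order_tendstoD(2)[OF e0 this]
    show "\<forall>\<^sub>F n in sequentially. \<forall>z\<in>cball z0 d. dist (integral (cbox (- real n) (real n)) (?f z)) (LINT x|lborel. ?f z x) < r"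
      proof eventually_elim
      case (elim n)
      show ?case using le_less_trans[OF bound elim] by blast
    qed
  qed
  moreover have "cball z0 d \<subseteq> {z. Re z > 0}" using sub d by force
  ultimately show "\<exists>d. 0 < d \<and> cball z0 d \<subseteq> {z. Re z > 0} \<and>
     uniform_limit (cball z0 d) (\<lambda>n z. integral (cbox (- real n) (real n)) (?f z)) (\<lambda>z. LINT x|lborel. ?f z x) sequentially"
    using d by blast
qed

lemma Re_divide_pos: "Re z > 0 \<Longrightarrow> r > 0 \<Longrightarrow> Re (of_real r / z) > 0"
  by (simp add: Re_divide zero_less_divide_iff power2_eq_square sum_power2_gt_zero_iff add_pos_nonneg)

text \<open>Analytic continuation from positive real \<open>z\<close>. The principal square root is
  the right branch throughout, because \<open>pi / z\<close> stays in the right half plane.\<close>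

lemma gaussian_1d:
  assumes z: "Re z > 0"
  shows "(LINT x|lborel. exp (- (z * (of_real x)\<^sup>2)) * cis (s * x)) =
    csqrt (of_real pi / z) * exp (- (of_real s)\<^sup>2 / (4 * z))"
proof -
  let ?S = "{z. Re z > 0}"
  let ?f = "\<lambda>z. LINT x|lborel. exp (- (z * (of_real x)\<^sup>2)) * cis (s * x)"
  let ?g = "\<lambda>z. csqrt (of_real pi / z) * exp (- (of_real s)\<^sup>2 / (4 * z))"
  have nr: "of_real pi / z \<notin> \<real>\<^sub>\<le>\<^sub>0" if "Re z > 0" for z
    using Re_divide_pos[OF that pi_gt_zero] by (auto simp: complex_nonpos_Reals_iff)
  have "?f z - ?g z = 0"
  proof (rule analytic_continuation[of "\<lambda>z. ?f z - ?g z" ?S "of_real ` {0<..}" 1])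
    have "?g holomorphic_on ?S"
      using nr by (intro holomorphic_intros) (auto simp: complex_eq_iff)
    then show "(\<lambda>z. ?f z - ?g z) holomorphic_on ?S"
      by (intro holomorphic_on_diff gaussian_1d_holomorphic)
    show "open ?S" by (rule open_halfspace_Re_gt)
    show "connected ?S" by (intro convex_connected convex_halfspace_Re_gt)
    show "(1::complex) islimpt (of_real ` {0<..})"
    proof (rule islimpt_sequential[THEN iffD2], intro exI[of _ "\<lambda>n. of_real (1 + 1 / real (Suc n)) :: complex"] conjI allI)
      show "of_real (1 + 1 / real (Suc n)) \<in> complex_of_real ` {0<..} - {1}" for n
      proof -
        have "1 / real (Suc n) > 0" by simp
        then have g: "1 + 1 / real (Suc n) > 1" by linarith
        then have "1 + 1 / real (Suc n) \<in> {0<..}" "1 + 1 / real (Suc n) \<noteq> 1"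
          unfolding greaterThan_iff by linarith+
        then show ?thesis
          by (intro DiffI imageI) (simp_all only: singleton_iff of_real_eq_1_iff not_False_eq_True)
      qed
      have "(\<lambda>n. 1 + 1 / real (Suc n)) \<longlonglongrightarrow> 1 + 0"
        by (intro tendsto_add tendsto_const LIMSEQ_Suc[OF lim_1_over_n])
      then show "(\<lambda>n. complex_of_real (1 + 1 / real (Suc n))) \<longlonglongrightarrow> 1"
        by (auto dest!: tendsto_of_real[where 'a=complex] simp only: add_0_right of_real_1)
    qed
    fix y assume "y \<in> complex_of_real ` {0<..}"
    then obtain a where a: "a > 0" "y = of_real a" by auto
    have "csqrt (of_real pi / of_real a) = of_real (sqrt (pi / a))"
      using a by (simp flip: of_real_divide)
    then show "?f y - ?g y = 0"
      unfolding a gaussian_1d_real(2)[OF a(1)] by (simp flip: exp_of_real)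
  qed (use z in auto)
  then show ?thesis by simp
qed

text \<open>For \<open>Re z > 0\<close> this is the integral of
  \<open>exp (- z |\<xi>|\<^sup>2)\<close> against \<open>cis (x \<bullet> \<xi>)\<close>. The
  closed form also makes sense at \<open>z = \<i> t\<close>, where that integral no longer converges
  absolutely and the expression is a multiple of the Schroedinger kernel.\<close>

definition gk :: "complex \<Rightarrow> real ^ 'n \<Rightarrow> complex" where
  "gk z x = csqrt (of_real pi / z) ^ CARD('n) * exp (- (of_real (norm x))\<^sup>2 / (4 * z))"

lemma gk_measurable [measurable]: "gk z \<in> borel_measurable borel"
  unfolding gk_def by measurable

lemma norm_sq_sum_Basis: "(norm x)\<^sup>2 = (\<Sum>b\<in>Basis. (x \<bullet> b)\<^sup>2)" for x :: "'a::euclidean_space"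
  unfolding power2_norm_eq_inner by (subst euclidean_inner) (simp add: power2_eq_square)

lemma gauss_integral:
  fixes x :: "real ^ 'n"
  assumes z: "Re z > 0"
  shows "integrable lborel (\<lambda>\<xi>. exp (- (z * (of_real (norm \<xi>))\<^sup>2)) * cis (x \<bullet> \<xi>))"
    and "(LINT \<xi>|lborel. exp (- (z * (of_real (norm \<xi>))\<^sup>2)) * cis (x \<bullet> \<xi>)) = gk z x"
proof -
  let ?h = "\<lambda>b s. exp (- (z * (of_real s)\<^sup>2)) * cis ((x \<bullet> b) * s)"
  have eq: "exp (- (z * (of_real (norm \<xi>))\<^sup>2)) * cis (x \<bullet> \<xi>) = (\<Prod>b\<in>Basis. ?h b (\<xi> \<bullet> b))" for \<xi>
  proof -
    have "(\<Prod>b\<in>Basis. ?h b (\<xi> \<bullet> b)) = exp (\<Sum>b\<in>Basis. - (z * (of_real (\<xi> \<bullet> b))\<^sup>2) + \<i> * of_real ((x \<bullet> b) * (\<xi> \<bullet> b)))"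
      by (simp only: exp_sum[OF finite_Basis] exp_add cis_conv_exp)
    also have "(\<Sum>b\<in>Basis. - (z * (of_real (\<xi> \<bullet> b))\<^sup>2) + \<i> * of_real ((x \<bullet> b) * (\<xi> \<bullet> b)))
       = - (z * of_real ((norm \<xi>)\<^sup>2)) + \<i> * of_real (x \<bullet> \<xi>)"
      unfolding norm_sq_sum_Basis euclidean_inner[of x \<xi>]
      by (simp add: sum.distrib sum_distrib_left sum_negf sum_subtractf)
    finally show ?thesis by (simp only: exp_add cis_conv_exp of_real_power)
  qed
  show "integrable lborel (\<lambda>\<xi>. exp (- (z * (of_real (norm \<xi>))\<^sup>2)) * cis (x \<bullet> \<xi>))"
    unfolding eq by (rule lborel_prod_integral) (rule gaussian_1d_integrable[OF z])
  have "(LINT \<xi>|lborel. exp (- (z * (of_real (norm \<xi>))\<^sup>2)) * cis (x \<bullet> \<xi>)) =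
    (\<Prod>b\<in>(Basis::(real^'n) set). csqrt (of_real pi / z) * exp (- (of_real (x \<bullet> b))\<^sup>2 / (4 * z)))"
    unfolding eq by (subst lborel_prod_integral(2)) (auto simp: gaussian_1d_integrable[OF z] gaussian_1d[OF z])
  also have "\<dots> = csqrt (of_real pi / z) ^ CARD('n) * exp (\<Sum>b\<in>(Basis::(real^'n) set). - (of_real (x \<bullet> b))\<^sup>2 / (4 * z))"
    by (simp add: prod.distrib exp_sum)
  also have "(\<Sum>b\<in>(Basis::(real^'n) set). - (of_real (x \<bullet> b))\<^sup>2 / (4 * z)) = - (of_real (norm x))\<^sup>2 / (4 * z)"
    unfolding of_real_power[symmetric] norm_sq_sum_Basis by (simp add: sum_negf sum_divide_distrib)
  finally show "(LINT \<xi>|lborel. exp (- (z * (of_real (norm \<xi>))\<^sup>2)) * cis (x \<bullet> \<xi>)) = gk z x"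
    by (simp add: gk_def)
qed

lemma gauss_integrable:
  assumes "a > 0" shows "integrable lborel (\<lambda>\<xi>::real^'n. exp (- (a * (norm \<xi>)\<^sup>2)))"
proof -
  have "integrable lborel (\<lambda>\<xi>::real^'n. norm (exp (- (of_real a * (of_real (norm \<xi>))\<^sup>2)) * cis (0 \<bullet> \<xi>)))"
    by (rule integrable_norm, rule gauss_integral) (use assms in simp)
  then show ?thesis by (simp add: norm_mult power2_eq_square)
qed

lemma norm_gk_le:
  fixes x :: "real ^ 'n"
  assumes "Re z > 0"
  shows "norm (gk z x) \<le> (pi / norm z) powr (real CARD('n) / 2)"
proof -
  have "- (of_real (norm x))\<^sup>2 / (4 * z) = of_real (- ((norm x)\<^sup>2 / 4)) * (1 / z)" by simp
  then have eq: "Re (- (of_real (norm x))\<^sup>2 / (4 * z)) = - ((norm x)\<^sup>2 / 4) * Re (1 / z)"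
    by (simp only: times_complex.sel(1) Re_complex_of_real Im_complex_of_real mult_zero_left diff_zero)
  have "Re (1 / z) \<ge> 0" using Re_divide_pos[OF assms, of 1] by simp
  then have "Re (- (of_real (norm x))\<^sup>2 / (4 * z)) \<le> 0" unfolding eq by (intro mult_nonpos_nonneg) auto
  then have le: "norm (exp (- (of_real (norm x))\<^sup>2 / (4 * z))) \<le> 1" by simp
  have "z \<noteq> 0" using assms by auto
  then have "norm (csqrt (of_real pi / z) ^ CARD('n)) = (pi / norm z) powr (real CARD('n) / 2)"
    by (simp add: norm_power norm_csqrt norm_divide powr_half_sqrt[symmetric] powr_powr flip: powr_realpow)
  with le show ?thesis unfolding gk_def norm_mult by (simp add: mult_left_le)
qed
section \<open>The Fourier transform of integrable functions\<close>

definition fconst :: "'n::finite itself \<Rightarrow> real" where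
  "fconst _ = (2 * pi) powr (- real CARD('n) / 2)"

lemma fconst_pos [simp]: "fconst T > 0"
  by (simp add: fconst_def)

lemma fconst_sq: "(fconst TYPE('n::finite))\<^sup>2 * (2 * pi) ^ CARD('n) = 1"
  unfolding fconst_def power2_eq_square powr_realpow[symmetric, OF pi_gt_zero[THEN mult_pos_pos[OF zero_less_numeral]]] powr_add[symmetric]
  by simp

lemma fourier_L1_eq:
  "fourier_L1 f \<xi> = of_real (fconst TYPE('n)) * (LINT x|lborel. cis (- (x \<bullet> \<xi>)) * f x)"
  for f :: "real^'n \<Rightarrow> complex"
  by (simp add: fourier_L1_def fconst_def)

lemma fourier_L1_measurable [measurable]:
  fixes f :: "real^'n \<Rightarrow> complex"
  assumes [measurable]: "f \<in> borel_measurable borel"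
  shows "fourier_L1 f \<in> borel_measurable borel"
  unfolding fourier_L1_eq[abs_def] by measurable

lemma integrable_bounded_mult:
  fixes f h :: "'a::euclidean_space \<Rightarrow> complex"
  assumes "integrable lborel f" and [measurable]: "h \<in> borel_measurable borel" and "\<And>x. norm (h x) \<le> B"
  shows "integrable lborel (\<lambda>x. h x * f x)"
proof -
  have [measurable]: "f \<in> borel_measurable borel" using borel_measurable_integrable[OF assms(1)] by simp
  have B: "0 \<le> B" using assms(3) norm_ge_zero order_trans by blast
  show ?thesis
    by (rule Bochner_Integration.integrable_bound[OF integrable_mult_right[OF assms(1), of "of_real B"]])
      (use assms(3) B in \<open>auto simp: norm_mult intro!: mult_right_mono\<close>)
qed

lemma integrable_cis_mult:
  fixes f :: "'a::euclidean_space \<Rightarrow> complex"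
  assumes "integrable lborel f" and [measurable]: "h \<in> borel_measurable borel"
  shows "integrable lborel (\<lambda>x. cis (h x) * f x)"
  by (rule integrable_bounded_mult[OF assms(1), where B=1]) auto

lemma fourier_L1_add:
  fixes f :: "real^'n \<Rightarrow> complex"
  assumes "integrable lborel f" "integrable lborel g"
  shows "fourier_L1 (\<lambda>x. f x + g x) \<xi> = fourier_L1 f \<xi> + fourier_L1 g \<xi>"
  using assms unfolding fourier_L1_eq
  by (simp add: distrib_left Bochner_Integration.integral_add integrable_cis_mult)

lemma fourier_L1_diff:
  fixes f :: "real^'n \<Rightarrow> complex"
  assumes "integrable lborel f" "integrable lborel g"
  shows "fourier_L1 (\<lambda>x. f x - g x) \<xi> = fourier_L1 f \<xi> - fourier_L1 g \<xi>"
  using assms unfolding fourier_L1_eq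
  by (simp add: right_diff_distrib Bochner_Integration.integral_diff integrable_cis_mult)

lemma fourier_L1_cmult:
  fixes f :: "real^'n \<Rightarrow> complex"
  shows "fourier_L1 (\<lambda>x. a * f x) \<xi> = a * fourier_L1 f \<xi>"
  unfolding fourier_L1_eq by (simp add: mult.left_commute[of _ a])

lemma fourier_L1_cong_AE:
  fixes f g :: "real^'n \<Rightarrow> complex"
  assumes "AE x in lborel. f x = g x" and [measurable]: "f \<in> borel_measurable borel" "g \<in> borel_measurable borel"
  shows "fourier_L1 f \<xi> = fourier_L1 g \<xi>"
  unfolding fourier_L1_eq
  by (rule arg_cong[where f="\<lambda>x. _ * x"], rule integral_cong_AE) (use assms(1) in auto)

lemma fourier_L1_bound:
  fixes f :: "real^'n \<Rightarrow> complex"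
  shows "norm (fourier_L1 f \<xi>) \<le> fconst TYPE('n) * (LINT x|lborel. norm (f x))"
proof -
  have "norm (LINT x|lborel. cis (- (x \<bullet> \<xi>)) * f x) \<le> (LINT x|lborel. norm (f x))"
    using integral_norm_bound[of lborel "\<lambda>x. cis (- (x \<bullet> \<xi>)) * f x"] by (simp add: norm_mult)
  then show ?thesis unfolding fourier_L1_eq by (simp add: norm_mult less_imp_le)
qed

lemma swap_bounded_kernel:
  fixes f :: "'a::euclidean_space \<Rightarrow> complex" and g :: "'b::euclidean_space \<Rightarrow> complex"
  assumes f: "integrable lborel f" and g: "integrable lborel g"
    and K [measurable]: "case_prod K \<in> borel_measurable (borel \<Otimes>\<^sub>M borel)" and B: "\<And>x y. norm (K x y) \<le> B"
  shows "(LINT x|lborel. f x * (LINT y|lborel. K x y * g y)) = (LINT y|lborel. g y * (LINT x|lborel. K x y * f x))"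
proof -
  have [measurable]: "f \<in> borel_measurable borel" "g \<in> borel_measurable borel"
    using borel_measurable_integrable[OF f] borel_measurable_integrable[OF g] by auto
  have B0: "0 \<le> B" using B norm_ge_zero order_trans by blast
  have [measurable]: "K x \<in> borel_measurable borel" for x
  proof -
    have "(\<lambda>y. case_prod K (x, y)) \<in> borel_measurable borel" by measurable
    then show ?thesis by simp
  qed
  have inner: "integrable lborel (\<lambda>y. K x y * g y)" for x
    by (rule integrable_bounded_mult[OF g _ B]) measurable
  have int: "integrable (lborel \<Otimes>\<^sub>M lborel) (\<lambda>(x, y). f x * (K x y * g y))"
  proof (rule lborel_pair.Fubini_integrable)
    show "(\<lambda>(x, y). f x * (K x y * g y)) \<in> borel_measurable (lborel \<Otimes>\<^sub>M lborel)" by measurable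
    show "AE x in lborel. integrable lborel (\<lambda>y. case (x, y) of (x, y) \<Rightarrow> f x * (K x y * g y))"
      using inner by (auto intro!: AE_I2 integrable_mult_right)
    show "integrable lborel (\<lambda>x. LINT y|lborel. norm (case (x, y) of (x, y) \<Rightarrow> f x * (K x y * g y)))"
    proof (rule Bochner_Integration.integrable_bound)
      show "integrable lborel (\<lambda>x. (B * (LINT y|lborel. norm (g y))) * norm (f x))"
        by (intro integrable_mult_right integrable_norm f)
      show "(\<lambda>x. LINT y|lborel. norm (case (x, y) of (x, y) \<Rightarrow> f x * (K x y * g y))) \<in> borel_measurable lborel"
        by measurable
      have le: "(LINT y|lborel. norm (f x * (K x y * g y))) \<le> (B * (LINT y|lborel. norm (g y))) * norm (f x)" for x
      proof -
        have "(LINT y|lborel. norm (f x * (K x y * g y))) \<le> (LINT y|lborel. norm (f x) * B * norm (g y))"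
          by (rule integral_mono)
            (use inner g B in \<open>auto simp: norm_mult mult.assoc intro!: integrable_mult_right mult_left_mono mult_right_mono integrable_norm[where f="\<lambda>y. K x y * g y", unfolded norm_mult]\<close>)
        then show ?thesis by (simp add: mult.commute mult.left_commute)
      qed
      have nn: "0 \<le> (LINT y|lborel. norm (f x * (K x y * g y)))" for x by simp
      show "AE x in lborel. norm (LINT y|lborel. norm (case (x, y) of (x, y) \<Rightarrow> f x * (K x y * g y)))
          \<le> norm ((B * (LINT y|lborel. norm (g y))) * norm (f x))"
        using order_trans[OF le abs_ge_self] by (intro AE_I2) (simp del: norm_mult abs_mult)
    qed
  qed
  have "(LINT x|lborel. f x * (LINT y|lborel. K x y * g y)) = (LINT x|lborel. LINT y|lborel. f x * (K x y * g y))"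
    by simp
  also have "\<dots> = (LINT y|lborel. LINT x|lborel. f x * (K x y * g y))"
    by (rule lborel_pair.Fubini_integral[OF int, symmetric])
  also have "\<dots> = (LINT y|lborel. LINT x|lborel. g y * (K x y * f x))"
    by (simp add: mult_ac)
  finally show ?thesis by simp
qed

lemma gauss_mult_integrable:
  fixes h :: "real^'n \<Rightarrow> complex"
  assumes z: "Re z > 0" and [measurable]: "h \<in> borel_measurable borel" and "\<And>x. norm (h x) \<le> B"
  shows "integrable lborel (\<lambda>\<xi>. exp (- (z * (of_real (norm \<xi>))\<^sup>2)) * h \<xi>)"
  using integrable_bounded_mult[OF gauss_integral(1)[OF z, of 0] assms(2,3)] by (simp add: mult.commute)

text \<open>Evaluation at \<open>- x\<close> is the inverse transform, so this is Fourier inversion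
  with Gaussian damping. With complex \<open>z\<close> it yields both the heat kernel and the
  regularised Schroedinger kernel.\<close>

lemma fourier_gauss:
  fixes f :: "real^'n \<Rightarrow> complex"
  assumes f: "integrable lborel f" and z: "Re z > 0"
  shows "fourier_L1 (\<lambda>\<xi>. exp (- (z * (of_real (norm \<xi>))\<^sup>2)) * fourier_L1 f \<xi>) (- x) =
    of_real ((fconst TYPE('n))\<^sup>2) * (LINT y|lborel. gk z (x - y) * f y)"
proof -
  let ?e = "\<lambda>\<xi>. exp (- (z * (of_real (norm \<xi>))\<^sup>2))" and ?c = "complex_of_real (fconst TYPE('n))"
  have [measurable]: "f \<in> borel_measurable borel" using borel_measurable_integrable[OF f] by simp
  have "fourier_L1 (\<lambda>\<xi>. ?e \<xi> * fourier_L1 f \<xi>) (- x) =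
     ?c * (LINT \<xi>|lborel. ?c * ((?e \<xi> * cis (x \<bullet> \<xi>)) * (LINT y|lborel. cis (- (y \<bullet> \<xi>)) * f y)))"
    unfolding fourier_L1_eq by (simp add: inner_commute[of _ x] mult_ac)
  also have "\<dots> = ?c\<^sup>2 * (LINT \<xi>|lborel. (?e \<xi> * cis (x \<bullet> \<xi>)) * (LINT y|lborel. cis (- (y \<bullet> \<xi>)) * f y))"
    by (simp add: power2_eq_square)
  also have "(LINT \<xi>|lborel. (?e \<xi> * cis (x \<bullet> \<xi>)) * (LINT y|lborel. cis (- (y \<bullet> \<xi>)) * f y))
    = (LINT y|lborel. f y * (LINT \<xi>|lborel. cis (- (y \<bullet> \<xi>)) * (?e \<xi> * cis (x \<bullet> \<xi>))))"
    by (rule swap_bounded_kernel[where B=1]) (use f gauss_integral(1)[OF z] in \<open>auto\<close>)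
  also have "\<dots> = (LINT y|lborel. gk z (x - y) * f y)"
  proof (rule Bochner_Integration.integral_cong[OF refl])
    fix y
    have "(LINT \<xi>|lborel. cis (- (y \<bullet> \<xi>)) * (?e \<xi> * cis (x \<bullet> \<xi>))) = (LINT \<xi>|lborel. ?e \<xi> * cis ((x - y) \<bullet> \<xi>))"
      by (rule Bochner_Integration.integral_cong[OF refl])
        (simp add: mult.left_commute[of "cis _"] cis_mult inner_diff_left)
    then show "f y * (LINT \<xi>|lborel. cis (- (y \<bullet> \<xi>)) * (?e \<xi> * cis (x \<bullet> \<xi>))) = gk z (x - y) * f y"
      by (simp add: gauss_integral(2)[OF z])
  qed
  finally show ?thesis by simp
qed

text \<open>The bilinear form of the previous identity. Real \<open>z\<close> leads to the Bessel
  inequality, complex \<open>z\<close> to the dispersive estimate.\<close>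

lemma fourier_gauss_pair:
  fixes f g :: "real^'n \<Rightarrow> complex"
  assumes f: "integrable lborel f" and g: "integrable lborel g" and z: "Re z > 0"
  shows "(LINT \<xi>|lborel. exp (- (z * (of_real (norm \<xi>))\<^sup>2)) * fourier_L1 f \<xi> * cnj (fourier_L1 g \<xi>)) =
    of_real ((fconst TYPE('n))\<^sup>2) * (LINT x|lborel. cnj (g x) * (LINT y|lborel. gk z (x - y) * f y))"
proof -
  let ?c = "complex_of_real (fconst TYPE('n))"
  let ?F = "\<lambda>\<xi>. exp (- (z * (of_real (norm \<xi>))\<^sup>2)) * fourier_L1 f \<xi>"
  have [measurable]: "f \<in> borel_measurable borel" "g \<in> borel_measurable borel"
    using borel_measurable_integrable[OF f] borel_measurable_integrable[OF g] by auto
  have F: "integrable lborel ?F" by (rule gauss_mult_integrable[OF z _ fourier_L1_bound]) measurable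
  have g': "integrable lborel (\<lambda>x. cnj (g x))" using g by simp
  have cg: "cnj (fourier_L1 g \<xi>) = ?c * (LINT x|lborel. cis (x \<bullet> \<xi>) * cnj (g x))" for \<xi>
  proof -
    have "cnj (LINT x|lborel. cis (- (x \<bullet> \<xi>)) * g x) = (LINT x|lborel. cnj (cis (- (x \<bullet> \<xi>)) * g x))"
      by (rule Bochner_Integration.integral_cnj[symmetric])
    then show ?thesis unfolding fourier_L1_eq by (simp add: cis_cnj)
  qed
  have "(LINT \<xi>|lborel. ?F \<xi> * cnj (fourier_L1 g \<xi>)) =
      ?c * (LINT \<xi>|lborel. ?F \<xi> * (LINT x|lborel. cis (x \<bullet> \<xi>) * cnj (g x)))"
    unfolding cg by (simp only: mult.left_commute[of _ ?c] integral_mult_right_zero)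
  also have "(LINT \<xi>|lborel. ?F \<xi> * (LINT x|lborel. cis (x \<bullet> \<xi>) * cnj (g x)))
    = (LINT x|lborel. cnj (g x) * (LINT \<xi>|lborel. cis (x \<bullet> \<xi>) * ?F \<xi>))"
    by (rule swap_bounded_kernel[where B=1]) (use F g' in \<open>auto\<close>)
  also have "?c * \<dots> = (LINT x|lborel. cnj (g x) * fourier_L1 ?F (- x))"
    unfolding fourier_L1_eq[of ?F] by (simp add: inner_commute mult.left_commute[of _ ?c])
  also have "\<dots> = (LINT x|lborel. ?c\<^sup>2 * (cnj (g x) * (LINT y|lborel. gk z (x - y) * f y)))"
    unfolding fourier_gauss[OF f z] by (simp add: mult_ac)
  finally show ?thesis by simp
qed

text \<open>The heat kernel at time \<open>\<epsilon>\<close>: the constants combine to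
  \<open>(4 * pi * \<epsilon>) powr (- N / 2)\<close>.\<close>

definition heat :: "real \<Rightarrow> real^'n \<Rightarrow> real" where
  "heat \<epsilon> x = (fconst TYPE('n))\<^sup>2 * (sqrt (pi / \<epsilon>) ^ CARD('n) * exp (- (norm x)\<^sup>2 / (4 * \<epsilon>)))"

lemma heat_measurable [measurable]: "heat \<epsilon> \<in> borel_measurable borel"
  unfolding heat_def by measurable

lemma heat_nonneg: "\<epsilon> > 0 \<Longrightarrow> 0 \<le> heat \<epsilon> x"
  by (simp add: heat_def)

lemma gk_heat: "\<epsilon> > 0 \<Longrightarrow> of_real ((fconst TYPE('n))\<^sup>2) * gk (of_real \<epsilon>) x = of_real (heat \<epsilon> x)" for x :: "real^'n"
proof -
  assume "\<epsilon> > 0"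
  moreover have "exp (- (of_real (norm x))\<^sup>2 / (4 * of_real \<epsilon>)) = complex_of_real (exp (- (norm x)\<^sup>2 / (4 * \<epsilon>)))"
    unfolding exp_of_real[symmetric] by simp
  ultimately show ?thesis by (simp add: heat_def gk_def flip: of_real_divide)
qed

lemma heat_integrable: "\<epsilon> > 0 \<Longrightarrow> integrable lborel (heat \<epsilon> :: real^'n \<Rightarrow> real)"
  unfolding heat_def using gauss_integrable[of "1 / (4 * \<epsilon>)"] by (intro integrable_mult_right) simp

lemma heat_total:
  assumes e: "\<epsilon> > 0" shows "(LINT x|lborel. heat \<epsilon> (x :: real^'n)) = 1"
proof -
  have "of_real (LINT x|lborel. exp (- (norm (x::real^'n))\<^sup>2 / (4 * \<epsilon>))) =
     (LINT x|lborel. exp (- (of_real (1 / (4 * \<epsilon>)) * (of_real (norm x))\<^sup>2)) * cis ((0::real^'n) \<bullet> x))"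
    by (subst integral_complex_of_real[symmetric]) (simp flip: exp_of_real)
  also have "\<dots> = gk (of_real (1 / (4 * \<epsilon>))) (0::real^'n)"
    by (rule gauss_integral(2)) (use e in simp)
  also have "\<dots> = of_real (sqrt (pi * (4 * \<epsilon>)) ^ CARD('n))"
  proof -
    have "complex_of_real pi / of_real (1 / (4 * \<epsilon>)) = of_real (pi * (4 * \<epsilon>))" by simp
    then show ?thesis using e by (simp only: gk_def) (simp del: of_real_mult)
  qed
  finally have 1: "(LINT x|lborel. exp (- (norm (x::real^'n))\<^sup>2 / (4 * \<epsilon>))) = sqrt (pi * (4 * \<epsilon>)) ^ CARD('n)"
    unfolding of_real_eq_iff .
  have "sqrt (pi / \<epsilon>) * sqrt (pi * (4 * \<epsilon>)) = 2 * pi"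
  proof -
    have "(pi / \<epsilon>) * (pi * (4 * \<epsilon>)) = (2 * pi)\<^sup>2" using e by (simp add: power2_eq_square)
    then show ?thesis unfolding real_sqrt_mult[symmetric] by (simp only: real_sqrt_abs) simp
  qed
  then have "sqrt (pi / \<epsilon>) ^ CARD('n) * sqrt (pi * (4 * \<epsilon>)) ^ CARD('n) = (2 * pi) ^ CARD('n)"
    by (simp only: power_mult_distrib[symmetric])
  then show ?thesis unfolding heat_def by (simp only: integral_mult_right_zero 1 fconst_sq)
qed

lemma heat_shift:
  fixes x :: "real^'n"
  assumes e: "\<epsilon> > 0"
  shows "(\<integral>\<^sup>+y. ennreal (heat \<epsilon> (x - y)) \<partial>lborel) = 1" "(\<integral>\<^sup>+y. ennreal (heat \<epsilon> (y - x)) \<partial>lborel) = 1"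
proof -
  have tot: "(\<integral>\<^sup>+y. ennreal (heat \<epsilon> (y::real^'n)) \<partial>lborel) = 1"
    using heat_integrable[OF e] heat_total[OF e, where 'n='n]
    by (subst nn_integral_eq_integral) (auto simp: heat_nonneg[OF e])
  have "(\<integral>\<^sup>+y. ennreal (heat \<epsilon> (y::real^'n)) \<partial>lborel) = (\<integral>\<^sup>+y. ennreal (heat \<epsilon> (y - x)) \<partial>lborel)"
    by (subst lborel_distr_plus[of "-x", symmetric]) (simp add: nn_integral_distr)
  with tot show 2: "(\<integral>\<^sup>+y. ennreal (heat \<epsilon> (y - x)) \<partial>lborel) = 1" by simp
  show "(\<integral>\<^sup>+y. ennreal (heat \<epsilon> (x - y)) \<partial>lborel) = 1"
    using 2 by (simp add: heat_def norm_minus_commute)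
qed

lemma norm_integral_le_nn:
  fixes f :: "'a \<Rightarrow> 'b::{banach, second_countable_topology}"
  shows "ennreal (norm (integral\<^sup>L M f)) \<le> (\<integral>\<^sup>+x. ennreal (norm (f x)) \<partial>M)"
  by (cases "integrable M f") (auto simp: integral_norm_bound_ennreal not_integrable_integral_eq)

text \<open>The Gaussian-weighted squared norm of the transform equals the pairing of
  \<open>f\<close> with its heat evolution, which the norm of \<open>f\<close> bounds because the
  kernel has mass 1; Fatou's lemma removes the weight. This is half of Plancherel's identity; the
  other half comes from inversion.\<close>

lemma fourier_bessel:
  fixes f :: "real^'n \<Rightarrow> complex"
  assumes f: "integrable lborel f" and f2: "sq_int f"
  shows "(\<integral>\<^sup>+\<xi>. ennreal ((norm (fourier_L1 f \<xi>))\<^sup>2) \<partial>lborel) \<le> (\<integral>\<^sup>+x. ennreal ((norm (f x))\<^sup>2) \<partial>lborel)"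
proof -
  have [measurable]: "f \<in> borel_measurable borel" using borel_measurable_integrable[OF f] by simp
  let ?N = "\<integral>\<^sup>+x. ennreal ((norm (f x))\<^sup>2) \<partial>lborel"
  let ?c = "(fconst TYPE('n))\<^sup>2"
  have eps: "(\<integral>\<^sup>+\<xi>. ennreal (exp (- (\<epsilon> * (norm \<xi>)\<^sup>2)) * (norm (fourier_L1 f \<xi>))\<^sup>2) \<partial>lborel) \<le> ?N" if e: "\<epsilon> > 0" for \<epsilon>
  proof -
    let ?I = "\<lambda>\<xi>. exp (- (\<epsilon> * (norm \<xi>)\<^sup>2)) * (norm (fourier_L1 f \<xi>))\<^sup>2"
    have Ic: "complex_of_real (?I \<xi>) = exp (- (of_real \<epsilon> * (of_real (norm \<xi>))\<^sup>2)) * fourier_L1 f \<xi> * cnj (fourier_L1 f \<xi>)" for \<xi>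
      by (simp add: mult.assoc complex_norm_square[symmetric] flip: exp_of_real)
    have "integrable lborel (\<lambda>\<xi>. exp (- (of_real \<epsilon> * (of_real (norm \<xi>))\<^sup>2)) * (fourier_L1 f \<xi> * cnj (fourier_L1 f \<xi>)))"
    proof (rule gauss_mult_integrable)
      show "norm (fourier_L1 f \<xi> * cnj (fourier_L1 f \<xi>)) \<le> (fconst TYPE('n) * (LINT x|lborel. norm (f x)))\<^sup>2" for \<xi>
        using power_mono[OF fourier_L1_bound[of f \<xi>] norm_ge_zero, of 2] by (simp add: norm_mult power2_eq_square)
    qed (use e in auto)
    then have "integrable lborel (\<lambda>\<xi>. complex_of_real (?I \<xi>))" unfolding Ic by (simp add: mult.assoc)
    then have Ii: "integrable lborel ?I" by (simp only: complex_of_real_integrable_eq)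
    have "complex_of_real (LINT \<xi>|lborel. ?I \<xi>) = of_real ?c * (LINT x|lborel. cnj (f x) * (LINT y|lborel. gk (of_real \<epsilon>) (x - y) * f y))"
    proof -
      have "(LINT \<xi>|lborel. complex_of_real (?I \<xi>)) = of_real ?c * (LINT x|lborel. cnj (f x) * (LINT y|lborel. gk (of_real \<epsilon>) (x - y) * f y))"
        unfolding Ic by (rule fourier_gauss_pair[OF f f]) (use e in simp)
      then show ?thesis by (simp only: integral_complex_of_real)
    qed
    also have "\<dots> = (LINT x|lborel. cnj (f x) * (LINT y|lborel. (of_real ?c * gk (of_real \<epsilon>) (x - y)) * f y))"
    proof -
      have "(LINT y|lborel. (of_real ?c * gk (of_real \<epsilon>) (x - y)) * f y) = of_real ?c * (LINT y|lborel. gk (of_real \<epsilon>) (x - y) * f y)" for x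
        by (simp only: mult.assoc integral_mult_right_zero)
      then show ?thesis by (simp only: mult.left_commute[of _ "of_real ?c"] integral_mult_right_zero)
    qed
    also have "\<dots> = (LINT x|lborel. cnj (f x) * (LINT y|lborel. of_real (heat \<epsilon> (x - y)) * f y))"
      by (simp only: gk_heat[OF e])
    finally have eq: "complex_of_real (LINT \<xi>|lborel. ?I \<xi>) = (LINT x|lborel. cnj (f x) * (LINT y|lborel. of_real (heat \<epsilon> (x - y)) * f y))" .
    have "(\<integral>\<^sup>+\<xi>. ennreal (?I \<xi>) \<partial>lborel) = ennreal (LINT \<xi>|lborel. ?I \<xi>)"
      by (rule nn_integral_eq_integral[OF Ii]) auto
    also have "\<dots> \<le> ennreal (norm (complex_of_real (LINT \<xi>|lborel. ?I \<xi>)))"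
      by (intro ennreal_leI) simp
    also have "\<dots> \<le> (\<integral>\<^sup>+x. ennreal (norm (cnj (f x) * (LINT y|lborel. of_real (heat \<epsilon> (x - y)) * f y))) \<partial>lborel)"
      unfolding eq by (rule norm_integral_le_nn)
    also have "\<dots> \<le> (\<integral>\<^sup>+x. ennreal (norm (f x)) * (\<integral>\<^sup>+y. ennreal (heat \<epsilon> (x - y) * norm (f y)) \<partial>lborel) \<partial>lborel)"
    proof (rule nn_integral_mono)
      fix x
      have "ennreal (norm (LINT y|lborel. of_real (heat \<epsilon> (x - y)) * f y)) \<le> (\<integral>\<^sup>+y. ennreal (heat \<epsilon> (x - y) * norm (f y)) \<partial>lborel)"
        using norm_integral_le_nn[of lborel "\<lambda>y. of_real (heat \<epsilon> (x - y)) * f y"]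
        by (simp add: norm_mult heat_nonneg[OF e])
      then show "ennreal (norm (cnj (f x) * (LINT y|lborel. of_real (heat \<epsilon> (x - y)) * f y)))
         \<le> ennreal (norm (f x)) * (\<integral>\<^sup>+y. ennreal (heat \<epsilon> (x - y) * norm (f y)) \<partial>lborel)"
        by (simp add: norm_mult ennreal_mult mult_left_mono)
    qed
    also have "\<dots> = (\<integral>\<^sup>+x. \<integral>\<^sup>+y. ennreal (heat \<epsilon> (x - y) * (norm (f x) * norm (f y))) \<partial>lborel \<partial>lborel)"
      by (intro nn_integral_cong, subst nn_integral_cmult[symmetric])
        (auto simp: ennreal_mult[symmetric] heat_nonneg[OF e] mult_ac)
    \<comment> \<open>The product is split by the arithmetic-geometric mean; integrating the kernel
      over the free variable then gives half the squared norm twice.\<close>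
    also have "\<dots> \<le> (\<integral>\<^sup>+x. \<integral>\<^sup>+y. ennreal (heat \<epsilon> (x - y)) * ennreal ((norm (f x))\<^sup>2 / 2) + ennreal (heat \<epsilon> (x - y)) * ennreal ((norm (f y))\<^sup>2 / 2) \<partial>lborel \<partial>lborel)"
    proof (intro nn_integral_mono)
      fix x y
      have "norm (f x) * norm (f y) \<le> (norm (f x))\<^sup>2 / 2 + (norm (f y))\<^sup>2 / 2"
        using sum_squares_bound[of "norm (f x)" "norm (f y)"] by simp
      from mult_left_mono[OF this heat_nonneg[OF e, of "x - y"]]
      show "ennreal (heat \<epsilon> (x - y) * (norm (f x) * norm (f y))) \<le>
         ennreal (heat \<epsilon> (x - y)) * ennreal ((norm (f x))\<^sup>2 / 2) + ennreal (heat \<epsilon> (x - y)) * ennreal ((norm (f y))\<^sup>2 / 2)"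
        by (simp add: ennreal_mult[symmetric] ennreal_plus[symmetric] heat_nonneg[OF e] distrib_left ennreal_leI del: ennreal_plus)
    qed
    also have "\<dots> = (\<integral>\<^sup>+x. \<integral>\<^sup>+y. ennreal (heat \<epsilon> (x - y)) * ennreal ((norm (f x))\<^sup>2 / 2) \<partial>lborel \<partial>lborel)
        + (\<integral>\<^sup>+x. \<integral>\<^sup>+y. ennreal (heat \<epsilon> (x - y)) * ennreal ((norm (f y))\<^sup>2 / 2) \<partial>lborel \<partial>lborel)"
      by (subst nn_integral_add[symmetric]) (auto intro!: nn_integral_cong nn_integral_add)
    also have "(\<integral>\<^sup>+x. \<integral>\<^sup>+y. ennreal (heat \<epsilon> (x - y)) * ennreal ((norm (f y))\<^sup>2 / 2) \<partial>lborel \<partial>lborel)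
      = (\<integral>\<^sup>+y. \<integral>\<^sup>+x. ennreal (heat \<epsilon> (x - y)) * ennreal ((norm (f y))\<^sup>2 / 2) \<partial>lborel \<partial>lborel)"
      by (rule lborel_pair.Fubini') measurable
    also have "(\<integral>\<^sup>+x. \<integral>\<^sup>+y. ennreal (heat \<epsilon> (x - y)) * ennreal ((norm (f x))\<^sup>2 / 2) \<partial>lborel \<partial>lborel) = (\<integral>\<^sup>+x. ennreal ((norm (f x))\<^sup>2 / 2) \<partial>lborel)"
      by (subst nn_integral_multc) (auto simp: heat_shift[OF e])
    also have "(\<integral>\<^sup>+y. \<integral>\<^sup>+x. ennreal (heat \<epsilon> (x - y)) * ennreal ((norm (f y))\<^sup>2 / 2) \<partial>lborel \<partial>lborel) = (\<integral>\<^sup>+x. ennreal ((norm (f x))\<^sup>2 / 2) \<partial>lborel)"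
      by (subst nn_integral_multc) (auto simp: heat_shift[OF e])
    also have "(\<integral>\<^sup>+x. ennreal ((norm (f x))\<^sup>2 / 2) \<partial>lborel) + (\<integral>\<^sup>+x. ennreal ((norm (f x))\<^sup>2 / 2) \<partial>lborel) = ?N"
      by (subst nn_integral_add[symmetric]) (auto simp: ennreal_plus[symmetric] simp del: ennreal_plus)
    finally show ?thesis .
  qed
  have "(\<integral>\<^sup>+\<xi>. ennreal ((norm (fourier_L1 f \<xi>))\<^sup>2) \<partial>lborel)
     = (\<integral>\<^sup>+\<xi>. liminf (\<lambda>n. ennreal (exp (- (1 / real (Suc n) * (norm \<xi>)\<^sup>2)) * (norm (fourier_L1 f \<xi>))\<^sup>2)) \<partial>lborel)"
  proof (rule nn_integral_cong)
    fix \<xi>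
    have "(\<lambda>n. ennreal (exp (- (1 / real (Suc n) * (norm \<xi>)\<^sup>2)) * (norm (fourier_L1 f \<xi>))\<^sup>2)) \<longlonglongrightarrow>
       ennreal (exp (- (0 * (norm \<xi>)\<^sup>2)) * (norm (fourier_L1 f \<xi>))\<^sup>2)"
      by (intro tendsto_intros LIMSEQ_Suc[OF lim_1_over_n])
    then show "ennreal ((norm (fourier_L1 f \<xi>))\<^sup>2) = liminf (\<lambda>n. ennreal (exp (- (1 / real (Suc n) * (norm \<xi>)\<^sup>2)) * (norm (fourier_L1 f \<xi>))\<^sup>2))"
      by (intro lim_imp_Liminf[symmetric]) (auto simp del: of_nat_Suc)
  qed
  also have "\<dots> \<le> liminf (\<lambda>n. \<integral>\<^sup>+\<xi>. ennreal (exp (- (1 / real (Suc n) * (norm \<xi>)\<^sup>2)) * (norm (fourier_L1 f \<xi>))\<^sup>2) \<partial>lborel)"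
    by (rule nn_integral_liminf) measurable
  also have "\<dots> \<le> ?N"
    by (intro Liminf_le always_eventually allI eps) (simp_all del: of_nat_Suc)
  finally show ?thesis .
qed

lemma fourier_L1_sq_int:
  fixes f :: "real^'n \<Rightarrow> complex"
  assumes f: "integrable lborel f" and f2: "sq_int f"
  shows "sq_int (fourier_L1 f)" and "norm (L2c (fourier_L1 f)) \<le> norm (L2c f)"
proof -
  have [measurable]: "f \<in> borel_measurable borel" using f2 by auto
  show s: "sq_int (fourier_L1 f)"
    unfolding sq_int_iff_nn using le_less_trans[OF fourier_bessel[OF f f2]] f2[unfolded sq_int_iff_nn] by auto
  have "ennreal ((norm (L2c (fourier_L1 f)))\<^sup>2) \<le> ennreal ((norm (L2c f))\<^sup>2)"
    using fourier_bessel[OF f f2] by (simp add: nn_norm_L2c s f2)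
  then show "norm (L2c (fourier_L1 f)) \<le> norm (L2c f)" by (simp add: ennreal_le_iff power_mono_iff)
qed

text \<open>Substituting \<open>y = x - sqrt \<epsilon> w\<close> moves the small parameter from the
  kernel into the argument of the bounded continuous \<open>f\<close>, so dominated convergence
  applies with a fixed Gaussian.\<close>

lemma heat_approximation:
  fixes f :: "real^'n \<Rightarrow> complex"
  assumes cont: "continuous_on UNIV f" and B: "\<And>x. norm (f x) \<le> B"
  shows "(\<lambda>n. LINT y|lborel. of_real (heat (1 / real (Suc n)) (x - y)) * f y) \<longlonglongrightarrow> f x"
proof -
  have [measurable]: "f \<in> borel_measurable borel" using cont by (rule borel_measurable_continuous_onI)
  define G where "G w = heat 1 (w :: real^'n)" for w
  have eq: "(LINT y|lborel. of_real (heat \<epsilon> (x - y)) * f y) = (LINT w|lborel. of_real (G w) * f (x + (- sqrt \<epsilon>) *\<^sub>R w))"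
    if e: "\<epsilon> > 0" for \<epsilon>
  proof -
    have sc: "sqrt \<epsilon> ^ CARD('n) * heat \<epsilon> (sqrt \<epsilon> *\<^sub>R w) = G w" for w
    proof -
      have "sqrt \<epsilon> ^ CARD('n) * sqrt (pi / \<epsilon>) ^ CARD('n) = sqrt (pi / 1) ^ CARD('n)"
        unfolding power_mult_distrib[symmetric] real_sqrt_mult[symmetric] using e by simp
      moreover have "- (norm (sqrt \<epsilon> *\<^sub>R w))\<^sup>2 / (4 * \<epsilon>) = - (norm w)\<^sup>2 / (4 * 1)"
        using e by (simp add: power_mult_distrib)
      moreover have "sqrt \<epsilon> ^ CARD('n) * heat \<epsilon> (sqrt \<epsilon> *\<^sub>R w) = (fconst TYPE('n))\<^sup>2 *
          ((sqrt \<epsilon> ^ CARD('n) * sqrt (pi / \<epsilon>) ^ CARD('n)) * exp (- (norm (sqrt \<epsilon> *\<^sub>R w))\<^sup>2 / (4 * \<epsilon>)))"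
        unfolding heat_def by (simp only: mult_ac)
      ultimately show ?thesis by (simp only: G_def heat_def)
    qed
    have "(LINT y|lborel. of_real (heat \<epsilon> (x - y)) * f y) =
       \<bar>- sqrt \<epsilon>\<bar> ^ CARD('n) *\<^sub>R (LINT w|lborel. of_real (heat \<epsilon> (x - (x + (- sqrt \<epsilon>) *\<^sub>R w))) * f (x + (- sqrt \<epsilon>) *\<^sub>R w))"
      by (subst integral_lborel_affine[of "- sqrt \<epsilon>" _ x]) (use e in auto)
    also have "\<dots> = (LINT w|lborel. of_real (sqrt \<epsilon> ^ CARD('n) * heat \<epsilon> (sqrt \<epsilon> *\<^sub>R w)) * f (x + (- sqrt \<epsilon>) *\<^sub>R w))"
      using e by (simp add: scaleR_conv_of_real mult.assoc flip: of_real_power)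
    finally show ?thesis unfolding sc .
  qed
  have G: "integrable lborel G" "(LINT w|lborel. G w) = 1"
    unfolding G_def[abs_def] using heat_integrable[of 1] heat_total[of 1] by auto
  have [measurable]: "G \<in> borel_measurable borel" unfolding G_def[abs_def] by measurable
  have "(\<lambda>n. LINT w|lborel. of_real (G w) * f (x + (- sqrt (1 / real (Suc n))) *\<^sub>R w)) \<longlonglongrightarrow> (LINT w|lborel. of_real (G w) * f x)"
  proof (rule integral_dominated_convergence[where w="\<lambda>w. B * G w"])
    show "integrable lborel (\<lambda>w. B * G w)" using G by simp
    show "AE w in lborel. (\<lambda>n. of_real (G w) * f (x + (- sqrt (1 / real (Suc n))) *\<^sub>R w)) \<longlonglongrightarrow> of_real (G w) * f x"
    proof (rule AE_I2)
      fix w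
      have "(\<lambda>n. x + (- sqrt (1 / real (Suc n))) *\<^sub>R w) \<longlonglongrightarrow> x + (- sqrt 0) *\<^sub>R w"
        by (intro tendsto_intros LIMSEQ_Suc[OF lim_1_over_n])
      then have "(\<lambda>n. f (x + (- sqrt (1 / real (Suc n))) *\<^sub>R w)) \<longlonglongrightarrow> f x"
        by (intro continuous_on_tendsto_compose[OF cont]) (auto simp del: of_nat_Suc)
      then show "(\<lambda>n. of_real (G w) * f (x + (- sqrt (1 / real (Suc n))) *\<^sub>R w)) \<longlonglongrightarrow> of_real (G w) * f x"
        by (intro tendsto_intros)
    qed
    show "AE w in lborel. norm (of_real (G w) * f (x + (- sqrt (1 / real (Suc n))) *\<^sub>R w)) \<le> B * G w" for n
    proof (rule AE_I2)
      fix w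
      show "norm (of_real (G w) * f (x + (- sqrt (1 / real (Suc n))) *\<^sub>R w)) \<le> B * G w"
        using mult_left_mono[OF B heat_nonneg[OF zero_less_one, of w], of "x + (- sqrt (1 / real (Suc n))) *\<^sub>R w"]
        by (simp only: norm_mult norm_of_real G_def abs_of_nonneg[OF heat_nonneg[OF zero_less_one]] mult.commute)
    qed
  qed auto
  moreover have "(LINT w|lborel. of_real (G w) * f x) = f x"
    by (simp only: integral_mult_left_zero integral_complex_of_real G(2) of_real_1 mult_1_left)
  moreover have pos: "1 / real (Suc n) > 0" for n by simp
  ultimately show ?thesis by (simp only: eq[OF pos])
qed

section \<open>Density of compactly supported continuous functions\<close>

definition nice :: "('a::euclidean_space \<Rightarrow> complex) \<Rightarrow> bool" where
  "nice f \<longleftrightarrow> continuous_on UNIV f \<and> (\<exists>B. \<forall>x. norm (f x) \<le> B) \<and> (\<exists>R. \<forall>x. norm x > R \<longrightarrow> f x = 0)"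

lemma sq_int_bounded_support:
  fixes f :: "'a::euclidean_space \<Rightarrow> complex"
  assumes [measurable]: "f \<in> borel_measurable borel" and B: "\<And>x. norm (f x) \<le> B" and R: "\<And>x. norm x > R \<Longrightarrow> f x = 0"
  shows "sq_int f"
proof -
  have fin: "emeasure lborel (cball (0::'a) R) < \<infinity>" by (rule emeasure_lborel_cball_finite)
  have "integrable lborel (\<lambda>x. B\<^sup>2 * indicator (cball (0::'a) R) x :: real)"
    using fin by (intro integrable_mult_right) auto
  then have "integrable lborel (\<lambda>x. (norm (f x))\<^sup>2)"
  proof (rule Bochner_Integration.integrable_bound)
    show "AE x in lborel. norm ((norm (f x))\<^sup>2) \<le> norm (B\<^sup>2 * indicator (cball 0 R) x :: real)"
      using B R by (intro AE_I2) (auto simp: indicator_def not_le intro!: power_mono)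
  qed auto
  then show ?thesis by (simp add: sq_int_def)
qed

lemma sq_int_indicator: "sq_int (indicator (cball (0::'a::euclidean_space) R))"
  by (rule sq_int_bounded_support[where B=1 and R=R], measurable) (auto simp: indicator_def)

lemma sq_int_support_integrable:
  fixes f :: "'a::euclidean_space \<Rightarrow> complex"
  assumes "sq_int f" and R: "\<And>x. norm x > R \<Longrightarrow> f x = 0"
  shows "integrable lborel f"
proof -
  have "(\<lambda>x. indicator (cball 0 R) x * f x) = f"
    by (rule ext) (use R in \<open>auto simp: indicator_def not_le\<close>)
  then show ?thesis using sq_int_prod_integrable[OF sq_int_indicator[of R] assms(1)] by simp
qed

lemma nice_sq_int: "nice f \<Longrightarrow> sq_int f"
  unfolding nice_def by (metis sq_int_bounded_support borel_measurable_continuous_onI)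

lemma nice_integrable: "nice f \<Longrightarrow> integrable lborel f"
  using nice_sq_int[of f] sq_int_support_integrable[of f] unfolding nice_def by blast

text \<open>A cutoff in space and in size reduces to bounded functions of bounded support, and these
  are almost everywhere limits of continuous functions, which are then cut off in the same way so
  that convergence is dominated.\<close>

lemma nice_dense:
  fixes u :: "'a::euclidean_space l2"
  assumes e: "e > 0"
  shows "\<exists>f. nice f \<and> norm (u - L2c f) < e"
proof -
  define c where "c k x = (if norm x \<le> real k \<and> norm (Fn u x) \<le> real k then Fn u x else 0)" for k x
  have [measurable]: "c k \<in> borel_measurable borel" for k unfolding c_def by measurable
  have sc: "sq_int (c k)" for k by (rule sq_int_dominated[OF sq_int_Fn[of u], where C=1]) (auto simp: c_def)
  have "(\<lambda>k. L2c (c k)) \<longlonglongrightarrow> L2c (Fn u)"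
  proof (rule L2_dominated_convergence[where w="Fn u"])
    show "AE x in lborel. (\<lambda>k. c k x) \<longlonglongrightarrow> Fn u x"
    proof (rule AE_I2)
      fix x
      obtain N where N: "norm x + norm (Fn u x) \<le> real N" using real_arch_simple by blast
      have "eventually (\<lambda>k. c k x = Fn u x) sequentially"
      proof (rule eventually_sequentiallyI[of N])
        fix k assume "N \<le> k"
        then have "real N \<le> real k" by simp
        then have "norm x \<le> real k" "norm (Fn u x) \<le> real k"
          using N norm_ge_zero[of x] norm_ge_zero[of "Fn u x"] by linarith+
        then show "c k x = Fn u x" unfolding c_def by simp
      qed
      then show "(\<lambda>k. c k x) \<longlonglongrightarrow> Fn u x" by (rule tendsto_eventually)
    qed
  qed (auto simp: sc c_def)
  from LIMSEQ_D[OF this, of "e/2"] e obtain k where k: "norm (L2c (c k) - u) < e / 2" by auto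
  \<comment> \<open>Lebesgue measurability in the sense of \<open>measurable_on\<close> supplies
    continuous functions converging off a negligible set.\<close>
  have "c k \<in> borel_measurable (lebesgue_on UNIV)"
    by (simp add: lebesgue_on_UNIV_eq measurable_completion)
  then have "c k measurable_on UNIV" by (simp add: measurable_on_iff_borel_measurable)
  then obtain N g where N: "negligible N" and g: "\<And>n. continuous_on UNIV (g n :: 'a \<Rightarrow> complex)"
    and lim: "\<And>x. x \<notin> N \<Longrightarrow> (\<lambda>n. g n x) \<longlonglongrightarrow> c k x"
    unfolding measurable_on_def by auto
  have aeN: "AE x in lborel. x \<notin> N"
    using AE_not_in[OF N[unfolded negligible_iff_null_sets]] by (simp only: AE_completion_iff)
  \<comment> \<open>\<open>t\<close> is a continuous spatial cutoff and \<open>cl\<close> the radial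
    retraction onto the disc of radius \<open>Suc k\<close>. Both leave \<open>c k\<close> unchanged
    while they force bounds uniform in \<open>n\<close>.\<close>
  define t where "t x = max 0 (min 1 (real k + 1 - norm x))" for x :: 'a
  define cl where "cl w = w * of_real (real (Suc k) / max (real (Suc k)) (norm w))" for w :: complex
  have clb: "norm (cl w) \<le> real (Suc k)" for w
    unfolding cl_def norm_mult norm_of_real
    by (simp add: max_def abs_mult divide_simps del: of_nat_Suc)
  have clcont: "continuous_on UNIV cl"
    unfolding cl_def by (intro continuous_intros) (auto simp: max_def)
  have clid: "cl w = w" if "norm w \<le> real k" for w
    using that by (simp add: cl_def max_def del: of_nat_Suc)
  define h where "h n x = of_real (t x) * cl (g n x)" for n x
  have t01: "0 \<le> t x" "t x \<le> 1" and t0: "norm x > real k + 1 \<Longrightarrow> t x = 0" and t1: "norm x \<le> real k \<Longrightarrow> t x = 1" for x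
    unfolding t_def by auto
  have hb: "norm (h n x) \<le> real (Suc k)" for n x
    using mult_mono[OF t01(2)[of x] clb[of "g n x"]] t01[of x] by (simp add: h_def norm_mult)
  have hc: "continuous_on UNIV (h n)" for n
    unfolding h_def t_def
    by (intro continuous_intros continuous_on_compose2[OF clcont] g) auto
  have nice: "nice (h n)" for n
  proof -
    have "h n x = 0" if "norm x > real k + 1" for x using t0[OF that] by (simp add: h_def)
    then show ?thesis unfolding nice_def using hc hb by blast
  qed
  have "(\<lambda>n. L2c (h n)) \<longlonglongrightarrow> L2c (c k)"
  proof (rule L2_dominated_convergence[where w="\<lambda>x. of_real (real (Suc k)) * indicator (cball 0 (real k + 1)) x"])
    show "sq_int (\<lambda>x. of_real (real (Suc k)) * indicator (cball 0 (real k + 1)) x)"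
      by (rule sq_int_cmult[OF sq_int_indicator])
    show "norm (h n x) \<le> norm (of_real (real (Suc k)) * indicator (cball 0 (real k + 1)) x :: complex)" for n x
    proof (cases "norm x \<le> real k + 1")
      case True
      then have "indicator (cball 0 (real k + 1)) x = (1::complex)" by simp
      then show ?thesis using hb[of n x] by (simp only: norm_mult norm_of_real norm_one mult_1_right abs_of_nat)
    qed (use t0[of x] in \<open>simp add: h_def\<close>)
    show "AE x in lborel. (\<lambda>n. h n x) \<longlonglongrightarrow> c k x"
      using aeN
    proof eventually_elim
      case (elim x)
      have "(\<lambda>n. h n x) \<longlonglongrightarrow> of_real (t x) * cl (c k x)"
        unfolding h_def by (intro tendsto_intros continuous_on_tendsto_compose[OF clcont lim] elim) auto
      also have "of_real (t x) * cl (c k x) = c k x"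
        using t1[of x] clid[of "c k x"] by (cases "norm x \<le> real k") (auto simp: c_def clid cl_def)
      finally show ?case .
    qed
  qed (use nice nice_sq_int sc in auto)
  from LIMSEQ_D[OF this, of "e/2"] e obtain n where n: "norm (L2c (h n) - L2c (c k)) < e / 2" by auto
  have "norm (u - L2c (h n)) < e"
    using norm_triangle_ineq[of "u - L2c (c k)" "L2c (c k) - L2c (h n)"] n k by (simp add: norm_minus_commute)
  then show ?thesis using nice by blast
qed
section \<open>The Fourier--Plancherel transform\<close>

definition trunc :: "real \<Rightarrow> ('a::euclidean_space \<Rightarrow> complex) \<Rightarrow> 'a \<Rightarrow> complex" where
  "trunc R f x = indicator (cball 0 R) x * f x"

lemma sq_int_trunc: "sq_int f \<Longrightarrow> sq_int (trunc R f)"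
  unfolding trunc_def[abs_def]
  by (rule sq_int_dominated[where C=1 and f=f], assumption, measurable) (auto simp: indicator_def)

lemma integrable_trunc: "sq_int f \<Longrightarrow> integrable lborel (trunc R f)"
  by (rule sq_int_support_integrable[where R=R, OF sq_int_trunc]) (auto simp: trunc_def)

lemma trunc_tendsto:
  fixes f :: "'a::euclidean_space \<Rightarrow> complex"
  assumes f: "sq_int f" and R: "filterlim R at_top sequentially"
  shows "(\<lambda>n. L2c (trunc (R n) f)) \<longlonglongrightarrow> L2c f"
proof (rule L2_dominated_convergence[where w=f])
  show "AE x in lborel. (\<lambda>n. trunc (R n) f x) \<longlonglongrightarrow> f x"
  proof (rule AE_I2)
    fix x :: 'a
    have "eventually (\<lambda>n. R n \<ge> norm x) sequentially" using R by (simp add: filterlim_at_top)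
    then have "eventually (\<lambda>n. trunc (R n) f x = f x) sequentially"
      by eventually_elim (simp add: trunc_def)
    then show "(\<lambda>n. trunc (R n) f x) \<longlonglongrightarrow> f x" by (rule tendsto_eventually)
  qed
  show "norm (trunc (R n) f x) \<le> norm (f x)" for n x by (auto simp: trunc_def indicator_def)
qed (use f sq_int_trunc in auto)

lemma fourier_contraction:
  fixes f g :: "real^'n \<Rightarrow> complex"
  assumes "integrable lborel f" "sq_int f" "integrable lborel g" "sq_int g"
  shows "norm (L2c (fourier_L1 f) - L2c (fourier_L1 g)) \<le> norm (L2c f - L2c g)"
proof -
  have "L2c (fourier_L1 f) - L2c (fourier_L1 g) = L2c (fourier_L1 (\<lambda>x. f x - g x))"
  proof -
    have "fourier_L1 (\<lambda>x. f x - g x) = (\<lambda>\<xi>. fourier_L1 f \<xi> - fourier_L1 g \<xi>)"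
      by (rule ext, rule fourier_L1_diff) (use assms in auto)
    then show ?thesis using assms by (simp add: L2c_diff fourier_L1_sq_int)
  qed
  then show ?thesis
    using fourier_L1_sq_int(2)[of "\<lambda>x. f x - g x"] assms by (simp add: L2c_diff sq_int_diff)
qed

text \<open>The limit exists because the transform is a contraction on integrable square integrable
  functions, so that it maps the convergent truncations to a Cauchy sequence.\<close>

definition FT :: "(real^'n) l2 \<Rightarrow> (real^'n) l2" where
  "FT u = lim (\<lambda>k. L2c (fourier_L1 (trunc (real k) (Fn u))))"

lemma FT_lim: "(\<lambda>k. L2c (fourier_L1 (trunc (real k) (Fn u)))) \<longlonglongrightarrow> FT u"
proof -
  have "(\<lambda>k. L2c (trunc (real k) (Fn u))) \<longlonglongrightarrow> L2c (Fn u)"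
    by (rule trunc_tendsto[OF sq_int_Fn filterlim_real_sequentially])
  then have C: "Cauchy (\<lambda>k. L2c (trunc (real k) (Fn u)))" by (rule LIMSEQ_imp_Cauchy)
  have "Cauchy (\<lambda>k. L2c (fourier_L1 (trunc (real k) (Fn u))))"
    unfolding Cauchy_def
  proof (intro allI impI)
    fix e :: real assume "e > 0"
    then obtain M where M: "\<And>m n. m \<ge> M \<Longrightarrow> n \<ge> M \<Longrightarrow> dist (L2c (trunc (real m) (Fn u))) (L2c (trunc (real n) (Fn u))) < e"
      using C unfolding Cauchy_def by blast
    show "\<exists>M. \<forall>m\<ge>M. \<forall>n\<ge>M. dist (L2c (fourier_L1 (trunc (real m) (Fn u)))) (L2c (fourier_L1 (trunc (real n) (Fn u)))) < e"
    proof (intro exI[of _ M] allI impI)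
      fix m n assume "m \<ge> M" "n \<ge> M"
      then show "dist (L2c (fourier_L1 (trunc (real m) (Fn u)))) (L2c (fourier_L1 (trunc (real n) (Fn u)))) < e"
        using fourier_contraction[of "trunc (real m) (Fn u)" "trunc (real n) (Fn u)"] M[of m n]
        by (simp add: dist_norm integrable_trunc sq_int_trunc)
    qed
  qed
  then show ?thesis unfolding FT_def by (simp add: Cauchy_convergent_iff convergent_LIMSEQ_iff)
qed

lemma FT_L2c:
  fixes f :: "real^'n \<Rightarrow> complex"
  assumes f: "integrable lborel f" "sq_int f"
  shows "FT (L2c f) = L2c (fourier_L1 f)"
proof (rule LIMSEQ_unique[OF FT_lim])
  have "(\<lambda>k. L2c (trunc (real k) (Fn (L2c f)))) \<longlonglongrightarrow> L2c (Fn (L2c f))"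
    by (rule trunc_tendsto[OF sq_int_Fn filterlim_real_sequentially])
  then have z: "(\<lambda>k. norm (L2c (trunc (real k) (Fn (L2c f))) - L2c f)) \<longlonglongrightarrow> 0"
    by (simp add: LIM_zero_iff tendsto_norm_zero)
  have "(\<lambda>k. L2c (fourier_L1 (trunc (real k) (Fn (L2c f)))) - L2c (fourier_L1 f)) \<longlonglongrightarrow> 0"
    by (rule Lim_null_comparison[OF _ z])
      (intro always_eventually allI fourier_contraction integrable_trunc sq_int_trunc sq_int_Fn f)
  then show "(\<lambda>k. L2c (fourier_L1 (trunc (real k) (Fn (L2c f))))) \<longlonglongrightarrow> L2c (fourier_L1 f)"
    by (simp add: LIM_zero_iff)
qed

lemma FT_add: "FT (u + v) = FT u + FT v"
proof (rule LIMSEQ_unique[OF FT_lim])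
  have eq: "L2c (fourier_L1 (trunc R (Fn (u + v)))) = L2c (fourier_L1 (trunc R (Fn u))) + L2c (fourier_L1 (trunc R (Fn v)))" for R
  proof -
    have "fourier_L1 (trunc R (Fn (u + v))) = fourier_L1 (\<lambda>x. trunc R (Fn u) x + trunc R (Fn v) x)"
    proof (rule ext, rule fourier_L1_cong_AE)
      show "AE x in lborel. trunc R (Fn (u + v)) x = trunc R (Fn u) x + trunc R (Fn v) x"
        using Fn_plus[of u v] by eventually_elim (simp add: trunc_def algebra_simps)
    qed (intro sq_int_measurable sq_int_add sq_int_trunc sq_int_Fn)+
    also have "\<dots> = (\<lambda>\<xi>. fourier_L1 (trunc R (Fn u)) \<xi> + fourier_L1 (trunc R (Fn v)) \<xi>)"
      by (rule ext, rule fourier_L1_add) (simp_all add: integrable_trunc)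
    finally show ?thesis by (simp add: L2c_add fourier_L1_sq_int integrable_trunc sq_int_trunc)
  qed
  show "(\<lambda>k. L2c (fourier_L1 (trunc (real k) (Fn (u + v))))) \<longlonglongrightarrow> FT u + FT v"
    unfolding eq by (intro tendsto_add FT_lim)
qed

lemma FT_scaleR: "FT (r *\<^sub>R u) = r *\<^sub>R FT u"
proof (rule LIMSEQ_unique[OF FT_lim])
  have eq: "L2c (fourier_L1 (trunc R (Fn (r *\<^sub>R u)))) = r *\<^sub>R L2c (fourier_L1 (trunc R (Fn u)))" for R
  proof -
    have "fourier_L1 (trunc R (Fn (r *\<^sub>R u))) = fourier_L1 (\<lambda>x. of_real r * trunc R (Fn u) x)"
    proof (rule ext, rule fourier_L1_cong_AE)
      show "AE x in lborel. trunc R (Fn (r *\<^sub>R u)) x = of_real r * trunc R (Fn u) x"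
        using Fn_scaleR[of r u] by eventually_elim (simp add: trunc_def)
    qed (intro sq_int_measurable sq_int_cmult sq_int_trunc sq_int_Fn)+
    then show ?thesis
      by (simp add: fourier_L1_cmult[abs_def] L2c_scaleR fourier_L1_sq_int integrable_trunc sq_int_trunc)
  qed
  show "(\<lambda>k. L2c (fourier_L1 (trunc (real k) (Fn (r *\<^sub>R u))))) \<longlonglongrightarrow> r *\<^sub>R FT u"
    unfolding eq by (intro tendsto_scaleR tendsto_const FT_lim)
qed

lemma linear_FT: "linear FT"
  by (rule linearI) (simp_all add: FT_add FT_scaleR)

lemma FT_norm_le: "norm (FT u) \<le> norm u"
proof (rule LIMSEQ_le[OF tendsto_norm[OF FT_lim] tendsto_norm])
  show "(\<lambda>k. L2c (trunc (real k) (Fn u))) \<longlonglongrightarrow> u"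
    using trunc_tendsto[OF sq_int_Fn[of u] filterlim_real_sequentially] by simp
  show "\<exists>N. \<forall>n\<ge>N. norm (L2c (fourier_L1 (trunc (real n) (Fn u)))) \<le> norm (L2c (trunc (real n) (Fn u)))"
    by (auto intro!: fourier_L1_sq_int(2) integrable_trunc sq_int_trunc)
qed

lemma lipschitz_tendsto:
  fixes A :: "'h::real_normed_vector \<Rightarrow> 'k::real_normed_vector"
  assumes "linear A" "\<And>u. norm (A u) \<le> norm u" "(f \<longlongrightarrow> v) F"
  shows "((\<lambda>x. A (f x)) \<longlongrightarrow> A v) F"
proof -
  have "bounded_linear A"
    using assms by (intro bounded_linear_intro[where K=1]) (auto simp: linear_add linear_scale)
  then show ?thesis using assms(3) by (rule bounded_linear.tendsto)
qed

section \<open>Reflection and Fourier inversion\<close>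

definition reflect :: "'a::euclidean_space l2 \<Rightarrow> 'a l2" where
  "reflect u = L2c (\<lambda>x. Fn u (- x))"

lemma distr_lborel_uminus: "distr lborel borel (uminus :: 'a::euclidean_space \<Rightarrow> 'a) = lborel"
  using lborel_affine[of "-1" "0::'a"] by (simp add: density_1)

lemma sq_int_reflect:
  fixes f :: "'a::euclidean_space \<Rightarrow> complex"
  assumes f: "sq_int f"
  shows "sq_int (\<lambda>x. f (- x))" "norm (L2c (\<lambda>x. f (- x))) = norm (L2c f)"
proof -
  have [measurable]: "f \<in> borel_measurable borel" using f by auto
  have eq: "(\<integral>\<^sup>+x. ennreal ((norm (f (- x)))\<^sup>2) \<partial>lborel) = (\<integral>\<^sup>+x. ennreal ((norm (f x))\<^sup>2) \<partial>lborel)"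
    by (subst (2) distr_lborel_uminus[symmetric]) (simp add: nn_integral_distr)
  show s: "sq_int (\<lambda>x. f (- x))" using f by (simp add: sq_int_iff_nn eq)
  have "ennreal ((norm (L2c (\<lambda>x. f (- x))))\<^sup>2) = ennreal ((norm (L2c f))\<^sup>2)"
    using eq by (simp add: nn_norm_L2c s f)
  then have "(norm (L2c (\<lambda>x. f (- x))))\<^sup>2 = (norm (L2c f))\<^sup>2" by (subst (asm) ennreal_inj) auto
  then show "norm (L2c (\<lambda>x. f (- x))) = norm (L2c f)" by simp
qed

lemma AE_lborel_reflect:
  fixes P :: "'a::euclidean_space \<Rightarrow> bool"
  assumes "AE x in lborel. P x" and [measurable]: "Measurable.pred borel P"
  shows "AE x in lborel. P (- x)"
proof -
  have "AE x in distr lborel borel (uminus :: 'a \<Rightarrow> 'a). P x" unfolding distr_lborel_uminus by (rule assms(1))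
  then show ?thesis by (subst (asm) AE_distr_iff) auto
qed

lemma reflect_L2c:
  assumes f: "sq_int f" shows "reflect (L2c f) = L2c (\<lambda>x. f (- x))"
proof -
  have [measurable]: "f \<in> borel_measurable borel" using f by auto
  have "AE x in lborel. Fn (L2c f) (- x) = f (- x)"
    by (rule AE_lborel_reflect[OF Fn_L2c[OF f]]) measurable
  then show ?thesis unfolding reflect_def by (subst L2c_eq_iff) (auto simp: sq_int_reflect f)
qed

lemma reflect_reflect [simp]: "reflect (reflect u) = u"
  using reflect_L2c[OF sq_int_reflect(1)[OF sq_int_Fn[of u]]] by (simp add: reflect_def[of u])

lemma norm_reflect [simp]: "norm (reflect u) = norm u"
  unfolding reflect_def using sq_int_reflect(2)[OF sq_int_Fn[of u]] by simp

lemma linear_reflect: "linear reflect"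
proof (rule linearI)
  fix u v :: "'a l2" and r :: real
  show "reflect (u + v) = reflect u + reflect v"
    using reflect_L2c[OF sq_int_add[OF sq_int_Fn[of u] sq_int_Fn[of v]]]
    by (simp add: L2c_add sq_int_reflect reflect_def[of u] reflect_def[of v])
  show "reflect (r *\<^sub>R u) = r *\<^sub>R reflect u"
    using reflect_L2c[OF sq_int_cmult[OF sq_int_Fn[of u], of "of_real r"]]
    by (simp add: L2c_scaleR sq_int_reflect reflect_def[of u])
qed

lemma sq_int_gauss_fourier:
  fixes f :: "real^'n \<Rightarrow> complex"
  assumes f: "integrable lborel f" "sq_int f" and z: "Re z > 0"
  defines "g \<equiv> \<lambda>\<xi>. exp (- (z * (of_real (norm \<xi>))\<^sup>2)) * fourier_L1 f \<xi>"
  shows "sq_int g" "integrable lborel g" "norm (g \<xi>) \<le> norm (fourier_L1 f \<xi>)"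
proof -
  have [measurable]: "f \<in> borel_measurable borel" using f by auto
  have le: "norm (g \<xi>) \<le> norm (fourier_L1 f \<xi>)" for \<xi>
    unfolding g_def norm_mult using z
    by (intro mult_left_le_one_le) (auto simp: power2_eq_square)
  then show "norm (g \<xi>) \<le> norm (fourier_L1 f \<xi>)" .
  show "sq_int g"
    by (rule sq_int_dominated[OF fourier_L1_sq_int(1)[OF f], where C=1]) (use le in \<open>auto simp: g_def\<close>)
  show "integrable lborel g"
    unfolding g_def by (rule gauss_mult_integrable[OF z _ fourier_L1_bound]) measurable
qed

text \<open>The transform is damped by a Gaussian before it is transformed again. In norm the
  damping disappears by domination and continuity of \<open>FT\<close>; pointwise the result is a
  heat approximation of \<open>f\<close> at \<open>- y\<close>.\<close>

lemma FT_FT_nice: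
  fixes f :: "real^'n \<Rightarrow> complex"
  assumes n: "nice f" shows "FT (FT (L2c f)) = reflect (L2c f)"
proof -
  have f: "integrable lborel f" "sq_int f" using n by (auto intro: nice_integrable nice_sq_int)
  have [measurable]: "f \<in> borel_measurable borel" using f by auto
  define g where "g k \<xi> = exp (- (complex_of_real (1 / real (Suc k)) * (of_real (norm \<xi>))\<^sup>2)) * fourier_L1 f \<xi>" for k \<xi>
  have z: "Re (complex_of_real (1 / real (Suc k))) > 0" for k by (simp del: of_nat_Suc)
  have g: "sq_int (g k)" "integrable lborel (g k)" for k
    using sq_int_gauss_fourier(1,2)[OF f z] by (simp_all only: g_def[abs_def])
  have g_le: "norm (g k \<xi>) \<le> norm (fourier_L1 f \<xi>)" for k \<xi>
    using sq_int_gauss_fourier(3)[OF f z] by (simp only: g_def)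
  have "(\<lambda>k. L2c (g k)) \<longlonglongrightarrow> L2c (fourier_L1 f)"
  proof (rule L2_dominated_convergence[where w="fourier_L1 f"])
    show "AE \<xi> in lborel. (\<lambda>k. g k \<xi>) \<longlonglongrightarrow> fourier_L1 f \<xi>"
    proof (rule AE_I2)
      fix \<xi>
      have "(\<lambda>k. g k \<xi>) \<longlonglongrightarrow> exp (- (complex_of_real 0 * (of_real (norm \<xi>))\<^sup>2)) * fourier_L1 f \<xi>"
        unfolding g_def by (intro tendsto_intros LIMSEQ_Suc[OF lim_1_over_n])
      then show "(\<lambda>k. g k \<xi>) \<longlonglongrightarrow> fourier_L1 f \<xi>" by simp
    qed
  qed (use g g_le fourier_L1_sq_int[OF f] in auto)
  then have lim: "(\<lambda>k. FT (L2c (g k))) \<longlonglongrightarrow> FT (FT (L2c f))"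
    unfolding FT_L2c[OF f] by (rule lipschitz_tendsto[OF linear_FT FT_norm_le])
  have ae: "AE y in lborel. \<forall>k. Fn (FT (L2c (g k))) y = fourier_L1 (g k) y"
    unfolding AE_all_countable using FT_L2c[OF g(2,1)] Fn_L2c[OF fourier_L1_sq_int(1)[OF g(2,1)]] by simp
  obtain B where B: "\<And>x. norm (f x) \<le> B" and cont: "continuous_on UNIV f" using n by (auto simp: nice_def)
  have pt: "(\<lambda>k. fourier_L1 (g k) y) \<longlonglongrightarrow> f (- y)" for y
  proof -
    have "fourier_L1 (g k) y = (LINT w|lborel. of_real (heat (1 / real (Suc k)) (- y - w)) * f w)" for k
    proof -
      have "fourier_L1 (g k) (- (- y)) = of_real ((fconst TYPE('n))\<^sup>2) * (LINT w|lborel. gk (of_real (1 / real (Suc k))) (- y - w) * f w)"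
        unfolding g_def[abs_def] by (rule fourier_gauss[OF f(1) z])
      also have "\<dots> = (LINT w|lborel. (of_real ((fconst TYPE('n))\<^sup>2) * gk (of_real (1 / real (Suc k))) (- y - w)) * f w)"
        by (simp only: mult.assoc integral_mult_right_zero)
      also have "\<dots> = (LINT w|lborel. of_real (heat (1 / real (Suc k)) (- y - w)) * f w)"
        by (subst gk_heat) (auto simp del: of_nat_Suc)
      finally show ?thesis by simp
    qed
    then show ?thesis using heat_approximation[OF cont B, of "- y"] by (simp only:)
  qed
  have "AE y in lborel. Fn (FT (FT (L2c f))) y = f (- y)"
    by (rule L2_limit_pointwise[OF lim]) (use ae in \<open>eventually_elim, use pt in simp\<close>)
  then have "L2c (Fn (FT (FT (L2c f)))) = L2c (\<lambda>y. f (- y))"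
    by (subst L2c_eq_iff) (auto simp: sq_int_reflect f)
  then show ?thesis by (simp add: reflect_L2c f)
qed

text \<open>Both sides are linear and do not increase the norm, so the identity extends from the
  dense class.\<close>

theorem FT_FT: "FT (FT u) = reflect u"
proof -
  have "norm (FT (FT u) - reflect u) < e" if e: "e > 0" for e
  proof -
    obtain f where f: "nice f" "norm (u - L2c f) < e / 2" using nice_dense[of "e/2" u] e by auto
    define d where "d = u - L2c f"
    have "FT (FT u) - reflect u = FT (FT d) - reflect d"
      unfolding d_def linear_diff[OF linear_FT] linear_diff[OF linear_reflect] FT_FT_nice[OF f(1)] by simp
    also have "norm \<dots> \<le> norm (FT (FT d)) + norm (reflect d)" by (rule norm_triangle_ineq4)
    also have "\<dots> \<le> norm d + norm d" using FT_norm_le[of d] FT_norm_le[of "FT d"] by simp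
    finally show ?thesis using f(2) by (simp add: d_def)
  qed
  then have "norm (FT (FT u) - reflect u) \<le> 0" by (meson field_le_epsilon less_eq_real_def not_le add_0_left order_refl dense_ge)
  then show ?thesis by simp
qed

text \<open>A contraction whose square is an isometry is itself an isometry.\<close>

lemma norm_FT [simp]: "norm (FT u) = norm u"
proof (rule antisym[OF FT_norm_le])
  have "norm u = norm (FT (FT u))" by (simp add: FT_FT)
  then show "norm u \<le> norm (FT u)" using FT_norm_le[of "FT u"] by simp
qed

definition FTinv :: "(real^'n) l2 \<Rightarrow> (real^'n) l2" where "FTinv v = reflect (FT v)"

lemma FT_FTinv [simp]: "FT (FTinv v) = v"
proof -
  have "FT (FTinv v) = FT (FT (FT (FT v)))" by (simp only: FTinv_def FT_FT[of "FT v", symmetric])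
  then show ?thesis by (simp only: FT_FT reflect_reflect)
qed

lemma FTinv_FT [simp]: "FTinv (FT u) = u"
  by (simp add: FTinv_def FT_FT)

lemma norm_FTinv [simp]: "norm (FTinv v) = norm v"
  by (simp add: FTinv_def)

lemma linear_FTinv: "linear FTinv"
  unfolding FTinv_def[abs_def] using linear_compose[OF linear_FT linear_reflect] by (simp add: o_def)

lemma inner_FT: "inner (FT u) (FT v) = inner u v"
  by (simp only: dot_norm FT_add[symmetric] norm_FT)

section \<open>Bounded multipliers\<close>

definition bmeas :: "('a::euclidean_space \<Rightarrow> complex) \<Rightarrow> bool" where
  "bmeas h \<longleftrightarrow> h \<in> borel_measurable borel \<and> (\<exists>B. \<forall>x. norm (h x) \<le> B)"

definition mul :: "('a::euclidean_space \<Rightarrow> complex) \<Rightarrow> 'a l2 \<Rightarrow> 'a l2" where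
  "mul h u = L2c (\<lambda>x. h x * Fn u x)"

lemma bmeas_cis: "f \<in> borel_measurable borel \<Longrightarrow> bmeas (\<lambda>x. cis (f x))"
  unfolding bmeas_def by (auto intro!: exI[of _ 1])

lemma sq_int_bmult:
  assumes "bmeas h" "sq_int f" shows "sq_int (\<lambda>x. h x * f x)"
proof -
  have [measurable]: "h \<in> borel_measurable borel" "f \<in> borel_measurable borel"
    using assms by (auto simp: bmeas_def)
  obtain B where "\<And>x. norm (h x) \<le> B" using assms by (auto simp: bmeas_def)
  then show ?thesis
    by (intro sq_int_dominated[OF assms(2), where C=B]) (auto simp: norm_mult intro!: mult_right_mono)
qed

lemma mul_L2c:
  assumes "bmeas h" "sq_int f" shows "mul h (L2c f) = L2c (\<lambda>x. h x * f x)"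
  unfolding mul_def using Fn_L2c[OF assms(2)]
  by (subst L2c_eq_iff) (auto simp: sq_int_bmult assms)

lemma linear_mul: assumes h: "bmeas h" shows "linear (mul h)"
proof (rule linearI)
  fix u v and r :: real
  show "mul h (u + v) = mul h u + mul h v"
    using mul_L2c[OF h sq_int_add[OF sq_int_Fn[of u] sq_int_Fn[of v]]]
    by (simp add: L2c_add sq_int_bmult h distrib_left mul_def[of h u] mul_def[of h v])
  show "mul h (r *\<^sub>R u) = r *\<^sub>R mul h u"
    using mul_L2c[OF h sq_int_cmult[OF sq_int_Fn[of u], of "of_real r"]]
    by (simp add: L2c_scaleR sq_int_bmult h mult.left_commute[of "h _"] mul_def[of h u])
qed

lemma mul_mul:
  assumes "bmeas h" "bmeas k" shows "mul h (mul k u) = mul (\<lambda>x. h x * k x) u"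
  unfolding mul_def[of k u] using assms by (subst mul_L2c) (auto simp: sq_int_bmult mul_def mult.assoc)

lemma norm_mul_unimodular:
  assumes h: "bmeas h" and 1: "\<And>x. norm (h x) = 1" shows "norm (mul h u) = norm u"
proof -
  have "(norm (mul h u))\<^sup>2 = (LINT x|lborel. (norm (h x * Fn u x))\<^sup>2)"
    unfolding mul_def by (rule norm_L2c_sq) (simp add: sq_int_bmult h)
  then have "(norm (mul h u))\<^sup>2 = (norm u)\<^sup>2" by (simp add: norm_mult 1 norm_l2_sq)
  then show ?thesis by simp
qed

section \<open>The free Schroedinger group\<close>

definition schr :: "real \<Rightarrow> (real^'n) l2 \<Rightarrow> (real^'n) l2" where
  "schr t u = FTinv (mul (\<lambda>\<xi>. cis (- (t * (norm \<xi>)\<^sup>2))) (FT u))"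

lemma bmeas_phase: "bmeas (\<lambda>\<xi>::'a::euclidean_space. cis (- (t * (norm \<xi>)\<^sup>2)))"
  by (rule bmeas_cis) measurable

lemma norm_schr [simp]: "norm (schr t u) = norm u"
  unfolding schr_def by (simp add: norm_mul_unimodular bmeas_phase)

lemma linear_schr: "linear (schr t)"
  unfolding schr_def[abs_def]
  using linear_compose[OF linear_compose[OF linear_FT linear_mul[OF bmeas_phase]] linear_FTinv] by (simp add: o_def)

section \<open>Agreement with the given Fourier-Plancherel transform and Schroedinger group\<close>

lemma Lp_norm_2:
  fixes f :: "real^'n \<Rightarrow> complex"
  assumes f: "sq_int f" shows "Lp_norm 2 f = ennreal (norm (L2c f))"
proof -
  have "(\<integral>\<^sup>+ x. ennreal (norm (f x) powr 2) \<partial>lborel) = ennreal ((norm (L2c f))\<^sup>2)"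
    using nn_norm_L2c[OF f] by simp
  then show ?thesis unfolding Lp_norm_def enn_powr_def by (simp add: powr_half_sqrt)
qed

lemma in_Lp_2_iff: "in_Lp 2 f \<longleftrightarrow> sq_int f" for f :: "real^'n \<Rightarrow> complex"
proof
  assume "in_Lp 2 f"
  then have m: "f \<in> borel_measurable borel" and l: "Lp_norm 2 f < \<infinity>" by (auto simp: in_Lp_def)
  have "(\<integral>\<^sup>+ x. ennreal (norm (f x) powr 2) \<partial>lborel) \<noteq> \<infinity>"
    using l unfolding Lp_norm_def enn_powr_def by (auto split: if_splits)
  then show "sq_int f" using m by (simp add: sq_int_iff_nn less_top)
next
  assume "sq_int f"
  then show "in_Lp 2 f" by (auto simp: in_Lp_def Lp_norm_2)
qed

text \<open>The relation takes its limit over real radii, \<open>FT\<close> over integers. Since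
  truncations along any divergent radii converge in norm and \<open>FT\<close> is continuous, both
  limits agree, and uniqueness of limits gives the equivalence.\<close>

lemma fourier_L2_iff:
  fixes f g :: "real^'n \<Rightarrow> complex"
  shows "fourier_L2 f g \<longleftrightarrow> sq_int f \<and> sq_int g \<and> FT (L2c f) = L2c g"
proof (cases "sq_int f \<and> sq_int g")
  case True
  then have f: "sq_int f" and g: "sq_int g" by auto
  define a where "a R = L2c (fourier_L1 (trunc R f))" for R
  have N: "Lp_norm 2 (\<lambda>\<xi>. fourier_L1 (\<lambda>x. indicator (cball 0 R) x * f x) \<xi> - g \<xi>) = ennreal (norm (a R - L2c g))" for R
    unfolding trunc_def[of R f, abs_def, symmetric] a_def
    using f g by (subst Lp_norm_2) (auto simp: sq_int_diff L2c_diff fourier_L1_sq_int integrable_trunc sq_int_trunc)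
  have lim: "(a \<longlongrightarrow> FT (L2c f)) at_top"
  proof (rule tendsto_at_topI_sequentially)
    fix X :: "nat \<Rightarrow> real" assume "filterlim X at_top sequentially"
    from lipschitz_tendsto[OF linear_FT FT_norm_le trunc_tendsto[OF f this]]
    show "(\<lambda>n. a (X n)) \<longlonglongrightarrow> FT (L2c f)" by (simp add: a_def FT_L2c f integrable_trunc sq_int_trunc)
  qed
  have "((\<lambda>R. ennreal (norm (a R - L2c g))) \<longlongrightarrow> 0) at_top \<longleftrightarrow> FT (L2c f) = L2c g"
  proof
    assume "((\<lambda>R. ennreal (norm (a R - L2c g))) \<longlongrightarrow> 0) at_top"
    then have "((\<lambda>R. norm (a R - L2c g)) \<longlongrightarrow> 0) at_top"
      by (subst (asm) ennreal_0[symmetric], subst (asm) tendsto_ennreal_iff) auto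
    then have "(a \<longlongrightarrow> L2c g) at_top" by (simp add: LIM_zero_iff tendsto_norm_zero_iff)
    from tendsto_unique[OF trivial_limit_at_top_linorder lim this] show "FT (L2c f) = L2c g" .
  next
    assume "FT (L2c f) = L2c g"
    then have "((\<lambda>R. norm (a R - L2c g)) \<longlongrightarrow> 0) at_top" using lim by (simp add: LIM_zero_iff tendsto_norm_zero)
    from tendsto_ennrealI[OF this] show "((\<lambda>R. ennreal (norm (a R - L2c g))) \<longlongrightarrow> 0) at_top" by simp
  qed
  then show ?thesis unfolding fourier_L2_def N in_Lp_2_iff using f g by simp
next
  case False
  then show ?thesis by (auto simp: fourier_L2_def in_Lp_2_iff)
qed

text \<open>The condition under the choice operator determines the class of \<open>u\<close> and can
  be met, so the chosen function is a representative of \<open>schr t (L2c f)\<close>.\<close>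

lemma schroedinger_L2c:
  fixes f :: "real^'n \<Rightarrow> complex"
  assumes f: "sq_int f"
  shows "sq_int (schroedinger t f)" "L2c (schroedinger t f) = schr t (L2c f)"
proof -
  let ?h = "\<lambda>\<xi>::real^'n. cis (- (t * (norm \<xi>)\<^sup>2))"
  let ?P = "\<lambda>u. \<exists>g. fourier_L2 f g \<and> fourier_L2 u (\<lambda>\<xi>. ?h \<xi> * g \<xi>)"
  have eq: "?P u \<longleftrightarrow> sq_int u \<and> L2c u = schr t (L2c f)" for u
  proof
    assume "?P u"
    then obtain g where g: "sq_int g" "FT (L2c f) = L2c g" "sq_int u" "FT (L2c u) = L2c (\<lambda>\<xi>. ?h \<xi> * g \<xi>)"
      by (auto simp: fourier_L2_iff)
    then have "FT (L2c u) = mul ?h (FT (L2c f))" by (simp add: mul_L2c bmeas_phase)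
    then have "L2c u = FTinv (mul ?h (FT (L2c f)))" by (metis FTinv_FT)
    then show "sq_int u \<and> L2c u = schr t (L2c f)" using g by (simp add: schr_def)
  next
    assume u: "sq_int u \<and> L2c u = schr t (L2c f)"
    have "fourier_L2 f (Fn (FT (L2c f)))" by (simp add: fourier_L2_iff f)
    moreover have "fourier_L2 u (\<lambda>\<xi>. ?h \<xi> * Fn (FT (L2c f)) \<xi>)"
      using u by (simp add: fourier_L2_iff sq_int_bmult bmeas_phase schr_def mul_def)
    ultimately show "?P u" by blast
  qed
  have "?P (Fn (schr t (L2c f)))" unfolding eq by simp
  then have "?P (schroedinger t f)" unfolding schroedinger_def by (rule someI[of ?P])
  then show "sq_int (schroedinger t f)" "L2c (schroedinger t f) = schr t (L2c f)" unfolding eq by auto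
qed

lemma schroedinger_AE:
  assumes "sq_int f" shows "AE x in lborel. schroedinger t f x = Fn (schr t (L2c f)) x"
  using Fn_L2c[OF schroedinger_L2c(1)[OF assms, of t]] unfolding schroedinger_L2c(2)[OF assms]
  by eventually_elim simp

text \<open>The multiplier is regularised to \<open>exp (- (\<epsilon> + \<i> t) |\<xi>|\<^sup>2)\<close>, whose kernel is an absolutely
  convergent Gaussian integral, and \<open>\<epsilon>\<close> tends to zero.\<close>

definition free_kernel :: "real \<Rightarrow> (real^'n \<Rightarrow> complex) \<Rightarrow> real^'n \<Rightarrow> complex" where
  "free_kernel t f x = of_real ((fconst TYPE('n))\<^sup>2) * (LINT y|lborel. gk (\<i> * of_real t) (x - y) * f y)"

lemma reg_tendsto: "(\<lambda>k. complex_of_real (1 / real (Suc k)) + \<i> * of_real t) \<longlonglongrightarrow> \<i> * of_real t"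
proof -
  have "(\<lambda>k. complex_of_real (1 / real (Suc k)) + \<i> * of_real t) \<longlonglongrightarrow> complex_of_real 0 + \<i> * of_real t"
    by (intro tendsto_intros LIMSEQ_Suc[OF lim_1_over_n])
  then show ?thesis by simp
qed

text \<open>At the limit the argument of the square root is a nonzero imaginary number, hence off
  the branch cut.\<close>

lemma gk_reg_tendsto:
  assumes t: "t \<noteq> 0"
  shows "(\<lambda>k. gk (complex_of_real (1 / real (Suc k)) + \<i> * of_real t) x) \<longlonglongrightarrow> gk (\<i> * of_real t) x"
proof -
  have "of_real pi / (\<i> * of_real t) = - (\<i> * of_real (pi / t))" using t by (simp add: field_simps)
  then have "Im (of_real pi / (\<i> * of_real t)) = - (pi / t)" by (simp only:) simp
  then have "of_real pi / (\<i> * of_real t) \<notin> \<real>\<^sub>\<le>\<^sub>0" using t by (auto simp: complex_nonpos_Reals_iff)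
  then have "isCont csqrt (of_real pi / (\<i> * of_real t))" by (rule continuous_at_csqrt)
  then show ?thesis unfolding gk_def
    by (intro tendsto_intros isCont_tendsto_compose[of _ csqrt] reg_tendsto) (use t in auto)
qed

text \<open>The bound is uniform in the regularisation because the modulus of
  \<open>\<epsilon> + \<i> t\<close> is at least that of \<open>t\<close>; this allows dominated
  convergence of the kernels.\<close>

lemma reg_norm_bound:
  fixes x :: "real^'n"
  assumes t: "t \<noteq> 0"
  shows "norm (gk (complex_of_real (1 / real (Suc k)) + \<i> * of_real t) x) \<le> (pi / \<bar>t\<bar>) powr (real CARD('n) / 2)"
proof -
  let ?z = "complex_of_real (1 / real (Suc k)) + \<i> * of_real t"
  have Re: "Re ?z > 0" by (simp del: of_nat_Suc)
  have le: "\<bar>t\<bar> \<le> norm ?z" using abs_Im_le_cmod[of ?z] by simp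
  have p: "0 < \<bar>t\<bar>" using t by simp
  have "pi / norm ?z \<le> pi / \<bar>t\<bar>"
    by (rule divide_left_mono[OF le pi_ge_zero mult_pos_pos[OF order_less_le_trans[OF p le] p]])
  then have "(pi / norm ?z) powr (real CARD('n) / 2) \<le> (pi / \<bar>t\<bar>) powr (real CARD('n) / 2)"
    by (intro powr_mono2) auto
  with norm_gk_le[OF Re, of x] show ?thesis by linarith
qed

text \<open>On the frequency side the regularised multipliers converge in norm, on the space side
  their kernels converge boundedly against the integrable \<open>f\<close>; the two limits must be
  the same function.\<close>

lemma schr_kernel:
  fixes f :: "real^'n \<Rightarrow> complex"
  assumes f: "integrable lborel f" "sq_int f" and t: "t \<noteq> 0"
  shows "AE x in lborel. Fn (schr t (L2c f)) x = free_kernel t f x"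
proof -
  have [measurable]: "f \<in> borel_measurable borel" using f by auto
  define z where "z k = complex_of_real (1 / real (Suc k)) + \<i> * of_real t" for k
  have z: "Re (z k) > 0" for k by (simp add: z_def del: of_nat_Suc)
  define g where "g k \<xi> = exp (- (z k * (of_real (norm \<xi>))\<^sup>2)) * fourier_L1 f \<xi>" for k \<xi>
  have g: "sq_int (g k)" "integrable lborel (g k)" for k
    using sq_int_gauss_fourier(1,2)[OF f z] by (simp_all only: g_def[abs_def])
  have g_le: "norm (g k \<xi>) \<le> norm (fourier_L1 f \<xi>)" for k \<xi>
    using sq_int_gauss_fourier(3)[OF f z] by (simp only: g_def)
  let ?h = "\<lambda>\<xi>::real^'n. cis (- (t * (norm \<xi>)\<^sup>2))"
  have "(\<lambda>k. L2c (g k)) \<longlonglongrightarrow> L2c (\<lambda>\<xi>. ?h \<xi> * fourier_L1 f \<xi>)"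
  proof (rule L2_dominated_convergence[where w="fourier_L1 f"])
    show "AE \<xi> in lborel. (\<lambda>k. g k \<xi>) \<longlonglongrightarrow> ?h \<xi> * fourier_L1 f \<xi>"
    proof (rule AE_I2)
      fix \<xi>
      have "(\<lambda>k. g k \<xi>) \<longlonglongrightarrow> exp (- ((\<i> * of_real t) * (of_real (norm \<xi>))\<^sup>2)) * fourier_L1 f \<xi>"
        unfolding g_def z_def by (intro tendsto_intros reg_tendsto)
      moreover have "exp (- ((\<i> * of_real t) * (of_real (norm \<xi>))\<^sup>2)) = ?h \<xi>"
        by (simp add: cis_conv_exp mult.assoc)
      ultimately show "(\<lambda>k. g k \<xi>) \<longlonglongrightarrow> ?h \<xi> * fourier_L1 f \<xi>" by simp
    qed
  qed (use g g_le fourier_L1_sq_int[OF f] sq_int_bmult[OF bmeas_phase] in auto)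
  then have lim: "(\<lambda>k. FTinv (L2c (g k))) \<longlonglongrightarrow> schr t (L2c f)"
    unfolding schr_def FT_L2c[OF f] mul_L2c[OF bmeas_phase fourier_L1_sq_int(1)[OF f]]
    by (intro lipschitz_tendsto[OF linear_FTinv]) simp
  have "AE y in lborel. Fn (FTinv (L2c (g k))) y = fourier_L1 (g k) (- y)" for k
    unfolding FTinv_def FT_L2c[OF g(2,1)] reflect_L2c[OF fourier_L1_sq_int(1)[OF g(2,1)]]
    by (rule Fn_L2c) (intro sq_int_reflect fourier_L1_sq_int g)
  then have ae: "AE y in lborel. \<forall>k. Fn (FTinv (L2c (g k))) y = fourier_L1 (g k) (- y)"
    unfolding AE_all_countable by blast
  have pt: "(\<lambda>k. fourier_L1 (g k) (- y)) \<longlonglongrightarrow> free_kernel t f y" for y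
  proof -
    have "(\<lambda>k. LINT w|lborel. gk (z k) (y - w) * f w) \<longlonglongrightarrow> (LINT w|lborel. gk (\<i> * of_real t) (y - w) * f w)"
    proof (rule integral_dominated_convergence[where w="\<lambda>w. (pi / \<bar>t\<bar>) powr (real CARD('n) / 2) * norm (f w)"])
      show "AE w in lborel. (\<lambda>k. gk (z k) (y - w) * f w) \<longlonglongrightarrow> gk (\<i> * of_real t) (y - w) * f w"
        unfolding z_def by (intro AE_I2 tendsto_intros gk_reg_tendsto t)
      show "AE w in lborel. norm (gk (z k) (y - w) * f w) \<le> (pi / \<bar>t\<bar>) powr (real CARD('n) / 2) * norm (f w)" for k
        unfolding z_def norm_mult by (intro AE_I2 mult_right_mono reg_norm_bound t) auto
    qed (use f in auto)
    then show ?thesis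
      unfolding free_kernel_def g_def[abs_def] fourier_gauss[OF f(1) z] by (intro tendsto_intros)
  qed
  show ?thesis by (rule L2_limit_pointwise[OF lim]) (use ae in \<open>eventually_elim, use pt in simp\<close>)
qed

text \<open>The dispersive estimate in bilinear form and on the frequency side, which is the form in
  which slices at two different times are paired below.\<close>

lemma dispersive_pair:
  fixes f g :: "real^'n \<Rightarrow> complex"
  assumes f: "integrable lborel f" "sq_int f" and g: "integrable lborel g" "sq_int g" and t: "t \<noteq> 0"
  shows "norm (LINT \<xi>|lborel. cis (- (t * (norm \<xi>)\<^sup>2)) * fourier_L1 f \<xi> * cnj (fourier_L1 g \<xi>)) \<le>
    (fconst TYPE('n))\<^sup>2 * (pi / \<bar>t\<bar>) powr (real CARD('n) / 2) * (LINT x|lborel. norm (f x)) * (LINT x|lborel. norm (g x))"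
proof -
  have [measurable]: "f \<in> borel_measurable borel" "g \<in> borel_measurable borel" using f g by auto
  define z where "z k = complex_of_real (1 / real (Suc k)) + \<i> * of_real t" for k
  have z: "Re (z k) > 0" for k by (simp add: z_def del: of_nat_Suc)
  let ?B = "(pi / \<bar>t\<bar>) powr (real CARD('n) / 2)"
  let ?e = "\<lambda>k \<xi>. exp (- (z k * (of_real (norm \<xi>))\<^sup>2))"
  have P: "integrable lborel (\<lambda>\<xi>. fourier_L1 f \<xi> * cnj (fourier_L1 g \<xi>))"
    by (intro sq_int_cnj_integrable fourier_L1_sq_int f g)
  have lim: "(\<lambda>k. LINT \<xi>|lborel. ?e k \<xi> * fourier_L1 f \<xi> * cnj (fourier_L1 g \<xi>)) \<longlonglongrightarrow>
     (LINT \<xi>|lborel. cis (- (t * (norm \<xi>)\<^sup>2)) * fourier_L1 f \<xi> * cnj (fourier_L1 g \<xi>))"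
  proof (rule integral_dominated_convergence[where w="\<lambda>\<xi>. norm (fourier_L1 f \<xi> * cnj (fourier_L1 g \<xi>))"])
    show "AE \<xi> in lborel. (\<lambda>k. ?e k \<xi> * fourier_L1 f \<xi> * cnj (fourier_L1 g \<xi>)) \<longlonglongrightarrow>
       cis (- (t * (norm \<xi>)\<^sup>2)) * fourier_L1 f \<xi> * cnj (fourier_L1 g \<xi>)"
    proof (rule AE_I2)
      fix \<xi>
      have "(\<lambda>k. ?e k \<xi> * fourier_L1 f \<xi> * cnj (fourier_L1 g \<xi>)) \<longlonglongrightarrow>
         exp (- ((\<i> * of_real t) * (of_real (norm \<xi>))\<^sup>2)) * fourier_L1 f \<xi> * cnj (fourier_L1 g \<xi>)"
        unfolding z_def by (intro tendsto_intros reg_tendsto)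
      moreover have "exp (- ((\<i> * of_real t) * (of_real (norm \<xi>))\<^sup>2)) = cis (- (t * (norm \<xi>)\<^sup>2))"
        by (simp add: cis_conv_exp mult.assoc)
      ultimately show "(\<lambda>k. ?e k \<xi> * fourier_L1 f \<xi> * cnj (fourier_L1 g \<xi>)) \<longlonglongrightarrow>
         cis (- (t * (norm \<xi>)\<^sup>2)) * fourier_L1 f \<xi> * cnj (fourier_L1 g \<xi>)" by simp
    qed
    show "AE \<xi> in lborel. norm (?e k \<xi> * fourier_L1 f \<xi> * cnj (fourier_L1 g \<xi>)) \<le> norm (fourier_L1 f \<xi> * cnj (fourier_L1 g \<xi>))" for k
    proof (rule AE_I2)
      fix \<xi>
      have "norm (?e k \<xi> * fourier_L1 f \<xi>) \<le> norm (fourier_L1 f \<xi>)" by (rule sq_int_gauss_fourier(3)[OF f z])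
      then show "norm (?e k \<xi> * fourier_L1 f \<xi> * cnj (fourier_L1 g \<xi>)) \<le> norm (fourier_L1 f \<xi> * cnj (fourier_L1 g \<xi>))"
        unfolding norm_mult[of _ "cnj _"] by (rule mult_right_mono) simp
    qed
  qed (use P in auto)
  have "norm (LINT \<xi>|lborel. ?e k \<xi> * fourier_L1 f \<xi> * cnj (fourier_L1 g \<xi>)) \<le>
     (fconst TYPE('n))\<^sup>2 * ?B * (LINT x|lborel. norm (f x)) * (LINT x|lborel. norm (g x))" for k
  proof -
    have inner: "norm (LINT y|lborel. gk (z k) (x - y) * f y) \<le> ?B * (LINT y|lborel. norm (f y))" for x
    proof -
      have "norm (LINT y|lborel. gk (z k) (x - y) * f y) \<le> (LINT y|lborel. norm (gk (z k) (x - y) * f y))"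
        by (rule integral_norm_bound)
      also have "\<dots> \<le> (LINT y|lborel. ?B * norm (f y))"
      proof (rule integral_mono)
        show "integrable lborel (\<lambda>y. norm (gk (z k) (x - y) * f y))"
          unfolding z_def by (intro integrable_norm integrable_bounded_mult[OF f(1) _ reg_norm_bound] t) measurable
        show "norm (gk (z k) (x - y) * f y) \<le> ?B * norm (f y)" for y
          unfolding z_def norm_mult by (intro mult_right_mono reg_norm_bound t) auto
      qed (use f in auto)
      finally show ?thesis by simp
    qed
    have "norm (LINT x|lborel. cnj (g x) * (LINT y|lborel. gk (z k) (x - y) * f y)) \<le>
        (LINT x|lborel. norm (cnj (g x) * (LINT y|lborel. gk (z k) (x - y) * f y)))"
      by (rule integral_norm_bound)
    also have "\<dots> \<le> (LINT x|lborel. (?B * (LINT y|lborel. norm (f y))) * norm (g x))"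
    proof (rule integral_mono)
      have "integrable lborel (\<lambda>x. (LINT y|lborel. gk (z k) (x - y) * f y) * cnj (g x))"
        by (rule integrable_bounded_mult[OF _ _ inner]) (use g in auto)
      then show "integrable lborel (\<lambda>x. norm (cnj (g x) * (LINT y|lborel. gk (z k) (x - y) * f y)))"
        by (intro integrable_norm) (simp add: mult.commute)
      show "norm (cnj (g x) * (LINT y|lborel. gk (z k) (x - y) * f y)) \<le> (?B * (LINT y|lborel. norm (f y))) * norm (g x)" for x
        using mult_right_mono[OF inner[of x] norm_ge_zero[of "g x"]] by (simp add: norm_mult mult.commute)
    qed (use g in auto)
    finally have "norm (LINT x|lborel. cnj (g x) * (LINT y|lborel. gk (z k) (x - y) * f y)) \<le>
        (?B * (LINT y|lborel. norm (f y))) * (LINT x|lborel. norm (g x))" by simp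
    from mult_left_mono[OF this, of "(fconst TYPE('n))\<^sup>2"]
    show ?thesis unfolding fourier_gauss_pair[OF f(1) g(1) z]
      by (simp only: norm_mult norm_of_real abs_of_nonneg[OF zero_le_power2] zero_le_power2 mult.assoc simp_thms)
  qed
  then show ?thesis by (intro LIMSEQ_le_const2[OF tendsto_norm[OF lim]]) blast
qed
section \<open>Level sets\<close>

lemma powr_split_sq: "x > 0 \<Longrightarrow> x powr a = x powr (a - 2) * x\<^sup>2" for x a :: real
  by (simp add: powr_diff)

lemma nn_powr_layer:
  assumes "0 \<le> a" "0 < r"
  shows "(\<integral>\<^sup>+s. ennreal (r * s powr (r - 1)) * indicator {0..a} s \<partial>lborel) = ennreal (a powr r)"
proof -
  have "((\<lambda>s. s powr (r - 1)) has_integral (a powr (r - 1 + 1) / (r - 1 + 1))) {0..a}"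
    by (rule has_integral_powr_from_0) (use assms in auto)
  from has_integral_mult_right[OF this, of r]
  have "((\<lambda>s. r * s powr (r - 1)) has_integral (a powr r)) {0..a}" using assms by simp
  from nn_integral_has_integral_lebesgue[OF _ this] assms
  have "integral\<^sup>N lborel (\<lambda>s. ennreal (indicator {0..a} s * (r * s powr (r - 1)))) = ennreal (a powr r)" by simp
  also have "(\<lambda>s. ennreal (indicator {0..a} s * (r * s powr (r - 1)))) = (\<lambda>s. ennreal (r * s powr (r - 1)) * indicator {0..a} s)"
    by (auto simp: indicator_def)
  finally show ?thesis .
qed

text \<open>Stated for a general measure because it is applied both in space at a fixed time and in
  space-time.\<close>

lemma layer_cake:
  assumes M: "sigma_finite_measure M" and [measurable]: "v \<in> borel_measurable M"
    and v: "\<And>x. 0 \<le> v x" and r: "0 < r"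
  shows "(\<integral>\<^sup>+x. ennreal (v x powr r) \<partial>M) =
    (\<integral>\<^sup>+s. ennreal (r * s powr (r - 1)) * indicator {0..} s * emeasure M {x \<in> space M. s \<le> v x} \<partial>lborel)"
proof -
  interpret M: sigma_finite_measure M by (rule M)
  interpret pair_sigma_finite M "lborel :: real measure" ..
  define h where "h x s = ennreal (r * s powr (r - 1)) * (if 0 \<le> s \<and> s \<le> v x then 1 else 0)" for x s
  have [measurable]: "case_prod h \<in> borel_measurable (M \<Otimes>\<^sub>M lborel)"
    unfolding h_def by measurable
  have "(\<integral>\<^sup>+x. ennreal (v x powr r) \<partial>M) = (\<integral>\<^sup>+x. \<integral>\<^sup>+s. h x s \<partial>lborel \<partial>M)"
    unfolding nn_powr_layer[OF v r, symmetric] h_def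
    by (intro nn_integral_cong) (auto simp: indicator_def)
  also have "\<dots> = (\<integral>\<^sup>+s. \<integral>\<^sup>+x. h x s \<partial>M \<partial>lborel)"
    by (rule Fubini'[symmetric]) measurable
  also have "\<dots> = (\<integral>\<^sup>+s. ennreal (r * s powr (r - 1)) * indicator {0..} s * emeasure M {x \<in> space M. s \<le> v x} \<partial>lborel)"
  proof (rule nn_integral_cong)
    fix s :: real
    have "(\<integral>\<^sup>+x. h x s \<partial>M) = (\<integral>\<^sup>+x. (ennreal (r * s powr (r - 1)) * indicator {0..} s) * indicator {x \<in> space M. s \<le> v x} x \<partial>M)"
      unfolding h_def by (intro nn_integral_cong) (auto simp: indicator_def)
    also have "\<dots> = ennreal (r * s powr (r - 1)) * indicator {0..} s * emeasure M {x \<in> space M. s \<le> v x}"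
      by (subst nn_integral_cmult) auto
    finally show "(\<integral>\<^sup>+x. h x s \<partial>M) = ennreal (r * s powr (r - 1)) * indicator {0..} s * emeasure M {x \<in> space M. s \<le> v x}" .
  qed
  finally show ?thesis .
qed

lemma chebyshev_sq:
  assumes [measurable]: "g \<in> borel_measurable M" and a: "a > 0"
  shows "emeasure M {x \<in> space M. a \<le> norm (g x)} \<le> ennreal (1 / a\<^sup>2) * (\<integral>\<^sup>+x. ennreal ((norm (g x))\<^sup>2) \<partial>M)"
proof -
  have "emeasure M {x \<in> space M. a \<le> norm (g x)} = (\<integral>\<^sup>+x. indicator {x \<in> space M. a \<le> norm (g x)} x \<partial>M)"
    by simp
  also have "\<dots> \<le> (\<integral>\<^sup>+x. ennreal (1 / a\<^sup>2) * ennreal ((norm (g x))\<^sup>2) \<partial>M)"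
  proof (rule nn_integral_mono)
    fix x
    have "1 \<le> 1 / a\<^sup>2 * (norm (g x))\<^sup>2" if "a \<le> norm (g x)"
      using power_mono[OF that, of 2] a by (simp add: field_simps)
    then have "1 \<le> ennreal (1 / a\<^sup>2 * (norm (g x))\<^sup>2)" if "a \<le> norm (g x)"
      using that by (metis ennreal_1 ennreal_leI)
    then show "indicator {x \<in> space M. a \<le> norm (g x)} x \<le> ennreal (1 / a\<^sup>2) * ennreal ((norm (g x))\<^sup>2)"
      by (auto simp: indicator_def ennreal_mult[symmetric])
  qed
  also have "\<dots> = ennreal (1 / a\<^sup>2) * (\<integral>\<^sup>+x. ennreal ((norm (g x))\<^sup>2) \<partial>M)"
    by (rule nn_integral_cmult) measurable
  finally show ?thesis .
qed

lemma integral_abs_prod_le: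
  assumes "sq_int f" "sq_int g"
  shows "(LINT x|lborel. norm (f x) * norm (g x)) \<le> norm (L2c f) * norm (L2c g)"
proof -
  have [measurable]: "f \<in> borel_measurable borel" "g \<in> borel_measurable borel" using assms by auto
  let ?f = "\<lambda>x. complex_of_real (norm (f x))" and ?g = "\<lambda>x. complex_of_real (norm (g x))"
  have s: "sq_int ?f" "sq_int ?g"
    by (rule sq_int_dominated[OF assms(1), where C=1]; simp) (rule sq_int_dominated[OF assms(2), where C=1]; simp)
  have "(LINT x|lborel. norm (f x) * norm (g x)) = inner (L2c ?f) (L2c ?g)"
    by (simp add: inner_L2c s)
  also have "\<dots> \<le> norm (L2c ?f) * norm (L2c ?g)" by (rule norm_cauchy_schwarz)
  also have "norm (L2c ?f) = norm (L2c f)"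
    by (rule power2_eq_imp_eq) (simp_all add: norm_L2c_sq s assms)
  also have "norm (L2c ?g) = norm (L2c g)"
    by (rule power2_eq_imp_eq) (simp_all add: norm_L2c_sq s assms)
  finally show ?thesis .
qed

section \<open>Pointwise in time estimates\<close>

definition disp_const :: "'n::finite itself \<Rightarrow> real" where
  "disp_const _ = (fconst TYPE('n))\<^sup>2 * pi powr (real CARD('n) / 2)"

lemma disp_const_pos: "disp_const TYPE('n::finite) > 0"
  unfolding disp_const_def by (intro mult_pos_pos zero_less_power fconst_pos) simp

lemma disp_const_eq:
  assumes "t > 0"
  shows "(fconst TYPE('n::finite))\<^sup>2 * (pi / t) powr (real CARD('n) / 2) = disp_const TYPE('n) * t powr (- (real CARD('n) / 2))"
  using assms by (simp add: disp_const_def powr_divide powr_minus_divide)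

text \<open>Expanding \<open>|x - y|\<^sup>2\<close> separates a unimodular factor in
  \<open>x\<close>, lost in the modulus, from a Fourier integral at frequency
  \<open>x / (2t)\<close>. The point \<open>x\<close> thus enters only through a modulation and the
  time only through the quadratic phase and the prefactor.\<close>

lemma free_kernel_norm:
  fixes f :: "real^'n \<Rightarrow> complex"
  assumes t: "t > 0"
  shows "norm (free_kernel t f x) = disp_const TYPE('n) * t powr (- (real CARD('n) / 2)) *
    norm (LINT y|lborel. cis (- (((1 / (2 * t)) *\<^sub>R x) \<bullet> y)) * (cis (1 / (4 * t) * (norm y)\<^sup>2) * f y))"
proof -
  let ?s = "csqrt (of_real pi / (\<i> * of_real t)) ^ CARD('n)"
  have gk: "gk (\<i> * of_real t) (x - y) = (?s * cis ((norm x)\<^sup>2 / (4 * t))) *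
      (cis (- (((1 / (2 * t)) *\<^sub>R x) \<bullet> y)) * cis (1 / (4 * t) * (norm y)\<^sup>2))" for y
  proof -
    have "- (complex_of_real (norm (x - y)))\<^sup>2 / (4 * (\<i> * of_real t)) = \<i> * of_real ((norm (x - y))\<^sup>2 / (4 * t))"
      using t by (simp add: field_simps)
    moreover have "(norm (x - y))\<^sup>2 / (4 * t) = (norm x)\<^sup>2 / (4 * t) + (- (((1 / (2 * t)) *\<^sub>R x) \<bullet> y) + 1 / (4 * t) * (norm y)\<^sup>2)"
      using t by (simp add: power2_norm_eq_inner inner_diff_left inner_diff_right inner_commute field_simps)
    ultimately have "exp (- (complex_of_real (norm (x - y)))\<^sup>2 / (4 * (\<i> * of_real t))) =
       cis ((norm x)\<^sup>2 / (4 * t)) * (cis (- (((1 / (2 * t)) *\<^sub>R x) \<bullet> y)) * cis (1 / (4 * t) * (norm y)\<^sup>2))"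
      by (simp only: cis_conv_exp[symmetric] cis_mult)
    then show ?thesis unfolding gk_def by (simp only: mult.assoc)
  qed
  have "(LINT y|lborel. gk (\<i> * of_real t) (x - y) * f y) = (?s * cis ((norm x)\<^sup>2 / (4 * t))) *
     (LINT y|lborel. cis (- (((1 / (2 * t)) *\<^sub>R x) \<bullet> y)) * (cis (1 / (4 * t) * (norm y)\<^sup>2) * f y))"
    unfolding gk by (simp only: mult.assoc integral_mult_right_zero)
  moreover have "norm (?s * cis ((norm x)\<^sup>2 / (4 * t))) = (pi / t) powr (real CARD('n) / 2)"
    using t by (simp add: norm_mult norm_power norm_csqrt norm_divide powr_half_sqrt[symmetric] powr_powr flip: powr_realpow)
  ultimately have "norm (LINT y|lborel. gk (\<i> * of_real t) (x - y) * f y) = (pi / t) powr (real CARD('n) / 2) *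
    norm (LINT y|lborel. cis (- (((1 / (2 * t)) *\<^sub>R x) \<bullet> y)) * (cis (1 / (4 * t) * (norm y)\<^sup>2) * f y))"
    by (simp only: norm_mult)
  then show ?thesis
    unfolding free_kernel_def disp_const_eq[OF t, symmetric]
    by (simp only: norm_mult norm_of_real abs_of_nonneg[OF zero_le_power2] mult.assoc)
qed

lemma free_kernel_L1_bound:
  fixes f :: "real^'n \<Rightarrow> complex"
  assumes t: "t > 0"
  shows "norm (free_kernel t f x) \<le> disp_const TYPE('n) * t powr (- (real CARD('n) / 2)) * (LINT y|lborel. norm (f y))"
proof -
  have "norm (LINT y|lborel. cis (- (((1 / (2 * t)) *\<^sub>R x) \<bullet> y)) * (cis (1 / (4 * t) * (norm y)\<^sup>2) * f y)) \<le> (LINT y|lborel. norm (f y))"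
    using integral_norm_bound[of lborel "\<lambda>y. cis (- (((1 / (2 * t)) *\<^sub>R x) \<bullet> y)) * (cis (1 / (4 * t) * (norm y)\<^sup>2) * f y)"]
    by (simp add: norm_mult)
  then show ?thesis unfolding free_kernel_norm[OF t] using disp_const_pos[where 'n='n]
    by (intro mult_left_mono) (auto simp: less_imp_le)
qed

lemma trunc_L1_bound:
  fixes f :: "'a::euclidean_space \<Rightarrow> complex"
  assumes f: "sq_int f" and R: "R \<ge> 0"
  shows "(LINT x|lborel. norm (trunc R f x)) \<le> sqrt (unit_ball_vol (real DIM('a)) * R ^ DIM('a)) * norm (L2c f)"
proof -
  let ?i = "indicator (cball (0::'a) R) :: 'a \<Rightarrow> complex"
  have i: "sq_int ?i" by (rule sq_int_indicator)
  have "(LINT x|lborel. norm (trunc R f x)) = (LINT x|lborel. norm (?i x) * norm (f x))"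
    by (simp add: trunc_def norm_mult)
  also have "\<dots> \<le> norm (L2c ?i) * norm (L2c f)" by (rule integral_abs_prod_le[OF i f])
  also have "norm (L2c ?i) = sqrt (unit_ball_vol (real DIM('a)) * R ^ DIM('a))"
  proof -
    have "ennreal ((norm (L2c ?i))\<^sup>2) = (\<integral>\<^sup>+x. indicator (cball (0::'a) R) x \<partial>lborel)"
      unfolding nn_norm_L2c[OF i, symmetric] by (intro nn_integral_cong) (auto simp: indicator_def)
    also have "\<dots> = ennreal (unit_ball_vol (real DIM('a)) * R ^ DIM('a))"
      using R by (simp add: emeasure_cball)
    finally have "(norm (L2c ?i))\<^sup>2 = unit_ball_vol (real DIM('a)) * R ^ DIM('a)"
      using R by (subst (asm) ennreal_inj) (auto intro!: mult_nonneg_nonneg)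
    then show ?thesis by (simp add: real_sqrt_unique)
  qed
  finally show ?thesis .
qed

lemma trunc_compl:
  assumes f: "sq_int f"
  shows "sq_int (\<lambda>x. f x - trunc R f x)" "L2c f = L2c (trunc R f) + L2c (\<lambda>x. f x - trunc R f x)"
    "(norm (f x - trunc R f x))\<^sup>2 = (if R < norm x then (norm (f x))\<^sup>2 else 0)"
  by (simp_all add: f sq_int_diff sq_int_trunc L2c_diff) (auto simp: trunc_def indicator_def)

lemma schr_add_AE:
  "AE x in lborel. Fn (schr t (u + v)) x = Fn (schr t u) x + Fn (schr t v) x"
  unfolding linear_add[OF linear_schr] by (rule Fn_plus)

text \<open>The 4 comes from Chebyshev's inequality at level \<open>s / 2\<close>, the factor
  \<open>r / (r - 2)\<close> from integrating a power of the level, and the last power from the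
  cutting radius.\<close>

definition high_const :: "'n::finite itself \<Rightarrow> real \<Rightarrow> real" where
  "high_const _ r = 4 * r / (r - 2) * (2 * disp_const TYPE('n) * sqrt (unit_ball_vol (real CARD('n)))) powr (r - 2)"

text \<open>Interpolation in the manner of Marcinkiewicz: at level \<open>s\<close> the datum is cut at the radius
  for which the \<open>L\<^sup>1\<close> dispersive bound of the inner part is at most \<open>s / 2\<close>.\<close>
lemma schr_high:
  fixes f :: "real^'n \<Rightarrow> complex"
  assumes r: "r > 2" and f: "sq_int f" and A: "norm (L2c f) \<le> A" "A > 0" and t: "t > 0"
  shows "(\<integral>\<^sup>+x. ennreal (norm (Fn (schr t (L2c f)) x) powr r) \<partial>lborel) \<le>
    ennreal (high_const TYPE('n) r * A powr (r - 2) * t powr (- (real CARD('n) * (r - 2) / 2))) *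
    (\<integral>\<^sup>+x. ennreal (norm x powr (real CARD('n) * (r - 2) / 2) * (norm (f x))\<^sup>2) \<partial>lborel)"
proof -
  let ?N = "real CARD('n)" and ?w = "sqrt (unit_ball_vol (real CARD('n)))" and ?D = "disp_const TYPE('n)"
  let ?u = "Fn (schr t (L2c f))"
  have [measurable]: "f \<in> borel_measurable borel" using f by auto
  have w: "?w > 0" by simp
  \<comment> \<open>The \<open>L\<^sup>1\<close> norm on a ball of radius \<open>R\<close> costs the
    root of its volume, a multiple of \<open>R powr (N / 2)\<close>. With \<open>R s\<close> the
    solution of \<open>R powr (N / 2) = s / Q\<close>, this \<open>Q\<close> makes the dispersive
    bound of the inner part exactly \<open>s / 2\<close>.\<close>
  define Q where "Q = 2 * ?D * ?w * A * t powr (- (?N / 2))"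
  have Q: "Q > 0" unfolding Q_def using w disp_const_pos[where 'n='n] A t by simp
  define R where "R s = (s / Q) powr (2 / ?N)" for s
  have [measurable]: "R \<in> borel_measurable borel" unfolding R_def by measurable
  have N: "?N > 0" by simp
  define g where "g s = (\<integral>\<^sup>+x. ennreal (if R s < norm x then (norm (f x))\<^sup>2 else 0) \<partial>lborel)" for s
  have level: "emeasure lborel {x. s \<le> norm (?u x)} \<le> ennreal (4 / s\<^sup>2) * g s" if s: "s > 0" for s
  proof -
    let ?f1 = "trunc (R s) f" and ?f2 = "\<lambda>x. f x - trunc (R s) f x"
    have R0: "0 \<le> R s" by (simp add: R_def)
    have "R s ^ CARD('n) = (s / Q)\<^sup>2"
    proof -
      have "R s ^ CARD('n) = R s powr ?N" using s Q by (intro powr_realpow[symmetric]) (simp add: R_def)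
      also have "\<dots> = (s / Q) powr 2" by (simp add: R_def powr_powr)
      also have "\<dots> = (s / Q)\<^sup>2" using s Q by simp
      finally show ?thesis .
    qed
    then have sq: "sqrt (unit_ball_vol ?N * R s ^ CARD('n)) = ?w * (s / Q)"
      using s Q by (simp add: real_sqrt_mult)
    have b1: "norm (free_kernel t ?f1 x) \<le> s / 2" for x
    proof -
      have "norm (free_kernel t ?f1 x) \<le> ?D * t powr (- (?N / 2)) * (LINT y|lborel. norm (?f1 y))"
        by (rule free_kernel_L1_bound[OF t])
      also have "\<dots> \<le> ?D * t powr (- (?N / 2)) * (?w * (s / Q) * A)"
      proof (rule mult_left_mono)
        have "(LINT y|lborel. norm (?f1 y)) \<le> ?w * (s / Q) * norm (L2c f)"
          using trunc_L1_bound[OF f R0] by (simp add: sq)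
        also have "\<dots> \<le> ?w * (s / Q) * A" using A s Q w by (intro mult_left_mono) auto
        finally show "(LINT y|lborel. norm (?f1 y)) \<le> ?w * (s / Q) * A" .
      qed (use disp_const_pos[where 'n='n] in simp)
      also have "\<dots> = Q * (s / Q) / 2" by (simp add: Q_def)
      also have "\<dots> = s / 2" using Q by simp
      finally show ?thesis .
    qed
    have t0: "t \<noteq> 0" using t by simp
    \<comment> \<open>The inner part contributes at most \<open>s / 2\<close>, so on the level set
      the outer part is at least \<open>s / 2\<close>.\<close>
    have "AE x in lborel. x \<in> {x. s \<le> norm (?u x)} \<longrightarrow> x \<in> {x \<in> space lborel. s / 2 \<le> norm (Fn (schr t (L2c ?f2)) x)}"
      using schr_add_AE[of t "L2c ?f1" "L2c ?f2"] schr_kernel[OF integrable_trunc[OF f] sq_int_trunc[OF f] t0, of "R s"]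
      unfolding trunc_compl(2)[OF f, of "R s", symmetric]
    proof eventually_elim
      case (elim x)
      have "norm (?u x) \<le> s / 2 + norm (Fn (schr t (L2c ?f2)) x)"
        using norm_triangle_ineq[of "Fn (schr t (L2c ?f1)) x" "Fn (schr t (L2c ?f2)) x"] b1[of x] elim by simp
      then show ?case by auto
    qed
    then have "emeasure lborel {x. s \<le> norm (?u x)} \<le> emeasure lborel {x \<in> space lborel. s / 2 \<le> norm (Fn (schr t (L2c ?f2)) x)}"
      by (rule emeasure_mono_AE) measurable
    also have "\<dots> \<le> ennreal (1 / (s / 2)\<^sup>2) * (\<integral>\<^sup>+x. ennreal ((norm (Fn (schr t (L2c ?f2)) x))\<^sup>2) \<partial>lborel)"
      by (rule chebyshev_sq) (use s in auto)
    also have "(\<integral>\<^sup>+x. ennreal ((norm (Fn (schr t (L2c ?f2)) x))\<^sup>2) \<partial>lborel) = g s"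
      unfolding nn_norm_l2 norm_schr nn_norm_L2c[OF trunc_compl(1)[OF f], symmetric] g_def trunc_compl(3)[OF f] ..
    finally show ?thesis by (simp add: power_divide)
  qed
  have "(\<integral>\<^sup>+x. ennreal (norm (?u x) powr r) \<partial>lborel) =
     (\<integral>\<^sup>+s. ennreal (r * s powr (r - 1)) * indicator {0..} s * emeasure lborel {x \<in> space lborel. s \<le> norm (?u x)} \<partial>lborel)"
    by (rule layer_cake[OF sigma_finite_lborel]) (use r in auto)
  also have "\<dots> \<le> (\<integral>\<^sup>+s. ennreal (4 * r * s powr (r - 3)) * indicator {0<..} s * g s \<partial>lborel)"
  proof (rule nn_integral_mono)
    fix s :: real
    show "ennreal (r * s powr (r - 1)) * indicator {0..} s * emeasure lborel {x \<in> space lborel. s \<le> norm (?u x)}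
      \<le> ennreal (4 * r * s powr (r - 3)) * indicator {0<..} s * g s"
    proof (cases "s > 0")
      case True
      have p: "s powr (r - 1) = s powr (r - 3) * s\<^sup>2"
        using powr_split_sq[OF True, of "r - 1"] by simp
      have "ennreal (r * s powr (r - 1)) * emeasure lborel {x. s \<le> norm (?u x)} \<le> ennreal (r * s powr (r - 1)) * (ennreal (4 / s\<^sup>2) * g s)"
        by (intro mult_left_mono level True) auto
      also have "\<dots> = ennreal (4 * r * s powr (r - 3)) * g s"
        unfolding mult.assoc[symmetric] using True r by (subst ennreal_mult[symmetric]) (auto simp: p mult_ac)
      finally show ?thesis using True by simp
    qed (cases "s = 0"; simp)
  qed
  also have "\<dots> = (\<integral>\<^sup>+s. \<integral>\<^sup>+x. ennreal (4 * r * s powr (r - 3)) * indicator {0<..} s * ennreal (if R s < norm x then (norm (f x))\<^sup>2 else 0) \<partial>lborel \<partial>lborel)"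
    unfolding g_def by (subst nn_integral_cmult) auto
  \<comment> \<open>The level integral is now done first, at fixed \<open>x\<close>: it extends over
    the levels whose cutting radius is below \<open>norm x\<close> and produces the power
    weight.\<close>
  also have "\<dots> = (\<integral>\<^sup>+x. \<integral>\<^sup>+s. ennreal (4 * r * s powr (r - 3)) * indicator {0<..} s * ennreal (if R s < norm x then (norm (f x))\<^sup>2 else 0) \<partial>lborel \<partial>lborel)"
    by (rule lborel_pair.Fubini') measurable
  also have "\<dots> \<le> (\<integral>\<^sup>+x. ennreal (high_const TYPE('n) r * A powr (r - 2) * t powr (- (?N * (r - 2) / 2))) *
      ennreal (norm x powr (?N * (r - 2) / 2) * (norm (f x))\<^sup>2) \<partial>lborel)"
  proof (rule nn_integral_mono)
    fix x :: "real^'n"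
    \<comment> \<open>The level whose cutting radius is \<open>norm x\<close>.\<close>
    define a where "a = Q * norm x powr (?N / 2)"
    have a: "a \<ge> 0" using Q by (simp add: a_def)
    have "(\<integral>\<^sup>+s. ennreal (4 * r * s powr (r - 3)) * indicator {0<..} s * ennreal (if R s < norm x then (norm (f x))\<^sup>2 else 0) \<partial>lborel)
      \<le> (\<integral>\<^sup>+s. ennreal (4 * r / (r - 2) * (norm (f x))\<^sup>2) * (ennreal ((r - 2) * s powr (r - 2 - 1)) * indicator {0..a} s) \<partial>lborel)"
    proof (rule nn_integral_mono)
      fix s :: real
      show "ennreal (4 * r * s powr (r - 3)) * indicator {0<..} s * ennreal (if R s < norm x then (norm (f x))\<^sup>2 else 0)
        \<le> ennreal (4 * r / (r - 2) * (norm (f x))\<^sup>2) * (ennreal ((r - 2) * s powr (r - 2 - 1)) * indicator {0..a} s)"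
      proof (cases "s > 0 \<and> R s < norm x")
        case True
        then have "(R s) powr (?N / 2) \<le> norm x powr (?N / 2)" by (intro powr_mono2) (auto simp: R_def)
        then have "s / Q \<le> norm x powr (?N / 2)" using True Q by (simp add: R_def powr_powr)
        then have "s \<le> a" using Q by (simp add: a_def divide_le_eq mult.commute)
        have canc: "4 * r / q * F * (q * S) = 4 * r * S * F" if "q \<noteq> 0" for q S F :: real using that by simp
        have "4 * r / (r - 2) * (norm (f x))\<^sup>2 * ((r - 2) * s powr (r - 2 - 1)) = 4 * r * s powr (r - 3) * (norm (f x))\<^sup>2"
          using r by (subst canc) (auto simp: diff_diff_eq)
        then have "ennreal (4 * r / (r - 2) * (norm (f x))\<^sup>2) * ennreal ((r - 2) * s powr (r - 2 - 1)) =
            ennreal (4 * r * s powr (r - 3)) * ennreal ((norm (f x))\<^sup>2)"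
          using r by (subst (1 2) ennreal_mult[symmetric]) auto
        then show ?thesis using True \<open>s \<le> a\<close> by simp
      next
        case False
        then show ?thesis by (auto simp: indicator_def)
      qed
    qed
    also have "\<dots> = ennreal (4 * r / (r - 2) * (norm (f x))\<^sup>2) * ennreal (a powr (r - 2))"
    proof -
      have L: "(\<integral>\<^sup>+s. ennreal ((r - 2) * s powr (r - 2 - 1)) * indicator {0..a} s \<partial>lborel) = ennreal (a powr (r - 2))"
        by (rule nn_powr_layer) (use a r in auto)
      show ?thesis by (subst nn_integral_cmult, measurable) (simp only: L)
    qed
    also have "\<dots> = ennreal (high_const TYPE('n) r * A powr (r - 2) * t powr (- (?N * (r - 2) / 2))) *
      ennreal (norm x powr (?N * (r - 2) / 2) * (norm (f x))\<^sup>2)"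
    proof -
      have "a powr (r - 2) = (2 * ?D * ?w) powr (r - 2) * A powr (r - 2) * t powr (- (?N * (r - 2) / 2)) * norm x powr (?N * (r - 2) / 2)"
        unfolding a_def Q_def using disp_const_pos[where 'n='n] w A
        by (simp add: powr_mult powr_powr mult.commute)
      then show ?thesis using r disp_const_pos[where 'n='n] w A
        by (subst (1 2) ennreal_mult[symmetric]) (auto simp: high_const_def mult_ac)
    qed
    finally show "(\<integral>\<^sup>+s. ennreal (4 * r * s powr (r - 3)) * indicator {0<..} s * ennreal (if R s < norm x then (norm (f x))\<^sup>2 else 0) \<partial>lborel)
      \<le> ennreal (high_const TYPE('n) r * A powr (r - 2) * t powr (- (?N * (r - 2) / 2))) *
      ennreal (norm x powr (?N * (r - 2) / 2) * (norm (f x))\<^sup>2)" .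
  qed
  also have "\<dots> = ennreal (high_const TYPE('n) r * A powr (r - 2) * t powr (- (?N * (r - 2) / 2))) *
    (\<integral>\<^sup>+x. ennreal (norm x powr (?N * (r - 2) / 2) * (norm (f x))\<^sup>2) \<partial>lborel)"
    by (rule nn_integral_cmult) measurable
  finally show ?thesis .
qed

text \<open>Interpolation between the sup norm and the conserved \<open>L\<^sup>2\<close> norm:
  \<open>r - 2\<close> powers are estimated pointwise by \<open>\<eta>\<close>, the other two are
  integrated.\<close>

lemma schr_low:
  fixes f :: "real^'n \<Rightarrow> complex"
  assumes r: "r > 2" and f: "integrable lborel f" "sq_int f" and A: "norm (L2c f) \<le> A" and t: "t > 0"
    and \<eta>: "\<And>\<xi>. norm (LINT y|lborel. cis (- (\<xi> \<bullet> y)) * (cis (1 / (4 * t) * (norm y)\<^sup>2) * f y)) \<le> \<eta>"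
  shows "(\<integral>\<^sup>+x. ennreal (norm (Fn (schr t (L2c f)) x) powr r) \<partial>lborel) \<le>
    ennreal ((disp_const TYPE('n) * \<eta>) powr (r - 2) * t powr (- (real CARD('n) * (r - 2) / 2)) * A\<^sup>2)"
proof -
  let ?N = "real CARD('n)" and ?D = "disp_const TYPE('n)" and ?u = "Fn (schr t (L2c f))"
  have \<eta>0: "\<eta> \<ge> 0" using \<eta>[of 0] norm_ge_zero order_trans by blast
  define b where "b = (?D * \<eta>) powr (r - 2) * t powr (- (?N * (r - 2) / 2))"
  have b0: "0 \<le> b" by (simp add: b_def)
  have t0: "t \<noteq> 0" using t by simp
  have "(\<integral>\<^sup>+x. ennreal (norm (?u x) powr r) \<partial>lborel) \<le> (\<integral>\<^sup>+x. ennreal b * ennreal ((norm (?u x))\<^sup>2) \<partial>lborel)"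
  proof (rule nn_integral_mono_AE, use schr_kernel[OF f t0] in eventually_elim)
    case (elim x)
    have "norm (?u x) \<le> ?D * t powr (- (?N / 2)) * \<eta>"
      unfolding elim free_kernel_norm[OF t] using disp_const_pos[where 'n='n] by (intro mult_left_mono \<eta>) auto
    then have "norm (?u x) powr (r - 2) \<le> (?D * t powr (- (?N / 2)) * \<eta>) powr (r - 2)"
      using r by (intro powr_mono2) auto
    also have "\<dots> = b"
      unfolding b_def using disp_const_pos[where 'n='n] \<eta>0 by (simp add: powr_mult powr_powr mult_ac)
    finally have "norm (?u x) powr (r - 2) * (norm (?u x))\<^sup>2 \<le> b * (norm (?u x))\<^sup>2" by (intro mult_right_mono) auto
    moreover have "norm (?u x) powr r = norm (?u x) powr (r - 2) * (norm (?u x))\<^sup>2"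
      using powr_split_sq[of "norm (?u x)" r] by (cases "norm (?u x) = 0") auto
    ultimately show ?case using b0 by (simp add: ennreal_mult[symmetric] ennreal_leI)
  qed
  also have "\<dots> = ennreal b * ennreal ((norm (L2c f))\<^sup>2)"
    by (subst nn_integral_cmult) (auto simp: nn_norm_l2)
  also have "\<dots> \<le> ennreal b * ennreal (A\<^sup>2)"
    using A by (intro mult_left_mono ennreal_leI power_mono) auto
  finally show ?thesis using b0 by (simp add: b_def ennreal_mult[symmetric])
qed

lemma norm_add_powr_le:
  fixes a b :: "'a::real_normed_vector"
  assumes "r > 0" shows "norm (a + b) powr r \<le> 2 powr r * (norm a powr r + norm b powr r)"
proof -
  have "norm (a + b) \<le> 2 * max (norm a) (norm b)" using norm_triangle_ineq[of a b] by simp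
  then have "norm (a + b) powr r \<le> (2 * max (norm a) (norm b)) powr r" using assms by (intro powr_mono2) auto
  also have "\<dots> = 2 powr r * max (norm a) (norm b) powr r" by (simp add: powr_mult)
  also have "\<dots> \<le> 2 powr r * (norm a powr r + norm b powr r)" by (intro mult_left_mono) (auto simp: max_def)
  finally show ?thesis .
qed

text \<open>The truncated datum is treated by \<open>schr_low\<close>, its complement by
  \<open>schr_high\<close>. Both give the same power of \<open>t\<close>, so smallness rests only on
  \<open>\<eta>\<close> and on a negative power of \<open>R\<close> when the weight exponent is
  below 2.\<close>

lemma schr_away_from_zero:
  fixes f :: "real^'n \<Rightarrow> complex"
  assumes r: "r > 2" "real CARD('n) * (r - 2) / 2 \<le> 2" and f: "sq_int f"
    and A: "norm (L2c f) \<le> A" "A > 0" and xf: "(\<integral>\<^sup>+x. ennreal ((norm x)\<^sup>2 * (norm (f x))\<^sup>2) \<partial>lborel) \<le> ennreal (A\<^sup>2)"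
    and t: "t > 0" and R: "R > 0"
    and \<eta>: "\<And>\<xi>. norm (LINT y|lborel. cis (- (\<xi> \<bullet> y)) * (cis (1 / (4 * t) * (norm y)\<^sup>2) * trunc R f y)) \<le> \<eta>"
  shows "(\<integral>\<^sup>+x. ennreal (norm (Fn (schr t (L2c f)) x) powr r) \<partial>lborel) \<le>
    ennreal (2 powr r * ((disp_const TYPE('n) * \<eta>) powr (r - 2) * A\<^sup>2 +
      high_const TYPE('n) r * A powr r * R powr (real CARD('n) * (r - 2) / 2 - 2)) * t powr (- (real CARD('n) * (r - 2) / 2)))"
proof -
  let ?\<sigma> = "real CARD('n) * (r - 2) / 2"
  let ?f1 = "trunc R f" and ?f2 = "\<lambda>x. f x - trunc R f x"
  let ?u1 = "Fn (schr t (L2c ?f1))" and ?u2 = "Fn (schr t (L2c ?f2))"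
  have [measurable]: "f \<in> borel_measurable borel" using f by auto
  have hc: "high_const TYPE('n) r \<ge> 0" using r by (simp add: high_const_def)
  have le1: "norm (L2c ?f1) \<le> norm (L2c f)" and le2: "norm (L2c ?f2) \<le> norm (L2c f)"
  proof -
    have "ennreal ((norm (L2c ?f1))\<^sup>2) \<le> ennreal ((norm (L2c f))\<^sup>2)"
      unfolding nn_norm_L2c[OF f, symmetric] nn_norm_L2c[OF sq_int_trunc[OF f], symmetric]
      by (intro nn_integral_mono) (auto simp: trunc_def indicator_def)
    then show "norm (L2c ?f1) \<le> norm (L2c f)" by (simp add: ennreal_le_iff power_mono_iff)
    have "ennreal ((norm (L2c ?f2))\<^sup>2) \<le> ennreal ((norm (L2c f))\<^sup>2)"
      unfolding nn_norm_L2c[OF f, symmetric] nn_norm_L2c[OF trunc_compl(1)[OF f], symmetric]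
      by (intro nn_integral_mono) (auto simp: trunc_def indicator_def)
    then show "norm (L2c ?f2) \<le> norm (L2c f)" by (simp add: ennreal_le_iff power_mono_iff)
  qed
  have 1: "(\<integral>\<^sup>+x. ennreal (norm (?u1 x) powr r) \<partial>lborel) \<le>
    ennreal ((disp_const TYPE('n) * \<eta>) powr (r - 2) * t powr (- ?\<sigma>) * A\<^sup>2)"
    using le1 A by (intro schr_low r integrable_trunc sq_int_trunc f t \<eta>) auto
  have "(\<integral>\<^sup>+x. ennreal (norm (?u2 x) powr r) \<partial>lborel) \<le> ennreal (high_const TYPE('n) r * A powr (r - 2) * t powr (- ?\<sigma>)) *
    (\<integral>\<^sup>+x. ennreal (norm x powr ?\<sigma> * (norm (?f2 x))\<^sup>2) \<partial>lborel)"
    using le2 A by (intro schr_high r t trunc_compl f) auto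
  also have "\<dots> \<le> ennreal (high_const TYPE('n) r * A powr (r - 2) * t powr (- ?\<sigma>)) * ennreal (R powr (?\<sigma> - 2) * A\<^sup>2)"
  proof (rule mult_left_mono)
    have "(\<integral>\<^sup>+x. ennreal (norm x powr ?\<sigma> * (norm (?f2 x))\<^sup>2) \<partial>lborel) \<le>
        (\<integral>\<^sup>+x. ennreal (R powr (?\<sigma> - 2)) * ennreal ((norm x)\<^sup>2 * (norm (f x))\<^sup>2) \<partial>lborel)"
    proof (rule nn_integral_mono)
      fix x
      show "ennreal (norm x powr ?\<sigma> * (norm (?f2 x))\<^sup>2) \<le> ennreal (R powr (?\<sigma> - 2)) * ennreal ((norm x)\<^sup>2 * (norm (f x))\<^sup>2)"
      proof (cases "R < norm x")
        case True
        \<comment> \<open>Outside the ball the weight of exponent at most 2 is traded for the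
          available second moment, at the gain of a nonpositive power of \<open>R\<close>.\<close>
        have "norm x powr (?\<sigma> - 2) \<le> R powr (?\<sigma> - 2)" using True R r by (intro powr_mono2') auto
        moreover have "norm x powr ?\<sigma> = norm x powr (?\<sigma> - 2) * (norm x)\<^sup>2"
          using True R by (intro powr_split_sq) auto
        ultimately have "norm x powr ?\<sigma> * (norm (f x))\<^sup>2 \<le> R powr (?\<sigma> - 2) * ((norm x)\<^sup>2 * (norm (f x))\<^sup>2)"
          unfolding mult.assoc[symmetric] by (simp add: mult_right_mono)
        then show ?thesis using True unfolding trunc_compl(3)[OF f] by (simp add: ennreal_mult[symmetric] ennreal_leI)
      qed (simp add: trunc_compl(3)[OF f])
    qed
    also have "\<dots> = ennreal (R powr (?\<sigma> - 2)) * (\<integral>\<^sup>+x. ennreal ((norm x)\<^sup>2 * (norm (f x))\<^sup>2) \<partial>lborel)"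
      by (rule nn_integral_cmult) measurable
    also have "\<dots> \<le> ennreal (R powr (?\<sigma> - 2)) * ennreal (A\<^sup>2)" by (intro mult_left_mono xf) auto
    finally show "(\<integral>\<^sup>+x. ennreal (norm x powr ?\<sigma> * (norm (?f2 x))\<^sup>2) \<partial>lborel) \<le> ennreal (R powr (?\<sigma> - 2) * A\<^sup>2)"
      by (simp add: ennreal_mult)
  qed auto
  also have "\<dots> = ennreal (high_const TYPE('n) r * A powr r * R powr (?\<sigma> - 2) * t powr (- ?\<sigma>))"
  proof -
    have "A powr r = A powr (r - 2) * A\<^sup>2" using A by (intro powr_split_sq)
    then show ?thesis using hc by (simp add: ennreal_mult[symmetric] mult_ac)
  qed
  finally have 2: "(\<integral>\<^sup>+x. ennreal (norm (?u2 x) powr r) \<partial>lborel) \<le> ennreal (high_const TYPE('n) r * A powr r * R powr (?\<sigma> - 2) * t powr (- ?\<sigma>))" .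
  have "(\<integral>\<^sup>+x. ennreal (norm (Fn (schr t (L2c f)) x) powr r) \<partial>lborel) \<le>
     (\<integral>\<^sup>+x. ennreal (2 powr r) * (ennreal (norm (?u1 x) powr r) + ennreal (norm (?u2 x) powr r)) \<partial>lborel)"
  proof (rule nn_integral_mono_AE, use schr_add_AE[of t "L2c ?f1" "L2c ?f2", unfolded trunc_compl(2)[OF f, of R, symmetric]] in eventually_elim)
    case (elim x)
    show ?case unfolding elim using norm_add_powr_le[of r "?u1 x" "?u2 x"] r
      by (simp add: ennreal_mult[symmetric] ennreal_plus[symmetric] ennreal_leI del: ennreal_plus)
  qed
  also have "\<dots> = ennreal (2 powr r) * ((\<integral>\<^sup>+x. ennreal (norm (?u1 x) powr r) \<partial>lborel) + (\<integral>\<^sup>+x. ennreal (norm (?u2 x) powr r) \<partial>lborel))"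
    by (simp add: nn_integral_cmult nn_integral_add)
  also have "\<dots> \<le> ennreal (2 powr r) * (ennreal ((disp_const TYPE('n) * \<eta>) powr (r - 2) * t powr (- ?\<sigma>) * A\<^sup>2) +
     ennreal (high_const TYPE('n) r * A powr r * R powr (?\<sigma> - 2) * t powr (- ?\<sigma>)))"
    by (intro mult_left_mono add_mono 1 2) auto
  also have "\<dots> = ennreal (2 powr r * ((disp_const TYPE('n) * \<eta>) powr (r - 2) * A\<^sup>2 +
      high_const TYPE('n) r * A powr r * R powr (?\<sigma> - 2)) * t powr (- ?\<sigma>))"
    using hc by (simp add: ennreal_mult[symmetric] ennreal_plus[symmetric] algebra_simps del: ennreal_plus)
  finally show ?thesis .
qed
section \<open>A weak type Strichartz estimate\<close>

lemma borel_measurable_csqrt [measurable]: "csqrt \<in> borel_measurable borel"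
  unfolding borel_measurable_complex_iff by simp

lemma gk_joint_measurable [measurable (raw)]:
  fixes g :: "'a \<Rightarrow> real^'n"
  assumes [measurable]: "z \<in> borel_measurable M" "g \<in> borel_measurable M"
  shows "(\<lambda>p. gk (z p) (g p)) \<in> borel_measurable M"
  unfolding gk_def by measurable

lemma free_kernel_joint_measurable [measurable (raw)]:
  fixes f :: "real^'n \<Rightarrow> complex"
  assumes [measurable]: "f \<in> borel_measurable borel" "t \<in> borel_measurable M" "g \<in> borel_measurable M"
  shows "(\<lambda>p. free_kernel (t p) f (g p)) \<in> borel_measurable M"
  unfolding free_kernel_def by measurable

lemma fourier_L1_joint_measurable:
  fixes F :: "real \<Rightarrow> real^'n \<Rightarrow> complex"
  assumes [measurable]: "case_prod F \<in> borel_measurable (borel \<Otimes>\<^sub>M borel)"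
  shows "(\<lambda>(t, \<xi>). fourier_L1 (F t) \<xi>) \<in> borel_measurable (borel \<Otimes>\<^sub>M borel)"
  unfolding fourier_L1_eq by measurable

lemma emeasure_Ioo_finite: "emeasure lborel {a<..<b::real} < \<infinity>"
  by (intro emeasure_bounded_finite bounded_subset[OF bounded_closed_interval[of a b]]) auto

lemma integrable_bounded_interval:
  fixes h :: "real \<Rightarrow> 'b::{banach, second_countable_topology}"
  assumes [measurable]: "h \<in> borel_measurable borel" and "\<And>t. norm (h t) \<le> B * indicator {0<..<T} t"
  shows "integrable lborel h"
proof (rule Bochner_Integration.integrable_bound)
  show "integrable lborel (\<lambda>t. B * indicator {0<..<T} t :: real)"
    by (intro integrable_mult_right) (intro integrable_real_indicator emeasure_Ioo_finite, simp)
  show "AE t in lborel. norm (h t) \<le> norm (B * indicator {0<..<T} t :: real)"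
    using order_trans[OF assms(2) abs_ge_self] by simp
qed auto

text \<open>Pairing the level set of the solution with the phase of the solution and squaring reduces
  the estimate to the double time integral of pairings of slices. Those at times closer than
  \<open>\<theta>\<close> are bounded in \<open>L\<^sup>2\<close>, the others by dispersion; \<open>\<theta>\<close> is then optimised.\<close>

lemma weak_strichartz:
  fixes f :: "real^'n \<Rightarrow> complex"
  assumes f: "integrable lborel f" "sq_int f" and A: "norm (L2c f) \<le> A" "A > 0" and T: "T > 0" and l: "l > 0"
  defines "E \<equiv> {p :: real \<times> (real^'n). 0 < fst p \<and> fst p < T \<and> l \<le> norm (free_kernel (fst p) f (snd p))}"
  shows "emeasure (lborel \<Otimes>\<^sub>M lborel) E \<le> ennreal (4 * (2 * disp_const TYPE('n)) powr (2 / real CARD('n)) * (A\<^sup>2 / l\<^sup>2) powr (1 + 2 / real CARD('n)))"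
    and "emeasure (lborel \<Otimes>\<^sub>M lborel) E \<le> ennreal (T * (A\<^sup>2 / l\<^sup>2))"
proof -
  let ?N = "real CARD('n)" and ?D = "disp_const TYPE('n)"
  have [measurable]: "f \<in> borel_measurable borel" using f by auto
  have D: "?D > 0" by (rule disp_const_pos)
  define v where "v t x = free_kernel t f x" for t x
  have [measurable]: "case_prod v \<in> borel_measurable (borel \<Otimes>\<^sub>M borel)" unfolding v_def by measurable
  have [measurable]: "v t \<in> borel_measurable borel" for t unfolding v_def by measurable
  \<comment> \<open>Dual function: the phase of the solution on its level set, of modulus 1 there
    and 0 elsewhere, so that its \<open>L\<^sup>1\<close> norm and squared \<open>L\<^sup>2\<close>
    norm on a slice both equal the measure of the slice.\<close>
  define F where "F t x = (if 0 < t \<and> t < T \<and> l \<le> norm (v t x) then sgn (v t x) else 0)" for t x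
  have sgnm: "(\<lambda>p. sgn (g p)) \<in> borel_measurable M" if [measurable]: "g \<in> borel_measurable M" for g :: "'z \<Rightarrow> complex" and M :: "'z measure"
    unfolding sgn_div_norm by measurable
  have Fm [measurable]: "case_prod F \<in> borel_measurable (borel \<Otimes>\<^sub>M borel)"
    unfolding F_def split_beta' using sgnm by measurable
  have [measurable]: "F t \<in> borel_measurable borel" for t unfolding F_def using sgnm by measurable
  have Em [measurable]: "E \<in> sets (lborel \<Otimes>\<^sub>M lborel)"
  proof -
    have "E = {p \<in> space (borel \<Otimes>\<^sub>M borel). 0 < fst p \<and> fst p < T \<and> l \<le> norm (free_kernel (fst p) f (snd p))}"
      by (simp add: E_def space_pair_measure)
    also have "\<dots> \<in> sets (borel \<Otimes>\<^sub>M borel)" by measurable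
    finally show ?thesis by simp
  qed
  have normF: "norm (F t x) = indicator {x. (t, x) \<in> E} x" for t x
    using l by (auto simp: F_def E_def v_def indicator_def norm_sgn)
  have F0: "F t x = 0" if "t \<notin> {0<..<T}" for t x using that by (auto simp: F_def)
  define M0 where "M0 = A\<^sup>2 / l\<^sup>2"
  have M0: "M0 > 0" using A l by (simp add: M0_def)
  \<comment> \<open>Chebyshev's inequality with conservation of the norm. Integrated over the time
    interval this is already the second claim.\<close>
  have slice: "emeasure lborel {x. (t, x) \<in> E} \<le> ennreal M0 * indicator {0<..<T} t" for t
  proof (cases "t \<in> {0<..<T}")
    case True
    then have t: "t \<noteq> 0" by simp
    have "emeasure lborel {x. (t, x) \<in> E} = emeasure lborel {x \<in> space lborel. l \<le> norm (v t x)}"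
      using True by (simp add: E_def v_def)
    also have "\<dots> \<le> ennreal (1 / l\<^sup>2) * (\<integral>\<^sup>+x. ennreal ((norm (v t x))\<^sup>2) \<partial>lborel)"
      by (rule chebyshev_sq) (use l in auto)
    also have "(\<integral>\<^sup>+x. ennreal ((norm (v t x))\<^sup>2) \<partial>lborel) = (\<integral>\<^sup>+x. ennreal ((norm (Fn (schr t (L2c f)) x))\<^sup>2) \<partial>lborel)"
      unfolding v_def by (rule nn_integral_cong_AE, use schr_kernel[OF f t] in eventually_elim) simp
    also have "\<dots> = ennreal ((norm (L2c f))\<^sup>2)" by (simp add: nn_norm_l2)
    also have "ennreal (1 / l\<^sup>2) * \<dots> \<le> ennreal (1 / l\<^sup>2) * ennreal (A\<^sup>2)"
      using A by (intro mult_left_mono ennreal_leI power_mono) auto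
    finally show ?thesis using True by (simp add: M0_def ennreal_mult[symmetric])
  next
    case False
    then have "{x. (t, x) \<in> E} = {}" by (auto simp: E_def)
    then show ?thesis by simp
  qed
  have nnF: "(\<integral>\<^sup>+x. ennreal (norm (F t x)) \<partial>lborel) = emeasure lborel {x. (t, x) \<in> E}" for t
  proof -
    have [measurable]: "{x. (t, x) \<in> E} \<in> sets borel"
      using sets_Pair1[OF Em, of t] by (simp add: vimage_def)
    show ?thesis unfolding normF by (simp add: ennreal_indicator)
  qed
  have nnF2: "(\<integral>\<^sup>+x. ennreal ((norm (F t x))\<^sup>2) \<partial>lborel) = emeasure lborel {x. (t, x) \<in> E}" for t
    unfolding nnF[symmetric] by (intro nn_integral_cong) (auto simp: normF indicator_def)
  have fin: "emeasure lborel {x. (t, x) \<in> E} < \<infinity>" for t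
    using slice[of t] by (rule le_less_trans) (auto simp: indicator_def)
  have Fi: "integrable lborel (F t)" for t using fin nnF by (intro integrableI_bounded) auto
  have Fs: "sq_int (F t)" for t unfolding sq_int_iff_nn using fin nnF2 by auto
  define e where "e t = (LINT x|lborel. norm (F t x))" for t
  have ee: "ennreal (e t) = emeasure lborel {x. (t, x) \<in> E}" for t
    unfolding nnF[symmetric] e_def using Fi[of t] by (intro nn_integral_eq_integral[symmetric]) auto
  have e0: "0 \<le> e t" for t by (simp add: e_def)
  have eM: "e t \<le> M0 * indicator {0<..<T} t" for t
  proof -
    have "ennreal (e t) \<le> ennreal (M0 * indicator {0<..<T} t)"
      unfolding ee using slice[of t] M0 by (auto simp: indicator_def)
    then show ?thesis using M0 by (simp add: ennreal_le_iff)
  qed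
  have [measurable]: "e \<in> borel_measurable borel" unfolding e_def by measurable
  have ei: "integrable lborel e"
    by (rule integrable_bounded_interval[where B=M0 and T=T]) (use eM e0 in auto)
  define m where "m = (LINT t|lborel. e t)"
  have m0: "0 \<le> m" unfolding m_def using e0 by (intro integral_nonneg_AE) auto
  have nnm: "(\<integral>\<^sup>+t. ennreal (e t) \<partial>lborel) = ennreal m"
    unfolding m_def by (rule nn_integral_eq_integral[OF ei]) (use e0 in auto)
  have Emeas: "emeasure (lborel \<Otimes>\<^sub>M lborel) E = ennreal m"
    unfolding nnm[symmetric] ee by (subst lborel.emeasure_pair_measure_alt[OF Em]) (simp add: vimage_def)
  have "ennreal m \<le> (\<integral>\<^sup>+t. ennreal M0 * indicator {0<..<T} t \<partial>lborel)"
    unfolding nnm[symmetric] ee by (intro nn_integral_mono slice)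
  also have "\<dots> = ennreal (T * M0)"
    using T M0 by (simp add: nn_integral_cmult ennreal_mult mult.commute)
  finally show "emeasure (lborel \<Otimes>\<^sub>M lborel) E \<le> ennreal (T * (A\<^sup>2 / l\<^sup>2))"
    unfolding Emeas by (simp add: M0_def)

  \<comment> \<open>The slice \<open>F t\<close> carried back to time zero, on the frequency side;
    the conjugate evolution has the phase with the plus sign.\<close>
  define a where "a t \<xi> = cis (t * (norm \<xi>)\<^sup>2) * fourier_L1 (F t) \<xi>" for t \<xi>
  have am [measurable]: "case_prod a \<in> borel_measurable (borel \<Otimes>\<^sub>M borel)"
    using fourier_L1_joint_measurable[OF Fm] unfolding a_def by measurable
  have am1 [measurable]: "a t \<in> borel_measurable borel" for t unfolding a_def by measurable
  have am2 [measurable]: "(\<lambda>t. a t \<xi>) \<in> borel_measurable borel" for \<xi>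
    using measurable_compose[OF measurable_Pair2' am] by simp
  let ?c = "fconst TYPE('n)"
  have a_bound: "norm (a t \<xi>) \<le> ?c * e t" for t \<xi>
    using fourier_L1_bound[of "F t" \<xi>] by (simp add: a_def norm_mult e_def)
  have a_bound': "norm (a t \<xi>) \<le> ?c * M0 * indicator {0<..<T} t" for t \<xi>
    using order_trans[OF a_bound mult_left_mono[OF eM]] by (simp add: mult.assoc less_imp_le)
  have as: "sq_int (a t)" for t
    unfolding a_def using sq_int_bmult[OF bmeas_cis fourier_L1_sq_int(1)[OF Fi Fs]] by simp
  have a_nn: "(\<integral>\<^sup>+\<xi>. ennreal ((norm (a t \<xi>))\<^sup>2) \<partial>lborel) \<le> ennreal (e t)" for t
    using fourier_bessel[OF Fi Fs, of t] unfolding ee nnF2 by (simp add: a_def norm_mult)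
  have a_norm: "(norm (L2c (a t)))\<^sup>2 \<le> e t" for t
    using a_nn[of t] e0[of t] by (simp add: nn_norm_L2c[OF as] ennreal_le_iff)
  have at: "integrable lborel (\<lambda>t. a t \<xi>)" for \<xi>
    by (rule integrable_bounded_interval[where B="?c * M0" and T=T]) (use a_bound' in auto)
  let ?f = "fourier_L1 f"
  have fs: "sq_int ?f" by (rule fourier_L1_sq_int[OF f])
  have fn: "norm (L2c ?f) \<le> A" using fourier_L1_sq_int(2)[OF f] A by linarith

  \<comment> \<open>On the level set the solution times the conjugate of its own phase is its
    modulus, which is at least \<open>l\<close>; unitarity then moves the evolution onto the
    slice.\<close>
  have step1: "l * e t \<le> Re (LINT \<xi>|lborel. ?f \<xi> * cnj (a t \<xi>))" for t
  proof (cases "t \<in> {0<..<T}")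
    case True
    then have t: "t \<noteq> 0" by simp
    have ae: "AE x in lborel. Fn (schr t (L2c f)) x = v t x" unfolding v_def by (rule schr_kernel[OF f t])
    have vs: "sq_int (v t)" by (rule sq_int_AE_cong[OF sq_int_Fn ae]) measurable
    have vL: "L2c (v t) = schr t (L2c f)" by (rule L2c_eqI[OF _ vs]) (use ae in \<open>eventually_elim, simp\<close>)
    have "l * e t = (LINT x|lborel. l * norm (F t x))" by (simp add: e_def)
    also have "\<dots> \<le> (LINT x|lborel. Re (v t x * cnj (F t x)))"
    proof (rule integral_mono)
      show "integrable lborel (\<lambda>x. l * norm (F t x))" using Fi by simp
      show "integrable lborel (\<lambda>x. Re (v t x * cnj (F t x)))" by (rule sq_int_Re_integrable[OF vs Fs])
      fix x
      have "Re (w * cnj (sgn w)) = norm w" for w :: complex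
      proof -
        have "w * cnj (sgn w) = of_real (inverse (norm w)) * (w * cnj w)"
          by (simp add: sgn_div_norm scaleR_conv_of_real)
        also have "\<dots> = of_real (inverse (norm w) * (norm w)\<^sup>2)"
          by (simp only: complex_norm_square[symmetric] of_real_mult)
        finally have "Re (w * cnj (sgn w)) = inverse (norm w) * (norm w)\<^sup>2" by (simp only: Re_complex_of_real)
        then show ?thesis by (cases "w = 0") (auto simp: power2_eq_square)
      qed
      then show "l * norm (F t x) \<le> Re (v t x * cnj (F t x))"
        using l by (auto simp: F_def norm_sgn simp del: times_complex.sel)
    qed
    also have "\<dots> = inner (schr t (L2c f)) (L2c (F t))" by (simp only: inner_L2c[OF vs Fs, symmetric] vL)
    also have "\<dots> = inner (FT (schr t (L2c f))) (FT (L2c (F t)))" by (simp only: inner_FT)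
    also have "\<dots> = inner (L2c (\<lambda>\<xi>. cis (- (t * (norm \<xi>)\<^sup>2)) * ?f \<xi>)) (L2c (fourier_L1 (F t)))"
      by (simp only: schr_def FT_FTinv FT_L2c[OF f] FT_L2c[OF Fi Fs] mul_L2c[OF bmeas_phase fs])
    also have "\<dots> = (LINT \<xi>|lborel. Re ((cis (- (t * (norm \<xi>)\<^sup>2)) * ?f \<xi>) * cnj (fourier_L1 (F t) \<xi>)))"
      by (rule inner_L2c[OF sq_int_bmult[OF bmeas_phase fs] fourier_L1_sq_int(1)[OF Fi Fs]])
    also have "\<dots> = (LINT \<xi>|lborel. Re (?f \<xi> * cnj (a t \<xi>)))"
      by (rule Bochner_Integration.integral_cong[OF refl]) (simp only: a_def complex_cnj_mult cis_cnj mult_ac)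
    also have "\<dots> = Re (LINT \<xi>|lborel. ?f \<xi> * cnj (a t \<xi>))"
      by (rule integral_Re[OF sq_int_cnj_integrable[OF fs as]])
    finally show ?thesis .
  next
    case False
    then have "e t = 0" "a t \<xi> = 0" for \<xi> using eM[of t] e0[of t] a_bound[of t \<xi>] by auto
    then show ?thesis by simp
  qed

  \<comment> \<open>The adjoint of the evolution applied to \<open>F\<close>: after exchanging the
    integrals, \<open>l * m\<close> is bounded by the pairing of \<open>b\<close> with the transform
    of the datum.\<close>
  define b where "b \<xi> = (LINT t|lborel. a t \<xi>)" for \<xi>
  have [measurable]: "b \<in> borel_measurable borel" unfolding b_def by measurable
  have H: "integrable (lborel \<Otimes>\<^sub>M lborel) (\<lambda>(t, \<xi>). ?f \<xi> * cnj (a t \<xi>))"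
  proof (rule lborel_pair.Fubini_integrable)
    show "AE t in lborel. integrable lborel (\<lambda>\<xi>. case (t, \<xi>) of (t, \<xi>) \<Rightarrow> ?f \<xi> * cnj (a t \<xi>))"
      using sq_int_cnj_integrable[OF fs as] by simp
    show "integrable lborel (\<lambda>t. LINT \<xi>|lborel. norm (case (t, \<xi>) of (t, \<xi>) \<Rightarrow> ?f \<xi> * cnj (a t \<xi>)))"
    proof (rule integrable_bounded_interval[where B="A * sqrt M0" and T=T])
      fix t
      have "(LINT \<xi>|lborel. norm (?f \<xi>) * norm (a t \<xi>)) \<le> norm (L2c ?f) * norm (L2c (a t))"
        by (rule integral_abs_prod_le[OF fs as])
      also have "\<dots> \<le> A * (sqrt M0 * indicator {0<..<T} t)"
      proof (rule mult_mono[OF fn])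
        have "norm (L2c (a t)) \<le> sqrt (e t)" using real_sqrt_le_mono[OF a_norm[of t]] by simp
        also have "\<dots> \<le> sqrt (M0 * indicator {0<..<T} t)" by (intro real_sqrt_le_mono eM)
        finally show "norm (L2c (a t)) \<le> sqrt M0 * indicator {0<..<T} t" by (auto simp: indicator_def)
      qed (use A in auto)
      finally show "norm (LINT \<xi>|lborel. norm (case (t, \<xi>) of (t, \<xi>) \<Rightarrow> ?f \<xi> * cnj (a t \<xi>))) \<le> A * sqrt M0 * indicator {0<..<T} t"
        by (simp add: norm_mult mult.assoc)
    qed measurable
  qed measurable
  have cb: "(LINT t|lborel. ?f \<xi> * cnj (a t \<xi>)) = ?f \<xi> * cnj (b \<xi>)" for \<xi>
    unfolding b_def by simp
  have "l * m = (LINT t|lborel. l * e t)" by (simp add: m_def)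
  also have "\<dots> \<le> (LINT t|lborel. Re (LINT \<xi>|lborel. ?f \<xi> * cnj (a t \<xi>)))"
  proof (rule integral_mono[OF _ _ step1])
    show "integrable lborel (\<lambda>t. l * e t)" using ei by simp
    show "integrable lborel (\<lambda>t. Re (LINT \<xi>|lborel. ?f \<xi> * cnj (a t \<xi>)))"
      using lborel_pair.integrable_fst[OF H] by (intro integrable_Re) simp
  qed
  also have "\<dots> = Re (LINT t|lborel. LINT \<xi>|lborel. ?f \<xi> * cnj (a t \<xi>))"
    using lborel_pair.integrable_fst[OF H] by (intro integral_Re) simp
  also have "(LINT t|lborel. LINT \<xi>|lborel. ?f \<xi> * cnj (a t \<xi>)) = (LINT \<xi>|lborel. LINT t|lborel. ?f \<xi> * cnj (a t \<xi>))"
    by (rule lborel_pair.Fubini_integral[OF H, symmetric])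
  also have "\<dots> = (LINT \<xi>|lborel. ?f \<xi> * cnj (b \<xi>))" by (simp only: cb)
  also have "Re \<dots> \<le> norm (LINT \<xi>|lborel. ?f \<xi> * cnj (b \<xi>))" by (rule complex_Re_le_cmod)
  also have "\<dots> \<le> (LINT \<xi>|lborel. norm (?f \<xi>) * norm (b \<xi>))"
    using integral_norm_bound[of lborel "\<lambda>\<xi>. ?f \<xi> * cnj (b \<xi>)"] by (simp add: norm_mult)
  finally have step2: "l * m \<le> (LINT \<xi>|lborel. norm (?f \<xi>) * norm (b \<xi>))" .

  \<comment> \<open>The squared norm of \<open>b\<close> expands into the integral of pairings of
    slices over pairs of times, and \<open>G\<close> is the modulus of such a pairing.\<close>
  define G where "G p = norm (LINT \<xi>|lborel. a (fst p) \<xi> * cnj (a (snd p) \<xi>))" for p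
  have aa_int: "integrable lborel (\<lambda>\<xi>. a t \<xi> * cnj (a s \<xi>))" for t s by (rule sq_int_cnj_integrable[OF as as])
  have aa: "(LINT \<xi>|lborel. norm (a t \<xi> * cnj (a s \<xi>))) \<le> (e t + e s) / 2" for t s
  proof -
    have "(LINT \<xi>|lborel. norm (a t \<xi> * cnj (a s \<xi>))) \<le> norm (L2c (a t)) * norm (L2c (a s))"
      using integral_abs_prod_le[OF as as, of t s] by (simp add: norm_mult)
    also have "\<dots> \<le> ((norm (L2c (a t)))\<^sup>2 + (norm (L2c (a s)))\<^sup>2) / 2"
      using sum_squares_bound[of "norm (L2c (a t))" "norm (L2c (a s))"] by simp
    also have "\<dots> \<le> (e t + e s) / 2" using a_norm[of t] a_norm[of s] by simp
    finally show ?thesis .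
  qed
  have sf: "sigma_finite_measure (lborel \<Otimes>\<^sub>M lborel :: (real \<times> real) measure)"
    unfolding lborel_prod by (rule sigma_finite_lborel)
  interpret P: pair_sigma_finite "lborel \<Otimes>\<^sub>M lborel :: (real \<times> real) measure" "lborel :: (real^'n) measure"
    by (intro pair_sigma_finite.intro sf sigma_finite_lborel)
  have sqi: "integrable (lborel \<Otimes>\<^sub>M lborel) (\<lambda>p. B * (indicator {0<..<T} (fst p) * indicator {0<..<T} (snd p)) :: real)" for B
  proof -
    have "emeasure (lborel \<Otimes>\<^sub>M lborel) ({0<..<T} \<times> {0<..<T}) < \<infinity>"
      by (subst lborel.emeasure_pair_measure_Times) (use emeasure_Ioo_finite[of 0 T] in \<open>auto simp: ennreal_mult_less_top\<close>)
    then have "integrable (lborel \<Otimes>\<^sub>M lborel) (\<lambda>p. B * indicator ({0<..<T} \<times> {0<..<T}) p)"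
      by (intro integrable_mult_right integrable_real_indicator) auto
    then show ?thesis by (simp add: indicator_times)
  qed
  have a_zero: "a t \<xi> = 0" if "t \<notin> {0<..<T}" for t \<xi>
    using a_bound'[of t \<xi>] that by simp
  have H3: "integrable ((lborel \<Otimes>\<^sub>M lborel) \<Otimes>\<^sub>M lborel) (\<lambda>(p, \<xi>). a (fst p) \<xi> * cnj (a (snd p) \<xi>))"
  proof (rule P.Fubini_integrable)
    show "AE p in lborel \<Otimes>\<^sub>M lborel. integrable lborel (\<lambda>\<xi>. case (p, \<xi>) of (p, \<xi>) \<Rightarrow> a (fst p) \<xi> * cnj (a (snd p) \<xi>))"
      using aa_int by simp
    show "integrable (lborel \<Otimes>\<^sub>M lborel) (\<lambda>p. LINT \<xi>|lborel. norm (case (p, \<xi>) of (p, \<xi>) \<Rightarrow> a (fst p) \<xi> * cnj (a (snd p) \<xi>)))"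
    proof (rule Bochner_Integration.integrable_bound[OF sqi[of M0]])
      show "AE p in lborel \<Otimes>\<^sub>M lborel. norm (LINT \<xi>|lborel. norm (case (p, \<xi>) of (p, \<xi>) \<Rightarrow> a (fst p) \<xi> * cnj (a (snd p) \<xi>)))
         \<le> norm (M0 * (indicator {0<..<T} (fst p) * indicator {0<..<T} (snd p)) :: real)"
      proof (rule AE_I2)
        fix p :: "real \<times> real"
        show "norm (LINT \<xi>|lborel. norm (case (p, \<xi>) of (p, \<xi>) \<Rightarrow> a (fst p) \<xi> * cnj (a (snd p) \<xi>)))
         \<le> norm (M0 * (indicator {0<..<T} (fst p) * indicator {0<..<T} (snd p)) :: real)"
        proof (cases "fst p \<in> {0<..<T} \<and> snd p \<in> {0<..<T}")
          case True
          have "(LINT \<xi>|lborel. norm (a (fst p) \<xi> * cnj (a (snd p) \<xi>))) \<le> M0"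
            using aa[of "fst p" "snd p"] eM[of "fst p"] eM[of "snd p"] True by simp
          then show ?thesis using True M0 by simp
        next
          case False
          then have z: "norm (a (fst p) \<xi> * cnj (a (snd p) \<xi>)) = 0" for \<xi> using a_zero by auto
          show ?thesis by (simp only: prod.case z) simp
        qed
      qed
    qed measurable
  qed measurable
  have bb: "(LINT p|(lborel \<Otimes>\<^sub>M lborel). a (fst p) \<xi> * cnj (a (snd p) \<xi>)) = of_real ((norm (b \<xi>))\<^sup>2)" for \<xi>
  proof -
    have "integrable (lborel \<Otimes>\<^sub>M lborel) (\<lambda>p. a (fst p) \<xi> * cnj (a (snd p) \<xi>))"
    proof (rule Bochner_Integration.integrable_bound[OF sqi[of "(?c * M0)\<^sup>2"]])
      show "AE p in lborel \<Otimes>\<^sub>M lborel. norm (a (fst p) \<xi> * cnj (a (snd p) \<xi>)) \<le> norm ((?c * M0)\<^sup>2 * (indicator {0<..<T} (fst p) * indicator {0<..<T} (snd p)) :: real)"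
      proof (rule AE_I2)
        fix p :: "real \<times> real"
        have "norm (a (fst p) \<xi>) * norm (a (snd p) \<xi>) \<le> (?c * M0 * indicator {0<..<T} (fst p)) * (?c * M0 * indicator {0<..<T} (snd p))"
          using M0 by (intro mult_mono a_bound') (auto simp: less_imp_le)
        also have "\<dots> = (?c * M0)\<^sup>2 * (indicator {0<..<T} (fst p) * indicator {0<..<T} (snd p))"
          by (simp add: power2_eq_square mult_ac)
        finally show "norm (a (fst p) \<xi> * cnj (a (snd p) \<xi>)) \<le> norm ((?c * M0)\<^sup>2 * (indicator {0<..<T} (fst p) * indicator {0<..<T} (snd p)) :: real)"
          unfolding norm_mult complex_mod_cnj real_norm_def by (rule order_trans) simp
      qed
    qed measurable
    then have "(LINT p|(lborel \<Otimes>\<^sub>M lborel). a (fst p) \<xi> * cnj (a (snd p) \<xi>)) = (LINT t|lborel. LINT s|lborel. a t \<xi> * cnj (a s \<xi>))"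
      using lborel_pair.integral_fst'[of "\<lambda>p. a (fst p) \<xi> * cnj (a (snd p) \<xi>)"] by simp
    also have "\<dots> = (LINT t|lborel. a t \<xi> * cnj (b \<xi>))" by (simp add: b_def)
    also have "\<dots> = b \<xi> * cnj (b \<xi>)" by (simp add: b_def)
    finally show ?thesis by (simp only: complex_norm_square)
  qed
  have G_nn: "(\<integral>\<^sup>+\<xi>. ennreal ((norm (b \<xi>))\<^sup>2) \<partial>lborel) \<le> (\<integral>\<^sup>+p. ennreal (G p) \<partial>(lborel \<Otimes>\<^sub>M lborel))"
  proof -
    have i: "integrable lborel (\<lambda>\<xi>. complex_of_real ((norm (b \<xi>))\<^sup>2))"
      using P.integrable_snd[OF H3] unfolding bb .
    then have i': "integrable lborel (\<lambda>\<xi>. (norm (b \<xi>))\<^sup>2)" by (simp only: complex_of_real_integrable_eq)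
    have "complex_of_real (LINT \<xi>|lborel. (norm (b \<xi>))\<^sup>2) = (LINT \<xi>|lborel. LINT p|(lborel \<Otimes>\<^sub>M lborel). a (fst p) \<xi> * cnj (a (snd p) \<xi>))"
      unfolding bb by (rule integral_complex_of_real[symmetric])
    also have "\<dots> = (LINT p|(lborel \<Otimes>\<^sub>M lborel). LINT \<xi>|lborel. a (fst p) \<xi> * cnj (a (snd p) \<xi>))"
      by (rule P.Fubini_integral[OF H3])
    finally have eq: "complex_of_real (LINT \<xi>|lborel. (norm (b \<xi>))\<^sup>2) = (LINT p|(lborel \<Otimes>\<^sub>M lborel). LINT \<xi>|lborel. a (fst p) \<xi> * cnj (a (snd p) \<xi>))" .
    have "(\<integral>\<^sup>+\<xi>. ennreal ((norm (b \<xi>))\<^sup>2) \<partial>lborel) = ennreal (LINT \<xi>|lborel. (norm (b \<xi>))\<^sup>2)"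
      by (rule nn_integral_eq_integral[OF i']) simp
    also have "\<dots> \<le> ennreal (norm (complex_of_real (LINT \<xi>|lborel. (norm (b \<xi>))\<^sup>2)))" by (intro ennreal_leI) simp
    also have "\<dots> \<le> (\<integral>\<^sup>+p. ennreal (G p) \<partial>(lborel \<Otimes>\<^sub>M lborel))"
      unfolding eq G_def by (rule norm_integral_le_nn)
    finally show ?thesis .
  qed
  \<comment> \<open>Near the diagonal Cauchy-Schwarz and the arithmetic-geometric mean are used,
    away from it the dispersive decay, largest at distance \<open>\<theta>\<close>.\<close>
  have G_le: "G (t, s) \<le> (if \<bar>t - s\<bar> \<le> \<theta> then e t / 2 else 0) + (if \<bar>t - s\<bar> \<le> \<theta> then e s / 2 else 0) + ?D * \<theta> powr (- (?N / 2)) * e t * e s"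
    if \<theta>: "\<theta> > 0" for \<theta> t s
  proof (cases "\<bar>t - s\<bar> \<le> \<theta>")
    case True
    have "G (t, s) \<le> (LINT \<xi>|lborel. norm (a t \<xi> * cnj (a s \<xi>)))" unfolding G_def by simp
    also have "\<dots> \<le> (e t + e s) / 2" by (rule aa)
    finally show ?thesis using True D e0[of t] e0[of s] by (simp add: add_divide_distrib add_increasing2)
  next
    case False
    have eq: "(LINT \<xi>|lborel. a t \<xi> * cnj (a s \<xi>)) = (LINT \<xi>|lborel. cis (- ((s - t) * (norm \<xi>)\<^sup>2)) * fourier_L1 (F t) \<xi> * cnj (fourier_L1 (F s) \<xi>))"
    proof (rule Bochner_Integration.integral_cong[OF refl])
      fix \<xi> :: "real^'n"
      have "- ((s - t) * (norm \<xi>)\<^sup>2) = t * (norm \<xi>)\<^sup>2 + - (s * (norm \<xi>)\<^sup>2)" by (simp add: algebra_simps)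
      then have "cis (- ((s - t) * (norm \<xi>)\<^sup>2)) = cis (t * (norm \<xi>)\<^sup>2) * cis (- (s * (norm \<xi>)\<^sup>2))"
        by (simp only: cis_mult)
      then show "a t \<xi> * cnj (a s \<xi>) = cis (- ((s - t) * (norm \<xi>)\<^sup>2)) * fourier_L1 (F t) \<xi> * cnj (fourier_L1 (F s) \<xi>)"
        by (simp only: a_def complex_cnj_mult cis_cnj mult_ac)
    qed
    have ts: "s - t \<noteq> 0" "\<bar>s - t\<bar> > 0" and th: "\<theta> \<le> \<bar>s - t\<bar>" using False \<theta> by auto
    have "G (t, s) \<le> ?c\<^sup>2 * (pi / \<bar>s - t\<bar>) powr (?N / 2) * e t * e s"
      unfolding G_def e_def using dispersive_pair[OF Fi Fs Fi Fs ts(1)] by (simp add: eq)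
    also have "?c\<^sup>2 * (pi / \<bar>s - t\<bar>) powr (?N / 2) = ?D * \<bar>s - t\<bar> powr (- (?N / 2))" by (rule disp_const_eq[OF ts(2)])
    also have "?D * \<bar>s - t\<bar> powr (- (?N / 2)) * e t * e s \<le> ?D * \<theta> powr (- (?N / 2)) * e t * e s"
      using D e0 \<theta> th by (intro mult_right_mono mult_left_mono powr_mono2') auto
    finally show ?thesis using False by simp
  qed
  \<comment> \<open>The window around each time has length \<open>2 * \<theta>\<close>, so each of
    the two symmetric near-diagonal halves contributes \<open>\<theta> * m\<close>; the far part
    factors into the square of \<open>m\<close>.\<close>
  have b_nn: "(\<integral>\<^sup>+\<xi>. ennreal ((norm (b \<xi>))\<^sup>2) \<partial>lborel) \<le> ennreal (2 * \<theta> * m + ?D * \<theta> powr (- (?N / 2)) * m\<^sup>2)" if \<theta>: "\<theta> > 0" for \<theta>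
  proof -
    define I where "I t s = (if \<bar>t - s\<bar> \<le> \<theta> then 1 else 0 :: ennreal)" for t s :: real
    let ?K = "?D * \<theta> powr (- (?N / 2))"
    have K: "?K \<ge> 0" using D by simp
    have i_sym: "I t s = I s t" for t s by (simp add: I_def abs_minus_commute)
    have i_int: "(\<integral>\<^sup>+s. I t s \<partial>lborel) = ennreal (2 * \<theta>)" for t
    proof -
      have "(\<integral>\<^sup>+s. I t s \<partial>lborel) = (\<integral>\<^sup>+s. indicator {t - \<theta>..t + \<theta>} s \<partial>lborel)"
        by (intro nn_integral_cong) (auto simp: I_def indicator_def)
      then show ?thesis using \<theta> by simp
    qed
    have [measurable]: "case_prod I \<in> borel_measurable (borel \<Otimes>\<^sub>M borel)" unfolding I_def by measurable
    have [measurable]: "I t \<in> borel_measurable borel" for t unfolding I_def by measurable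
    have "(\<integral>\<^sup>+p. ennreal (G p) \<partial>(lborel \<Otimes>\<^sub>M lborel)) \<le>
       (\<integral>\<^sup>+p. (ennreal (e (fst p) / 2) * I (fst p) (snd p) + ennreal (e (snd p) / 2) * I (fst p) (snd p)) + ennreal ?K * ennreal (e (fst p)) * ennreal (e (snd p)) \<partial>(lborel \<Otimes>\<^sub>M lborel))"
    proof (rule nn_integral_mono)
      fix p :: "real \<times> real"
      obtain t s where p: "p = (t, s)" by (cases p)
      have "ennreal (G p) \<le> ennreal ((if \<bar>t - s\<bar> \<le> \<theta> then e t / 2 else 0) + (if \<bar>t - s\<bar> \<le> \<theta> then e s / 2 else 0) + ?K * e t * e s)"
        unfolding p by (intro ennreal_leI G_le \<theta>)
      also have "\<dots> = (ennreal (e (fst p) / 2) * I (fst p) (snd p) + ennreal (e (snd p) / 2) * I (fst p) (snd p)) + ennreal ?K * ennreal (e (fst p)) * ennreal (e (snd p))"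
      proof -
        have "ennreal (?K * e t * e s) = ennreal ?K * ennreal (e t) * ennreal (e s)"
          using K e0 by (simp add: ennreal_mult)
        then show ?thesis unfolding p fst_conv snd_conv I_def using e0[of t] e0[of s] K by (simp add: ennreal_plus)
      qed
      finally show "ennreal (G p) \<le> (ennreal (e (fst p) / 2) * I (fst p) (snd p) + ennreal (e (snd p) / 2) * I (fst p) (snd p)) + ennreal ?K * ennreal (e (fst p)) * ennreal (e (snd p))" .
    qed
    also have "\<dots> = (\<integral>\<^sup>+t. \<integral>\<^sup>+s. (ennreal (e t / 2) * I t s + ennreal (e s / 2) * I t s) + ennreal ?K * ennreal (e t) * ennreal (e s) \<partial>lborel \<partial>lborel)"
      by (subst lborel.nn_integral_fst[symmetric]) simp_all
    also have "\<dots> = (\<integral>\<^sup>+t. \<integral>\<^sup>+s. ennreal (e t / 2) * I t s \<partial>lborel \<partial>lborel) + (\<integral>\<^sup>+t. \<integral>\<^sup>+s. ennreal (e s / 2) * I t s \<partial>lborel \<partial>lborel)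
       + (\<integral>\<^sup>+t. \<integral>\<^sup>+s. ennreal ?K * ennreal (e t) * ennreal (e s) \<partial>lborel \<partial>lborel)"
      by (simp add: nn_integral_add)
    also have "(\<integral>\<^sup>+t. \<integral>\<^sup>+s. ennreal (e s / 2) * I t s \<partial>lborel \<partial>lborel) = (\<integral>\<^sup>+s. \<integral>\<^sup>+t. ennreal (e s / 2) * I t s \<partial>lborel \<partial>lborel)"
      by (rule lborel_pair.Fubini') measurable
    also have "\<dots> = (\<integral>\<^sup>+t. \<integral>\<^sup>+s. ennreal (e t / 2) * I t s \<partial>lborel \<partial>lborel)" by (simp only: i_sym)
    also have "(\<integral>\<^sup>+t. \<integral>\<^sup>+s. ennreal (e t / 2) * I t s \<partial>lborel \<partial>lborel) = (\<integral>\<^sup>+t. ennreal \<theta> * ennreal (e t) \<partial>lborel)"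
      using \<theta> e0 by (intro nn_integral_cong, subst nn_integral_cmult) (auto simp: i_int ennreal_mult[symmetric] mult_ac simp del: nn_integral_indicator)
    also have "\<dots> = ennreal (\<theta> * m)" using \<theta> m0 by (simp add: nn_integral_cmult nnm ennreal_mult)
    also have "(\<integral>\<^sup>+t. \<integral>\<^sup>+s. ennreal ?K * ennreal (e t) * ennreal (e s) \<partial>lborel \<partial>lborel) = (\<integral>\<^sup>+t. ennreal (?K * m) * ennreal (e t) \<partial>lborel)"
      using K m0 by (intro nn_integral_cong, subst nn_integral_cmult) (auto simp: nnm ennreal_mult mult_ac)
    also have "\<dots> = ennreal (?K * m\<^sup>2)"
    proof -
      have "ennreal (?K * m) * ennreal m = ennreal (?K * m * m)"
        by (rule ennreal_mult[symmetric, OF mult_nonneg_nonneg[OF K m0] m0])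
      then show ?thesis by (simp add: nn_integral_cmult nnm power2_eq_square mult.assoc)
    qed
    also have "ennreal (\<theta> * m) + ennreal (\<theta> * m) + ennreal (?K * m\<^sup>2) = ennreal (2 * \<theta> * m + ?K * m\<^sup>2)"
      using \<theta> m0 K by (simp add: ennreal_plus[symmetric] del: ennreal_plus)
    finally show ?thesis using G_nn by (rule order_trans[rotated])
  qed
  \<comment> \<open>Duality squared: the factor \<open>A\<close> is the bound on the datum, the
    bracket the bound on the squared norm of \<open>b\<close>.\<close>
  have key: "l\<^sup>2 * m\<^sup>2 \<le> A\<^sup>2 * (2 * \<theta> * m + ?D * \<theta> powr (- (?N / 2)) * m\<^sup>2)" if \<theta>: "\<theta> > 0" for \<theta>
  proof -
    let ?S = "2 * \<theta> * m + ?D * \<theta> powr (- (?N / 2)) * m\<^sup>2"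
    have S: "?S \<ge> 0" using \<theta> m0 D by simp
    have bs: "sq_int b" unfolding sq_int_iff_nn using le_less_trans[OF b_nn[OF \<theta>]] by auto
    have "(norm (L2c b))\<^sup>2 \<le> ?S" using b_nn[OF \<theta>] S by (simp add: nn_norm_L2c[OF bs] ennreal_le_iff)
    moreover have "l * m \<le> A * norm (L2c b)"
      using step2 integral_abs_prod_le[OF fs bs] mult_right_mono[OF fn norm_ge_zero[of "L2c b"]] by linarith
    then have "(l * m)\<^sup>2 \<le> (A * norm (L2c b))\<^sup>2" using l m0 by (intro power_mono) auto
    ultimately show ?thesis using mult_left_mono[of "(norm (L2c b))\<^sup>2" ?S "A\<^sup>2"] by (simp add: power_mult_distrib)
  qed
  \<comment> \<open>With this \<open>q\<close> the far term, multiplied by the square of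
    \<open>A\<close>, is exactly half of the left side of \<open>key\<close> and can be absorbed;
    what remains is linear in \<open>m\<close> after division.\<close>
  define q where "q = 2 * ?D * A\<^sup>2 / l\<^sup>2"
  have q: "q > 0" using D A l by (simp add: q_def)
  define \<theta> where "\<theta> = q powr (2 / ?N)"
  have \<theta>: "\<theta> > 0" using q by (simp add: \<theta>_def)
  have "\<theta> powr (- (?N / 2)) = q powr (-1)" by (simp add: \<theta>_def powr_powr)
  also have "\<dots> = 1 / q" using q by (simp add: powr_minus_divide)
  finally have th: "A\<^sup>2 * (?D * \<theta> powr (- (?N / 2))) = l\<^sup>2 / 2" using D A l by (simp add: q_def field_simps)
  have "A\<^sup>2 * (2 * \<theta> * m + ?D * \<theta> powr (- (?N / 2)) * m\<^sup>2) = 2 * A\<^sup>2 * \<theta> * m + (A\<^sup>2 * (?D * \<theta> powr (- (?N / 2)))) * m\<^sup>2"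
    by (simp add: algebra_simps)
  then have "l\<^sup>2 * m\<^sup>2 \<le> 2 * A\<^sup>2 * \<theta> * m + l\<^sup>2 / 2 * m\<^sup>2" using key[OF \<theta>] unfolding th by simp
  then have "(l\<^sup>2 * m) * m \<le> (4 * A\<^sup>2 * \<theta>) * m" by (simp add: power2_eq_square algebra_simps)
  then have "l\<^sup>2 * m \<le> 4 * A\<^sup>2 * \<theta>" using m0 \<theta> by (cases "m = 0") auto
  then have "m \<le> 4 * (A\<^sup>2 / l\<^sup>2) * \<theta>" using l by (simp add: field_simps)
  also have "\<dots> = 4 * (2 * ?D) powr (2 / ?N) * M0 powr (1 + 2 / ?N)"
  proof -
    have "q = (2 * ?D) * M0" by (simp add: q_def M0_def)
    then have "\<theta> = (2 * ?D) powr (2 / ?N) * M0 powr (2 / ?N)" using D M0 by (simp add: \<theta>_def powr_mult)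
    moreover have "M0 powr (1 + 2 / ?N) = M0 * M0 powr (2 / ?N)" using M0 by (simp add: powr_add)
    ultimately show ?thesis by (simp add: M0_def)
  qed
  finally show "emeasure (lborel \<Otimes>\<^sub>M lborel) E \<le> ennreal (4 * (2 * ?D) powr (2 / ?N) * (A\<^sup>2 / l\<^sup>2) powr (1 + 2 / ?N))"
    unfolding Emeas M0_def by (rule ennreal_leI)
qed
section \<open>Short times\<close>

text \<open>Norm convergence gives pointwise convergence only along a subsequence, so a subsequence
  realising the liminf is chosen before that one.\<close>

lemma L2_fatou:
  assumes lim: "(\<lambda>n. u n) \<longlonglongrightarrow> (v :: 'a::euclidean_space l2)" and r: "r > 0"
  shows "(\<integral>\<^sup>+x. ennreal (norm (Fn v x) powr r) \<partial>lborel) \<le> liminf (\<lambda>n. \<integral>\<^sup>+x. ennreal (norm (Fn (u n) x) powr r) \<partial>lborel)"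
proof -
  define I where "I n = (\<integral>\<^sup>+x. ennreal (norm (Fn (u n) x) powr r) \<partial>lborel)" for n
  obtain q :: "nat \<Rightarrow> nat" where q: "strict_mono q" "(I \<circ> q) \<longlonglongrightarrow> liminf I" using liminf_subseq_lim by blast
  have "(\<lambda>n. u (q n)) \<longlonglongrightarrow> v" using LIMSEQ_subseq_LIMSEQ[OF lim q(1)] by (simp add: o_def)
  from L2_limit_AE_subseq[OF this] obtain k :: "nat \<Rightarrow> nat" where k: "strict_mono k"
    and ae: "AE x in lborel. (\<lambda>n. Fn (u (q (k n))) x) \<longlonglongrightarrow> Fn v x" by blast
  have "(\<integral>\<^sup>+x. ennreal (norm (Fn v x) powr r) \<partial>lborel) = (\<integral>\<^sup>+x. liminf (\<lambda>n. ennreal (norm (Fn (u (q (k n))) x) powr r)) \<partial>lborel)"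
  proof (rule nn_integral_cong_AE, use ae in eventually_elim)
    case (elim x)
    have "(\<lambda>n. ennreal (norm (Fn (u (q (k n))) x) powr r)) \<longlonglongrightarrow> ennreal (norm (Fn v x) powr r)"
      by (intro tendsto_ennrealI tendsto_powr' tendsto_norm elim tendsto_const) (use r in auto)
    then show ?case by (intro lim_imp_Liminf[symmetric]) auto
  qed
  also have "\<dots> \<le> liminf (\<lambda>n. \<integral>\<^sup>+x. ennreal (norm (Fn (u (q (k n))) x) powr r) \<partial>lborel)"
    by (rule nn_integral_liminf) measurable
  also have "\<dots> = liminf I"
    using LIMSEQ_subseq_LIMSEQ[OF q(2) k] by (intro lim_imp_Liminf) (auto simp: o_def I_def)
  finally show ?thesis by (simp add: I_def[abs_def])
qed

lemma nn_powr_tail: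
  assumes "a > 0" "e < -1"
  shows "(\<integral>\<^sup>+s. ennreal (s powr e) * indicator {a..} s \<partial>lborel) = ennreal (a powr (e + 1) / (- e - 1))"
proof -
  have "- (a powr (e + 1)) / (e + 1) = a powr (e + 1) / (- e - 1)"
    by (simp add: minus_divide_left[symmetric] minus_divide_right)
  then have "((\<lambda>x. x powr e) has_integral a powr (e + 1) / (- e - 1)) {a..}"
    using has_integral_powr_to_inf[OF assms(2,1)] by simp
  from nn_integral_has_integral_lebesgue[OF _ this]
  have "integral\<^sup>N lborel (\<lambda>s. ennreal (indicator {a..} s * s powr e)) = ennreal (a powr (e + 1) / (- e - 1))" by simp
  also have "(\<lambda>s. ennreal (indicator {a..} s * s powr e)) = (\<lambda>s. ennreal (s powr e) * indicator {a..} s)"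
    by (auto simp: indicator_def)
  finally show ?thesis .
qed

definition weak_const :: "'n::finite itself \<Rightarrow> real" where
  "weak_const _ = 4 * (2 * disp_const TYPE('n)) powr (2 / real CARD('n))"

text \<open>The level integral is split at \<open>L\<close>. Below it the trivial bound proportional
  to \<open>T\<close> is integrable at zero because \<open>r > 2\<close>; above it the weak type
  bound is integrable at infinity because \<open>r < 2 + 4/N\<close>.\<close>

lemma strichartz_bounded_support:
  fixes f :: "real^'n \<Rightarrow> complex"
  assumes r: "2 < r" "r < 2 + 4 / real CARD('n)" and f: "integrable lborel f" "sq_int f"
    and A: "norm (L2c f) \<le> A" "A > 0" and T: "T > 0" and L: "L > 0"
  shows "(\<integral>\<^sup>+t. (\<integral>\<^sup>+x. ennreal (norm (free_kernel t f x) powr r) \<partial>lborel) * indicator {0<..<T} t \<partial>lborel) \<le>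
    ennreal (r * T * A\<^sup>2 / (r - 2) * L powr (r - 2) +
      r * weak_const TYPE('n) * (A\<^sup>2) powr (1 + 2 / real CARD('n)) * (L powr (r - 2 - 4 / real CARD('n)) / (2 + 4 / real CARD('n) - r)))"
proof -
  let ?N = "real CARD('n)" and ?K = "weak_const TYPE('n)"
  have [measurable]: "f \<in> borel_measurable borel" using f by auto
  have K: "?K \<ge> 0" by (simp add: weak_const_def)
  define V where "V p = (if 0 < fst p \<and> fst p < T then norm (free_kernel (fst p) f (snd p)) else 0)" for p :: "real \<times> (real^'n)"
  have Vm [measurable]: "V \<in> borel_measurable (lborel \<Otimes>\<^sub>M lborel)" unfolding V_def by measurable
  have V0: "0 \<le> V p" for p by (simp add: V_def)
  have sf: "sigma_finite_measure (lborel \<Otimes>\<^sub>M lborel :: (real \<times> (real^'n)) measure)"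
    unfolding lborel_prod by (rule sigma_finite_lborel)
  define c1 where "c1 = r * T * A\<^sup>2 / (r - 2)"
  define c2 where "c2 = r * ?K * (A\<^sup>2) powr (1 + 2 / ?N)"
  define k where "k = r - 3 - 4 / ?N"
  have c: "c1 \<ge> 0" "c2 \<ge> 0" using r T K by (auto simp: c1_def c2_def)
  have k: "k < -1" using r by (simp add: k_def)
  have "(\<integral>\<^sup>+t. (\<integral>\<^sup>+x. ennreal (norm (free_kernel t f x) powr r) \<partial>lborel) * indicator {0<..<T} t \<partial>lborel) =
     (\<integral>\<^sup>+t. \<integral>\<^sup>+x. ennreal (V (t, x) powr r) \<partial>lborel \<partial>lborel)"
    by (intro nn_integral_cong) (auto simp: V_def indicator_def)
  also have "\<dots> = (\<integral>\<^sup>+p. ennreal (V p powr r) \<partial>(lborel \<Otimes>\<^sub>M lborel))"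
    by (rule lborel.nn_integral_fst) measurable
  also have "\<dots> = (\<integral>\<^sup>+s. ennreal (r * s powr (r - 1)) * indicator {0..} s *
      emeasure (lborel \<Otimes>\<^sub>M lborel) {p \<in> space (lborel \<Otimes>\<^sub>M lborel). s \<le> V p} \<partial>lborel)"
    by (rule layer_cake[OF sf Vm V0]) (use r in simp)
  also have "\<dots> \<le> (\<integral>\<^sup>+s. ennreal c1 * (ennreal ((r - 2) * s powr (r - 2 - 1)) * indicator {0..L} s) +
      ennreal c2 * (ennreal (s powr k) * indicator {L..} s) \<partial>lborel)"
  proof (rule nn_integral_mono)
    fix s :: real
    let ?m = "emeasure (lborel \<Otimes>\<^sub>M lborel) {p \<in> space (lborel \<Otimes>\<^sub>M lborel). s \<le> V p}"
    show "ennreal (r * s powr (r - 1)) * indicator {0..} s * ?m \<le>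
       ennreal c1 * (ennreal ((r - 2) * s powr (r - 2 - 1)) * indicator {0..L} s) + ennreal c2 * (ennreal (s powr k) * indicator {L..} s)"
    proof (cases "s > 0")
      case s: True
      have E: "{p \<in> space (lborel \<Otimes>\<^sub>M lborel). s \<le> V p} =
          {p :: real \<times> (real^'n). 0 < fst p \<and> fst p < T \<and> s \<le> norm (free_kernel (fst p) f (snd p))}"
        using s by (auto simp: V_def space_pair_measure split: if_splits)
      show ?thesis
      proof (cases "s \<le> L")
        case True
        have "ennreal (r * s powr (r - 1)) * ?m \<le> ennreal (r * s powr (r - 1)) * ennreal (T * (A\<^sup>2 / s\<^sup>2))"
          unfolding E by (intro mult_left_mono weak_strichartz(2)[OF f A T s]) simp
        also have "\<dots> = ennreal (r * s powr (r - 1) * (T * (A\<^sup>2 / s\<^sup>2)))"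
          using r T by (intro ennreal_mult[symmetric]) auto
        also have "r * s powr (r - 1) * (T * (A\<^sup>2 / s\<^sup>2)) = c1 * ((r - 2) * s powr (r - 2 - 1))"
        proof -
          have "s powr (r - 1) = s powr (r - 2 - 1) * s\<^sup>2" using powr_split_sq[OF s, of "r - 1"] by (simp add: diff_diff_eq add.commute)
          then show ?thesis using s r by (simp add: c1_def)
        qed
        also have "ennreal \<dots> = ennreal c1 * ennreal ((r - 2) * s powr (r - 2 - 1))"
          using c r by (intro ennreal_mult) auto
        finally show ?thesis using True s by (simp add: add_increasing2)
      next
        case False
        have "ennreal (r * s powr (r - 1)) * ?m \<le> ennreal (r * s powr (r - 1)) * ennreal (?K * (A\<^sup>2 / s\<^sup>2) powr (1 + 2 / ?N))"
          unfolding E weak_const_def by (intro mult_left_mono weak_strichartz(1)[OF f A T s]) simp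
        also have "\<dots> = ennreal (r * s powr (r - 1) * (?K * (A\<^sup>2 / s\<^sup>2) powr (1 + 2 / ?N)))"
          using r K by (intro ennreal_mult[symmetric]) auto
        also have "r * s powr (r - 1) * (?K * (A\<^sup>2 / s\<^sup>2) powr (1 + 2 / ?N)) = c2 * s powr k"
        proof -
          have "(s\<^sup>2) powr (1 + 2 / ?N) = (s powr 2) powr (1 + 2 / ?N)" using s by simp
          also have "\<dots> = s powr (2 + 4 / ?N)" unfolding powr_powr by (simp add: distrib_left)
          finally have "(A\<^sup>2 / s\<^sup>2) powr (1 + 2 / ?N) = (A\<^sup>2) powr (1 + 2 / ?N) / s powr (2 + 4 / ?N)"
            by (simp add: powr_divide)
          moreover have "s powr k = s powr (r - 1) / s powr (2 + 4 / ?N)"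
            unfolding k_def powr_diff[symmetric] by (rule arg_cong[where f="\<lambda>a. s powr a"]) simp
          ultimately show ?thesis by (simp add: c2_def)
        qed
        also have "ennreal \<dots> = ennreal c2 * ennreal (s powr k)" using c by (intro ennreal_mult) auto
        finally show ?thesis using False s by simp
      qed
    qed (cases "s = 0"; simp)
  qed
  also have "\<dots> = ennreal c1 * ennreal (L powr (r - 2)) + ennreal c2 * ennreal (L powr (k + 1) / (- k - 1))"
  proof -
    have 1: "(\<integral>\<^sup>+s. ennreal ((r - 2) * s powr (r - 2 - 1)) * indicator {0..L} s \<partial>lborel) = ennreal (L powr (r - 2))"
      by (rule nn_powr_layer) (use L r in auto)
    show ?thesis by (subst nn_integral_add, measurable, subst (1 2) nn_integral_cmult, measurable)
      (simp only: 1 nn_powr_tail[OF L k])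
  qed
  also have "\<dots> = ennreal (c1 * L powr (r - 2) + c2 * (L powr (k + 1) / (- k - 1)))"
    using c k by (simp add: ennreal_mult[symmetric] ennreal_plus[symmetric] del: ennreal_plus)
  also have "k + 1 = r - 2 - 4 / ?N" by (simp add: k_def)
  also have "- k - 1 = 2 + 4 / ?N - r" by (simp add: k_def)
  finally show ?thesis by (simp only: c1_def c2_def)
qed

text \<open>The level \<open>L\<close> is chosen first, making the tail small independently of
  \<open>T\<close>; then \<open>T\<close> makes the low part small. One \<open>T\<close> thus serves
  all data in the ball. The measurable majorant \<open>M\<close> avoids discussing measurability in
  time of representatives that are chosen separately at each time.\<close>

lemma strichartz_small:
  assumes r: "2 < r" "r < 2 + 4 / real CARD('n::finite)" and A: "A > 0" and \<epsilon>: "\<epsilon> > 0"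
  shows "\<exists>T>0. T \<le> \<epsilon> \<and> (\<forall>f :: real^'n \<Rightarrow> complex. sq_int f \<longrightarrow> norm (L2c f) \<le> A \<longrightarrow>
    (\<exists>M\<in>borel_measurable borel.
      (\<forall>t. 0 < t \<longrightarrow> t < T \<longrightarrow> (\<integral>\<^sup>+x. ennreal (norm (Fn (schr t (L2c f)) x) powr r) \<partial>lborel) \<le> M t) \<and>
      (\<integral>\<^sup>+t. M t \<partial>lborel) \<le> ennreal \<epsilon>))"
proof -
  let ?N = "real CARD('n)"
  define c2 where "c2 = r * weak_const TYPE('n) * (A\<^sup>2) powr (1 + 2 / ?N) / (2 + 4 / ?N - r)"
  have "((\<lambda>L. L powr (r - 2 - 4 / ?N)) \<longlongrightarrow> 0) at_top"
    by (rule tendsto_neg_powr) (use r in \<open>auto intro: filterlim_ident\<close>)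
  then have "((\<lambda>L. c2 * L powr (r - 2 - 4 / ?N)) \<longlongrightarrow> 0) at_top" by (rule tendsto_mult_right_zero)
  then have "eventually (\<lambda>L. c2 * L powr (r - 2 - 4 / ?N) < \<epsilon> / 2 \<and> L > 0) at_top"
    using \<epsilon> by (intro eventually_conj order_tendstoD eventually_gt_at_top) auto
  from eventually_happens'[OF trivial_limit_at_top_linorder this]
  obtain L where L: "c2 * L powr (r - 2 - 4 / ?N) < \<epsilon> / 2" "L > 0" by blast
  define d where "d = r * A\<^sup>2 / (r - 2) * L powr (r - 2)"
  have d: "d > 0" using r A L by (simp add: d_def)
  \<comment> \<open>The bound by \<open>\<epsilon>\<close> itself is included because the length of
    the interval enters the later time integral.\<close>
  define T where "T = min \<epsilon> (\<epsilon> / 2 / d)"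
  have T: "T > 0" "T \<le> \<epsilon>" using \<epsilon> d by (auto simp: T_def)
  have "d * T \<le> d * (\<epsilon> / 2 / d)" using d by (intro mult_left_mono) (auto simp: T_def)
  then have dT: "d * T \<le> \<epsilon> / 2" using d by simp
  have cpt: "(\<integral>\<^sup>+t. (\<integral>\<^sup>+x. ennreal (norm (free_kernel t f x) powr r) \<partial>lborel) * indicator {0<..<T} t \<partial>lborel) \<le> ennreal \<epsilon>"
    if f: "integrable lborel f" "sq_int f" "norm (L2c f) \<le> A" for f :: "real^'n \<Rightarrow> complex"
  proof -
    have "r * T * A\<^sup>2 / (r - 2) * L powr (r - 2) + r * weak_const TYPE('n) * (A\<^sup>2) powr (1 + 2 / ?N) * (L powr (r - 2 - 4 / ?N) / (2 + 4 / ?N - r))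
      = d * T + c2 * L powr (r - 2 - 4 / ?N)" by (simp add: d_def c2_def)
    also have "\<dots> \<le> \<epsilon>" using dT L by simp
    finally show ?thesis
      using strichartz_bounded_support[OF r f(1,2,3) A T(1) L(2)] by (meson ennreal_leI order_trans)
  qed
  have "\<exists>M\<in>borel_measurable borel.
      (\<forall>t. 0 < t \<longrightarrow> t < T \<longrightarrow> (\<integral>\<^sup>+x. ennreal (norm (Fn (schr t (L2c f)) x) powr r) \<partial>lborel) \<le> M t) \<and>
      (\<integral>\<^sup>+t. M t \<partial>lborel) \<le> ennreal \<epsilon>"
    if f: "sq_int f" and fA: "norm (L2c f) \<le> A" for f :: "real^'n \<Rightarrow> complex"
  proof -
    have [measurable]: "f \<in> borel_measurable borel" using f by auto
    have [measurable]: "trunc (real k) f \<in> borel_measurable borel" for k using sq_int_trunc[OF f] by auto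
    define J where "J k t = (\<integral>\<^sup>+x. ennreal (norm (free_kernel t (trunc (real k) f) x) powr r) \<partial>lborel)" for k t
    have [measurable]: "J k \<in> borel_measurable borel" for k unfolding J_def by measurable
    have tA: "norm (L2c (trunc (real k) f)) \<le> A" for k
    proof -
      have "ennreal ((norm (L2c (trunc (real k) f)))\<^sup>2) \<le> ennreal ((norm (L2c f))\<^sup>2)"
        unfolding nn_norm_L2c[OF f, symmetric] nn_norm_L2c[OF sq_int_trunc[OF f], symmetric]
        by (intro nn_integral_mono) (auto simp: trunc_def indicator_def)
      then show ?thesis using fA by (simp add: ennreal_le_iff power_mono_iff)
    qed
    have lim: "(\<lambda>k. schr t (L2c (trunc (real k) f))) \<longlonglongrightarrow> schr t (L2c f)" for t
      by (rule lipschitz_tendsto[OF linear_schr _ trunc_tendsto[OF f filterlim_real_sequentially]]) simp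
    \<comment> \<open>The truncated data have an explicit, jointly measurable evolution; the liminf
      bounds the true one at each time by Fatou's lemma in space, and its integral by Fatou's lemma
      in time.\<close>
    define M where "M t = liminf (\<lambda>k. J k t * indicator {0<..<T} t)" for t
    have "(\<integral>\<^sup>+x. ennreal (norm (Fn (schr t (L2c f)) x) powr r) \<partial>lborel) \<le> M t" if "0 < t" "t < T" for t
    proof -
      have t: "t \<noteq> 0" using that by simp
      have "(\<integral>\<^sup>+x. ennreal (norm (Fn (schr t (L2c (trunc (real k) f))) x) powr r) \<partial>lborel) = J k t" for k
        unfolding J_def
        by (rule nn_integral_cong_AE, use schr_kernel[OF integrable_trunc[OF f] sq_int_trunc[OF f] t, of "real k"] in eventually_elim) simp
      then show ?thesis using L2_fatou[OF lim, of r t] r that by (simp add: M_def)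
    qed
    moreover have "(\<integral>\<^sup>+t. M t \<partial>lborel) \<le> ennreal \<epsilon>"
    proof -
      have "(\<integral>\<^sup>+t. M t \<partial>lborel) \<le> liminf (\<lambda>k. \<integral>\<^sup>+t. J k t * indicator {0<..<T} t \<partial>lborel)"
        unfolding M_def by (rule nn_integral_liminf) measurable
      also have "\<dots> \<le> ennreal \<epsilon>"
        unfolding J_def by (intro Liminf_le always_eventually allI cpt integrable_trunc sq_int_trunc f tA) simp_all
      finally show ?thesis .
    qed
    moreover have "M \<in> borel_measurable borel" unfolding M_def by measurable
    ultimately show ?thesis by blast
  qed
  then show ?thesis using T by blast
qed

section \<open>The mixed norm of the evolution\<close>

lemma enn_powr_mono: "x \<le> y \<Longrightarrow> 0 \<le> a \<Longrightarrow> enn_powr x a \<le> enn_powr y a"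
  unfolding enn_powr_def
  by (cases x; cases y) (auto simp: ennreal_le_iff top_unique intro!: powr_mono2)

lemma enn_powr_ennreal: "0 \<le> x \<Longrightarrow> enn_powr (ennreal x) a = ennreal (x powr a)"
  by (simp add: enn_powr_def)

text \<open>Serves in place of Hoelder's inequality in time: a power at most 1 of the space integral
  is bounded by 1 plus the integral, and the 1 costs only the length of a short interval.\<close>

lemma enn_powr_le_one_plus:
  assumes "0 < a" "0 < b" "a * b \<le> 1"
  shows "enn_powr (enn_powr X a) b \<le> 1 + X"
proof (cases X)
  case (real x)
  have "(x powr a) powr b \<le> 1 + x"
  proof (cases "x \<le> 1")
    case True
    then have "(x powr a) powr b \<le> 1" using real assms unfolding powr_powr by (intro powr_le1) auto
    then show ?thesis using real by simp
  next
    case False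
    then have "x powr (a * b) \<le> x powr 1" using assms by (intro powr_mono) auto
    then show ?thesis using real by (simp add: powr_powr)
  qed
  then show ?thesis using real by (simp add: enn_powr_ennreal ennreal_plus[symmetric] ennreal_leI del: ennreal_plus flip: ennreal_1)
qed (simp add: enn_powr_def)

text \<open>The three summands come from the constant 1 on the short interval, from the majorant
  \<open>M\<close>, and from the tail of a power of \<open>t\<close> with exponent below -1.\<close>

lemma time_integral_bound:
  fixes W :: "real^'n \<Rightarrow> complex"
  assumes W: "sq_int W" and g: "g > 0" and q: "0 < q" "q \<le> g" and T: "T > 0" and B: "B \<ge> 0" and k: "\<sigma> * q / g > 1"
    and M [measurable]: "M \<in> borel_measurable borel"
    and small: "\<And>t. 0 < t \<Longrightarrow> t < T \<Longrightarrow> (\<integral>\<^sup>+x. ennreal (norm (Fn (schr t (L2c W)) x) powr g) \<partial>lborel) \<le> M t"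
      "(\<integral>\<^sup>+t. M t \<partial>lborel) \<le> ennreal e" "e \<ge> 0"
    and large: "\<And>t. t \<ge> T \<Longrightarrow> (\<integral>\<^sup>+x. ennreal (norm (Fn (schr t (L2c W)) x) powr g) \<partial>lborel) \<le> ennreal (B * t powr (- \<sigma>))"
  shows "(\<integral>\<^sup>+t. enn_powr (Lp_norm g (schroedinger t W)) q * indicator {0<..} t \<partial>lborel) \<le>
    ennreal (T + e + B powr (q / g) * (T powr (1 - \<sigma> * q / g) / (\<sigma> * q / g - 1)))"
proof -
  let ?\<kappa> = "\<sigma> * q / g"
  define X where "X t = (\<integral>\<^sup>+x. ennreal (norm (Fn (schr t (L2c W)) x) powr g) \<partial>lborel)" for t
  have Lp: "Lp_norm g (schroedinger t W) = enn_powr (X t) (1 / g)" for t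
    unfolding Lp_norm_def X_def
    by (rule arg_cong[where f="\<lambda>x. enn_powr x _"], rule nn_integral_cong_AE, use schroedinger_AE[OF W, of t] in eventually_elim) simp
  have pt: "enn_powr (Lp_norm g (schroedinger t W)) q * indicator {0<..} t \<le>
     (indicator {0<..<T} t + M t) + ennreal (B powr (q / g)) * (ennreal (t powr (- ?\<kappa>)) * indicator {T..} t)" for t
  proof (cases "t > 0")
    case True
    show ?thesis
    proof (cases "t < T")
      case lt: True
      have "enn_powr (Lp_norm g (schroedinger t W)) q \<le> 1 + X t"
        unfolding Lp by (rule enn_powr_le_one_plus) (use g q in auto)
      also have "\<dots> \<le> 1 + M t" unfolding X_def by (intro add_left_mono small(1) True lt)
      finally show ?thesis using True lt by simp
    next
      case False
      have "enn_powr (Lp_norm g (schroedinger t W)) q \<le> enn_powr (enn_powr (ennreal (B * t powr (- \<sigma>))) (1 / g)) q"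
        unfolding Lp X_def using False g q by (intro enn_powr_mono large) auto
      also have "\<dots> = ennreal ((B * t powr (- \<sigma>)) powr (q / g))"
        using B by (simp add: enn_powr_ennreal powr_powr)
      also have "(B * t powr (- \<sigma>)) powr (q / g) = B powr (q / g) * t powr (- ?\<kappa>)"
        using B by (simp add: powr_mult powr_powr)
      finally show ?thesis using True False by (simp add: ennreal_mult add_increasing)
    qed
  qed simp
  have "(\<integral>\<^sup>+t. enn_powr (Lp_norm g (schroedinger t W)) q * indicator {0<..} t \<partial>lborel) \<le>
     (\<integral>\<^sup>+t. (indicator {0<..<T} t + M t) + ennreal (B powr (q / g)) * (ennreal (t powr (- ?\<kappa>)) * indicator {T..} t) \<partial>lborel)"
    by (rule nn_integral_mono) (rule pt)
  also have "\<dots> \<le> ennreal T + ennreal e + ennreal (B powr (q / g)) * ennreal (T powr (1 - ?\<kappa>) / (?\<kappa> - 1))"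
  proof -
    have tail: "(\<integral>\<^sup>+t. ennreal (t powr (- ?\<kappa>)) * indicator {T..} t \<partial>lborel) = ennreal (T powr (1 - ?\<kappa>) / (?\<kappa> - 1))"
      using nn_powr_tail[OF T, of "- ?\<kappa>"] k by (simp add: algebra_simps)
    have one: "(\<integral>\<^sup>+t. indicator {0<..<T} t \<partial>lborel) = ennreal T" using T by simp
    show ?thesis
      by (subst nn_integral_add, measurable, subst nn_integral_add, measurable, subst nn_integral_cmult, measurable)
        (simp only: tail one, intro add_mono small(2) order_refl)
  qed
  also have "\<dots> = ennreal (T + e + B powr (q / g) * (T powr (1 - ?\<kappa>) / (?\<kappa> - 1)))"
    using T small(3) B k by (simp add: ennreal_mult[symmetric] ennreal_plus[symmetric] del: ennreal_plus)
  finally show ?thesis .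
qed
section \<open>Modulations\<close>

definition modul :: "real^'n \<Rightarrow> (real^'n) l2 \<Rightarrow> (real^'n) l2" where
  "modul \<xi> = mul (\<lambda>x. cis (\<xi> \<bullet> x))"

lemma bmeas_modul: "bmeas (\<lambda>x::'a::euclidean_space. cis (\<xi> \<bullet> x))"
  by (rule bmeas_cis) measurable

lemma inner_isometry:
  fixes A :: "'h::real_inner \<Rightarrow> 'k::real_inner"
  assumes "linear A" "\<And>u. norm (A u) = norm u"
  shows "inner (A u) (A v) = inner u v"
  by (simp only: dot_norm linear_add[OF assms(1), symmetric] assms(2))

text \<open>Translation by half a period changes the sign of the oscillating factor, so twice the
  integral is an integral against the difference of the function and its translate, which vanishes
  as the period shrinks.\<close>

lemma riemann_lebesgue_nice:
  fixes f g :: "'a::euclidean_space \<Rightarrow> complex"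
  assumes f: "nice f" and g: "nice g" and a: "filterlim (\<lambda>n. norm (a n)) at_top sequentially"
  shows "(\<lambda>n. LINT z|lborel. cis (a n \<bullet> z) * (f z * cnj (g z))) \<longlonglongrightarrow> 0"
proof -
  define h where "h z = f z * cnj (g z)" for z
  have hc: "continuous_on UNIV h" using f g unfolding h_def nice_def by (auto intro!: continuous_intros)
  then have [measurable]: "h \<in> borel_measurable borel" by (rule borel_measurable_continuous_onI)
  obtain B1 B2 R where "\<And>x. norm (f x) \<le> B1" "\<And>x. norm (g x) \<le> B2" and R: "\<And>x. norm x > R \<Longrightarrow> f x = 0"
    using f g by (auto simp: nice_def)
  then have hB: "norm (h x) \<le> B1 * B2" for x
    unfolding h_def norm_mult complex_mod_cnj by (intro mult_mono order_trans[OF norm_ge_zero]) auto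
  have h0: "h x = 0" if "norm x > R" for x using R[OF that] by (simp add: h_def)
  have hi: "integrable lborel h" using sq_int_cnj_integrable[OF nice_sq_int[OF f] nice_sq_int[OF g]] by (simp only: h_def[abs_def])
  \<comment> \<open>The shift along \<open>a n\<close> whose product with \<open>a n\<close> is
    \<open>pi\<close>. Above the threshold it has length at most 1, so all translates share one
    compact support; below it the shift is set to 0.\<close>
  define w where "w n = (if norm (a n) \<ge> pi + 1 then (pi / (norm (a n))\<^sup>2) *\<^sub>R a n else 0)" for n
  have nz: "eventually (\<lambda>n. norm (a n) \<ge> pi + 1) sequentially" using a by (simp add: filterlim_at_top)
  have nw: "norm (w n) = pi / norm (a n)" if "norm (a n) \<ge> pi + 1" for n using that by (simp add: w_def power2_eq_square)
  have w1: "norm (w n) \<le> 1" for n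
  proof (cases "norm (a n) \<ge> pi + 1")
    case True
    then have "norm (a n) > 0" "pi \<le> norm (a n)" using pi_gt_zero by linarith+
    then show ?thesis using nw[OF True] by simp
  qed (simp add: w_def)
  have w0: "w \<longlonglongrightarrow> 0"
  proof -
    have "(\<lambda>n. pi / norm (a n)) \<longlonglongrightarrow> 0" by (rule real_tendsto_divide_at_top[OF tendsto_const a])
    then have "(\<lambda>n. norm (w n)) \<longlonglongrightarrow> 0"
      by (rule Lim_transform_eventually) (use nz in \<open>eventually_elim, simp add: nw\<close>)
    then show ?thesis by (simp only: tendsto_norm_zero_iff)
  qed
  have shift: "(LINT z|lborel. cis (a n \<bullet> z) * h z) = - (LINT z|lborel. cis (a n \<bullet> z) * h (w n + z))" if n: "norm (a n) \<ge> pi + 1" for n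
  proof -
    have "norm (a n) > 0" using n pi_gt_zero by linarith
    then have "a n \<bullet> w n = pi" using n by (simp add: w_def power2_norm_eq_inner)
    then have c: "cis (a n \<bullet> (w n + z)) = - cis (a n \<bullet> z)" for z
      by (simp add: inner_add_right cis_mult[symmetric])
    have "(LINT z|lborel. cis (a n \<bullet> z) * h z) = (LINT z|distr lborel borel ((+) (w n)). cis (a n \<bullet> z) * h z)"
      by (simp only: lborel_distr_plus)
    also have "\<dots> = (LINT z|lborel. cis (a n \<bullet> (w n + z)) * h (w n + z))"
      by (subst integral_distr) auto
    finally show ?thesis unfolding c by simp
  qed
  have supp: "h (w n + z) = 0" if "norm z > R + 1" for n z
  proof (rule h0)
    show "norm (w n + z) > R" using norm_triangle_ineq4[of "w n + z" "w n"] w1[of n] that by simp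
  qed
  have B: "0 \<le> B1 * B2" using hB[of 0] norm_ge_zero order_trans by blast
  have his: "integrable lborel (\<lambda>z. h (w n + z))" for n
    by (rule sq_int_support_integrable[OF sq_int_bounded_support[OF _ hB supp] supp]) measurable
  have lim: "(\<lambda>n. LINT z|lborel. norm (h z - h (w n + z))) \<longlonglongrightarrow> (LINT z|(lborel::'a measure). 0)"
  proof (rule integral_dominated_convergence[where w="\<lambda>z. 2 * (B1 * B2) * indicator (cball 0 (R + 1)) z"])
    show "integrable lborel (\<lambda>z::'a. 2 * (B1 * B2) * indicator (cball 0 (R + 1)) z)"
      by (intro integrable_mult_right integrable_real_indicator) (use emeasure_lborel_cball_finite[of "0::'a" "R + 1"] in auto)
    show "AE z in lborel. (\<lambda>n. norm (h z - h (w n + z))) \<longlonglongrightarrow> 0"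
    proof (rule AE_I2)
      fix z
      have "(\<lambda>n. w n + z) \<longlonglongrightarrow> 0 + z" by (intro tendsto_intros w0)
      then have "(\<lambda>n. h (w n + z)) \<longlonglongrightarrow> h z"
        by (intro continuous_on_tendsto_compose[OF hc]) auto
      then have "(\<lambda>n. norm (h z - h (w n + z))) \<longlonglongrightarrow> norm (h z - h z)" by (intro tendsto_intros)
      then show "(\<lambda>n. norm (h z - h (w n + z))) \<longlonglongrightarrow> 0" by simp
    qed
    show "AE z in lborel. norm (norm (h z - h (w n + z))) \<le> 2 * (B1 * B2) * indicator (cball 0 (R + 1)) z" for n
    proof (rule AE_I2)
      fix z :: 'a
      show "norm (norm (h z - h (w n + z))) \<le> 2 * (B1 * B2) * indicator (cball 0 (R + 1)) z"
      proof (cases "norm z \<le> R + 1")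
        case True
        have "norm (h z - h (w n + z)) \<le> norm (h z) + norm (h (w n + z))" by (rule norm_triangle_ineq4)
        also have "\<dots> \<le> B1 * B2 + B1 * B2" by (intro add_mono hB)
        finally show ?thesis using True by simp
      qed (simp add: supp h0)
    qed
  qed auto
  show ?thesis
  proof (rule Lim_null_comparison)
    show "(\<lambda>n. LINT z|lborel. norm (h z - h (w n + z))) \<longlonglongrightarrow> 0" using lim by simp
    show "eventually (\<lambda>n. norm (LINT z|lborel. cis (a n \<bullet> z) * (f z * cnj (g z))) \<le> (LINT z|lborel. norm (h z - h (w n + z)))) sequentially"
      using nz
    proof eventually_elim
      case (elim n)
      let ?I = "LINT z|lborel. cis (a n \<bullet> z) * h z"
      have "?I + ?I = ?I - (LINT z|lborel. cis (a n \<bullet> z) * h (w n + z))" using shift[OF elim] by simp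
      also have "\<dots> = (LINT z|lborel. cis (a n \<bullet> z) * h z - cis (a n \<bullet> z) * h (w n + z))"
        by (rule Bochner_Integration.integral_diff[symmetric]) (auto intro!: integrable_cis_mult hi his)
      also have "\<dots> = (LINT z|lborel. cis (a n \<bullet> z) * (h z - h (w n + z)))" by (simp only: right_diff_distrib)
      finally have e: "2 * ?I = (LINT z|lborel. cis (a n \<bullet> z) * (h z - h (w n + z)))" by simp
      have "norm (2 * ?I) \<le> (LINT z|lborel. norm (h z - h (w n + z)))"
        unfolding e using integral_norm_bound[of lborel "\<lambda>z. cis (a n \<bullet> z) * (h z - h (w n + z))"] by (simp add: norm_mult)
      moreover have "norm ?I \<le> norm (2 * ?I)" by (simp add: norm_mult)
      ultimately show ?case unfolding h_def[symmetric] by linarith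
    qed
  qed
qed

lemma linear_modul: "linear (modul \<xi>)"
  unfolding modul_def by (rule linear_mul[OF bmeas_modul])

lemma norm_modul: "norm (modul \<xi> u) = norm u"
  unfolding modul_def by (rule norm_mul_unimodular[OF bmeas_modul]) simp

lemma modul_L2c: "sq_int f \<Longrightarrow> modul \<xi> (L2c f) = L2c (\<lambda>x. cis (\<xi> \<bullet> x) * f x)"
  unfolding modul_def by (rule mul_L2c[OF bmeas_modul])

lemma modul_mixing_seq:
  fixes u v :: "(real^'n) l2"
  assumes a: "filterlim (\<lambda>n. norm (a n)) at_top sequentially"
  shows "(\<lambda>n. inner (modul (a n) u) v) \<longlonglongrightarrow> 0"
proof (rule LIMSEQ_I)
  fix e :: real assume e: "e > 0"
  define d where "d = e / (4 * (norm u + norm v + 1))"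
  have s: "norm u + norm v + 1 > 0" using norm_ge_zero[of u] norm_ge_zero[of v] by linarith
  have d: "d > 0" using e s by (simp add: d_def)
  \<comment> \<open>The bound by 1 keeps the norm of the approximant below
    \<open>norm u + 1\<close>, which the second error term needs.\<close>
  obtain f where f: "nice f" "norm (u - L2c f) < min d 1" using nice_dense[of "min d 1" u] d by auto
  obtain g where g: "nice g" "norm (v - L2c g) < min d 1" using nice_dense[of "min d 1" v] d by auto
  have fs: "sq_int f" "sq_int g" using f g nice_sq_int by auto
  have "inner (modul (a n) (L2c f)) (L2c g) = Re (LINT z|lborel. cis (a n \<bullet> z) * (f z * cnj (g z)))" for n
  proof -
    have "inner (modul (a n) (L2c f)) (L2c g) = (LINT z|lborel. Re ((cis (a n \<bullet> z) * f z) * cnj (g z)))"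
      unfolding modul_L2c[OF fs(1)] by (rule inner_L2c[OF sq_int_bmult[OF bmeas_modul fs(1)] fs(2)])
    also have "\<dots> = Re (LINT z|lborel. (cis (a n \<bullet> z) * f z) * cnj (g z))"
      by (rule integral_Re[OF sq_int_cnj_integrable[OF sq_int_bmult[OF bmeas_modul fs(1)] fs(2)]])
    finally show ?thesis by (simp only: mult.assoc)
  qed
  then have "(\<lambda>n. inner (modul (a n) (L2c f)) (L2c g)) \<longlonglongrightarrow> Re 0"
    by (simp only:) (intro tendsto_Re riemann_lebesgue_nice f g a)
  then have lim0: "(\<lambda>n. inner (modul (a n) (L2c f)) (L2c g)) \<longlonglongrightarrow> 0" by simp
  obtain N where N: "\<And>n. n \<ge> N \<Longrightarrow> \<bar>inner (modul (a n) (L2c f)) (L2c g)\<bar> < e / 2"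
    using LIMSEQ_D[OF lim0, of "e/2"] e by auto
  have "norm (inner (modul (a n) u) v - 0) < e" if "n \<ge> N" for n
  proof -
    let ?p = "inner (modul (a n) (u - L2c f)) v" and ?q = "inner (modul (a n) (L2c f)) (v - L2c g)"
      and ?r = "inner (modul (a n) (L2c f)) (L2c g)"
    have "inner (modul (a n) u) v = ?p + ?q + ?r"
      by (simp add: linear_diff[OF linear_modul] inner_simps)
    then have "\<bar>inner (modul (a n) u) v\<bar> \<le> (\<bar>?p\<bar> + \<bar>?q\<bar>) + \<bar>?r\<bar>"
      using order_trans[OF abs_triangle_ineq[of "?p + ?q" ?r] add_right_mono[OF abs_triangle_ineq[of ?p ?q]]] by (simp only:)
    also have "\<dots> < (d * norm v + (norm u + 1) * d) + e / 2"
    proof (rule add_le_less_mono[OF add_mono N[OF that]])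
      show "\<bar>?p\<bar> \<le> d * norm v" using f by (intro abs_inner_le) (simp add: norm_modul)
      have "norm (L2c f) \<le> norm u + 1" using norm_triangle_ineq4[of u "u - L2c f"] f by simp
      then have "\<bar>?q\<bar> \<le> (norm u + 1) * norm (v - L2c g)"
        by (intro abs_inner_le) (simp add: norm_modul)
      also have "\<dots> \<le> (norm u + 1) * d" using g by (intro mult_left_mono) (auto intro: add_nonneg_nonneg)
      finally show "\<bar>?q\<bar> \<le> (norm u + 1) * d" .
    qed
    also have "d * norm v + (norm u + 1) * d = d * (norm u + norm v + 1)" by (simp add: algebra_simps)
    also have "\<dots> = e / 4"
    proof -
      have "e / (4 * S) * S = e / 4" if "S \<noteq> 0" for S :: real using that by simp
      from this[OF less_imp_neq[OF s, symmetric]] show ?thesis unfolding d_def .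
    qed
    also have "e / 4 + e / 2 \<le> e" using e by simp
    finally show ?thesis by simp
  qed
  then show "\<exists>N. \<forall>n\<ge>N. norm (inner (modul (a n) u) v - 0) < e" by blast
qed

interpretation modulation: dislocations modul
proof (rule dislocations.intro)
  fix a b :: "real^'n" and x y :: "(real^'n) l2"
  show "linear (modul a)" by (rule linear_modul)
  show "modul 0 x = x" by (simp add: modul_def mul_def)
  show "modul (a + b) x = modul a (modul b x)"
    unfolding modul_def by (simp add: mul_mul bmeas_modul cis_mult inner_add_left)
  show "inner (modul a x) (modul a y) = inner x y"
    by (rule inner_isometry[OF linear_modul norm_modul])
  show "continuous_on UNIV (\<lambda>a. modul a x)"
  proof (rule continuous_on_sequentiallyI)
    fix X :: "nat \<Rightarrow> real^'n" and c assume X: "X \<longlonglongrightarrow> c"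
    have "(\<lambda>n. L2c (\<lambda>z. cis (X n \<bullet> z) * Fn x z)) \<longlonglongrightarrow> L2c (\<lambda>z. cis (c \<bullet> z) * Fn x z)"
    proof (rule L2_dominated_convergence[where w="Fn x"])
      show "AE z in lborel. (\<lambda>n. cis (X n \<bullet> z) * Fn x z) \<longlonglongrightarrow> cis (c \<bullet> z) * Fn x z"
        using X by (intro AE_I2 tendsto_intros)
    qed (auto simp: norm_mult intro!: sq_int_bmult bmeas_modul)
    then show "(\<lambda>n. modul (X n) x) \<longlonglongrightarrow> modul c x" by (simp add: modul_def mul_def)
  qed
  show "((\<lambda>a. inner (modul a x) y) \<longlongrightarrow> 0) at_infinity"
    unfolding Lim_at_infinity
  \<comment> \<open>A failure of the limit at infinity yields a sequence of frequencies with norms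
    tending to infinity, contradicting the sequential version.\<close>
  proof (rule ccontr)
    assume "\<not> (\<forall>e>0. \<exists>b. \<forall>z. norm z \<ge> b \<longrightarrow> dist (inner (modul z x) y) 0 < e)"
    then obtain e where e: "e > 0" "\<And>b. \<exists>z. norm z \<ge> b \<and> \<not> dist (inner (modul z x) y) 0 < e" by blast
    from e(2)[of "real n" for n] obtain z where z: "\<And>n::nat. norm (z n) \<ge> real n" "\<And>n. \<not> dist (inner (modul (z n) x) y) 0 < e" by metis
    have "filterlim (\<lambda>n. norm (z n)) at_top sequentially"
      by (rule filterlim_at_top_mono[OF filterlim_real_sequentially]) (use z in auto)
    from modul_mixing_seq[OF this, of x y] have "eventually (\<lambda>n. dist (inner (modul (z n) x) y) 0 < e) sequentially"
      using e by (simp add: tendsto_iff)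
    then show False using z(2) by (auto simp: eventually_sequentially)
  qed
qed

section \<open>The weighted space\<close>

text \<open>The Japanese bracket, whose square is the weight of the squared \<open>FH1\<close>
  norm.\<close>

definition jap :: "'a::real_normed_vector \<Rightarrow> real" where "jap x = sqrt (1 + (norm x)\<^sup>2)"

lemma jap_sq: "(jap x)\<^sup>2 = 1 + (norm x)\<^sup>2" and jap_ge: "1 \<le> jap x" "norm x \<le> jap x" and jap_pos: "0 < jap x"
proof -
  show "(jap x)\<^sup>2 = 1 + (norm x)\<^sup>2" by (simp add: jap_def)
  show 1: "1 \<le> jap x" by (simp add: jap_def)
  show "norm x \<le> jap x" unfolding jap_def by (rule real_le_rsqrt) simp
  show "0 < jap x" using 1 by linarith
qed

lemma jap_measurable [measurable]: "(jap :: 'a::euclidean_space \<Rightarrow> real) \<in> borel_measurable borel"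
  unfolding jap_def by measurable

abbreviation japf :: "('a::euclidean_space \<Rightarrow> complex) \<Rightarrow> 'a \<Rightarrow> complex" where
  "japf f \<equiv> (\<lambda>x. of_real (jap x) * f x)"

lemma sq_int_of_japf:
  assumes f: "sq_int (japf f)" and [measurable]: "k \<in> borel_measurable borel" and k: "\<And>x. \<bar>k x\<bar> \<le> jap x"
  shows "sq_int (\<lambda>x. of_real (k x) * f x)" "norm (L2c (\<lambda>x. of_real (k x) * f x)) \<le> norm (L2c (japf f))"
proof -
  have [measurable]: "japf f \<in> borel_measurable borel" using f by auto
  have "jap x \<noteq> 0" for x :: 'a using jap_pos[of x] by simp
  then have "f = (\<lambda>x. of_real (1 / jap x) * japf f x)" by simp
  also have "\<dots> \<in> borel_measurable borel" by measurable
  finally have [measurable]: "f \<in> borel_measurable borel" .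
  have le: "norm (of_real (k x) * f x) \<le> norm (japf f x)" for x
    using k[of x] jap_pos[of x] by (simp add: norm_mult mult_right_mono)
  show s: "sq_int (\<lambda>x. of_real (k x) * f x)"
    by (rule sq_int_dominated[OF f, where C=1]) (use le in auto)
  have "ennreal ((norm (L2c (\<lambda>x. of_real (k x) * f x)))\<^sup>2) \<le> ennreal ((norm (L2c (japf f)))\<^sup>2)"
    unfolding nn_norm_L2c[OF f, symmetric] nn_norm_L2c[OF s, symmetric]
    by (intro nn_integral_mono ennreal_leI power_mono le) auto
  then show "norm (L2c (\<lambda>x. of_real (k x) * f x)) \<le> norm (L2c (japf f))"
    by (simp add: ennreal_le_iff power_mono_iff)
qed

lemma norm_pos_mult: "norm (pos_mult f x) = norm (of_real (norm x) * f x)"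
proof -
  have "norm (pos_mult f x) = L2_set (\<lambda>i. norm (vec_nth x i) * norm (f x)) UNIV"
    by (simp add: norm_vec_def pos_mult_def norm_mult)
  also have "\<dots> = L2_set (\<lambda>i. norm (vec_nth x i)) UNIV * norm (f x)" by (rule L2_set_left_distrib[symmetric]) simp
  finally show ?thesis by (simp add: norm_vec_def[of x] norm_mult)
qed

lemma pos_mult_measurable:
  fixes f :: "real^'n \<Rightarrow> complex"
  assumes [measurable]: "f \<in> borel_measurable borel" shows "pos_mult f \<in> borel_measurable borel"
proof (subst borel_measurable_euclidean_space, rule ballI)
  fix b :: "complex^'n" assume "b \<in> Basis"
  then obtain i u where b: "b = axis i u" by (auto simp: Basis_vec_def)
  have "(\<lambda>x. of_real (vec_nth x i) * f x) \<in> borel_measurable borel" by measurable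
  then show "(\<lambda>x. pos_mult f x \<bullet> b) \<in> borel_measurable borel"
    unfolding b inner_axis by (simp add: pos_mult_def)
qed

lemma Lp_norm_pos_mult: "Lp_norm 2 (pos_mult f) = Lp_norm 2 (\<lambda>x. of_real (norm x) * f x)"
  unfolding Lp_norm_def norm_pos_mult ..

lemma japf_sq: "(norm (japf f x))\<^sup>2 = (norm (f x))\<^sup>2 + (norm (of_real (norm x) * f x))\<^sup>2"
  by (simp add: norm_mult power_mult_distrib jap_sq algebra_simps)

lemma FH1_iff: "f \<in> FH1 \<longleftrightarrow> sq_int (japf f)"
proof
  assume "f \<in> FH1"
  then have f: "sq_int f" and p: "Lp_norm 2 (pos_mult f) < \<infinity>" unfolding FH1_def by (auto simp: in_Lp_2_iff in_Lp_def[of _ "pos_mult f"])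
  have [measurable]: "f \<in> borel_measurable borel" using f by auto
  have "in_Lp 2 (\<lambda>x. of_real (norm x) * f x)" unfolding in_Lp_def using p by (simp add: Lp_norm_pos_mult)
  then have g: "sq_int (\<lambda>x. of_real (norm x) * f x)" by (simp add: in_Lp_2_iff)
  have "integrable lborel (\<lambda>x. (norm (japf f x))\<^sup>2)"
    unfolding japf_sq by (intro Bochner_Integration.integrable_add sq_int_integrable f g)
  then show "sq_int (japf f)" by (simp add: sq_int_def)
next
  assume j: "sq_int (japf f)"
  have "sq_int (\<lambda>x. of_real 1 * f x)" by (rule sq_int_of_japf[OF j]) (use jap_ge in auto)
  then have f: "sq_int f" by simp
  have g: "sq_int (\<lambda>x. of_real (norm x) * f x)" by (rule sq_int_of_japf[OF j]) (use jap_ge in auto)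
  show "f \<in> FH1"
    unfolding FH1_def in_Lp_2_iff using f g in_Lp_2_iff[of "\<lambda>x. of_real (norm x) * f x"]
    by (auto simp: in_Lp_def[of _ "pos_mult f"] in_Lp_def[of _ "\<lambda>x. of_real (norm x) * f x"] Lp_norm_pos_mult intro: pos_mult_measurable)
qed

lemma FH1_norm_eq:
  assumes "f \<in> FH1" shows "FH1_norm f = norm (L2c (japf f))"
proof -
  have j: "sq_int (japf f)" using assms by (simp add: FH1_iff)
  have "sq_int (\<lambda>x. of_real 1 * f x)" by (rule sq_int_of_japf[OF j]) (use jap_ge in auto)
  then have f: "sq_int f" by simp
  have g: "sq_int (\<lambda>x. of_real (norm x) * f x)" by (rule sq_int_of_japf[OF j]) (use jap_ge in auto)
  have "(norm (L2c (japf f)))\<^sup>2 = (norm (L2c f))\<^sup>2 + (norm (L2c (\<lambda>x. of_real (norm x) * f x)))\<^sup>2"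
    unfolding norm_L2c_sq[OF j] norm_L2c_sq[OF f] norm_L2c_sq[OF g] japf_sq
    by (rule Bochner_Integration.integral_add) (intro sq_int_integrable f g)+
  then show ?thesis unfolding FH1_norm_def Lp_norm_pos_mult Lp_norm_2[OF f] Lp_norm_2[OF g]
    by (simp add: real_sqrt_unique)
qed

text \<open>The weight of the squared homogeneous norm divided by that of \<open>FH1\<close>. After
  the identification with \<open>L\<^sup>2\<close> the homogeneous norm becomes the quadratic form
  of this multiplier, which is bounded exactly because \<open>s\<close> runs from 0 to 1.\<close>

definition hweight :: "real \<Rightarrow> 'a::real_normed_vector \<Rightarrow> real" where
  "hweight s x = (norm x powr s)\<^sup>2 / (1 + (norm x)\<^sup>2)"

lemma powr_le_jap:
  assumes "s \<in> {0..1}" shows "norm x powr s \<le> jap x"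
proof (cases "norm x \<le> 1")
  case True
  then have "norm x powr s \<le> 1" using assms by (intro powr_le1) auto
  then show ?thesis using jap_ge(1)[of x] by linarith
next
  case False
  then have "norm x powr s \<le> norm x powr 1" using assms by (intro powr_mono) auto
  then show ?thesis using False jap_ge(2)[of x] by simp
qed

lemma hweight_bounds: "s \<in> {0..1} \<Longrightarrow> 0 \<le> hweight s x" "s \<in> {0..1} \<Longrightarrow> hweight s x \<le> 1"
proof -
  show "0 \<le> hweight s x" by (simp add: hweight_def add_nonneg_nonneg)
  assume "s \<in> {0..1}"
  then have "(norm x powr s)\<^sup>2 \<le> (jap x)\<^sup>2" by (intro power_mono powr_le_jap) auto
  then show "hweight s x \<le> 1" unfolding jap_sq hweight_def by (simp add: add_pos_nonneg)
qed

lemma bmeas_hweight: "s \<in> {0..1} \<Longrightarrow> bmeas (\<lambda>x::'a::euclidean_space. of_real (hweight s x))"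
  unfolding bmeas_def
proof (intro conjI exI[of _ 1] allI)
  assume s: "s \<in> {0..1}"
  show "(\<lambda>x::'a. complex_of_real (hweight s x)) \<in> borel_measurable borel" unfolding hweight_def by measurable
  show "norm (complex_of_real (hweight s x)) \<le> 1" for x :: 'a
    using hweight_bounds[OF s, of x] by (simp only: norm_of_real abs_of_nonneg)
qed

lemma FHdot_norm_eq:
  assumes j: "sq_int (japf f)" and s: "s \<in> {0..1}"
  shows "(FHdot_norm s f)\<^sup>2 = inner (mul (\<lambda>x. of_real (hweight s x)) (L2c (japf f))) (L2c (japf f))"
proof -
  let ?h = "\<lambda>x. of_real (norm x powr s) * f x" and ?m = "\<lambda>x::real^'n. complex_of_real (hweight s x)"
  have h: "sq_int ?h" by (rule sq_int_of_japf[OF j]) (use powr_le_jap[OF s] in auto)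
  have "(FHdot_norm s f)\<^sup>2 = (LINT x|lborel. (norm (?h x))\<^sup>2)"
    by (simp add: FHdot_norm_def Lp_norm_2[OF h] norm_L2c_sq[OF h])
  also have "\<dots> = (LINT x|lborel. Re ((?m x * japf f x) * cnj (japf f x)))"
  proof (rule Bochner_Integration.integral_cong[OF refl])
    fix x
    have "Re ((?m x * japf f x) * cnj (japf f x)) = hweight s x * (norm (japf f x))\<^sup>2"
      by (simp only: mult.assoc complex_norm_square[symmetric] of_real_mult[symmetric] Re_complex_of_real)
    also have "\<dots> = (norm x powr s)\<^sup>2 * (norm (f x))\<^sup>2"
    proof -
      have "1 + (norm x)\<^sup>2 > 0" by (simp add: add_pos_nonneg)
      then show ?thesis by (simp add: norm_mult power_mult_distrib jap_sq hweight_def)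
    qed
    finally show "(norm (?h x))\<^sup>2 = Re ((?m x * japf f x) * cnj (japf f x))"
      by (simp add: norm_mult power_mult_distrib)
  qed
  also have "\<dots> = inner (mul ?m (L2c (japf f))) (L2c (japf f))"
    unfolding mul_L2c[OF bmeas_hweight[OF s] j] by (rule inner_L2c[OF sq_int_bmult[OF bmeas_hweight[OF s] j] j, symmetric])
  finally show ?thesis .
qed

lemma inner_mul_real:
  assumes h: "bmeas (\<lambda>x. complex_of_real (h x))"
  shows "inner (mul (\<lambda>x. of_real (h x)) u) v = inner u (mul (\<lambda>x. of_real (h x)) v)"
proof -
  let ?h = "\<lambda>x. complex_of_real (h x)"
  have "inner (mul ?h (L2c (Fn u))) (L2c (Fn v)) = (LINT x|lborel. Re ((?h x * Fn u x) * cnj (Fn v x)))"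
    unfolding mul_L2c[OF h sq_int_Fn] by (rule inner_L2c[OF sq_int_bmult[OF h sq_int_Fn] sq_int_Fn])
  also have "\<dots> = (LINT x|lborel. Re (Fn u x * cnj (?h x * Fn v x)))"
    by (rule Bochner_Integration.integral_cong[OF refl]) (simp only: complex_cnj_mult complex_cnj_complex_of_real mult_ac)
  also have "\<dots> = inner (L2c (Fn u)) (mul ?h (L2c (Fn v)))"
    unfolding mul_L2c[OF h sq_int_Fn] by (rule inner_L2c[OF sq_int_Fn sq_int_bmult[OF h sq_int_Fn], symmetric])
  finally show ?thesis by simp
qed

lemma mul_modul:
  assumes "bmeas h" shows "mul h (modul \<xi> u) = modul \<xi> (mul h u)"
  unfolding modul_def by (simp add: mul_mul bmeas_modul assms mult.commute)

text \<open>Self-adjointness of the multiplier and its commutation with modulations merge both cross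
  terms into one pairing, in the frame of the profile, where the remainder is weakly null.\<close>

lemma quadratic_split:
  assumes h: "bmeas (\<lambda>x::real^'n. complex_of_real (h x))"
  defines "m \<equiv> mul (\<lambda>x::real^'n. complex_of_real (h x))"
  assumes w: "w' = w - modul \<xi> \<Psi>"
  shows "inner (m w) w = inner (m w') w' + inner (m \<Psi>) \<Psi> + 2 * inner (modul (- \<xi>) w') (m \<Psi>)"
proof -
  have lm: "linear m" unfolding m_def by (rule linear_mul[OF h])
  have mm: "m (modul \<xi> \<Psi>) = modul \<xi> (m \<Psi>)" unfolding m_def by (rule mul_modul[OF h])
  have sym: "inner (m w') (modul \<xi> \<Psi>) = inner w' (modul \<xi> (m \<Psi>))"
    unfolding mm[symmetric] unfolding m_def by (rule inner_mul_real[OF h])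
  have adj: "inner w' (modul \<xi> (m \<Psi>)) = inner (modul (- \<xi>) w') (m \<Psi>)"
    using modulation.M_adjoint[of "- \<xi>" w' "m \<Psi>"] by simp
  have "w = w' + modul \<xi> \<Psi>" using w by simp
  then have "inner (m w) w = inner (m w' + modul \<xi> (m \<Psi>)) (w' + modul \<xi> \<Psi>)"
    by (simp only: linear_add[OF lm] mm)
  also have "\<dots> = inner (m w') w' + inner (m w') (modul \<xi> \<Psi>) + inner w' (modul \<xi> (m \<Psi>)) + inner (m \<Psi>) \<Psi>"
    by (simp add: inner_add_left inner_add_right modulation.M_inner inner_commute[of "modul \<xi> (m \<Psi>)" w'])
  finally show ?thesis unfolding sym adj by simp
qed

text \<open>The parameter \<open>s\<close> ranges over an uncountable set, while the subsequence can
  satisfy only countably many conditions; compactness lets one condition cover all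
  \<open>s\<close>.\<close>

lemma compact_hweight_family:
  "compact ((\<lambda>s. mul (\<lambda>x. of_real (hweight s x)) \<Psi>) ` {0..1})" for \<Psi> :: "'a::euclidean_space l2"
proof (rule compact_continuous_image)
  show "continuous_on {0..1} (\<lambda>s. mul (\<lambda>x. of_real (hweight s x)) \<Psi>)"
  proof (rule continuous_on_sequentiallyI)
    fix X :: "nat \<Rightarrow> real" and c assume c: "c \<in> {0..1}" and X: "\<forall>n. X n \<in> {0..1}" "X \<longlonglongrightarrow> c"
    have "(\<lambda>n. L2c (\<lambda>x. of_real (hweight (X n) x) * Fn \<Psi> x)) \<longlonglongrightarrow> L2c (\<lambda>x. of_real (hweight c x) * Fn \<Psi> x)"
    proof (rule L2_dominated_convergence[where w="Fn \<Psi>"])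
      show "AE x in lborel. (\<lambda>n. of_real (hweight (X n) x) * Fn \<Psi> x) \<longlonglongrightarrow> of_real (hweight c x) * Fn \<Psi> x"
        using AE_lborel_singleton[of 0]
      proof eventually_elim
        case (elim x)
        have "1 + (norm x)\<^sup>2 \<noteq> 0" using zero_le_power2[of "norm x"] by linarith
        then show ?case unfolding hweight_def using elim by (intro tendsto_intros X(2)) auto
      qed
      show "norm (of_real (hweight (X n) x) * Fn \<Psi> x) \<le> norm (Fn \<Psi> x)" for n x
        using hweight_bounds[of "X n" x] X(1) by (simp add: norm_mult mult_left_le_one_le)
    qed (use c X(1) in \<open>auto intro!: sq_int_bmult bmeas_hweight simp del: atLeastAtMost_iff\<close>)
    then show "(\<lambda>n. mul (\<lambda>x. of_real (hweight (X n) x)) \<Psi>) \<longlonglongrightarrow> mul (\<lambda>x. of_real (hweight c x)) \<Psi>"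
      by (simp add: o_def mul_def)
  qed
qed simp

text \<open>Division by \<open>jap\<close> undoes the weight carried by the remainder, and the phase
  has a minus sign because it is conjugated in the inner product. The factor \<open>c\<close>
  selects real or imaginary part.\<close>

definition test_fun :: "complex \<Rightarrow> real \<Rightarrow> real \<Rightarrow> 'a::euclidean_space \<Rightarrow> complex" where
  "test_fun c R \<tau> y = c * (cis (- (\<tau> * (norm y)\<^sup>2)) * (indicator (cball 0 R) y / of_real (jap y)))"

lemma test_fun:
  assumes "norm c = 1"
  shows "sq_int (test_fun c R \<tau> :: 'a::euclidean_space \<Rightarrow> complex)"
    and "norm (L2c (test_fun c R \<tau> :: 'a \<Rightarrow> complex)) \<le> norm (L2c (indicator (cball (0::'a) R)))"
    and "norm (test_fun c R \<tau> (y::'a)) \<le> norm (indicator (cball 0 R) y :: complex)"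
proof -
  have le: "norm (test_fun c R \<tau> y) \<le> norm (indicator (cball 0 R) y :: complex)" for y :: 'a
    using jap_ge(1)[of y] assms by (auto simp: test_fun_def norm_mult norm_divide indicator_def)
  show "norm (test_fun c R \<tau> y) \<le> norm (indicator (cball 0 R) y :: complex)" by (rule le)
  show s: "sq_int (test_fun c R \<tau> :: 'a \<Rightarrow> complex)"
  proof (rule sq_int_dominated[OF sq_int_indicator[of R], where C=1])
    have [measurable]: "(indicator (cball 0 R) :: 'a \<Rightarrow> complex) \<in> borel_measurable borel"
      using sq_int_indicator by (rule sq_int_measurable)
    have [measurable]: "(\<lambda>y::'a. complex_of_real (jap y)) \<in> borel_measurable borel"
      unfolding jap_def by (intro borel_measurable_continuous_onI continuous_intros)
    show "(test_fun c R \<tau> :: 'a \<Rightarrow> complex) \<in> borel_measurable borel"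
      unfolding test_fun_def[abs_def] by measurable
  qed (use le in auto)
  have "ennreal ((norm (L2c (test_fun c R \<tau> :: 'a \<Rightarrow> complex)))\<^sup>2) \<le> ennreal ((norm (L2c (indicator (cball (0::'a) R))))\<^sup>2)"
    unfolding nn_norm_L2c[OF s, symmetric] nn_norm_L2c[OF sq_int_indicator, symmetric]
    by (intro nn_integral_mono ennreal_leI power_mono le) auto
  then show "norm (L2c (test_fun c R \<tau> :: 'a \<Rightarrow> complex)) \<le> norm (L2c (indicator (cball (0::'a) R)))"
    by (simp add: ennreal_le_iff power_mono_iff)
qed

text \<open>The parameter stands for \<open>1 / (4t)\<close>. Its value 0 corresponds to infinite
  time, so the unbounded range \<open>t \<ge> T\<close> lies inside a compact parameter
  interval.\<close>

lemma compact_test_family: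
  assumes c: "norm c = 1"
  shows "compact ((\<lambda>\<tau>. L2c (test_fun c R \<tau> :: 'a::euclidean_space \<Rightarrow> complex)) ` {0..S})"
proof (rule compact_continuous_image)
  show "continuous_on {0..S} (\<lambda>\<tau>. L2c (test_fun c R \<tau> :: 'a \<Rightarrow> complex))"
  proof (rule continuous_on_sequentiallyI)
    fix X :: "nat \<Rightarrow> real" and t assume X: "X \<longlonglongrightarrow> t"
    have "(\<lambda>n. L2c (test_fun c R (X n) :: 'a \<Rightarrow> complex)) \<longlonglongrightarrow> L2c (test_fun c R t)"
    proof (rule L2_dominated_convergence[where w="indicator (cball 0 R)"])
      show "AE y in lborel. (\<lambda>n. test_fun c R (X n) y) \<longlonglongrightarrow> test_fun c R t (y::'a)"
        unfolding test_fun_def by (intro AE_I2 tendsto_intros X)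
    qed (auto intro!: test_fun c sq_int_indicator)
    then show "(\<lambda>n. L2c (test_fun c R (X n) :: 'a \<Rightarrow> complex)) \<longlonglongrightarrow> L2c (test_fun c R t)" .
  qed
qed simp

text \<open>The real inner products with the test function for \<open>c = 1\<close> and \<open>c = \<i>\<close> are the real and
  imaginary parts of the oscillatory integral.\<close>
lemma oscillatory_integral_bound:
  fixes W :: "real^'n \<Rightarrow> complex"
  assumes W: "sq_int (japf W)"
    and 1: "\<bar>inner (L2c (japf W)) (modul \<xi> (L2c (test_fun 1 R \<tau>)))\<bar> \<le> b"
    and 2: "\<bar>inner (L2c (japf W)) (modul \<xi> (L2c (test_fun \<i> R \<tau>)))\<bar> \<le> b"
  shows "norm (LINT y|lborel. cis (- (\<xi> \<bullet> y)) * (cis (\<tau> * (norm y)\<^sup>2) * trunc R W y)) \<le> 2 * b"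
proof -
  define I where "I = (LINT y|lborel. cis (- (\<xi> \<bullet> y)) * (cis (\<tau> * (norm y)\<^sup>2) * trunc R W y))"
  have main: "inner (L2c (japf W)) (modul \<xi> (L2c (test_fun c R \<tau>))) = Re (cnj c * I)" if c: "norm c = 1" for c
  proof -
    let ?g = "\<lambda>y. cis (\<xi> \<bullet> y) * test_fun c R \<tau> y"
    have g: "sq_int ?g" by (rule sq_int_bmult[OF bmeas_modul test_fun(1)[OF c]])
    have "inner (L2c (japf W)) (modul \<xi> (L2c (test_fun c R \<tau>))) = (LINT y|lborel. Re (japf W y * cnj (?g y)))"
      unfolding modul_L2c[OF test_fun(1)[OF c]] by (rule inner_L2c[OF W g])
    also have "\<dots> = Re (LINT y|lborel. japf W y * cnj (?g y))"
      by (rule integral_Re[OF sq_int_cnj_integrable[OF W g]])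
    also have "(LINT y|lborel. japf W y * cnj (?g y)) = (LINT y|lborel. cnj c * (cis (- (\<xi> \<bullet> y)) * (cis (\<tau> * (norm y)\<^sup>2) * trunc R W y)))"
    proof (rule Bochner_Integration.integral_cong[OF refl])
      fix y :: "real^'n"
      have j: "jap y \<noteq> 0" using jap_pos[of y] by simp
      show "japf W y * cnj (?g y) = cnj c * (cis (- (\<xi> \<bullet> y)) * (cis (\<tau> * (norm y)\<^sup>2) * trunc R W y))"
        using j by (simp add: test_fun_def trunc_def cis_cnj indicator_def)
    qed
    finally show ?thesis by (simp add: I_def)
  qed
  have "\<bar>Re I\<bar> \<le> b" using 1 main[of 1] by simp
  moreover have "\<bar>Im I\<bar> \<le> b" using 2 main[of \<i>] by simp
  ultimately show ?thesis using cmod_le[of I] unfolding I_def by linarith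
qed
section \<open>Exponents\<close>

text \<open>With \<open>a = p - 1\<close> the threshold is the positive root of
  \<open>N * a\<^sup>2 + (N - 2) * a - 4\<close>. Positivity of this polynomial is the time decay
  condition, while \<open>N * a < 4\<close> gives both the exponent below the diagonal one and
  \<open>q \<le> g\<close>.\<close>

lemma exponent_facts:
  fixes N p :: real
  assumes N: "N \<ge> 1" and p: "p_St N < p" "p < 1 + 4 / N"
  defines "g \<equiv> gamma_exp p" and "q \<equiv> rho_exp N p"
  shows "2 < g" "g < 2 + 4 / N" "N * (g - 2) / 2 < 2" "0 < q" "q \<le> g" "(N * (g - 2) / 2) * q / g > 1"
proof -
  define a where "a = p - 1"
  define S where "S = sqrt (N\<^sup>2 + 12 * N + 4)"
  have S2p: "0 \<le> N\<^sup>2 + 12 * N + 4" using N by (intro add_nonneg_nonneg) auto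
  then have S2: "S\<^sup>2 = N\<^sup>2 + 12 * N + 4" unfolding S_def by (rule real_sqrt_pow2)
  have S0: "S \<ge> 0" unfolding S_def by (rule real_sqrt_ge_zero[OF S2p])
  have "(2 - N + S) / (2 * N) < a" using p(1) by (simp add: p_St_def a_def S_def)
  then have lt: "S < 2 * N * a + N - 2" using N by (simp add: divide_less_eq algebra_simps)
  \<comment> \<open>Compared with the upper bound for \<open>S\<close> this gives
    \<open>N * a > 2\<close>, hence the sign of \<open>a\<close>.\<close>
  have "N + 2 < S" unfolding S_def by (rule real_less_rsqrt) (use N in \<open>simp add: power2_eq_square algebra_simps\<close>)
  then have "N * a > 2" using lt by argo
  then have a0: "a > 0" using N by (metis less_trans zero_less_mult_pos zero_less_numeral zero_less_one less_le_trans)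
  have "S\<^sup>2 < (2 * N * a + N - 2)\<^sup>2" using lt S0 by (intro power_strict_mono) auto
  then have "N\<^sup>2 + 12 * N + 4 < (2 * N * a + N - 2)\<^sup>2" by (simp only: S2)
  \<comment> \<open>Squaring the lower bound on \<open>p\<close> turns the root formula back into
    its polynomial.\<close>
  then have "0 < 4 * N * (N * a\<^sup>2 + (N - 2) * a - 4)" by (simp add: power2_eq_square algebra_simps)
  then have key: "N * a\<^sup>2 > 4 - (N - 2) * a" using N by (simp add: zero_less_mult_iff)
  have Na: "N * a < 4" proof -
    have "a < 4 / N" using p(2) by (simp add: a_def)
    then have "N * a < N * (4 / N)" using N by (intro mult_strict_left_mono) auto
    then show ?thesis using N by simp
  qed
  define d where "d = 4 - (N - 2) * a"
  have d: "2 * a < d" using Na by (simp add: d_def algebra_simps)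
  then have d0: "d > 0" using a0 by linarith
  have g: "g = a + 2" by (simp add: g_def gamma_exp_def a_def)
  have q: "q = 2 * a * (a + 2) / d"
    by (simp add: q_def rho_exp_def d_def a_def power2_eq_square algebra_simps)
  show "2 < g" using a0 by (simp add: g)
  show "g < 2 + 4 / N" using p(2) by (simp add: g a_def)
  show "N * (g - 2) / 2 < 2" using Na by (simp add: g)
  show "0 < q" using a0 d0 by (simp add: q)
  show "q \<le> g"
  proof -
    have "2 * a * (a + 2) \<le> d * (a + 2)" using d a0 by (intro mult_right_mono) auto
    then show ?thesis using d0 by (simp add: q g divide_le_eq mult.commute)
  qed
  show "(N * (g - 2) / 2) * q / g > 1"
  proof -
    have "(N * (g - 2) / 2) * q / g = N * a\<^sup>2 / d"
      using a0 d0 by (simp add: q g power2_eq_square)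
    then show ?thesis using key d0 by (simp add: d_def)
  qed
qed

section \<open>Profiles in the weighted space\<close>

text \<open>Collects everything required of a single remainder, so that only the choice of constants
  is left. The oscillatory bound is asked for \<open>\<tau> \<le> 1 / (4 * T)\<close>, the range of
  \<open>1 / (4t)\<close> for \<open>t \<ge> T\<close>.\<close>

lemma mixed_norm_small:
  fixes W :: "real^'n \<Rightarrow> complex"
  assumes r: "2 < g" "real CARD('n) * (g - 2) / 2 \<le> 2" and q: "0 < q" "q \<le> g" and k: "(real CARD('n) * (g - 2) / 2) * q / g > 1"
    and W: "sq_int (japf W)" and A: "norm (L2c (japf W)) \<le> A" "A > 0" and T: "T > 0" and R: "R > 0" and B: "B \<ge> 0"
    and e: "e \<ge> 0"
    and M: "\<And>f :: real^'n \<Rightarrow> complex. sq_int f \<Longrightarrow> norm (L2c f) \<le> A \<Longrightarrow>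
      \<exists>M\<in>borel_measurable borel.
        (\<forall>t. 0 < t \<longrightarrow> t < T \<longrightarrow> (\<integral>\<^sup>+x. ennreal (norm (Fn (schr t (L2c f)) x) powr g) \<partial>lborel) \<le> M t) \<and>
        (\<integral>\<^sup>+t. M t \<partial>lborel) \<le> ennreal e"
    and \<eta>: "\<And>\<xi> \<tau>. 0 \<le> \<tau> \<Longrightarrow> \<tau> \<le> 1 / (4 * T) \<Longrightarrow> norm (LINT y|lborel. cis (- (\<xi> \<bullet> y)) * (cis (\<tau> * (norm y)\<^sup>2) * trunc R W y)) \<le> \<eta>"
    and BB: "2 powr g * ((disp_const TYPE('n) * \<eta>) powr (g - 2) * A\<^sup>2 +
      high_const TYPE('n) g * A powr g * R powr (real CARD('n) * (g - 2) / 2 - 2)) \<le> B"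
  shows "mixed_norm {0<..} q g (\<lambda>t. schroedinger t W) \<le>
    ennreal ((T + e + B powr (q / g) * (T powr (1 - (real CARD('n) * (g - 2) / 2) * q / g) / ((real CARD('n) * (g - 2) / 2) * q / g - 1))) powr (1 / q))"
proof -
  let ?\<sigma> = "real CARD('n) * (g - 2) / 2"
  have "sq_int (\<lambda>x. of_real 1 * W x)"
    by (rule sq_int_of_japf[OF W]) (use jap_ge in simp_all)
  moreover have "norm (L2c (\<lambda>x. of_real 1 * W x)) \<le> norm (L2c (japf W))"
    by (rule sq_int_of_japf(2)[OF W]) (use jap_ge in simp_all)
  ultimately have Ws: "sq_int W" and WA: "norm (L2c W) \<le> A" using A by auto
  have xW: "sq_int (\<lambda>x. of_real (norm x) * W x)"
    by (rule sq_int_of_japf[OF W]) (use jap_ge in simp_all)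
  have xW': "norm (L2c (\<lambda>x. of_real (norm x) * W x)) \<le> norm (L2c (japf W))"
    by (rule sq_int_of_japf(2)[OF W]) (use jap_ge in simp_all)
  have "(\<integral>\<^sup>+x. ennreal ((norm x)\<^sup>2 * (norm (W x))\<^sup>2) \<partial>lborel) = ennreal ((norm (L2c (\<lambda>x. of_real (norm x) * W x)))\<^sup>2)"
    unfolding nn_norm_L2c[OF xW, symmetric] by (simp add: norm_mult power_mult_distrib)
  also have "\<dots> \<le> ennreal (A\<^sup>2)" using xW' A by (intro ennreal_leI power_mono) auto
  finally have xf: "(\<integral>\<^sup>+x. ennreal ((norm x)\<^sup>2 * (norm (W x))\<^sup>2) \<partial>lborel) \<le> ennreal (A\<^sup>2)" .
  obtain M where M': "M \<in> borel_measurable borel"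
     "\<And>t. 0 < t \<Longrightarrow> t < T \<Longrightarrow> (\<integral>\<^sup>+x. ennreal (norm (Fn (schr t (L2c W)) x) powr g) \<partial>lborel) \<le> M t"
     "(\<integral>\<^sup>+t. M t \<partial>lborel) \<le> ennreal e" using M[OF Ws WA] by blast
  have large: "(\<integral>\<^sup>+x. ennreal (norm (Fn (schr t (L2c W)) x) powr g) \<partial>lborel) \<le> ennreal (B * t powr (- ?\<sigma>))" if t: "t \<ge> T" for t
  proof -
    have t0: "t > 0" using t T by linarith
    have "1 / (4 * t) \<le> 1 / (4 * T)" using t T by (intro divide_left_mono) auto
    then have et: "norm (LINT y|lborel. cis (- (\<xi> \<bullet> y)) * (cis (1 / (4 * t) * (norm y)\<^sup>2) * trunc R W y)) \<le> \<eta>" for \<xi>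
      using t0 by (intro \<eta>) auto
    show ?thesis
      by (rule order_trans[OF schr_away_from_zero[OF r Ws WA A(2) xf t0 R et]])
        (intro ennreal_leI mult_right_mono BB, simp)
  qed
  have "(\<integral>\<^sup>+t. enn_powr (Lp_norm g (schroedinger t W)) q * indicator {0<..} t \<partial>lborel) \<le>
     ennreal (T + e + B powr (q / g) * (T powr (1 - ?\<sigma> * q / g) / (?\<sigma> * q / g - 1)))"
    by (rule time_integral_bound[OF Ws _ q T B k M' e large]) (use r in auto)
  then have "mixed_norm {0<..} q g (\<lambda>t. schroedinger t W) \<le> enn_powr (ennreal (T + e + B powr (q / g) * (T powr (1 - ?\<sigma> * q / g) / (?\<sigma> * q / g - 1)))) (1 / q)"
    unfolding mixed_norm_def using q by (intro enn_powr_mono) auto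
  also have "\<dots> = ennreal ((T + e + B powr (q / g) * (T powr (1 - ?\<sigma> * q / g) / (?\<sigma> * q / g - 1))) powr (1 / q))"
    using T e k by (intro enn_powr_ennreal) (auto intro!: add_nonneg_nonneg mult_nonneg_nonneg divide_nonneg_nonneg)
  finally show ?thesis .
qed

lemma ennreal_tendsto_zeroI:
  fixes f :: "nat \<Rightarrow> ennreal"
  assumes "\<And>e::real. e > 0 \<Longrightarrow> \<exists>N. \<forall>n\<ge>N. f n \<le> ennreal e"
  shows "f \<longlonglongrightarrow> 0"
proof (rule order_tendstoI)
  fix a :: ennreal assume a: "0 < a"
  obtain e :: real where e: "e > 0" "ennreal e < a"
  proof (cases a)
    case (real b)
    then have "b > 0" using a by (simp add: ennreal_less_zero_iff)
    then show ?thesis using real by (intro that[of "b / 2"]) (auto simp: ennreal_less_iff)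
  qed (use that[of 1] in auto)
  from assms[OF e(1)] obtain N where "\<And>n. n \<ge> N \<Longrightarrow> f n \<le> ennreal e" by blast
  then show "eventually (\<lambda>n. f n < a) sequentially"
    by (intro eventually_sequentiallyI[of N]) (use e in \<open>auto intro: le_less_trans\<close>)
qed simp

lemma japf_profile:
  fixes \<Psi> :: "(real^'n) l2"
  shows "japf (\<lambda>x. Fn \<Psi> x / of_real (jap x)) = Fn \<Psi>"
proof
  fix x :: "real^'n"
  have "jap x \<noteq> 0" using jap_pos[of x] by simp
  then show "japf (\<lambda>x. Fn \<Psi> x / of_real (jap x)) x = Fn \<Psi> x" by simp
qed

text \<open>Identifies the abstract remainders with the weighted classes of explicit functions, so
  that the decomposition can be stated pointwise.\<close>

lemma japf_remainder:
  fixes \<phi> :: "nat \<Rightarrow> real^'n \<Rightarrow> complex"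
  assumes \<phi>: "\<And>n. sq_int (japf (\<phi> n))"
    and w0: "\<And>n. w 0 n = L2c (japf (\<phi> n))" and wS: "\<And>l n. w (Suc l) n = w l n - modul (\<xi> (Suc l) n) (\<Psi> (Suc l))"
  defines "W \<equiv> \<lambda>n l x. \<phi> n x - (\<Sum>j=1..l. cis (\<xi> j n \<bullet> x) * (Fn (\<Psi> j) x / of_real (jap x)))"
  shows "sq_int (japf (W n l)) \<and> L2c (japf (W n l)) = w l n"
proof (induction l)
  case 0
  then show ?case using \<phi> w0 by (simp add: W_def)
next
  case (Suc l)
  let ?c = "\<lambda>x. cis (\<xi> (Suc l) n \<bullet> x) * Fn (\<Psi> (Suc l)) x"
  have c: "sq_int ?c" by (rule sq_int_bmult[OF bmeas_modul sq_int_Fn])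
  have "japf (W n (Suc l)) = (\<lambda>x. japf (W n l) x - ?c x)"
  proof
    fix x :: "real^'n"
    have "jap x \<noteq> 0" using jap_pos[of x] by simp
    then show "japf (W n (Suc l)) x = japf (W n l) x - ?c x" by (simp add: W_def algebra_simps)
  qed
  then show ?case using Suc c by (simp add: sq_int_diff L2c_diff wS modul_def mul_def)
qed

theorem proposition5p1:
  fixes \<phi> :: "nat \<Rightarrow> real ^ 'n \<Rightarrow> complex" and p :: real
  assumes "p_St (real CARD('n)) < p" and "p < 1 + 4 / real CARD('n)"
    and "\<forall>n. \<phi> n \<in> FH1" and "\<exists>C. \<forall>n. FH1_norm (\<phi> n) \<le> C"
  shows "\<exists>(r :: nat \<Rightarrow> nat) (\<psi> :: nat \<Rightarrow> real ^ 'n \<Rightarrow> complex)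
      (W :: nat \<Rightarrow> nat \<Rightarrow> real ^ 'n \<Rightarrow> complex) (\<xi> :: nat \<Rightarrow> nat \<Rightarrow> real ^ 'n).
    strict_mono r \<and>
    (\<forall>j\<ge>1. \<psi> j \<in> FH1) \<and> (\<forall>n. \<forall>j\<ge>1. W n j \<in> FH1) \<and>
    (\<forall>l\<ge>1.
      (\<forall>n. AE x in lborel. \<phi> (r n) x = (\<Sum>j=1..l. cis (\<xi> n j \<bullet> x) * \<psi> j x) + W n l x) \<and>
      (\<forall>s\<in>{0..1}.
        (\<lambda>n. (FHdot_norm s (\<phi> (r n)))\<^sup>2 - (\<Sum>j=1..l. (FHdot_norm s (\<psi> j))\<^sup>2)
           - (FHdot_norm s (W n l))\<^sup>2) \<longlonglongrightarrow> 0)) \<and>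
    (\<exists>J :: enat.
      (J = 0 \<longrightarrow> (\<forall>j\<ge>1. AE x in lborel. \<psi> j x = 0)) \<and>
      (J = \<infinity> \<longrightarrow> (\<forall>j\<ge>1. \<not> (AE x in lborel. \<psi> j x = 0))) \<and>
      (1 \<le> J \<and> J < \<infinity> \<longrightarrow>
        (\<forall>j\<ge>1. (enat j \<le> J \<longrightarrow> \<not> (AE x in lborel. \<psi> j x = 0)) \<and>
               (enat j > J \<longrightarrow> (AE x in lborel. \<psi> j x = 0)))) \<and>
      (\<forall>i j. 1 \<le> i \<and> enat i \<le> J \<and> 1 \<le> j \<and> enat j \<le> J \<and> i \<noteq> j \<longrightarrow>
        filterlim (\<lambda>n. norm (\<xi> n i - \<xi> n j)) at_top sequentially)) \<and>
    (\<lambda>l. limsup (\<lambda>n. mixed_norm {0<..} (rho_exp (real CARD('n)) p) (gamma_exp p)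
        (\<lambda>t. schroedinger t (W n l)))) \<longlonglongrightarrow> 0"
proof -
  obtain C0 where "\<And>n. FH1_norm (\<phi> n) \<le> C0" using assms(4) by blast
  define C where "C = max C0 0"
  have C: "\<And>n. FH1_norm (\<phi> n) \<le> C" "C \<ge> 0" using \<open>\<And>n. FH1_norm (\<phi> n) \<le> C0\<close> by (auto simp: C_def le_max_iff_disj)
  have j\<phi>: "\<And>n. sq_int (japf (\<phi> n))" using assms(3) by (simp add: FH1_iff)
  define \<Phi> where "\<Phi> n = L2c (japf (\<phi> n))" for n
  have \<Phi>C: "norm (\<Phi> n) \<le> C" for n using C(1)[of n] FH1_norm_eq[of "\<phi> n"] assms(3) by (simp add: \<Phi>_def)
  obtain U :: "nat filter" where U: "ultra U" "U \<le> sequentially"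
    using ultra_exists[of "sequentially"] by auto
  obtain w \<xi> \<Psi> where w0: "w 0 = \<Phi>" and wS: "\<And>l n. w (Suc l) n = w l n - modul (\<xi> (Suc l) n) (\<Psi> (Suc l))"
    and weak0: "\<And>l. weakly U (\<lambda>n. modul (- \<xi> (Suc l) n) (w (Suc l) n)) 0"
    and weak1: "\<And>l. weakly U (\<lambda>n. modul (- \<xi> (Suc l) n) (w l n)) (\<Psi> (Suc l))"
    and nu: "\<And>l. modulation.nu U (w l) \<le> 2 * norm (\<Psi> (Suc l))" and bd: "\<And>l. \<exists>B. \<forall>n. norm (w l n) \<le> B"
    by (rule modulation.profile_sequence[OF U(1) \<Phi>C]) (rule that)
  have \<Psi>_nu: "norm (\<Psi> (Suc l)) \<le> modulation.nu U (w l)" for l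
  proof -
    obtain B where "\<And>n. norm (w l n) \<le> B" using bd by blast
    then show ?thesis by (rule modulation.profiles_norm_le_nu[OF U(1)]) (use weak1 in \<open>auto simp: modulation.profiles_def\<close>)
  qed
  have nu0: "0 \<le> modulation.nu U (w l)" for l using \<Psi>_nu[of l] norm_ge_zero[of "\<Psi> (Suc l)"] by linarith
  \<comment> \<open>A vanishing profile leaves the remainder unchanged, so \<open>nu\<close> is
    already zero and the next profile vanishes too: the nonzero profiles form an initial
    segment.\<close>
  have zero_next: "\<Psi> (Suc (Suc l)) = 0" if z: "\<Psi> (Suc l) = 0" for l
  proof -
    have "w (Suc l) = w l" using z by (auto simp: wS linear_0[OF linear_modul])
    then have "norm (\<Psi> (Suc (Suc l))) \<le> 2 * norm (\<Psi> (Suc l))" using \<Psi>_nu[of "Suc l"] nu[of l] by simp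
    then show ?thesis using z by simp
  qed
  have bw0: "\<And>n. norm (w 0 n) \<le> C" using \<Phi>C by (simp add: w0)
  note nulim = modulation.nu_tendsto_zero[where w = w and \<xi> = \<xi> and \<Psi> = \<Psi>, OF U(1) wS weak0 nu nu0 bw0]
  have div: "filterlim (\<lambda>n. norm (\<xi> i n - \<xi> j n)) at_top U" if "1 \<le> i" "1 \<le> j" "i \<noteq> j" "\<Psi> i \<noteq> 0" "\<Psi> j \<noteq> 0" for i j
  proof (cases "i < j")
    case True
    then show ?thesis using modulation.profile_divergence[where w = w and \<xi> = \<xi> and \<Psi> = \<Psi>, OF U(1) wS weak0 weak1 bd] that by blast
  next
    case False
    then have "filterlim (\<lambda>n. norm (\<xi> j n - \<xi> i n)) at_top U"
      using modulation.profile_divergence[where w = w and \<xi> = \<xi> and \<Psi> = \<Psi>, OF U(1) wS weak0 weak1 bd, of j i] that by simp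
    then show ?thesis by (simp add: norm_minus_commute)
  qed
  define K where "K j = (\<lambda>s. mul (\<lambda>x. of_real (hweight s x)) (\<Psi> j)) ` {0..1::real}" for j
  define V where "V R = norm (L2c (indicator (cball (0::real^'n) (real R))))" for R :: nat
  define H where "H R S = (\<lambda>\<tau>. L2c (test_fun 1 (real R) \<tau> :: real^'n \<Rightarrow> complex)) ` {0..real S}
      \<union> (\<lambda>\<tau>. L2c (test_fun \<i> (real R) \<tau>)) ` {0..real S}" for R S :: nat
  \<comment> \<open>All properties wanted of the subsequence, coded by quadruples of naturals. Here
    \<open>a\<close> is the stage; \<open>b\<close> is a cutting radius in the second clause and
    another stage in the last one; \<open>c\<close> bounds the quadratic phase; \<open>d\<close> is
    the precision, or in the last clause the distance. \<open>V b\<close> bounds the norms of the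
    test functions of radius \<open>b\<close>.\<close>
  define Q where "Q x n = (case x of (a, b, c, d) \<Rightarrow>
     (\<forall>h\<in>K (Suc a). \<bar>inner (modul (- \<xi> (Suc a) n) (w (Suc a) n)) h\<bar> \<le> 1 / real (Suc d)) \<and>
     (\<forall>\<zeta>. \<forall>h\<in>H b c. \<bar>inner (w a n) (modul \<zeta> h)\<bar> \<le> V b * modulation.nu U (w a) + 1 / real (Suc d)) \<and>
     norm (w a n) \<le> C + 1 \<and>
     (a \<noteq> b \<and> \<Psi> (Suc a) \<noteq> 0 \<and> \<Psi> (Suc b) \<noteq> 0 \<longrightarrow> real d \<le> norm (\<xi> (Suc a) n - \<xi> (Suc b) n)))" for x :: "nat \<times> nat \<times> nat \<times> nat" and n
  have Qev: "eventually (Q x) U" for x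
  proof -
    obtain a b c d where x: "x = (a, b, c, d)" by (metis prod_cases4)
    have d: "1 / real (Suc d) > 0" by simp
    obtain B where B: "\<And>n. norm (w a n) \<le> B" using bd by blast
    obtain B' where B': "\<And>n. norm (w (Suc a) n) \<le> B'" using bd by blast
    have 1: "eventually (\<lambda>n. \<forall>h\<in>K (Suc a). \<bar>inner (modul (- \<xi> (Suc a) n) (w (Suc a) n)) h\<bar> \<le> 1 / real (Suc d)) U"
      using B' by (intro weakly_null_uniform[OF U(1) weak0 _ _ d]) (auto simp: norm_modul K_def intro: compact_hweight_family)
    have cH: "compact (H b c)" unfolding H_def by (intro compact_Un compact_test_family) auto
    have nH: "norm h \<le> V b" if "h \<in> H b c" for h using that by (auto simp: H_def V_def intro!: test_fun(2))
    have 2: "eventually (\<lambda>n. \<forall>\<zeta>. \<forall>h\<in>H b c. \<bar>inner (w a n) (modul \<zeta> h)\<bar> \<le> V b * modulation.nu U (w a) + 1 / real (Suc d)) U"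
      by (rule modulation.nu_uniform[OF U(1) B cH nH d])
    have 3: "eventually (\<lambda>n. norm (w a n) \<le> C + 1) U" by (rule nulim(2))
    have 4: "eventually (\<lambda>n. a \<noteq> b \<and> \<Psi> (Suc a) \<noteq> 0 \<and> \<Psi> (Suc b) \<noteq> 0 \<longrightarrow> real d \<le> norm (\<xi> (Suc a) n - \<xi> (Suc b) n)) U"
    proof (cases "a \<noteq> b \<and> \<Psi> (Suc a) \<noteq> 0 \<and> \<Psi> (Suc b) \<noteq> 0")
      case True
      then have "filterlim (\<lambda>n. norm (\<xi> (Suc a) n - \<xi> (Suc b) n)) at_top U" by (intro div) auto
      then have "eventually (\<lambda>n. real d \<le> norm (\<xi> (Suc a) n - \<xi> (Suc b) n)) U" by (simp add: filterlim_at_top)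
      then show ?thesis by eventually_elim simp
    qed (intro always_eventually, blast)
    show ?thesis using 1 2 3 4 by eventually_elim (simp add: Q_def x)
  qed
  obtain r :: "nat \<Rightarrow> nat" where r: "strict_mono r" and rQ: "\<And>k n. n \<ge> k \<Longrightarrow> Q (from_nat k) (r n)"
    using diagonal_subsequence[OF ultra_nontrivial[OF U(1)] U(2), of "\<lambda>k. Q (from_nat k)"] Qev by blast
  have Qr: "Q x (r n)" if "n \<ge> to_nat x" for x n using rQ[OF that] by simp
  have Q1: "\<bar>inner (modul (- \<xi> (Suc a) (r n)) (w (Suc a) (r n))) h\<bar> \<le> 1 / real (Suc d)"
    if "n \<ge> to_nat (a, 0::nat, 0::nat, d)" "h \<in> K (Suc a)" for a d n h using Qr[OF that(1)] that(2) by (simp add: Q_def)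
  have Q2: "\<bar>inner (w a (r n)) (modul \<zeta> h)\<bar> \<le> V b * modulation.nu U (w a) + 1 / real (Suc d)"
    if "n \<ge> to_nat (a, b, c, d)" "h \<in> H b c" for a b c d n h \<zeta> using Qr[OF that(1)] that(2) by (simp add: Q_def)
  have Q3: "norm (w a (r n)) \<le> C + 1" if "n \<ge> to_nat (a, 0::nat, 0::nat, 0::nat)" for a n using Qr[OF that] by (simp add: Q_def)
  have Q4: "real d \<le> norm (\<xi> (Suc a) (r n) - \<xi> (Suc b) (r n))"
    if "n \<ge> to_nat (a, b, 0::nat, d)" "a \<noteq> b" "\<Psi> (Suc a) \<noteq> 0" "\<Psi> (Suc b) \<noteq> 0" for a b d n using Qr[OF that(1)] that(2-) by (simp add: Q_def)
  \<comment> \<open>Dividing by the weight carries the profiles back; modulations commute with this,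
    so the frames stay the same.\<close>
  define \<psi> where "\<psi> j x = Fn (\<Psi> j) x / of_real (jap x)" for j x
  define W where "W n l x = \<phi> (r n) x - (\<Sum>j=1..l. cis (\<xi> j (r n) \<bullet> x) * \<psi> j x)" for n l x
  have jW: "sq_int (japf (W n l))" "L2c (japf (W n l)) = w l (r n)" for n l
    using japf_remainder[of \<phi> w \<xi> \<Psi> "r n" l, OF j\<phi> _ wS] unfolding W_def[abs_def] \<psi>_def by (auto simp: w0 \<Phi>_def)
  have j\<psi>: "japf (\<psi> j) = Fn (\<Psi> j)" for j unfolding \<psi>_def[abs_def] by (rule japf_profile)
  have \<psi>0: "(AE x in lborel. \<psi> j x = 0) \<longleftrightarrow> \<Psi> j = 0" for j
  proof -
    have nz: "jap x \<noteq> 0" for x :: "real^'n" using jap_pos[of x] by simp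
    have "\<Psi> j = 0 \<longleftrightarrow> L2c (Fn (\<Psi> j)) = L2c (\<lambda>_. 0)" by (simp add: zero_l2_def)
    also have "\<dots> \<longleftrightarrow> (AE x in lborel. Fn (\<Psi> j) x = 0)" by (rule L2c_eq_iff) simp_all
    finally show ?thesis by (simp add: \<psi>_def nz)
  qed
  show ?thesis
  proof (intro exI[of _ r] exI[of _ \<psi>] exI[of _ W] exI[of _ "\<lambda>n j. \<xi> j (r n)"] conjI allI impI ballI)
    show "strict_mono r" by (rule r)
    show "\<psi> j \<in> FH1" for j by (simp add: FH1_iff j\<psi>)
    show "W n j \<in> FH1" for n j by (simp add: FH1_iff jW)
    show "AE x in lborel. \<phi> (r n) x = (\<Sum>j=1..l. cis (\<xi> j (r n) \<bullet> x) * \<psi> j x) + W n l x" for n l by (simp add: W_def)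
  next
    fix l :: nat and s :: real assume s: "s \<in> {0..1}"
    let ?m = "mul (\<lambda>x. complex_of_real (hweight s x))"
    \<comment> \<open>The defect is an exact sum of cross terms, one for each extraction, each
      pairing a remainder with the profile just removed.\<close>
    have tel: "(FHdot_norm s (\<phi> (r n)))\<^sup>2 - (\<Sum>j=1..k. (FHdot_norm s (\<psi> j))\<^sup>2) - (FHdot_norm s (W n k))\<^sup>2
       = (\<Sum>j=1..k. 2 * inner (modul (- \<xi> j (r n)) (w j (r n))) (?m (\<Psi> j)))" for n k
    proof (induction k)
      case 0
      then show ?case by (simp add: W_def[abs_def])
    next
      case (Suc k)
      have "(FHdot_norm s (W n k))\<^sup>2 = (FHdot_norm s (W n (Suc k)))\<^sup>2 + (FHdot_norm s (\<psi> (Suc k)))\<^sup>2 +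
         2 * inner (modul (- \<xi> (Suc k) (r n)) (w (Suc k) (r n))) (?m (\<Psi> (Suc k)))"
        using quadratic_split[OF bmeas_hweight[OF s] wS[of k "r n"]] FHdot_norm_eq[OF _ s, of "\<psi> (Suc k)"]
        by (simp add: FHdot_norm_eq[OF jW(1) s] jW(2) j\<psi>)
      then show ?case using Suc by simp
    qed
    show "(\<lambda>n. (FHdot_norm s (\<phi> (r n)))\<^sup>2 - (\<Sum>j=1..l. (FHdot_norm s (\<psi> j))\<^sup>2) - (FHdot_norm s (W n l))\<^sup>2) \<longlonglongrightarrow> 0"
      unfolding tel
    proof (rule tendsto_null_sum)
      fix j assume "j \<in> {1..l}"
      then obtain a where a: "j = Suc a" by (cases j) auto
      have "(\<lambda>n. inner (modul (- \<xi> j (r n)) (w j (r n))) (?m (\<Psi> j))) \<longlonglongrightarrow> 0"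
      proof (rule LIMSEQ_I)
        fix e :: real assume "e > 0"
        then obtain d where d: "1 / real (Suc d) < e" using nat_approx_posE by blast
        have "?m (\<Psi> (Suc a)) \<in> K (Suc a)" using s by (auto simp: K_def)
        then have "norm (inner (modul (- \<xi> j (r n)) (w j (r n))) (?m (\<Psi> j)) - 0) < e" if "n \<ge> to_nat (a, 0::nat, 0::nat, d)" for n
          using le_less_trans[OF Q1[OF that] d] by (simp add: a)
        then show "\<exists>no. \<forall>n\<ge>no. norm (inner (modul (- \<xi> j (r n)) (w j (r n))) (?m (\<Psi> j)) - 0) < e" by blast
      qed
      then show "(\<lambda>n. 2 * inner (modul (- \<xi> j (r n)) (w j (r n))) (?m (\<Psi> j))) \<longlonglongrightarrow> 0" by (rule tendsto_mult_right_zero)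
    qed
  next
    \<comment> \<open>Profiles are numbered from 1, so if \<open>Suc a\<close> is the number of the
      first vanishing profile, then exactly \<open>a\<close> of them are nonzero.\<close>
    define J where "J = (if \<forall>a. \<Psi> (Suc a) \<noteq> 0 then \<infinity> else enat (LEAST a. \<Psi> (Suc a) = 0))"
    have J: "enat j \<le> J \<longleftrightarrow> \<Psi> j \<noteq> 0" if j1: "j \<ge> 1" for j
    proof (cases "\<forall>a. \<Psi> (Suc a) \<noteq> 0")
      case True
      then show ?thesis using j1 by (cases j) (auto simp: J_def)
    next
      case False
      define L where "L = (LEAST a. \<Psi> (Suc a) = 0)"
      have JL: "J = enat L" unfolding J_def L_def using False by (rule if_not_P)
      have L: "\<Psi> (Suc L) = 0" unfolding L_def using False by (auto intro: LeastI)
      have after: "\<Psi> (Suc a) = 0" if "a \<ge> L" for a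
        using that by (induction a rule: dec_induct) (auto intro: L zero_next)
      have before: "\<Psi> (Suc a) \<noteq> 0" if "a < L" for a using not_less_Least[of a "\<lambda>a. \<Psi> (Suc a) = 0"] that by (simp add: L_def)
      obtain a where a: "j = Suc a" using j1 by (cases j) auto
      have "enat j \<le> J \<longleftrightarrow> a < L" by (simp add: JL a Suc_le_eq)
      also have "\<dots> \<longleftrightarrow> \<Psi> j \<noteq> 0" using after[of a] before[of a] by (cases "a < L") (auto simp: a)
      finally show ?thesis .
    qed
    show "\<exists>J :: enat.
      (J = 0 \<longrightarrow> (\<forall>j\<ge>1. AE x in lborel. \<psi> j x = 0)) \<and>
      (J = \<infinity> \<longrightarrow> (\<forall>j\<ge>1. \<not> (AE x in lborel. \<psi> j x = 0))) \<and>
      (1 \<le> J \<and> J < \<infinity> \<longrightarrow>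
        (\<forall>j\<ge>1. (enat j \<le> J \<longrightarrow> \<not> (AE x in lborel. \<psi> j x = 0)) \<and>
               (enat j > J \<longrightarrow> (AE x in lborel. \<psi> j x = 0)))) \<and>
      (\<forall>i j. 1 \<le> i \<and> enat i \<le> J \<and> 1 \<le> j \<and> enat j \<le> J \<and> i \<noteq> j \<longrightarrow>
        filterlim (\<lambda>n. norm (\<xi> i (r n) - \<xi> j (r n))) at_top sequentially)"
    proof (intro exI[of _ J] conjI allI impI)
      fix j :: nat assume "J = 0" "j \<ge> 1"
      then have "\<not> enat j \<le> J" by (simp add: enat_0_iff)
      then show "AE x in lborel. \<psi> j x = 0" using J[OF \<open>j \<ge> 1\<close>] by (simp add: \<psi>0)
    next
      fix j :: nat assume "J = \<infinity>" "j \<ge> 1"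
      then show "\<not> (AE x in lborel. \<psi> j x = 0)" using J[OF \<open>j \<ge> 1\<close>] by (simp add: \<psi>0)
    next
      fix j :: nat assume "j \<ge> 1" "enat j \<le> J"
      then show "\<not> (AE x in lborel. \<psi> j x = 0)" using J[OF \<open>j \<ge> 1\<close>] by (simp add: \<psi>0)
    next
      fix j :: nat assume "j \<ge> 1" "enat j > J"
      then have "\<not> enat j \<le> J" by (simp add: not_le)
      then show "AE x in lborel. \<psi> j x = 0" using J[OF \<open>j \<ge> 1\<close>] by (simp add: \<psi>0)
    next
      fix i j :: nat assume ij: "1 \<le> i \<and> enat i \<le> J \<and> 1 \<le> j \<and> enat j \<le> J \<and> i \<noteq> j"
      obtain a b where ab: "i = Suc a" "j = Suc b" using ij by (cases i; cases j) auto
      have nz: "\<Psi> (Suc a) \<noteq> 0" "\<Psi> (Suc b) \<noteq> 0" using J[of i] J[of j] ij ab by auto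
      show "filterlim (\<lambda>n. norm (\<xi> i (r n) - \<xi> j (r n))) at_top sequentially"
        unfolding filterlim_at_top
      proof
        fix Z :: real
        obtain d :: nat where d: "Z \<le> real d" using real_arch_simple by blast
        show "eventually (\<lambda>n. Z \<le> norm (\<xi> i (r n) - \<xi> j (r n))) sequentially"
          by (rule eventually_sequentiallyI[of "to_nat (a, b, 0::nat, d)"])
            (use order_trans[OF d Q4[OF _ _ nz]] ij ab in auto)
      qed
    qed
  next
    let ?N = "real CARD('n)" and ?D = "disp_const TYPE('n)"
    define g where "g = gamma_exp p"
    define q where "q = rho_exp ?N p"
    have N1: "?N \<ge> 1" by (simp add: Suc_le_eq)
    note ex = exponent_facts[OF N1 assms(1,2), folded g_def q_def]
    define \<sigma> where "\<sigma> = ?N * (g - 2) / 2"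
    define A where "A = C + 1"
    have A: "A > 0" using C by (simp add: A_def)
    have D: "?D > 0" by (rule disp_const_pos)
    have hc: "high_const TYPE('n) g \<ge> 0" using ex by (simp add: high_const_def)
    show "(\<lambda>l. limsup (\<lambda>n. mixed_norm {0<..} (rho_exp ?N p) (gamma_exp p) (\<lambda>t. schroedinger t (W n l)))) \<longlonglongrightarrow> 0"
      unfolding g_def[symmetric] q_def[symmetric]
    proof (rule ennreal_tendsto_zeroI)
      fix e :: real assume e: "e > 0"
      \<comment> \<open>The mixed norm is a root of order \<open>q\<close>, so its
        \<open>q\<close>-th power gets the budget \<open>e'\<close>: a quarter for the length
        \<open>T\<close>, a quarter for the Strichartz part, half for large times.\<close>
      define e' where "e' = e powr q"
      have e': "e' > 0" using e by (simp add: e'_def)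
      have "e' / 4 > 0" using e' by simp
      from strichartz_small[OF ex(1,2) A this] obtain T where T: "T > 0" "T \<le> e' / 4"
        and M: "\<And>f :: real^'n \<Rightarrow> complex. sq_int f \<Longrightarrow> norm (L2c f) \<le> A \<Longrightarrow>
          \<exists>M\<in>borel_measurable borel.
            (\<forall>t. 0 < t \<longrightarrow> t < T \<longrightarrow> (\<integral>\<^sup>+x. ennreal (norm (Fn (schr t (L2c f)) x) powr g) \<partial>lborel) \<le> M t) \<and>
            (\<integral>\<^sup>+t. M t \<partial>lborel) \<le> ennreal (e' / 4)" by blast
      define X where "X = T powr (1 - \<sigma> * q / g) / (\<sigma> * q / g - 1)"
      have k: "\<sigma> * q / g > 1" using ex(6) by (simp add: \<sigma>_def)
      have X: "X > 0" using T k by (simp add: X_def)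
      \<comment> \<open>Solves \<open>B powr (q / g) * X = e' / 2\<close>. Since \<open>X\<close>
        depends on \<open>T\<close>, the constant \<open>B\<close> has to come after
        \<open>T\<close>; then \<open>R\<close> is taken large and \<open>\<eta>\<close> small, each
        responsible for half of \<open>B\<close>.\<close>
      define B where "B = (e' / (2 * X)) powr (g / q)"
      have B: "B > 0" using e' X by (simp add: B_def)
      have gq: "g / q * (q / g) = 1" using ex by simp
      have BX: "B powr (q / g) * X = e' / 2" unfolding B_def powr_powr gq using e' X by simp
      have "((\<lambda>R. R powr (\<sigma> - 2)) \<longlongrightarrow> 0) at_top"
        by (rule tendsto_neg_powr) (use ex(3) in \<open>auto simp: \<sigma>_def intro: filterlim_ident\<close>)
      then have "(\<lambda>R. real R powr (\<sigma> - 2)) \<longlonglongrightarrow> 0" by (rule filterlim_compose[OF _ filterlim_real_sequentially])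
      then have "(\<lambda>R. 2 powr g * (high_const TYPE('n) g * A powr g) * real R powr (\<sigma> - 2)) \<longlonglongrightarrow> 0" by (rule tendsto_mult_right_zero)
      then have "eventually (\<lambda>R. 2 powr g * (high_const TYPE('n) g * A powr g) * real R powr (\<sigma> - 2) < B / 2 \<and> R > 0) sequentially"
        using B by (intro eventually_conj order_tendstoD eventually_gt_at_top) auto
      from eventually_happens'[OF sequentially_bot this]
      obtain R :: nat where R: "2 powr g * (high_const TYPE('n) g * A powr g) * real R powr (\<sigma> - 2) < B / 2" "R > 0" by blast
      \<comment> \<open>Chosen so that the inner part contributes exactly
        \<open>B / 2\<close>.\<close>
      define \<eta> where "\<eta> = (B / 2 / (2 powr g * A\<^sup>2)) powr (1 / (g - 2)) / ?D"
      have \<eta>: "\<eta> > 0" using B A D by (simp add: \<eta>_def)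
      have "(?D * \<eta>) powr (g - 2) = B / 2 / (2 powr g * A\<^sup>2)"
        using D B A ex(1) by (simp add: \<eta>_def powr_powr)
      then have "2 powr g * ((?D * \<eta>) powr (g - 2) * A\<^sup>2) = B / 2" using A by simp
      then have BB: "2 powr g * ((?D * \<eta>) powr (g - 2) * A\<^sup>2 + high_const TYPE('n) g * A powr g * real R powr (?N * (g - 2) / 2 - 2)) \<le> B"
        using R(1) unfolding \<sigma>_def by (simp add: distrib_left mult.assoc)
      \<comment> \<open>The compact families are indexed by natural bounds to keep the conditions
        countable; one bound above \<open>1 / (4 * T)\<close> is taken.\<close>
      obtain S :: nat where S: "1 / (4 * T) \<le> real S" using real_arch_simple by blast
      \<comment> \<open>The two errors, from the precision and from \<open>nu\<close>, are each
        below \<open>\<eta> / 4\<close>; the factor 2 in the oscillatory bound brings them to at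
        most \<open>\<eta>\<close>.\<close>
      obtain d where d: "1 / real (Suc d) < \<eta> / 4" using nat_approx_posE[of "\<eta> / 4"] \<eta> by auto
      have "(\<lambda>l. V R * modulation.nu U (w l)) \<longlonglongrightarrow> 0" by (rule tendsto_mult_right_zero[OF nulim(1)])
      then have "eventually (\<lambda>l. V R * modulation.nu U (w l) < \<eta> / 4) sequentially"
        using \<eta> by (intro order_tendstoD) auto
      then obtain L where L: "\<And>l. l \<ge> L \<Longrightarrow> V R * modulation.nu U (w l) < \<eta> / 4" by (auto simp: eventually_sequentially)
      have "mixed_norm {0<..} q g (\<lambda>t. schroedinger t (W n l)) \<le> ennreal e"
        if l: "l \<ge> L" and n: "n \<ge> max (to_nat (l, R, S, d)) (to_nat (l, 0::nat, 0::nat, 0::nat))" for l n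
      proof -
        have wA: "norm (L2c (japf (W n l))) \<le> A" using Q3[of l n] n by (simp add: jW A_def)
        have osc: "norm (LINT y|lborel. cis (- (\<zeta> \<bullet> y)) * (cis (\<tau> * (norm y)\<^sup>2) * trunc (real R) (W n l) y)) \<le> \<eta>"
          if \<tau>: "0 \<le> \<tau>" "\<tau> \<le> 1 / (4 * T)" for \<zeta> \<tau>
        proof -
          have \<tau>S: "\<tau> \<in> {0..real S}" using \<tau> S by auto
          have n': "n \<ge> to_nat (l, R, S, d)" using n by simp
          have "norm (LINT y|lborel. cis (- (\<zeta> \<bullet> y)) * (cis (\<tau> * (norm y)\<^sup>2) * trunc (real R) (W n l) y))
             \<le> 2 * (V R * modulation.nu U (w l) + 1 / real (Suc d))"
            by (rule oscillatory_integral_bound[OF jW(1)]; unfold jW(2); rule Q2[OF n']) (use \<tau>S in \<open>auto simp: H_def\<close>)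
          also have "\<dots> \<le> \<eta>" using L[OF l] d by simp
          finally show ?thesis .
        qed
        have "mixed_norm {0<..} q g (\<lambda>t. schroedinger t (W n l)) \<le>
            ennreal ((T + e' / 4 + B powr (q / g) * X) powr (1 / q))"
          unfolding X_def \<sigma>_def
          by (rule mixed_norm_small[OF ex(1) less_imp_le[OF ex(3)] ex(4,5,6) jW(1) wA A T(1) _ less_imp_le[OF B] _ M osc BB])
            (use R(2) e' in auto)
        also have "\<dots> \<le> ennreal (e' powr (1 / q))"
          unfolding BX using T e' ex(4) by (intro ennreal_leI powr_mono2) auto
        also have "e' powr (1 / q) = e" using e ex(4) by (simp add: e'_def powr_powr)
        finally show ?thesis .
      qed
      \<comment> \<open>The starting index for \<open>n\<close> depends on \<open>l\<close>, but
        \<open>R\<close>, \<open>S\<close>, \<open>d\<close> and the threshold for \<open>l\<close>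
        do not, so the limsup in \<open>n\<close> can be taken at each fixed large
        \<open>l\<close>.\<close>
      then have "limsup (\<lambda>n. mixed_norm {0<..} q g (\<lambda>t. schroedinger t (W n l))) \<le> ennreal e" if "l \<ge> L" for l
        using that by (intro Limsup_bounded eventually_sequentiallyI) blast
      then show "\<exists>L. \<forall>l\<ge>L. limsup (\<lambda>n. mixed_norm {0<..} q g (\<lambda>t. schroedinger t (W n l))) \<le> ennreal e" by blast
    qed
  qed
qed
end
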